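(* Let $X_1,X_2,\dots$ be i.i.d. with density $f_0=g_0(\cdot-\theta_0)$, where $\theta_0\in\mathbb{R}$, $g_0\in\mathcal{SLC}_0$, and $f_0$ has finite Fisher information for location. Let $(\hat\theta_n,\hat\psi_n)$ be the MLE, $\hat g_n=e^{\hat\psi_n}$ and $\hat f_{0,n}=\hat g_n(\cdot-\hat\theta_n)$. Then: (A) As $n\to\infty$, $H(\hat f_{0,n},f_0)\to0$ and $H(\hat g_n,g_0)\to0$ almost surely. Moreover, $H^2(\hat f_{0,n},f_0)=O_p(n^{-4/5})$. (B) $|\hat\theta_n-\theta_0|=O_p(n^{-2/5})$ and $H^2(\hat g_n,g_0)=O_p(n^{-4/5})$.
   Context: $\mathcal{C}$: functions $\varphi:\mathbb{R}\to[-\infty,\infty)$ that are concave, closed and proper. $\mathcal{SC}_0$: the $\psi\in\mathcal{C}$ symmetric about $0$. $\mathcal{SLC}_0$: probability densities $g$ on $\mathbb{R}$ symmetric about $0$ with $\log g\in\mathcal{C}$. A density $f$ has finite Fisher information for location iff $f$ is absolutely continuous with $\int(f'/f)^2f\,dx<\infty$. With $\mathbb{F}_n$ the empirical distribution function of $X_1,\dots,X_n$, the MLE $(\hat\theta_n,\hat\psi_n)$ is a maximizer of $\Psi_n(\theta,\psi)=\int\psi(x-\theta)d\mathbb{F}_n(x)-\int e^{\psi(x-\theta)}dx$ over $\theta\in\mathbb{R}$, $\psi\in\mathcal{SC}_0$ (any version, if not unique); then $e^{\hat\psi_n}$ is a density. The Hellinger distance is given by $H^2(f,g)=\frac12\int(\sqrt{f(x)}-\sqrt{g(x)})^2dx$.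 *)

theory Defs
  imports "HOL-Probability.Probability"
begin

definition hypograph :: "(real \<Rightarrow> ereal) \<Rightarrow> (real \<times> real) set"
  where "hypograph \<phi> = {(x, r). ereal r \<le> \<phi> x}"

(* Closed proper concave functions in Rockafellar's sense: concavity is convexity of the
   hypograph, and for a function that never takes the value +infinity, closedness
   (upper semicontinuity) is closedness of the hypograph. *)
definition closed_proper_concave :: "(real \<Rightarrow> ereal) set"
  where "closed_proper_concave =
    {\<phi>. convex (hypograph \<phi>) \<and> closed (hypograph \<phi>) \<and>
        (\<forall>x. \<phi> x < \<infinity>) \<and> (\<exists>x. - \<infinity> < \<phi> x)}"

definition SC0 :: "(real \<Rightarrow> ereal) set"
  where "SC0 = {\<psi> \<in> closed_proper_concave. \<forall>x. \<psi> (- x) = \<psi> x}"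

definition log_ext :: "real \<Rightarrow> ereal"
  where "log_ext y = (if y = 0 then - \<infinity> else ereal (ln y))"

(* The extension of exp with exp (-infinity) = 0; the value at +infinity is junk and is
   never used, because elements of SC0 do not take that value. *)
definition exp_ext :: "ereal \<Rightarrow> real"
  where "exp_ext y = (if \<bar>y\<bar> = \<infinity> then 0 else exp (real_of_ereal y))"

definition is_density :: "(real \<Rightarrow> real) \<Rightarrow> bool"
  where "is_density f \<longleftrightarrow> f \<in> borel_measurable borel \<and> (\<forall>x. 0 \<le> f x) \<and>
    (\<integral>\<^sup>+ x. ennreal (f x) \<partial>lborel) = 1"

definition SLC0 :: "(real \<Rightarrow> real) set"
  where "SLC0 = {g. is_density g \<and> (\<forall>x. g (- x) = g x) \<and>
    (\<lambda>x. log_ext (g x)) \<in> closed_proper_concave}"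

(* A finite set I of pairs (a, b) encodes a finite family of non-overlapping intervals. *)
definition abs_cont_on :: "real set \<Rightarrow> (real \<Rightarrow> real) \<Rightarrow> bool"
  where "abs_cont_on S f \<longleftrightarrow> (\<forall>\<epsilon>>0. \<exists>\<delta>>0. \<forall>I :: (real \<times> real) set.
    finite I \<longrightarrow> (\<forall>(a, b) \<in> I. a \<le> b \<and> {a..b} \<subseteq> S) \<longrightarrow>
    pairwise (\<lambda>p q. disjnt {fst p<..<snd p} {fst q<..<snd q}) I \<longrightarrow>
    (\<Sum>(a, b) \<in> I. b - a) < \<delta> \<longrightarrow> (\<Sum>(a, b) \<in> I. \<bar>f b - f a\<bar>) < \<epsilon>)"

(* Absolute continuity on the line is imposed on each compact interval. An absolutely
   continuous f is differentiable almost everywhere, so the values of deriv f at the other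
   points do not matter; points with f x = 0 contribute 0 because x / 0 = 0. *)
definition finite_fisher_info_location :: "(real \<Rightarrow> real) \<Rightarrow> bool"
  where "finite_fisher_info_location f \<longleftrightarrow> (\<forall>a b. abs_cont_on {a..b} f) \<and>
    (\<integral>\<^sup>+ x. ennreal ((deriv f x / f x)\<^sup>2 * f x) \<partial>lborel) < \<infinity>"

(* The integral against the empirical distribution of x 1, ..., x n is written as an average.
   For psi in SC0 no summand is +infinity, so the sum is well defined and the difference is
   never of the form infinity - infinity. *)
definition log_lik :: "nat \<Rightarrow> (nat \<Rightarrow> real) \<Rightarrow> real \<Rightarrow> (real \<Rightarrow> ereal) \<Rightarrow> ereal"
  where "log_lik n x \<theta> \<psi> =
    ereal (1 / real n) * (\<Sum>i\<in>{1..n}. \<psi> (x i - \<theta>))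
    - enn2ereal (\<integral>\<^sup>+ y. ennreal (exp_ext (\<psi> (y - \<theta>))) \<partial>lborel)"

definition is_MLE :: "nat \<Rightarrow> (nat \<Rightarrow> real) \<Rightarrow> real \<Rightarrow> (real \<Rightarrow> ereal) \<Rightarrow> bool"
  where "is_MLE n x \<theta> \<psi> \<longleftrightarrow> \<psi> \<in> SC0 \<and>
    (\<forall>\<theta>'. \<forall>\<psi>'\<in>SC0. log_lik n x \<theta>' \<psi>' \<le> log_lik n x \<theta> \<psi>)"

definition hellinger :: "(real \<Rightarrow> real) \<Rightarrow> (real \<Rightarrow> real) \<Rightarrow> real"
  where "hellinger f g = sqrt (1 / 2 * (\<integral>x. (sqrt (f x) - sqrt (g x))\<^sup>2 \<partial>lborel))"

(* Y n = O_p(r n). The outer measure agrees with the measure on events, so for measurable Y n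
   this is the usual notion, but it needs no measurability of the Y n, which may depend on
   an arbitrary choice of maximizers. *)
definition bounded_in_prob ::
    "'w measure \<Rightarrow> (nat \<Rightarrow> 'w \<Rightarrow> real) \<Rightarrow> (nat \<Rightarrow> real) \<Rightarrow> bool"
  where "bounded_in_prob M Y r \<longleftrightarrow> (\<forall>\<epsilon>>0. \<exists>K::real. \<forall>\<^sub>F n in sequentially.
    outer_measure_of M {\<omega> \<in> space M. \<bar>Y n \<omega>\<bar> > K * r n} \<le> ennreal \<epsilon>)"

end

theory Submission
  imports Defs
begin

text \<open>
  Put the true centre at 0, let \<open>f\<close> be the fitted density and \<open>P\<close>, \<open>P\<^sub>n\<close> the true and empirical measures.
  Since \<open>f\<close> has at least the likelihood of \<open>g\<close>, concavity of the logarithm shows that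
  \<open>h = 2 ln ((f + g) / (2 g))\<close> satisfies \<open>H\<^sup>2(f, g) / 4 \<le> (P\<^sub>n - P) h\<close>. Only log-concavity of \<open>f\<close> is used to bound
  the right-hand side. The line is cut at the dyadic quantiles of \<open>g\<close>. On a block whose mass exceeds a
  multiple of \<open>H\<^sup>2(f, g)\<close>, both \<open>ln f\<close> and \<open>ln g\<close> have slopes of the order of the inverse block length, so
  that \<open>h\<close> is approximated by piecewise affine functions on dyadic refinements of a mesh of about \<open>n\<^sup>1\<^sup>/\<^sup>5\<close> cells.
  Each level is charged against \<open>\<integral>h\<^sup>2 g\<close>, which is \<open>O(H\<^sup>2(f, g))\<close>, and against fluctuations of cell indicators
  that are controlled uniformly in \<open>f\<close> by their fourth moments. In the remaining tail \<open>f\<close> is monotone and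
  \<open>h\<close> grows at most linearly in the block index. This yields \<open>H\<^sup>2(f, g) \<le> C \<kappa> n\<^sup>-\<^sup>4\<^sup>/\<^sup>5\<close> outside an event of probability
  \<open>O(\<kappa>\<^sup>-\<^sup>2)\<close>; fixed \<open>\<kappa>\<close> gives the rate, and \<open>\<kappa>\<close> proportional to \<open>n\<^sup>4\<^sup>/\<^sup>5\<close> gives almost sure convergence by
  Borel-Cantelli.

  As \<open>f\<close> is symmetric about the estimated centre, \<open>g\<close> lies within \<open>2 H(f, g)\<close> of its reflection about that centre,
  which is a translate of \<open>g\<close> by twice the location error. The Hellinger distance between translates of \<open>g\<close> is bounded below
  by a multiple of a small shift and, by the Fisher information, above by a multiple of the shift.
\<close>

section \<open>Log-concave functions\<close>

text \<open>The number N of base cells is set by two costs: the base level costs about N / n, the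
  refinements about 1 / sqrt (N^3 n). At N = n^(1/5) both are n^(-4/5). The estimator is an
  arbitrary maximizer, so no measurability in the sample can be used. Every bound therefore passes
  to fluctuations of functions on cells that are fixed before \<open>f\<close>, and \<open>f\<close>
  enters only through coefficients. A coefficient times a fluctuation is split at a threshold: below
  it the interpolation error pays, above it the integral of \<open>h^2\<close> and the fourth power
  of the fluctuation pay. Hence fourth moments suffice where chaining usually asks for exponential
  tails. Refinement stops while cells still expect a bounded-below number of points, since in finer
  cells the Poissonian part of the fourth moment would dominate. The numerical constants meet one
  demand: the part of the bound charged to \<open>H^2(f, g)\<close> must stay below the 1/4 gained
  from concavity of the logarithm; it comes to 1/16. A further obstacle is that \<open>f\<close> and
  \<open>g\<close> may have different supports; the ends of the path between them are therefore cut
  versions of \<open>g\<close> and \<open>f\<close> and need estimates of their own.\<close>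

text \<open>Positivity between two positive values is demanded separately because
  \<open>ln 0 = 0\<close>: an inequality between logarithms alone would not make the positivity set
  an interval.\<close>

definition log_concave :: "(real \<Rightarrow> real) \<Rightarrow> bool" where
  "log_concave f \<longleftrightarrow> (\<forall>x. 0 \<le> f x) \<and>
    (\<forall>x y u. 0 \<le> u \<longrightarrow> u \<le> 1 \<longrightarrow> 0 < f x \<longrightarrow> 0 < f y \<longrightarrow>
      0 < f ((1 - u) * x + u * y) \<and>
      (1 - u) * ln (f x) + u * ln (f y) \<le> ln (f ((1 - u) * x + u * y)))"

lemma log_concave_nonneg: "log_concave f \<Longrightarrow> 0 \<le> f x"
  by (simp add: log_concave_def)

text \<open>The weights are multiplied by \<open>z - x\<close>, so the three-point inequality
  involves no division and becomes trivial when \<open>x = z\<close>.\<close>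

lemma log_concave_between:
  assumes "log_concave f" "x \<le> y" "y \<le> z" "0 < f x" "0 < f z"
  shows "0 < f y" and "(z - y) * ln (f x) + (y - x) * ln (f z) \<le> (z - x) * ln (f y)"
proof -
  have "0 < f y \<and> (z - y) * ln (f x) + (y - x) * ln (f z) \<le> (z - x) * ln (f y)"
  proof (cases "x = z")
    case True
    then show ?thesis using assms by auto
  next
    case False
    with assms have xz: "x < z" by auto
    define u where "u = (y - x) / (z - x)"
    have u: "0 \<le> u" "u \<le> 1" using assms xz by (auto simp: u_def)
    have "u * (z - x) = y - x" using xz by (simp add: u_def)
    hence y: "(1 - u) * x + u * z = y" by (simp add: algebra_simps)
    have *: "0 < f y" "(1 - u) * ln (f x) + u * ln (f z) \<le> ln (f y)"
      using assms u y unfolding log_concave_def by metis+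
    have "(z - x) * ((1 - u) * ln (f x) + u * ln (f z)) \<le> (z - x) * ln (f y)"
      using * xz by (intro mult_left_mono) auto
    moreover have "(z - x) * ((1 - u) * ln (f x) + u * ln (f z))
        = (z - x - u * (z - x)) * ln (f x) + u * (z - x) * ln (f z)"
      by (simp add: algebra_simps)
    ultimately show ?thesis using * \<open>u * (z - x) = y - x\<close> by simp
  qed
  thus "0 < f y" "(z - y) * ln (f x) + (y - x) * ln (f z) \<le> (z - x) * ln (f y)" by auto
qed

text \<open>Unimodality: a weighted mean of logarithms is at least the smaller one. Unlike the
  logarithmic form this also makes sense where \<open>f\<close> vanishes.\<close>

lemma log_concave_min:
  assumes "log_concave f" "x \<le> y" "y \<le> z"
  shows "min (f x) (f z) \<le> f y"
proof (cases "0 < f x \<and> 0 < f z \<and> x < z")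
  case True
  note * = log_concave_between[OF assms, of] 
  let ?m = "min (f x) (f z)"
  have m: "0 < ?m" using True by auto
  have "(z - x) * ln ?m = (z - y) * ln ?m + (y - x) * ln ?m" by (simp add: algebra_simps)
  also have "\<dots> \<le> (z - y) * ln (f x) + (y - x) * ln (f z)"
    using True assms m by (intro add_mono mult_left_mono) (auto simp: ln_mono)
  also have "\<dots> \<le> (z - x) * ln (f y)" using * True by auto
  finally have "ln ?m \<le> ln (f y)" using True by auto
  thus ?thesis using m * True by (subst (asm) ln_le_cancel_iff) auto
next
  case False
  have "0 \<le> f x" "0 \<le> f y" "0 \<le> f z" using assms(1) by (auto simp: log_concave_nonneg)
  show ?thesis
  proof (cases "x < z")
    case True
    hence "f x = 0 \<or> f z = 0" using False \<open>0 \<le> f x\<close> \<open>0 \<le> f z\<close> by auto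
    thus ?thesis using \<open>0 \<le> f y\<close> by (auto simp: min_def)
  next
    case False
    hence "x = z" "y = x" using assms by auto
    thus ?thesis by simp
  qed
qed

text \<open>One strict descent from \<open>y\<close> to \<open>w\<close> shows that the mode lies
  before \<open>w\<close>: a later value above \<open>f w\<close> would leave \<open>f w\<close>
  below values on both of its sides.\<close>

lemma log_concave_antimono_after:
  assumes "log_concave f" "y \<le> w" "f w < f y" "w \<le> a" "a \<le> b"
  shows "f b \<le> f a" "f a \<le> f w"
proof -
  have ge: "f c \<le> f w" if "w \<le> c" for c
    using log_concave_min[OF assms(1,2) that] assms(3) by (auto simp: min_def split: if_splits)
  show "f a \<le> f w" using ge assms by auto
  have "f b \<le> f w" using ge assms by auto
  thus "f b \<le> f a" using log_concave_min[OF assms(1,4,5)] by (auto simp: min_def split: if_splits)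
qed

text \<open>In the half of the segment next to the larger value \<open>f x\<close>, the logarithm of
  \<open>f x\<close> carries weight at least 1/2, so \<open>f\<close> is there at least the
  geometric mean of the end values. This turns one large value into large values on an interval,
  which is how \<open>f\<close> is bounded above on a block.\<close>

lemma log_concave_midpoint:
  assumes f: "log_concave f" and "0 < f z" "f z \<le> f x"
    and "x \<le> y \<and> y \<le> (x + z) / 2 \<or> (x + z) / 2 \<le> y \<and> y \<le> x"
  shows "f x * f z \<le> (f y)\<^sup>2"
proof (cases "x = z")
  case True
  hence "y = x" using assms by auto
  then show ?thesis using True by (simp add: power2_eq_square)
next
  case False
  have fx: "0 < f x" using assms by auto
  have "0 < f y \<and> ln (f x) + ln (f z) \<le> 2 * ln (f y)"
  proof (cases "x < z")
    case True
    have y: "x \<le> y" "y \<le> z" "y \<le> (x + z)/2" using assms True by auto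
    note * = log_concave_between[OF f y(1,2) fx \<open>0 < f z\<close>]
    have "(z - x) * (ln (f x) + ln (f z)) \<le> 2 * ((z - y) * ln (f x) + (y - x) * ln (f z))"
    proof -
      have "2 * ((z - y) * ln (f x) + (y - x) * ln (f z)) - (z - x) * (ln (f x) + ln (f z))
        = (x + z - 2 * y) * (ln (f x) - ln (f z))" by (simp add: algebra_simps)
      moreover have "0 \<le> (x + z - 2 * y) * (ln (f x) - ln (f z))"
        using y assms fx by (intro mult_nonneg_nonneg) (auto simp: field_simps)
      ultimately show ?thesis by linarith
    qed
    also have "\<dots> \<le> 2 * ((z - x) * ln (f y))" using *(2) by (intro mult_left_mono) auto
    finally have "(z - x) * (ln (f x) + ln (f z)) \<le> (z - x) * (2 * ln (f y))" by simp
    thus ?thesis using * True by (subst (asm) mult_le_cancel_left_pos) auto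
  next
    case F: False
    have y: "z \<le> y" "y \<le> x" "y \<ge> (x + z)/2" using assms False F by auto
    note * = log_concave_between[OF f y(1,2) \<open>0 < f z\<close> fx]
    have "(x - z) * (ln (f x) + ln (f z)) \<le> 2 * ((x - y) * ln (f z) + (y - z) * ln (f x))"
    proof -
      have "2 * ((x - y) * ln (f z) + (y - z) * ln (f x)) - (x - z) * (ln (f x) + ln (f z))
        = (2 * y - x - z) * (ln (f x) - ln (f z))" by (simp add: algebra_simps)
      moreover have "0 \<le> (2 * y - x - z) * (ln (f x) - ln (f z))"
        using y assms fx by (intro mult_nonneg_nonneg) (auto simp: field_simps)
      ultimately show ?thesis by linarith
    qed
    also have "\<dots> \<le> 2 * ((x - z) * ln (f y))" using *(2) by (intro mult_left_mono) auto
    finally have "(x - z) * (ln (f x) + ln (f z)) \<le> (x - z) * (2 * ln (f y))" by simp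
    thus ?thesis using * False F by (subst (asm) mult_le_cancel_left_pos) auto
  qed
  hence "0 < f y" "ln (f x * f z) \<le> ln ((f y)\<^sup>2)" using fx assms by (auto simp: ln_mult ln_realpow)
  thus ?thesis using fx assms by (subst (asm) ln_le_cancel_iff) auto
qed

text \<open>The inner points \<open>a + u\<close> and \<open>b\<close> are convex combinations of
  the outer points \<open>a\<close> and \<open>b + u\<close> with complementary weights; adding the
  two concavity inequalities gives total positivity of order 2 of the kernel
  \<open>f (x - y)\<close>.\<close>

lemma log_concave_cross:
  assumes f: "log_concave f" and "a \<le> b" "0 \<le> u"
  shows "f a * f (b + u) \<le> f (a + u) * f b"
proof (cases "0 < f a \<and> 0 < f (b + u) \<and> a < b + u")
  case True
  note 1 = log_concave_between[OF f, of a "a + u" "b + u"]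
  note 2 = log_concave_between[OF f, of a b "b + u"]
  have pos: "0 < f (a + u)" "0 < f b" using 1(1) 2(1) True assms by auto
  have "(b + u - a) * (ln (f a) + ln (f (b + u))) \<le> (b + u - a) * (ln (f (a + u)) + ln (f b))"
    using 1(2) 2(2) True assms by (simp add: algebra_simps)
  hence "ln (f a) + ln (f (b + u)) \<le> ln (f (a + u)) + ln (f b)"
    using True by (subst (asm) mult_le_cancel_left_pos) auto
  hence "ln (f a * f (b + u)) \<le> ln (f (a + u) * f b)" using True pos by (simp add: ln_mult)
  thus ?thesis using True pos by (subst (asm) ln_le_cancel_iff) auto
next
  case False
  have "0 \<le> f a" "0 \<le> f (b + u)" "0 \<le> f (a + u)" "0 \<le> f b"
    using f by (auto simp: log_concave_nonneg)
  moreover have "b = a \<and> u = 0" if "\<not> a < b + u" using that assms by auto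
  ultimately show ?thesis using False by (smt (verit) add.right_neutral mult_eq_0_iff mult_nonneg_nonneg)
qed

text \<open>Positive values on both sides put \<open>x\<close> into the interior of the positivity
  set, where the convex function \<open>- ln f\<close> has a subgradient.\<close>

lemma log_concave_supergradient:
  assumes f: "log_concave f" and "0 < f a" "0 < f b" "a < x" "x < b"
  obtains s where "\<And>y. 0 < f y \<Longrightarrow> ln (f y) \<le> ln (f x) + s * (y - x)"
proof -
  let ?I = "{x. 0 < f x}" and ?h = "\<lambda>x. - ln (f x)"
  have "convex ?I" unfolding convex_alt using f by (auto simp: log_concave_def)
  moreover have "convex_on ?I ?h"
  proof (intro convex_onI)
    show "convex ?I" by fact
    fix t y z :: real assume *: "0 < t" "t < 1" "y \<in> ?I" "z \<in> ?I"
    hence "(1-t) * ln (f y) + t * ln (f z) \<le> ln (f ((1-t)*y+t*z))"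
      using f by (auto simp: log_concave_def)
    thus "- ln (f ((1 - t) *\<^sub>R y + t *\<^sub>R z)) \<le> (1 - t) * - ln (f y) + t * - ln (f z)" by simp
  qed
  moreover have "x \<in> interior ?I"
  proof -
    have "{a<..<b} \<subseteq> ?I" using log_concave_between(1)[OF f, of a _ b] assms by auto
    hence "{a<..<b} \<subseteq> interior ?I" by (intro interior_maximal) auto
    thus ?thesis using assms by auto
  qed
  ultimately have "?h y \<ge> ?h x + Inf ((\<lambda>t. (?h x - ?h t) / (x - t)) ` ({x<..} \<inter> ?I)) * (y - x)"
    if "y \<in> ?I" for y using convex_le_Inf_differential that by blast
  then obtain D where *: "?h y \<ge> ?h x + D * (y - x)" if "y \<in> ?I" for y by blast
  show ?thesis
  proof (rule that[of "- D"])
    fix y assume "0 < f y"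
    thus "ln (f y) \<le> ln (f x) + - D * (y - x)" using *[of y] by simp
  qed
qed

text \<open>If \<open>f\<close> stayed strictly below its mean, then mean minus \<open>f\<close>
  would be a positive function with integral 0 on an interval of positive length.\<close>

lemma exists_ge_mean:
  fixes f :: "real \<Rightarrow> real"
  assumes "a < b" and int: "set_integrable lborel {a..b} f"
  obtains x where "x \<in> {a..b}" "(LINT x:{a..b}|lborel. f x) \<le> f x * (b - a)"
proof -
  have "\<exists>x\<in>{a..b}. (LINT x:{a..b}|lborel. f x) / (b - a) \<le> f x"
  proof (rule ccontr)
    assume "\<not> ?thesis"
    hence less: "f x < (LINT x:{a..b}|lborel. f x) / (b - a)" (is "_ < ?c") if "x \<in> {a..b}" for x
      using that by force
    have c: "set_integrable lborel {a..b} (\<lambda>_. ?c)" unfolding set_integrable_def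
      by (intro integrable_scaleR_left integrable_real_indicator)
        (auto simp: emeasure_lborel_Icc_eq)
    have "(LINT x:{a..b}|lborel. ?c - f x) = 0"
      using assms c by (subst set_integral_diff) (auto simp: set_lebesgue_integral_def)
    moreover have "set_integrable lborel {a..b} (\<lambda>x. ?c - f x)" by (intro set_integral_diff c int)
    ultimately have "AE x in lborel. indicator {a..b} x *\<^sub>R (?c - f x) = 0"
      unfolding set_lebesgue_integral_def set_integrable_def
      by (subst (asm) integral_nonneg_eq_0_iff_AE) (auto intro!: AE_I2 less_imp_le less[unfolded set_lebesgue_integral_def real_scaleR_def] simp: mult_nonneg_nonneg split: split_indicator)
    hence "AE x in lborel. x \<notin> {a..b}" by (rule AE_mp) (intro AE_I2, use less in \<open>force simp: indicator_def\<close>)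
    hence "{a..b} \<in> null_sets lborel" by (subst AE_iff_null_sets) auto
    thus False using \<open>a < b\<close> by (simp add: null_sets_def)
  qed
  thus ?thesis using that \<open>a < b\<close> by (auto simp: field_simps)
qed

lemma exists_le_mean:
  fixes f :: "real \<Rightarrow> real"
  assumes "a < b" and int: "set_integrable lborel {a..b} f"
  obtains x where "x \<in> {a..b}" "f x * (b - a) \<le> (LINT x:{a..b}|lborel. f x)"
proof -
  have "set_integrable lborel {a..b} (\<lambda>x. - f x)" using int by (auto simp: set_integrable_def)
  then obtain x where "x \<in> {a..b}" "(LINT x:{a..b}|lborel. - f x) \<le> - f x * (b - a)"
    using exists_ge_mean[OF \<open>a < b\<close>] by blast
  moreover have "(LINT x:{a..b}|lborel. - f x) = - (LINT x:{a..b}|lborel. f x)"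
    by (simp add: set_lebesgue_integral_def)
  ultimately show ?thesis using that[of x] by simp
qed

text \<open>Pairing \<open>g\<close> with the mixture \<open>(f + g) / 2\<close> keeps the log likelihood ratio bounded below, even
  where \<open>f\<close> vanishes.\<close>
definition logmix :: "real \<Rightarrow> real \<Rightarrow> real" where
  "logmix a b = 2 * ln ((a + b) / (2 * b))"

text \<open>In the variable \<open>r = sqrt (a / b)\<close> the claim reads
  \<open>\<bar>ln ((1 + r^2) / 2)\<bar> \<le> 2 * \<bar>r - 1\<bar>\<close>. Squared and integrated,
  it bounds the second moment of the ratio under \<open>g\<close> by a multiple of the squared
  Hellinger distance; a plain log ratio, unbounded below, satisfies no such bound.\<close>

lemma abs_logmix_le:
  assumes "0 \<le> a" "0 < b"
  shows "\<bar>logmix a b\<bar> * sqrt b \<le> 4 * \<bar>sqrt a - sqrt b\<bar>"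
proof -
  define r where "r = sqrt (a / b)"
  have r: "0 \<le> r" "a / b = r\<^sup>2" using assms by (auto simp: r_def)
  have e: "(a + b) / (2 * b) = (1 + r\<^sup>2) / 2" using assms r(2) by (auto simp: field_simps)
  have "\<bar>logmix a b\<bar> \<le> 4 * \<bar>r - 1\<bar>"
  proof (cases "1 \<le> r")
    case True
    hence "1 \<le> r\<^sup>2" by simp
    hence "0 \<le> ln ((1 + r\<^sup>2)/2)" "ln ((1 + r\<^sup>2)/2) \<le> ln (r\<^sup>2)"
      by (auto simp del: ln_le_cancel_iff intro!: ln_mono)
    moreover have "ln (r\<^sup>2) = 2 * ln r" using True by (simp add: ln_realpow)
    moreover have "ln r \<le> r - 1" using True by (intro ln_le_minus_one) auto
    ultimately show ?thesis using True unfolding logmix_def e by auto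
  next
    case False
    have pos: "0 < 1 + r\<^sup>2" by (simp add: add_pos_nonneg)
    have "- ln ((1 + r\<^sup>2)/2) = ln (2 / (1 + r\<^sup>2))" using pos by (simp add: ln_div)
    also have "\<dots> \<le> 2 / (1 + r\<^sup>2) - 1" using pos by (intro ln_le_minus_one) auto
    also have "\<dots> \<le> 2 * (1 - r)"
    proof -
      have "2 \<le> (1 + 2 * (1 - r)) * (1 + r\<^sup>2)"
      proof -
        have "(1 + 2 * (1 - r)) * (1 + r\<^sup>2) - 2 = (1 - r) * (1 - r + 2 * r\<^sup>2)"
          by (simp add: algebra_simps power2_eq_square)
        moreover have "0 \<le> (1 - r) * (1 - r + 2 * r\<^sup>2)" using False r by (intro mult_nonneg_nonneg) auto
        ultimately show ?thesis by linarith
      qed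
      thus ?thesis using pos by (simp add: field_simps)
    qed
    finally have "- ln ((1 + r\<^sup>2)/2) \<le> 2 * (1 - r)" .
    moreover have "ln ((1 + r\<^sup>2)/2) \<le> 0" using False r pos
      by (simp add: power_le_one)
    ultimately show ?thesis using False unfolding logmix_def e by auto
  qed
  hence "\<bar>logmix a b\<bar> * sqrt b \<le> 4 * \<bar>r - 1\<bar> * sqrt b" using assms by (intro mult_right_mono) auto
  also have "\<dots> = 4 * \<bar>r * sqrt b - sqrt b\<bar>" 
  proof -
    have "r * sqrt b - sqrt b = (r - 1) * sqrt b" by (simp add: algebra_simps)
    thus ?thesis using assms by (simp add: abs_mult)
  qed
  also have "r * sqrt b = sqrt a" using assms by (simp add: r_def real_sqrt_divide)
  finally show ?thesis .
qed

lemma logmix_ge: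
  assumes "0 \<le> a" "0 < b" shows "- (2 * ln 2) \<le> logmix a b"
proof -
  have "ln (1/2) \<le> ln ((a + b) / (2 * b))" using assms by (subst ln_le_cancel_iff) (auto simp: field_simps)
  thus ?thesis by (simp add: logmix_def ln_div)
qed

text \<open>Arithmetic-geometric means: \<open>a * b\<close> is at most the square of
  \<open>(a + b) / 2\<close>. The factor 2 in \<open>logmix\<close> is made for this: a fit whose
  likelihood is at least that of \<open>g\<close> has a nonnegative empirical mean of
  \<open>logmix\<close>.\<close>

lemma logmix_ge_ln:
  assumes "0 < a" "0 < b" shows "ln a - ln b \<le> logmix a b"
proof -
  have "a / b \<le> ((a + b) / (2 * b))\<^sup>2"
  proof -
    have "0 \<le> (a - b)\<^sup>2" by simp
    hence "4 * a * b \<le> (a + b)\<^sup>2" by (simp add: power2_eq_square algebra_simps)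
    thus ?thesis using assms by (simp add: field_simps power2_eq_square)
  qed
  hence "ln (a / b) \<le> ln (((a + b) / (2 * b))\<^sup>2)" using assms by (subst ln_le_cancel_iff) auto
  also have "\<dots> = logmix a b" using assms by (simp add: logmix_def ln_realpow)
  finally show ?thesis using assms by (simp add: ln_div)
qed

text \<open>With \<open>m\<close> and \<open>y\<close> the roots of the mixture and of
  \<open>b\<close>, \<open>logmix\<close> is \<open>4 * ln (m / y)\<close>, at most
  \<open>4 * (m / y - 1)\<close>. Multiplied by \<open>y^2\<close> this leaves the defect
  \<open>2 * (m - y)^2\<close>, and \<open>m + y \<le> 2 * (x + y)\<close> compares it with the
  roots of \<open>a\<close> and \<open>b\<close> at the price of a factor 16. After integration the
  defect is a quarter of the squared Hellinger distance.\<close>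

lemma logmix_mult_le:
  assumes "0 \<le> a" "0 < b"
  shows "logmix a b * b \<le> a + b - 2 * b - (sqrt a - sqrt b)\<^sup>2 / 8"
proof -
  define m where "m = sqrt ((a + b) / 2)"
  define x where "x = sqrt a" define y where "y = sqrt b"
  have y: "0 < y" "y\<^sup>2 = b" and x: "0 \<le> x" "x\<^sup>2 = a" and m: "0 < m" "m\<^sup>2 = (x\<^sup>2 + y\<^sup>2) / 2"
    using assms by (auto simp: m_def x_def y_def)
  have "(a + b) / (2 * b) = (m / y)\<^sup>2" unfolding power_divide m using y x by (simp add: field_simps)
  hence "logmix a b = 4 * ln (m / y)" using m y by (simp add: logmix_def ln_realpow)
  also have "\<dots> \<le> 4 * (m / y - 1)" using m y by (intro mult_left_mono ln_le_minus_one) auto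
  finally have "logmix a b * b \<le> 4 * (m / y - 1) * y\<^sup>2" using y by (metis assms(2) less_imp_le mult_right_mono)
  also have "\<dots> = 4 * m * y - 4 * y\<^sup>2" using y by (simp add: power2_eq_square field_simps)
  also have "\<dots> = 2 * m\<^sup>2 + 2 * y\<^sup>2 - 4 * y\<^sup>2 - 2 * (m - y)\<^sup>2" by (simp add: power2_eq_square algebra_simps)
  also have "\<dots> \<le> (a + b) - 2 * b - (x - y)\<^sup>2 / 8"
  proof -
    have my: "m \<le> x + y" 
    proof (rule power2_le_imp_le)
      show "m\<^sup>2 \<le> (x + y)\<^sup>2" unfolding m using mult_nonneg_nonneg[of x y] x(1) y(1) zero_le_power2[of x] zero_le_power2[of y]
        unfolding power2_sum by (simp del: zero_le_power2)
    qed (use x y in auto)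
    have "2 * (m - y) * (m + y) = (x - y) * (x + y)" using m by (simp add: algebra_simps power2_eq_square)
    hence "(2 * (m - y) * (m + y))\<^sup>2 = ((x - y) * (x + y))\<^sup>2" by (rule arg_cong)
    hence "4 * (m - y)\<^sup>2 * (m + y)\<^sup>2 = (x - y)\<^sup>2 * (x + y)\<^sup>2" unfolding power_mult_distrib by simp
    moreover have "(m + y)\<^sup>2 \<le> 4 * (x + y)\<^sup>2"
    proof -
      have "(m + y)\<^sup>2 \<le> (2 * (x + y))\<^sup>2" using my x y m by (intro power_mono) auto
      thus ?thesis unfolding power_mult_distrib by simp
    qed
    hence "4 * (m - y)\<^sup>2 * (m + y)\<^sup>2 \<le> 4 * (m - y)\<^sup>2 * (4 * (x + y)\<^sup>2)" by (intro mult_left_mono) auto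
    ultimately have "(x - y)\<^sup>2 * (x + y)\<^sup>2 \<le> (16 * (m - y)\<^sup>2) * (x + y)\<^sup>2" by (simp add: mult_ac)
    hence "(x - y)\<^sup>2 \<le> 16 * (m - y)\<^sup>2" using x y by (subst (asm) mult_le_cancel_right_pos) (auto simp: add_nonneg_pos)
    thus ?thesis using m x y by simp
  qed
  finally show ?thesis by (simp add: x_def y_def)
qed

section \<open>Fourth moments of empirical deviations\<close>

text \<open>Induction on \<open>n\<close>: the new summand is independent of the partial sum, so
  mixed moments factor, and those containing a first power vanish by centring. The three moments are
  carried together because the fourth one uses the first two.\<close>

lemma (in prob_space) fourth_moment_sum_indep:
  fixes Z :: "nat \<Rightarrow> 'a \<Rightarrow> real"
  assumes ind: "indep_vars (\<lambda>_. borel) Z {1..}"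
    and bd: "\<And>i \<omega>. 1 \<le> i \<Longrightarrow> \<bar>Z i \<omega>\<bar> \<le> B"
    and mean: "\<And>i. 1 \<le> i \<Longrightarrow> expectation (Z i) = 0"
    and sec: "\<And>i. 1 \<le> i \<Longrightarrow> expectation (\<lambda>\<omega>. (Z i \<omega>)\<^sup>2) \<le> v"
    and fou: "\<And>i. 1 \<le> i \<Longrightarrow> expectation (\<lambda>\<omega>. (Z i \<omega>) ^ 4) \<le> w"
  shows "expectation (\<lambda>\<omega>. \<Sum>i\<in>{1..n}. Z i \<omega>) = 0 \<and>
    expectation (\<lambda>\<omega>. (\<Sum>i\<in>{1..n}. Z i \<omega>)\<^sup>2) \<le> real n * v \<and>
    expectation (\<lambda>\<omega>. (\<Sum>i\<in>{1..n}. Z i \<omega>) ^ 4) \<le> real n * w + 3 * (real n)\<^sup>2 * v\<^sup>2"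
proof (induction n)
  case 0
  then show ?case by simp
next
  case (Suc n)
  define S where "S = (\<lambda>\<omega>. \<Sum>i\<in>{1..n}. Z i \<omega>)"
  define Y where "Y = Z (Suc n)"
  have Zm[measurable]: "Z i \<in> borel_measurable M" if "1 \<le> i" for i
    using ind that by (auto simp: indep_vars_def)
  have Sm[measurable]: "S \<in> borel_measurable M" unfolding S_def by (intro borel_measurable_sum Zm) auto
  have Ym[measurable]: "Y \<in> borel_measurable M" unfolding Y_def by (intro Zm) auto
  have "indep_vars (\<lambda>_. borel) Z (insert (Suc n) {1..n})"
    by (rule indep_vars_subset[OF ind]) auto
  hence YS: "indep_var borel Y borel S" unfolding Y_def S_def
    by (intro indep_vars_sum) auto
  have v0: "0 \<le> v" using sec[of 1] by (smt (verit) Bochner_Integration.integral_nonneg zero_le_power2 order.refl)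
  have Sb: "\<bar>S \<omega>\<bar> \<le> real n * B" for \<omega>
  proof -
    have "\<bar>S \<omega>\<bar> \<le> (\<Sum>i\<in>{1..n}. \<bar>Z i \<omega>\<bar>)" unfolding S_def by (rule sum_abs)
    also have "\<dots> \<le> (\<Sum>i\<in>{1..n}. B)" by (intro sum_mono bd) auto
    finally show ?thesis by simp
  qed
  have Yb: "\<bar>Y \<omega>\<bar> \<le> B" for \<omega> unfolding Y_def by (rule bd) auto
  have int: "integrable M (\<lambda>\<omega>. (S \<omega>) ^ j * (Y \<omega>) ^ k)" for j k
  proof (rule integrable_const_bound[where B = "(real n * B) ^ j * B ^ k"])
    show "AE x in M. norm (S x ^ j * Y x ^ k) \<le> (real n * B) ^ j * B ^ k"
    proof (rule AE_I2)
      fix x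
      have "\<bar>S x\<bar> ^ j * \<bar>Y x\<bar> ^ k \<le> (real n * B) ^ j * B ^ k"
        using Sb[of x] Yb[of x] by (intro mult_mono power_mono) auto
      thus "norm (S x ^ j * Y x ^ k) \<le> (real n * B) ^ j * B ^ k"
        by (simp add: abs_mult power_abs)
    qed
  qed measurable
  have intS: "integrable M (\<lambda>\<omega>. (S \<omega>) ^ j)" and intY: "integrable M (\<lambda>\<omega>. (Y \<omega>) ^ j)" for j
    using int[of j 0] int[of 0 j] by simp_all
  have prod: "expectation (\<lambda>\<omega>. (S \<omega>) ^ j * (Y \<omega>) ^ k) = expectation (\<lambda>\<omega>. S \<omega> ^ j) * expectation (\<lambda>\<omega>. Y \<omega> ^ k)"
    for j k
  proof -
    have "indep_var borel ((\<lambda>y. y ^ k) \<circ> Y) borel ((\<lambda>y. y ^ j) \<circ> S)"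
      by (rule indep_var_compose[OF YS]) measurable
    hence "expectation (\<lambda>\<omega>. ((\<lambda>y. y ^ k) \<circ> Y) \<omega> * ((\<lambda>y. y ^ j) \<circ> S) \<omega>)
       = expectation ((\<lambda>y. y ^ k) \<circ> Y) * expectation ((\<lambda>y. y ^ j) \<circ> S)"
      by (rule indep_var_lebesgue_integral) (use intS intY in \<open>simp_all add: o_def\<close>)
    thus ?thesis by (simp add: o_def mult.commute)
  qed
  have EY: "expectation Y = 0" "expectation (\<lambda>\<omega>. (Y \<omega>)\<^sup>2) \<le> v" "expectation (\<lambda>\<omega>. (Y \<omega>) ^ 4) \<le> w"
    unfolding Y_def by (intro mean sec fou; simp)+
  have ES: "expectation S = 0" "expectation (\<lambda>\<omega>. (S \<omega>)\<^sup>2) \<le> real n * v"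
    "expectation (\<lambda>\<omega>. (S \<omega>) ^ 4) \<le> real n * w + 3 * (real n)\<^sup>2 * v\<^sup>2"
    using Suc unfolding S_def by auto
  have e: "(\<Sum>i\<in>{1..Suc n}. Z i \<omega>) = S \<omega> + Y \<omega>" for \<omega> by (simp add: S_def Y_def)
  have 1: "expectation (\<lambda>\<omega>. S \<omega> + Y \<omega>) = 0"
    using intS[of 1] intY[of 1] EY ES by simp
  define F where "F = (\<lambda>j k \<omega>. S \<omega> ^ j * Y \<omega> ^ k)"
  have Fint: "integrable M (F j k)"
    and FE: "expectation (F j k) = expectation (\<lambda>\<omega>. S \<omega> ^ j) * expectation (\<lambda>\<omega>. Y \<omega> ^ k)" for j k
    unfolding F_def by (rule int, rule prod)
  have "(\<lambda>\<omega>. (S \<omega> + Y \<omega>)\<^sup>2) = (\<lambda>\<omega>. F 2 0 \<omega> + 2 * F 1 1 \<omega> + F 0 2 \<omega>)"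
    by (auto simp: F_def power2_eq_square algebra_simps)
  hence "expectation (\<lambda>\<omega>. (S \<omega> + Y \<omega>)\<^sup>2) = expectation (F 2 0) + 2 * expectation (F 1 1) + expectation (F 0 2)"
    using Fint by simp
  also have "\<dots> = expectation (\<lambda>\<omega>. S \<omega> ^ 2) + expectation (\<lambda>\<omega>. Y \<omega> ^ 2)"
    unfolding FE using EY ES by (simp add: prob_space)
  also have "\<dots> \<le> real (Suc n) * v" using ES EY by (simp add: algebra_simps)
  finally have 2: "expectation (\<lambda>\<omega>. (S \<omega> + Y \<omega>)\<^sup>2) \<le> real (Suc n) * v" .
  have "(\<lambda>\<omega>. (S \<omega> + Y \<omega>)^4) = (\<lambda>\<omega>. F 4 0 \<omega> + 4 * F 3 1 \<omega> + 6 * F 2 2 \<omega> + 4 * F 1 3 \<omega> + F 0 4 \<omega>)"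
    by (auto simp: F_def power2_eq_square power3_eq_cube power4_eq_xxxx algebra_simps)
  hence "expectation (\<lambda>\<omega>. (S \<omega> + Y \<omega>)^4) = expectation (F 4 0) + 4 * expectation (F 3 1)
      + 6 * expectation (F 2 2) + 4 * expectation (F 1 3) + expectation (F 0 4)"
    using Fint by simp
  also have "\<dots> = expectation (\<lambda>\<omega>. S \<omega> ^ 4) + 6 * (expectation (\<lambda>\<omega>. S \<omega> ^ 2) * expectation (\<lambda>\<omega>. Y \<omega> ^ 2)) + expectation (\<lambda>\<omega>. Y \<omega> ^ 4)"
    unfolding FE using EY ES by (simp add: prob_space)
  also have "\<dots> \<le> (real n * w + 3 * (real n)\<^sup>2 * v\<^sup>2) + 6 * (real n * v * v) + w"
    using ES EY v0 by (intro add_mono mult_left_mono mult_mono) auto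
  also have "\<dots> \<le> real (Suc n) * w + 3 * (real (Suc n))\<^sup>2 * v\<^sup>2"
    using v0 by (simp add: algebra_simps power2_eq_square)
  finally have 3: "expectation (\<lambda>\<omega>. (S \<omega> + Y \<omega>)^4) \<le> real (Suc n) * w + 3 * (real (Suc n))\<^sup>2 * v\<^sup>2" .
  show ?case unfolding e using 1 2 3 by simp
qed

text \<open>The centred empirical measure, without the factor sqrt n. The sample \<open>y\<close> is
  a plain sequence, which separates the deterministic estimates from probability.\<close>

definition dev :: "(real \<Rightarrow> real) \<Rightarrow> nat \<Rightarrow> (nat \<Rightarrow> real) \<Rightarrow> (real \<Rightarrow> real) \<Rightarrow> real" where
  "dev g n y e = (\<Sum>i\<in>{1..n}. e (y i)) / real n - (LINT x|lborel. e x * g x)"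

definition density_fun :: "(real \<Rightarrow> real) \<Rightarrow> bool" where
  "density_fun g \<longleftrightarrow> g \<in> borel_measurable borel \<and> (\<forall>x. 0 \<le> g x) \<and> integrable lborel g \<and> (LINT x|lborel. g x) = 1"

definition iid_sample :: "'w measure \<Rightarrow> (nat \<Rightarrow> 'w \<Rightarrow> real) \<Rightarrow> (real \<Rightarrow> real) \<Rightarrow> bool" where
  "iid_sample M Y g \<longleftrightarrow> prob_space.indep_vars M (\<lambda>_. borel) Y {1..} \<and>
    (\<forall>i\<ge>1. distributed M lborel (Y i) (\<lambda>x. ennreal (g x)))"

lemma integrable_mult_density:
  assumes g: "density_fun g" and [measurable]: "e \<in> borel_measurable borel" and "\<And>x. \<bar>e x\<bar> \<le> B"
  shows "integrable lborel (\<lambda>x. e x * g x)"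
proof (rule Bochner_Integration.integrable_bound)
  show "integrable lborel (\<lambda>x. B * g x)" using g by (auto simp: density_fun_def)
  have [measurable]: "g \<in> borel_measurable borel" using g by (simp add: density_fun_def)
  show "(\<lambda>x. e x * g x) \<in> borel_measurable lborel" by measurable
  have "0 \<le> B" using assms(3)[of 0] by auto
  thus "AE x in lborel. norm (e x * g x) \<le> norm (B * g x)"
    using g assms(3) by (intro AE_I2) (auto simp: abs_mult density_fun_def intro!: mult_right_mono)
qed

text \<open>The centred summands are bounded by 2 and have variance at most \<open>q\<close>, hence
  fourth moment at most \<open>4 * q\<close>. The part \<open>q^2 / n^2\<close> is Gaussian in
  nature, the part \<open>q / n^3\<close> Poissonian; the latter matters only when the expected
  count \<open>n * q\<close> is small.\<close>

lemma (in prob_space) fourth_moment_dev: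
  assumes g: "density_fun g" and iid: "iid_sample M Y g"
    and [measurable]: "e \<in> borel_measurable borel" and bd: "\<And>x. \<bar>e x\<bar> \<le> 1"
    and q: "(LINT x|lborel. \<bar>e x\<bar> * g x) \<le> q" and n: "1 \<le> n"
  shows "integrable M (\<lambda>\<omega>. (dev g n (\<lambda>i. Y i \<omega>) e) ^ 4)"
    and "expectation (\<lambda>\<omega>. (dev g n (\<lambda>i. Y i \<omega>) e) ^ 4) \<le> 3 * q\<^sup>2 / (real n)\<^sup>2 + 4 * q / (real n) ^ 3"
proof -
  have gm[measurable]: "g \<in> borel_measurable borel" and g0: "\<And>x. 0 \<le> g x" and gint: "integrable lborel g" "(LINT x|lborel. g x) = 1"
    using g by (auto simp: density_fun_def)
  note gi = integrable_mult_density[OF g]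
  define m where "m = (LINT x|lborel. e x * g x)"
  define Z where "Z = (\<lambda>i \<omega>. e (Y i \<omega>) - m)"
  have ind: "indep_vars (\<lambda>_. borel) Y {1..}" and dist: "\<And>i. 1 \<le> i \<Longrightarrow> distributed M lborel (Y i) (\<lambda>x. ennreal (g x))"
    using iid by (auto simp: iid_sample_def)
  have Ym[measurable]: "Y i \<in> borel_measurable M" if "1 \<le> i" for i
    using ind that by (auto simp: indep_vars_def)
  have E: "expectation (\<lambda>\<omega>. u (Y i \<omega>)) = (LINT x|lborel. u x * g x)"
    if "1 \<le> i" and [measurable]: "u \<in> borel_measurable borel" for u :: "real \<Rightarrow> real" and i
    using distributed_integral[OF dist[OF that(1)], of u] g0 by (simp add: mult.commute)
  have m1: "\<bar>m\<bar> \<le> 1"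
  proof -
    have "\<bar>m\<bar> \<le> (LINT x|lborel. \<bar>e x * g x\<bar>)" unfolding m_def by (rule integral_abs_bound)
    also have "\<dots> \<le> (LINT x|lborel. g x)"
      using gi[of "\<lambda>x. \<bar>e x\<bar>" 1] gint bd g0 by (intro integral_mono) (auto simp: abs_mult mult_left_le_one_le)
    finally show ?thesis using gint by simp
  qed
  have indZ: "indep_vars (\<lambda>_. borel) Z {1..}"
    unfolding Z_def by (rule indep_vars_compose2[OF ind]) auto
  have Zb: "\<bar>Z i \<omega>\<bar> \<le> 2" for i \<omega> unfolding Z_def using bd[of "Y i \<omega>"] m1 by linarith
  have EZ: "expectation (Z i) = 0" if "1 \<le> i" for i
  proof -
    have "expectation (Z i) = (LINT x|lborel. (e x - m) * g x)" unfolding Z_def using that by (subst E) auto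
    also have "\<dots> = (LINT x|lborel. e x * g x - m * g x)" by (simp add: algebra_simps)
    also have "\<dots> = 0" using gi[of e 1] bd gint by (subst Bochner_Integration.integral_diff) (auto simp: m_def)
    finally show ?thesis .
  qed
  have EZ2: "expectation (\<lambda>\<omega>. (Z i \<omega>)\<^sup>2) \<le> q" if "1 \<le> i" for i
  proof -
    have e2: "\<bar>(e x)\<^sup>2\<bar> \<le> 1" for x using bd[of x] by (simp add: abs_square_le_1)
    have "expectation (\<lambda>\<omega>. (Z i \<omega>)\<^sup>2) = (LINT x|lborel. (e x - m)\<^sup>2 * g x)" unfolding Z_def using that by (subst E) auto
    also have "\<dots> = (LINT x|lborel. (e x)\<^sup>2 * g x - 2 * m * (e x * g x) + m\<^sup>2 * g x)"
      by (simp add: algebra_simps power2_eq_square)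
    also have "\<dots> = (LINT x|lborel. (e x)\<^sup>2 * g x) - m\<^sup>2"
      using gi[of e 1] gi[of "\<lambda>x. (e x)\<^sup>2" 1] bd e2 gint
      by (simp add: m_def power2_eq_square)
    also have "\<dots> \<le> (LINT x|lborel. (e x)\<^sup>2 * g x)" by simp
    also have "\<dots> \<le> (LINT x|lborel. \<bar>e x\<bar> * g x)"
    proof (rule integral_mono)
      show "integrable lborel (\<lambda>x. (e x)\<^sup>2 * g x)" by (rule gi[of _ 1]) (use e2 in auto)
      show "integrable lborel (\<lambda>x. \<bar>e x\<bar> * g x)" by (rule gi[of _ 1]) (use bd in auto)
      fix x
      have "\<bar>e x\<bar> * \<bar>e x\<bar> \<le> \<bar>e x\<bar>" using bd[of x] by (intro mult_left_le) auto
      hence "(e x)\<^sup>2 \<le> \<bar>e x\<bar>" by (simp add: power2_eq_square)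
      thus "(e x)\<^sup>2 * g x \<le> \<bar>e x\<bar> * g x" using g0[of x] by (rule mult_right_mono)
    qed
    finally show ?thesis using q by simp
  qed
  have EZ4: "expectation (\<lambda>\<omega>. (Z i \<omega>)^4) \<le> 4 * q" if "1 \<le> i" for i
  proof -
    have [measurable]: "Z i \<in> borel_measurable M" using that unfolding Z_def by measurable
    have z2: "(Z i \<omega>)\<^sup>2 \<le> 4" for \<omega> using power_mono[OF Zb[of i \<omega>], of 2] by simp
    have i2: "integrable M (\<lambda>\<omega>. (Z i \<omega>)\<^sup>2)"
      by (rule integrable_const_bound[where B = 4]) (use z2 in auto)
    have "expectation (\<lambda>\<omega>. (Z i \<omega>)^4) \<le> expectation (\<lambda>\<omega>. 4 * (Z i \<omega>)\<^sup>2)"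
    proof (rule integral_mono')
      show "integrable M (\<lambda>\<omega>. 4 * (Z i \<omega>)\<^sup>2)" using i2 by simp
      show "(Z i \<omega>)^4 \<le> 4 * (Z i \<omega>)\<^sup>2" for \<omega>
        using mult_right_mono[OF z2[of \<omega>], of "(Z i \<omega>)\<^sup>2"] by (simp add: power4_eq_xxxx power2_eq_square mult.assoc)
      show "0 \<le> 4 * (Z i \<omega>)\<^sup>2" for \<omega> by simp
    qed
    also have "\<dots> \<le> 4 * q" using EZ2[OF that] by simp
    finally show ?thesis .
  qed
  have dev: "dev g n (\<lambda>i. Y i \<omega>) e = (\<Sum>i\<in>{1..n}. Z i \<omega>) / real n" for \<omega>
    using n by (simp add: dev_def Z_def sum_subtractf diff_divide_distrib m_def)
  have "expectation (\<lambda>\<omega>. (\<Sum>i\<in>{1..n}. Z i \<omega>) ^ 4) \<le> real n * (4 * q) + 3 * (real n)\<^sup>2 * q\<^sup>2"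
    using fourth_moment_sum_indep[OF indZ, of 2 q "4 * q" n] Zb EZ EZ2 EZ4 by auto
  hence "expectation (\<lambda>\<omega>. (\<Sum>i\<in>{1..n}. Z i \<omega>) ^ 4) / (real n)^4 \<le> (real n * (4 * q) + 3 * (real n)\<^sup>2 * q\<^sup>2) / (real n)^4"
    by (intro divide_right_mono) auto
  also have "\<dots> = 3 * q\<^sup>2 / (real n)\<^sup>2 + 4 * q / (real n) ^ 3"
    using n by (simp add: field_simps power2_eq_square power3_eq_cube power4_eq_xxxx)
  finally show "expectation (\<lambda>\<omega>. (dev g n (\<lambda>i. Y i \<omega>) e) ^ 4) \<le> 3 * q\<^sup>2 / (real n)\<^sup>2 + 4 * q / (real n) ^ 3"
    unfolding dev by (simp add: power_divide)
  have Zm[measurable]: "Z i \<in> borel_measurable M" if "1 \<le> i" for i using that unfolding Z_def by measurable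
  have [measurable]: "(\<lambda>\<omega>. \<Sum>i\<in>{1..n}. Z i \<omega>) \<in> borel_measurable M" by (intro borel_measurable_sum Zm) auto
  show "integrable M (\<lambda>\<omega>. (dev g n (\<lambda>i. Y i \<omega>) e) ^ 4)" unfolding dev
  proof (rule integrable_const_bound[where B = "2 ^ 4"])
    show "AE \<omega> in M. norm (((\<Sum>i\<in>{1..n}. Z i \<omega>) / real n) ^ 4) \<le> 2 ^ 4"
    proof (rule AE_I2)
      fix \<omega>
      have "\<bar>\<Sum>i\<in>{1..n}. Z i \<omega>\<bar> \<le> (\<Sum>i\<in>{1..n}. 2)" 
        by (rule order_trans[OF sum_abs sum_mono]) (use Zb in auto)
      hence "\<bar>(\<Sum>i\<in>{1..n}. Z i \<omega>) / real n\<bar> \<le> 2" using n by (simp add: field_simps)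
      hence "\<bar>(\<Sum>i\<in>{1..n}. Z i \<omega>) / real n\<bar> ^ 4 \<le> 2 ^ 4" by (intro power_mono) auto
      thus "norm (((\<Sum>i\<in>{1..n}. Z i \<omega>) / real n) ^ 4) \<le> 2 ^ 4" by (simp add: power_abs)
    qed
  qed measurable
qed

section \<open>Multiscale approximation by affine functions\<close>

text \<open>For a concave function \<open>\<nu>\<close> is an antitone multiple of the slope. The error then telescopes over the
  cells of a partition, so at mesh \<open>\<delta>\<close> the total interpolation error is \<open>O(\<delta>)\<close> times the variation of \<open>\<nu>\<close>.\<close>
definition near_affine :: "(real \<Rightarrow> real) \<Rightarrow> (real \<Rightarrow> real) \<Rightarrow> real \<Rightarrow> real \<Rightarrow> bool" where
  "near_affine h \<nu> \<alpha> \<beta> \<longleftrightarrow> (\<forall>a b. \<alpha> \<le> a \<longrightarrow> a < b \<longrightarrow> b \<le> \<beta> \<longrightarrow>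
     (\<exists>c d. \<forall>x\<in>{a..b}. \<bar>h x - (c + d * x)\<bar> \<le> (\<nu> a - \<nu> b) * (b - a)))"

text \<open>The affine coordinate \<open>u\<close>, 0 at \<open>x1\<close> and 1 at
  \<open>x2\<close>, stays between -1 and 4 because the two points are at least a quarter of the
  length apart. The interpolation weights \<open>1 - u\<close> and \<open>u\<close> are therefore at
  most 3 and 4 in absolute value.\<close>

lemma affine_interpolation_bound:
  fixes a b x1 x2 :: real
  assumes "a < b" "a \<le> x1" "x1 \<le> a + (b - a) / 4" "a + (b - a) / 2 \<le> x2" "x2 \<le> a + 3 * (b - a) / 4"
    and "\<bar>c + d * x1\<bar> \<le> s" "\<bar>c + d * x2\<bar> \<le> s" and x: "x \<in> {a..b}"
  shows "\<bar>c + d * x\<bar> \<le> 7 * s"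
proof -
  define u where "u = (x - x1) / (x2 - x1)"
  have d: "(b - a) / 4 \<le> x2 - x1" "0 < x2 - x1" using assms by (auto simp: field_simps)
  have "x - x1 \<le> 4 * (x2 - x1)" "x - x1 \<ge> - 1 * (x2 - x1)" using assms d by (auto simp: field_simps)
  hence u: "u \<le> 4" "-1 \<le> u" using d by (auto simp: u_def field_simps)
  have ux: "u * (x2 - x1) = x - x1" using d by (simp add: u_def)
  have "c + d * x = (1 - u) * (c + d * x1) + u * (c + d * x2)"
  proof -
    have "(1 - u) * (c + d * x1) + u * (c + d * x2) = c + d * (x1 + u * (x2 - x1))" by (simp add: algebra_simps)
    thus ?thesis unfolding ux by simp
  qed
  also have "\<bar>\<dots>\<bar> \<le> \<bar>1 - u\<bar> * \<bar>c + d * x1\<bar> + \<bar>u\<bar> * \<bar>c + d * x2\<bar>"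
    unfolding abs_mult[symmetric] by (rule abs_triangle_ineq)
  also have "\<dots> \<le> 3 * s + 4 * s" using u assms by (intro add_mono mult_mono) auto
  finally show ?thesis by simp
qed

lemma set_integral_mono_subset:
  fixes f :: "'a \<Rightarrow> real"
  assumes int: "set_integrable M B f" and "A \<in> sets M" "A \<subseteq> B" and "\<And>x. 0 \<le> f x"
  shows "(LINT x:A|M. f x) \<le> (LINT x:B|M. f x)"
proof -
  have "set_integrable M A f" by (rule set_integrable_subset[OF int assms(2,3)])
  thus ?thesis using int assms unfolding set_lebesgue_integral_def set_integrable_def
    by (intro integral_mono) (auto simp: indicator_def)
qed

text \<open>In the first and in the third quarter there is a point where \<open>h\<close> is at most
  twice its root mean square; the interpolant is the chord of \<open>h\<close> through these two
  points. The factor 7 of \<open>affine_interpolation_bound\<close> acts twice: 14 = 7 * 2 for the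
  size, 8 = 1 + 7 for the error against the unknown affine approximation.\<close>

lemma exists_local_interpolant:
  fixes h :: "real \<Rightarrow> real"
  assumes "a < b" and hm[measurable]: "h \<in> borel_measurable borel" and int: "set_integrable lborel {a..<b} (\<lambda>x. (h x)\<^sup>2)"
    and E: "\<exists>c d. \<forall>x\<in>{a..b}. \<bar>h x - (c + d * x)\<bar> \<le> E"
  shows "\<exists>p q. \<forall>x\<in>{a..b}. \<bar>p + q * x\<bar> \<le> 14 * sqrt ((LINT x:{a..<b}|lborel. (h x)\<^sup>2) / (b - a)) \<and>
    \<bar>h x - (p + q * x)\<bar> \<le> 8 * E"
proof -
  define S where "S = (LINT x:{a..<b}|lborel. (h x)\<^sup>2)"
  have *: "\<exists>x\<in>{u..u + (b-a)/4}. \<bar>h x\<bar> \<le> 2 * sqrt (S / (b - a))" if u: "a \<le> u" "u + (b-a)/4 < b" for u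
  proof -
    have sub: "{u..u + (b-a)/4} \<subseteq> {a..<b}" using u by auto
    have int': "set_integrable lborel {u..u + (b-a)/4} (\<lambda>x. (h x)\<^sup>2)"
      by (rule set_integrable_subset[OF int]) (use sub in auto)
    obtain x where x: "x \<in> {u..u + (b-a)/4}" "(h x)\<^sup>2 * (u + (b-a)/4 - u) \<le> (LINT x:{u..u + (b-a)/4}|lborel. (h x)\<^sup>2)"
      by (rule exists_le_mean[OF _ int']) (use \<open>a < b\<close> in auto)
    have "(LINT x:{u..u + (b-a)/4}|lborel. (h x)\<^sup>2) \<le> S" unfolding S_def
      by (rule set_integral_mono_subset[OF int]) (use sub in auto)
    hence "(h x)\<^sup>2 \<le> 4 * (S / (b - a))" using x \<open>a < b\<close> by (simp add: field_simps)
    hence "\<bar>h x\<bar> \<le> sqrt (4 * (S / (b - a)))" by (metis real_sqrt_abs real_sqrt_le_mono)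
    also have "\<dots> = 2 * sqrt (S / (b - a))" unfolding real_sqrt_mult by simp
    finally show ?thesis using x by blast
  qed
  obtain x1 where x1: "x1 \<in> {a..a + (b-a)/4}" "\<bar>h x1\<bar> \<le> 2 * sqrt (S / (b - a))"
  proof -
    have "a + (b-a)/4 < b" using \<open>a < b\<close> by (simp add: field_simps)
    thus ?thesis using *[of a] that by auto
  qed
  obtain x2 where x2: "x2 \<in> {a + (b-a)/2..a + (b-a)/2 + (b-a)/4}" "\<bar>h x2\<bar> \<le> 2 * sqrt (S / (b - a))"
  proof -
    have "a \<le> a + (b-a)/2" "a + (b-a)/2 + (b-a)/4 < b" using \<open>a < b\<close> by (simp_all add: field_simps)
    thus ?thesis using *[of "a + (b-a)/2"] that by auto
  qed
  have xx: "x1 < x2"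
  proof -
    have "a + (b-a)/4 < a + (b-a)/2" using \<open>a < b\<close> by (simp add: field_simps)
    thus ?thesis using x1(1) x2(1) unfolding atLeastAtMost_iff by linarith
  qed
  define q where "q = (h x2 - h x1) / (x2 - x1)"
  define p where "p = h x1 - q * x1"
  have p1: "p + q * x1 = h x1" by (simp add: p_def)
  have "q * (x2 - x1) = h x2 - h x1" using xx by (simp add: q_def)
  hence p2: "p + q * x2 = h x2" by (simp add: p_def algebra_simps)
  have rng: "a \<le> x1" "x1 \<le> a + (b - a) / 4" "a + (b - a) / 2 \<le> x2" "x2 \<le> a + 3 * (b - a) / 4"
    using x1 x2 by (auto simp: field_simps)
  obtain c d where cd: "\<And>x. x \<in> {a..b} \<Longrightarrow> \<bar>h x - (c + d * x)\<bar> \<le> E" using E by blast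
  have x12: "x1 \<in> {a..b}" "x2 \<in> {a..b}"
  proof -
    have "a + (b-a)/4 < b" "a + 3*(b-a)/4 < b" "a \<le> a + (b-a)/2" using \<open>a < b\<close> by (simp_all add: field_simps)
    thus "x1 \<in> {a..b}" "x2 \<in> {a..b}" using rng unfolding atLeastAtMost_iff by linarith+
  qed
  have "\<bar>p + q * x\<bar> \<le> 14 * sqrt (S / (b - a)) \<and> \<bar>h x - (p + q * x)\<bar> \<le> 8 * E" if x: "x \<in> {a..b}" for x
  proof
    have "\<bar>p + q * x\<bar> \<le> 7 * (2 * sqrt (S / (b - a)))"
      by (rule affine_interpolation_bound[OF \<open>a < b\<close> rng]) (use p1 p2 x1 x2 x in auto)
    thus "\<bar>p + q * x\<bar> \<le> 14 * sqrt (S / (b - a))" by simp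
    have "\<bar>(p - c) + (q - d) * x\<bar> \<le> 7 * E"
    proof (rule affine_interpolation_bound[OF \<open>a < b\<close> rng])
      have "(p - c) + (q - d) * x1 = h x1 - (c + d * x1)" using p1 by (simp add: algebra_simps)
      thus "\<bar>p - c + (q - d) * x1\<bar> \<le> E" using cd[OF x12(1)] by simp
      have "(p - c) + (q - d) * x2 = h x2 - (c + d * x2)" using p2 by (simp add: algebra_simps)
      thus "\<bar>p - c + (q - d) * x2\<bar> \<le> E" using cd[OF x12(2)] by simp
    qed (use x in auto)
    moreover have "h x - (p + q * x) = (h x - (c + d * x)) - ((p - c) + (q - d) * x)" by (simp add: algebra_simps)
    ultimately show "\<bar>h x - (p + q * x)\<bar> \<le> 8 * E" using cd[OF x] by linarith
  qed
  thus ?thesis unfolding S_def by blast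
qed

lemma sum_indicator_consecutive:
  fixes f :: "nat \<Rightarrow> real"
  assumes "mono f"
  shows "(\<Sum>k<m. indicator {f k..<f (Suc k)} x) = (indicator {f 0..<f m} x :: real)"
proof (induction m)
  case (Suc m)
  have "f 0 \<le> f m" "f m \<le> f (Suc m)" using assms by (auto simp: mono_def)
  then show ?case using Suc by (auto simp: indicator_def)
qed auto

lemma sum_pairs: "(\<Sum>k<2 * m. F k) = (\<Sum>j<m. F (2 * j) + F (2 * j + 1))" for F :: "nat \<Rightarrow> 'a :: comm_monoid_add"
proof (induction m)
  case (Suc m)
  have "2 * Suc m = Suc (Suc (2 * m))" by simp
  then show ?case using Suc by (simp only: sum.lessThan_Suc) (simp add: add.assoc)
qed simp

text \<open>Here \<open>x\<close> is a coefficient that depends on the fit and \<open>W\<close> a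
  fluctuation that does not. While \<open>W \<le> \<tau>\<close> the small bound \<open>b\<close> is
  used; beyond, \<open>W \<le> W^2 / \<tau>\<close> and Young's inequality trade the product for
  \<open>a^2\<close> and a fourth power, whose expectation does not involve the fit.\<close>

lemma product_threshold_bound:
  fixes a b x W \<tau> \<beta> :: real
  assumes "0 \<le> x" "x \<le> a" "x \<le> b" "0 \<le> W" "0 < \<tau>" "0 < \<beta>"
  shows "x * W \<le> b * \<tau> + \<beta> * a\<^sup>2 + W ^ 4 / (4 * \<beta> * \<tau>\<^sup>2)"
proof (cases "W \<le> \<tau>")
  case True
  have "x * W \<le> b * \<tau>" using assms True by (intro mult_mono) auto
  moreover have "0 \<le> \<beta> * a\<^sup>2" "0 \<le> W ^ 4 / (4 * \<beta> * \<tau>\<^sup>2)" using assms by auto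
  ultimately show ?thesis by linarith
next
  case False
  have "x * W \<le> a * (W\<^sup>2 / \<tau>)"
    using assms False by (intro mult_mono) (auto simp: field_simps power2_eq_square)
  also have "\<dots> \<le> \<beta> * a\<^sup>2 + (W\<^sup>2 / \<tau>)\<^sup>2 / (4 * \<beta>)"
  proof -
    have "0 \<le> (2 * \<beta> * a - W\<^sup>2 / \<tau>)\<^sup>2 / (4 * \<beta>)" using assms by simp
    also have "\<dots> = \<beta> * a\<^sup>2 + (W\<^sup>2 / \<tau>)\<^sup>2 / (4 * \<beta>) - a * (W\<^sup>2 / \<tau>)"
      using assms by (simp add: power2_diff field_simps power2_eq_square)
    finally show ?thesis by simp
  qed
  also have "(W\<^sup>2 / \<tau>)\<^sup>2 / (4 * \<beta>) = W ^ 4 / (4 * \<beta> * \<tau>\<^sup>2)"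
    by (simp add: power_divide flip: power_mult)
  finally show ?thesis using assms by (smt (verit) mult_nonneg_nonneg)
qed

text \<open>For the coarsest level, where no approximation bound \<open>b\<close> is at hand:
  \<open>x * \<tau>\<close> is absorbed by Young's inequality as well.\<close>

lemma product_threshold_bound':
  fixes x W \<tau> \<beta> :: real
  assumes "0 \<le> x" "0 \<le> W" "0 < \<tau>" "0 < \<beta>"
  shows "x * W \<le> 2 * (\<beta> * x\<^sup>2) + \<tau>\<^sup>2 / (4 * \<beta>) + W ^ 4 / (4 * \<beta> * \<tau>\<^sup>2)"
proof -
  have "0 \<le> (2 * \<beta> * x - \<tau>)\<^sup>2 / (4 * \<beta>)" using assms by simp
  also have "\<dots> = \<beta> * x\<^sup>2 + \<tau>\<^sup>2 / (4 * \<beta>) - x * \<tau>"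
    using assms by (simp add: power2_diff field_simps power2_eq_square)
  finally have "x * \<tau> \<le> \<beta> * x\<^sup>2 + \<tau>\<^sup>2 / (4 * \<beta>)" by simp
  thus ?thesis using product_threshold_bound[of x x x W \<tau> \<beta>] assms by simp
qed

section \<open>Linearity and crude bounds of the deviation functional\<close>

lemma dev_add:
  assumes "integrable lborel (\<lambda>x. e x * g x)" "integrable lborel (\<lambda>x. e' x * g x)"
  shows "dev g n y (\<lambda>x. e x + e' x) = dev g n y e + dev g n y e'"
proof -
  have "(LINT x|lborel. (e x + e' x) * g x) = (LINT x|lborel. e x * g x) + (LINT x|lborel. e' x * g x)"
    unfolding distrib_right using assms by (rule Bochner_Integration.integral_add)
  thus ?thesis unfolding dev_def by (simp add: sum.distrib add_divide_distrib)
qed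

lemma dev_diff:
  assumes "integrable lborel (\<lambda>x. e x * g x)" "integrable lborel (\<lambda>x. e' x * g x)"
  shows "dev g n y (\<lambda>x. e x - e' x) = dev g n y e - dev g n y e'"
proof -
  have "(LINT x|lborel. (e x - e' x) * g x) = (LINT x|lborel. e x * g x) - (LINT x|lborel. e' x * g x)"
    unfolding left_diff_distrib using assms by (rule Bochner_Integration.integral_diff)
  thus ?thesis unfolding dev_def by (simp add: sum_subtractf diff_divide_distrib)
qed

lemma dev_cmult: "dev g n y (\<lambda>x. c * e x) = c * dev g n y e"
proof -
  have "(LINT x|lborel. c * e x * g x) = c * (LINT x|lborel. e x * g x)"
    unfolding mult.assoc by (rule integral_mult_right_zero)
  moreover have "(\<Sum>i\<in>{1..n}. c * e (y i)) = c * (\<Sum>i\<in>{1..n}. e (y i))"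
    by (rule sum_distrib_left[symmetric])
  ultimately show ?thesis unfolding dev_def by (simp only: right_diff_distrib times_divide_eq_right)
qed

lemma dev_sum:
  assumes "\<And>k. k \<in> K \<Longrightarrow> integrable lborel (\<lambda>x. e k x * g x)"
  shows "dev g n y (\<lambda>x. \<Sum>k\<in>K. e k x) = (\<Sum>k\<in>K. dev g n y (e k))"
proof -
  have "(\<Sum>i\<in>{1..n}. \<Sum>k\<in>K. e k (y i)) = (\<Sum>k\<in>K. \<Sum>i\<in>{1..n}. e k (y i))" by (rule sum.swap)
  thus ?thesis using assms
    by (simp add: dev_def sum_subtractf sum_distrib_right sum_divide_distrib[symmetric])
qed

text \<open>Triangle inequality without cancellation between the empirical and the true mean. It
  serves for the residual of the last level, where \<open>s\<close> is already small.\<close>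

lemma abs_dev_le:
  assumes g: "density_fun g" and [measurable]: "e \<in> borel_measurable borel" "B \<in> sets borel"
    and e: "\<And>x. \<bar>e x\<bar> \<le> s * indicator B x" and "0 \<le> s"
  shows "\<bar>dev g n y e\<bar> \<le> s * ((\<Sum>i\<in>{1..n}. indicator B (y i)) / real n + (LINT x|lborel. indicator B x * g x))"
proof -
  have g0: "\<And>x. 0 \<le> g x" using g by (simp add: density_fun_def)
  have eb: "\<bar>e x\<bar> \<le> s" for x using e[of x] \<open>0 \<le> s\<close> by (cases "x \<in> B") auto
  have "\<bar>\<Sum>i\<in>{1..n}. e (y i)\<bar> \<le> (\<Sum>i\<in>{1..n}. s * indicator B (y i))"
    by (rule order_trans[OF sum_abs sum_mono]) (rule e)
  hence "\<bar>(\<Sum>i\<in>{1..n}. e (y i)) / real n\<bar> \<le> s * ((\<Sum>i\<in>{1..n}. indicator B (y i)) / real n)"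
    by (simp add: sum_distrib_left divide_right_mono)
  moreover have "\<bar>LINT x|lborel. e x * g x\<bar> \<le> s * (LINT x|lborel. indicator B x * g x)"
  proof -
    have i1: "integrable lborel (\<lambda>x. indicator B x * g x)" 
      by (rule integrable_mult_density[OF g, of _ 1]) (auto simp: indicator_def)
    have "\<bar>LINT x|lborel. e x * g x\<bar> \<le> (LINT x|lborel. \<bar>e x * g x\<bar>)" by (rule integral_abs_bound)
    also have "\<dots> \<le> (LINT x|lborel. s * (indicator B x * g x))"
    proof (rule integral_mono)
      show "integrable lborel (\<lambda>x. \<bar>e x * g x\<bar>)" 
        using integrable_mult_density[OF g _ eb] by auto
      show "integrable lborel (\<lambda>x. s * (indicator B x * g x))" using i1 by simp
      show "\<bar>e x * g x\<bar> \<le> s * (indicator B x * g x)" for x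
        using mult_right_mono[OF e[of x] g0[of x]] g0[of x] by (simp add: abs_mult mult_ac)
    qed
    finally show ?thesis by simp
  qed
  ultimately show ?thesis unfolding dev_def distrib_left by linarith
qed

text \<open>Together with the indicator, \<open>cell_e1\<close> spans the affine functions on a cell.\<close>
definition cell_e1 :: "real \<Rightarrow> real \<Rightarrow> real \<Rightarrow> real" where
  "cell_e1 a b x = indicator {a..<b} x * ((2 * x - a - b) / (b - a))"

definition cell_dev :: "(real \<Rightarrow> real) \<Rightarrow> nat \<Rightarrow> (nat \<Rightarrow> real) \<Rightarrow> real \<Rightarrow> real \<Rightarrow> real" where
  "cell_dev g n y a b = \<bar>dev g n y (indicator {a..<b})\<bar> + \<bar>dev g n y (cell_e1 a b)\<bar>"

lemma cell_dev_nonneg: "0 \<le> cell_dev g n y a b" by (simp add: cell_dev_def)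

lemma cell_e1_measurable[measurable]: "cell_e1 a b \<in> borel_measurable borel"
proof -
  have "cell_e1 a b = (\<lambda>x. indicator {a..<b} x * ((2 * x - a - b) / (b - a)))" by (rule ext) (rule cell_e1_def)
  moreover have "(\<lambda>x. indicator {a..<b} x * ((2 * x - a - b) / (b - a))) \<in> borel_measurable borel"
    by (intro borel_measurable_times borel_measurable_divide borel_measurable_diff borel_measurable_const
        borel_measurable_indicator measurable_ident) auto
  ultimately show ?thesis by simp
qed

lemma abs_cell_e1_le: "\<bar>cell_e1 a b x\<bar> \<le> indicator {a..<b} x"
proof (cases "x \<in> {a..<b}")
  case True
  hence "\<bar>2 * x - a - b\<bar> \<le> b - a" "0 < b - a" by auto
  hence "\<bar>(2 * x - a - b) / (b - a)\<bar> \<le> 1" by (simp add: abs_divide)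
  thus ?thesis using True by (simp add: cell_e1_def)
qed (simp add: cell_e1_def)

lemma abs_half_sum_diff_le:
  fixes A B s :: real
  assumes "\<bar>A\<bar> \<le> s" "\<bar>B\<bar> \<le> s"
  shows "\<bar>(A + B) / 2\<bar> \<le> s" "\<bar>(B - A) / 2\<bar> \<le> s"
proof -
  have *: "- s \<le> A" "A \<le> s" "- s \<le> B" "B \<le> s" using assms by (simp_all add: abs_le_iff)
  show "\<bar>(A + B) / 2\<bar> \<le> s" by (rule abs_leI) (use * in \<open>simp_all add: field_simps\<close>)
  show "\<bar>(B - A) / 2\<bar> \<le> s" by (rule abs_leI) (use * in \<open>simp_all add: field_simps\<close>)
qed

text \<open>The half sum \<open>u\<close> and half difference \<open>v\<close> of the end values are
  the coordinates with respect to the indicator and \<open>cell_e1\<close>; both are bounded by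
  \<open>s\<close>.\<close>

lemma abs_dev_affine_cell:
  assumes g: "density_fun g" and "a < b"
    and s: "\<bar>p + q * a\<bar> \<le> s" "\<bar>p + q * b\<bar> \<le> s"
  shows "\<bar>dev g n y (\<lambda>x. indicator {a..<b} x * (p + q * x))\<bar> \<le> s * cell_dev g n y a b"
proof -
  define u v where "u = ((p + q * a) + (p + q * b)) / 2" and "v = ((p + q * b) - (p + q * a)) / 2"
  have eq: "(\<lambda>x. indicator {a..<b} x * (p + q * x)) = (\<lambda>x. u * indicator {a..<b} x + v * cell_e1 a b x)"
  proof
    fix x
    have "p + q * x = u + v * ((2 * x - a - b) / (b - a))"
      using \<open>a < b\<close> by (simp add: u_def v_def field_simps)
    thus "indicator {a..<b} x * (p + q * x) = u * indicator {a..<b} x + v * cell_e1 a b x"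
      by (simp add: cell_e1_def algebra_simps)
  qed
  have i0: "integrable lborel (\<lambda>x. indicator {a..<b} x * g x)"
    by (rule integrable_mult_density[OF g, of _ 1]) (auto simp: indicator_def)
  have "\<bar>cell_e1 a b x\<bar> \<le> 1" for x using abs_cell_e1_le[of a b x] by (cases "x \<in> {a..<b}") auto
  hence i1: "integrable lborel (\<lambda>x. cell_e1 a b x * g x)"
    by (intro integrable_mult_density[OF g, of _ 1]) auto
  have dev_eq: "dev g n y (\<lambda>x. indicator {a..<b} x * (p + q * x))
     = u * dev g n y (indicator {a..<b}) + v * dev g n y (cell_e1 a b)"
  proof -
    have "integrable lborel (\<lambda>x. u * indicator {a..<b} x * g x)" "integrable lborel (\<lambda>x. v * cell_e1 a b x * g x)"
      unfolding mult.assoc by (intro integrable_mult_right i0 i1)+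
    thus ?thesis unfolding eq by (simp only: dev_add dev_cmult)
  qed
  have "\<bar>dev g n y (\<lambda>x. indicator {a..<b} x * (p + q * x))\<bar> \<le> \<bar>u\<bar> * \<bar>dev g n y (indicator {a..<b})\<bar> + \<bar>v\<bar> * \<bar>dev g n y (cell_e1 a b)\<bar>"
    using abs_triangle_ineq[of "u * dev g n y (indicator {a..<b})" "v * dev g n y (cell_e1 a b)"] unfolding abs_mult dev_eq .
  also have "\<dots> \<le> s * \<bar>dev g n y (indicator {a..<b})\<bar> + s * \<bar>dev g n y (cell_e1 a b)\<bar>"
  proof -
    have uv1: "\<bar>u\<bar> \<le> s" unfolding u_def by (rule abs_half_sum_diff_le(1)[OF s(1) s(2)])
    have uv2: "\<bar>v\<bar> \<le> s" unfolding v_def by (rule abs_half_sum_diff_le(2)[OF s(1) s(2)])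
    show ?thesis by (rule add_mono[OF mult_right_mono[OF uv1 abs_ge_zero] mult_right_mono[OF uv2 abs_ge_zero]])
  qed
  finally show ?thesis unfolding cell_dev_def distrib_left .
qed

section \<open>Deterministic chaining on one block\<close>

text \<open>The bound \<open>V / lam\<close> on the drop of \<open>\<nu>\<close> scales with the
  block length, so that one absolute constant \<open>V\<close> can serve all blocks.\<close>

locale near_affine_block =
  fixes g :: "real \<Rightarrow> real" and n :: nat and y :: "nat \<Rightarrow> real" and \<alpha> lam :: real and N :: nat
    and h \<nu> :: "real \<Rightarrow> real" and V :: real
  assumes dens: "density_fun g" and n1: "1 \<le> n" and lam: "0 < lam" and N1: "1 \<le> N"
    and hm[measurable]: "h \<in> borel_measurable borel"
    and na: "near_affine h \<nu> \<alpha> (\<alpha> + lam)" and Vb: "\<nu> \<alpha> - \<nu> (\<alpha> + lam) \<le> V / lam"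
begin

text \<open>Halving the cells at each level. \<open>S\<close> is the energy of \<open>h\<close> on a
  cell, \<open>E\<close> bounds its distance from affine functions, and \<open>W\<close> is the only
  quantity here that sees the sample.\<close>

definition cnt :: "nat \<Rightarrow> nat" where "cnt i = N * 2 ^ i"
definition pt :: "nat \<Rightarrow> nat \<Rightarrow> real" where "pt i k = \<alpha> + real k * (lam / real (cnt i))"
definition wid :: "nat \<Rightarrow> real" where "wid i = lam / real (cnt i)"
definition cell :: "nat \<Rightarrow> nat \<Rightarrow> real set" where "cell i k = {pt i k..<pt i (Suc k)}"
definition S :: "nat \<Rightarrow> nat \<Rightarrow> real" where "S i k = (LINT x:cell i k|lborel. (h x)\<^sup>2)"
definition SB :: real where "SB = (LINT x:{\<alpha>..<\<alpha> + lam}|lborel. (h x)\<^sup>2)"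
definition E :: "nat \<Rightarrow> nat \<Rightarrow> real" where "E i k = (\<nu> (pt i k) - \<nu> (pt i (Suc k))) * wid i"
definition W :: "nat \<Rightarrow> nat \<Rightarrow> real" where "W i k = cell_dev g n y (pt i k) (pt i (Suc k))"

lemma cnt_pos: "0 < cnt i" using N1 by (simp add: cnt_def)
lemma wid_pos: "0 < wid i" using cnt_pos lam by (simp add: wid_def)
lemma pt_Suc: "pt i (Suc k) = pt i k + wid i" by (simp add: pt_def wid_def algebra_simps add_divide_distrib)
lemma pt_less_Suc: "pt i k < pt i (Suc k)" using wid_pos by (simp add: pt_Suc)
lemma pt_0: "pt i 0 = \<alpha>" by (simp add: pt_def)
lemma pt_cnt: "pt i (cnt i) = \<alpha> + lam" using cnt_pos[of i] by (simp add: pt_def)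
lemma pt_mono: "mono (pt i)"
proof (rule monoI)
  fix k l :: nat assume "k \<le> l"
  show "pt i k \<le> pt i l" by (rule lift_Suc_mono_le[OF _ \<open>k \<le> l\<close>]) (rule less_imp_le[OF pt_less_Suc])
qed
lemma pt_double: "pt (Suc i) (2 * k) = pt i k" using cnt_pos[of i] by (simp add: pt_def cnt_def)
lemma wid_Suc: "wid (Suc i) = wid i / 2" by (simp add: wid_def cnt_def)
lemma pt_ge: "\<alpha> \<le> pt i k" using monoD[OF pt_mono, of 0 k i] by (simp add: pt_0)
lemma pt_le: "k \<le> cnt i \<Longrightarrow> pt i k \<le> \<alpha> + lam" using monoD[OF pt_mono, of k "cnt i" i] by (simp add: pt_cnt)
lemma W_nonneg: "0 \<le> W i k" by (simp add: W_def cell_dev_nonneg)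

lemma h_bounded: obtains C where "\<And>x. x \<in> {\<alpha>..\<alpha> + lam} \<Longrightarrow> \<bar>h x\<bar> \<le> C"
proof -
  have "\<exists>c d. \<forall>x\<in>{\<alpha>..\<alpha> + lam}. \<bar>h x - (c + d * x)\<bar> \<le> (\<nu> \<alpha> - \<nu> (\<alpha> + lam)) * (\<alpha> + lam - \<alpha>)"
    by (rule na[unfolded near_affine_def, rule_format]) (use lam in auto)
  then obtain c d where cd: "\<And>x. x \<in> {\<alpha>..\<alpha> + lam} \<Longrightarrow> \<bar>h x - (c + d * x)\<bar> \<le> (\<nu> \<alpha> - \<nu> (\<alpha> + lam)) * lam"
    unfolding add_diff_cancel_left' by blast
  show ?thesis
  proof (rule that)
    fix x assume x: "x \<in> {\<alpha>..\<alpha> + lam}"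
    have "\<bar>d * x\<bar> \<le> \<bar>d\<bar> * (\<bar>\<alpha>\<bar> + \<bar>\<alpha> + lam\<bar>)" unfolding abs_mult using x by (intro mult_left_mono) auto
    thus "\<bar>h x\<bar> \<le> (\<nu> \<alpha> - \<nu> (\<alpha> + lam)) * lam + \<bar>c\<bar> + \<bar>d\<bar> * (\<bar>\<alpha>\<bar> + \<bar>\<alpha> + lam\<bar>)"
      using cd[OF x] by linarith
  qed
qed

lemma set_integrable_h2: "A \<in> sets borel \<Longrightarrow> A \<subseteq> {\<alpha>..\<alpha> + lam} \<Longrightarrow> set_integrable lborel A (\<lambda>x. (h x)\<^sup>2)"
proof -
  assume A: "A \<in> sets borel" "A \<subseteq> {\<alpha>..\<alpha> + lam}"
  obtain C where C: "\<And>x. x \<in> {\<alpha>..\<alpha> + lam} \<Longrightarrow> \<bar>h x\<bar> \<le> C" by (rule h_bounded) blast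
  have "set_integrable lborel {\<alpha>..\<alpha> + lam} (\<lambda>x. (h x)\<^sup>2)"
    unfolding set_integrable_def
  proof (rule Bochner_Integration.integrable_bound)
    show "integrable lborel (\<lambda>x. indicator {\<alpha>..\<alpha> + lam} x *\<^sub>R C\<^sup>2)"
      by (intro integrable_scaleR_left integrable_real_indicator) (auto simp: emeasure_lborel_Icc_eq)
    show "AE x in lborel. norm (indicat_real {\<alpha>..\<alpha> + lam} x *\<^sub>R (h x)\<^sup>2) \<le> norm (indicat_real {\<alpha>..\<alpha> + lam} x *\<^sub>R C\<^sup>2)"
    proof (rule AE_I2)
      fix x show "norm (indicat_real {\<alpha>..\<alpha> + lam} x *\<^sub>R (h x)\<^sup>2) \<le> norm (indicat_real {\<alpha>..\<alpha> + lam} x *\<^sub>R C\<^sup>2)"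
        using power_mono[OF C[of x], of 2] by (cases "x \<in> {\<alpha>..\<alpha> + lam}") auto
    qed
  qed measurable
  thus ?thesis by (rule set_integrable_subset) (use A in auto)
qed

lemma cell_subset: "k < cnt i \<Longrightarrow> cell i k \<subseteq> {\<alpha>..<\<alpha> + lam}"
  using pt_ge[of i k] pt_le[of "Suc k" i] by (auto simp: cell_def)

lemma S_nonneg: "0 \<le> S i k"
  unfolding S_def set_lebesgue_integral_def by (intro integral_nonneg_AE AE_I2) auto

lemma interpolant_ex: "k < cnt i \<Longrightarrow> \<exists>pq. \<forall>x\<in>{pt i k..pt i (Suc k)}.
   \<bar>fst pq + snd pq * x\<bar> \<le> 14 * sqrt (S i k / wid i) \<and> \<bar>h x - (fst pq + snd pq * x)\<bar> \<le> 8 * E i k"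
proof -
  assume k: "k < cnt i"
  have w: "pt i (Suc k) - pt i k = wid i" by (simp add: pt_Suc)
  have "\<exists>c d. \<forall>x\<in>{pt i k..pt i (Suc k)}. \<bar>h x - (c + d * x)\<bar> \<le> E i k"
    using na pt_ge[of i k] pt_less_Suc[of i k] pt_le[of "Suc k" i] k
    unfolding near_affine_def E_def w[symmetric] by auto
  moreover have "set_integrable lborel (cell i k) (\<lambda>x. (h x)\<^sup>2)"
    by (rule set_integrable_h2) (use cell_subset[OF k] in \<open>auto simp: cell_def\<close>)
  ultimately have "\<exists>p q. \<forall>x\<in>{pt i k..pt i (Suc k)}. \<bar>p + q * x\<bar> \<le> 14 * sqrt (S i k / wid i) \<and>
    \<bar>h x - (p + q * x)\<bar> \<le> 8 * E i k"
    using exists_local_interpolant[OF pt_less_Suc hm, of i k "E i k"] unfolding S_def cell_def w by blast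
  thus ?thesis by auto
qed

definition ip :: "nat \<Rightarrow> nat \<Rightarrow> real \<times> real" where
  "ip i k = (SOME pq. \<forall>x\<in>{pt i k..pt i (Suc k)}.
   \<bar>fst pq + snd pq * x\<bar> \<le> 14 * sqrt (S i k / wid i) \<and> \<bar>h x - (fst pq + snd pq * x)\<bar> \<le> 8 * E i k)"

definition aff :: "nat \<Rightarrow> nat \<Rightarrow> real \<Rightarrow> real" where "aff i k x = fst (ip i k) + snd (ip i k) * x"

lemma aff_bounds:
  assumes "k < cnt i" "x \<in> {pt i k..pt i (Suc k)}"
  shows "\<bar>aff i k x\<bar> \<le> 14 * sqrt (S i k / wid i)" "\<bar>h x - aff i k x\<bar> \<le> 8 * E i k"
  using someI_ex[OF interpolant_ex[OF assms(1)]] assms(2) unfolding ip_def[symmetric] aff_def by auto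

text \<open>The deviation of \<open>h\<close> is telescoped into \<open>G 0\<close>, the increments
  between successive levels, and a residual at the last level.\<close>

definition G :: "nat \<Rightarrow> real \<Rightarrow> real" where
  "G i x = (\<Sum>k<cnt i. indicator (cell i k) x * aff i k x)"

lemma sum_cells: "(\<Sum>k<cnt i. indicator (cell i k) x) = (indicator {\<alpha>..<\<alpha> + lam} x :: real)"
  unfolding cell_def using sum_indicator_consecutive[OF pt_mono[of i], where m = "cnt i" and x = x] by (simp add: pt_0 pt_cnt)

text \<open>The errors telescope over the cells, so their sum decays like one over the number of
  cells. For a merely Lipschitz function each error is of the order of the mesh and the sum does not
  decay; this is the gain from concavity.\<close>

lemma sum_E: "(\<Sum>k<cnt i. E i k) \<le> V / real (cnt i)"
proof -
  have "(\<Sum>k<cnt i. E i k) = (\<nu> (pt i 0) - \<nu> (pt i (cnt i))) * wid i"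
    unfolding E_def sum_distrib_right[symmetric]
    using sum_lessThan_telescope'[of "\<lambda>k. \<nu> (pt i k)" "cnt i"] by simp
  also have "\<dots> \<le> V / lam * wid i" unfolding pt_0 pt_cnt using Vb wid_pos[of i] by (intro mult_right_mono) auto
  also have "\<dots> = V / real (cnt i)" using lam by (simp add: wid_def)
  finally show ?thesis .
qed

lemma sum_S: "(\<Sum>k<cnt i. S i k) = SB"
proof -
  have "(\<Sum>k<cnt i. S i k) = (LINT x|lborel. (\<Sum>k<cnt i. indicator (cell i k) x *\<^sub>R (h x)\<^sup>2))"
    unfolding S_def set_lebesgue_integral_def
    by (rule Bochner_Integration.integral_sum[symmetric])
       (use set_integrable_h2[of "cell i _"] cell_subset in \<open>force simp: set_integrable_def cell_def\<close>)
  also have "\<dots> = SB" unfolding SB_def set_lebesgue_integral_def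
    by (simp add: sum_distrib_right[symmetric] sum_cells)
  finally show ?thesis .
qed

lemma integrable_cell_affine: "integrable lborel (\<lambda>x. indicator {a..<b} x * (p + q * x) * g x)"
proof (rule integrable_mult_density[OF dens])
  fix x :: real
  have "\<bar>p + q * x\<bar> \<le> \<bar>p\<bar> + \<bar>q\<bar> * (\<bar>a\<bar> + \<bar>b\<bar>)" if "x \<in> {a..<b}"
  proof -
    have "\<bar>q * x\<bar> \<le> \<bar>q\<bar> * (\<bar>a\<bar> + \<bar>b\<bar>)" unfolding abs_mult using that by (intro mult_left_mono) auto
    thus ?thesis by linarith
  qed
  thus "\<bar>indicator {a..<b} x * (p + q * x)\<bar> \<le> \<bar>p\<bar> + \<bar>q\<bar> * (\<bar>a\<bar> + \<bar>b\<bar>)"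
    by (cases "x \<in> {a..<b}") auto
qed measurable

lemma integrable_G: "integrable lborel (\<lambda>x. G i x * g x)"
  unfolding G_def sum_distrib_right aff_def cell_def
  by (intro Bochner_Integration.integrable_sum integrable_cell_affine)

lemma aff_measurable[measurable]: "aff i k \<in> borel_measurable borel"
  unfolding aff_def[abs_def] by measurable
lemma cell_measurable[measurable]: "cell i k \<in> sets borel" by (simp add: cell_def)
lemma G_measurable[measurable]: "G i \<in> borel_measurable borel"
  unfolding G_def[abs_def] by measurable

lemma dev_G0: "\<bar>dev g n y (G 0)\<bar> \<le> (\<Sum>k<N. 14 * sqrt (S 0 k / wid 0) * W 0 k)"
proof -
  have c: "cnt 0 = N" by (simp add: cnt_def)
  have "dev g n y (G 0) = (\<Sum>k<cnt 0. dev g n y (\<lambda>x. indicator (cell 0 k) x * aff 0 k x))"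
    unfolding G_def[abs_def] by (rule dev_sum) (unfold cell_def aff_def, rule integrable_cell_affine)
  hence "\<bar>dev g n y (G 0)\<bar> \<le> (\<Sum>k<cnt 0. \<bar>dev g n y (\<lambda>x. indicator (cell 0 k) x * aff 0 k x)\<bar>)"
    by (simp only: sum_abs)
  also have "\<dots> \<le> (\<Sum>k<cnt 0. 14 * sqrt (S 0 k / wid 0) * W 0 k)"
  proof (rule sum_mono)
    fix k assume "k \<in> {..<cnt 0}"
    hence k: "k < cnt 0" by simp
    show "\<bar>dev g n y (\<lambda>x. indicator (cell 0 k) x * aff 0 k x)\<bar> \<le> 14 * sqrt (S 0 k / wid 0) * W 0 k"
      unfolding cell_def aff_def W_def
      by (rule abs_dev_affine_cell[OF dens pt_less_Suc])
         (use aff_bounds(1)[OF k] pt_less_Suc[of 0 k] in \<open>auto simp: aff_def\<close>)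
  qed
  finally show ?thesis by (simp add: c)
qed

text \<open>Two bounds for the change from a parent's interpolant to a child's: by their sizes, 28 =
  14 + 14, and by their distances to \<open>h\<close>, 8 times an error each. They play the parts of
  \<open>a\<close> and \<open>b\<close> in \<open>product_threshold_bound\<close>.\<close>

definition X :: "nat \<Rightarrow> nat \<Rightarrow> real" where
  "X i k = min (28 * sqrt (S i (k div 2) / wid (Suc i))) (8 * E (Suc i) k + 8 * E i (k div 2))"

lemma child:
  assumes k: "k < cnt (Suc i)"
  shows "k div 2 < cnt i" "pt i (k div 2) \<le> pt (Suc i) k" "pt (Suc i) (Suc k) \<le> pt i (Suc (k div 2))"
    "S (Suc i) k \<le> S i (k div 2)"
proof -
  show kd: "k div 2 < cnt i" using k by (simp add: cnt_def)
  have le: "2 * (k div 2) \<le> k" "Suc k \<le> 2 * Suc (k div 2)" by auto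
  show p1: "pt i (k div 2) \<le> pt (Suc i) k" using monoD[OF pt_mono le(1), of "Suc i"] by (simp only: pt_double)
  show p2: "pt (Suc i) (Suc k) \<le> pt i (Suc (k div 2))" using monoD[OF pt_mono le(2), of "Suc i"] by (simp only: pt_double)
  have "cell (Suc i) k \<subseteq> cell i (k div 2)" using p1 p2 by (auto simp: cell_def)
  moreover have "set_integrable lborel (cell i (k div 2)) (\<lambda>x. (h x)\<^sup>2)"
    using cell_subset[OF kd] by (intro set_integrable_h2) (auto simp: cell_def)
  ultimately show "S (Suc i) k \<le> S i (k div 2)"
    unfolding S_def by (intro set_integral_mono_subset) (auto simp: cell_def)
qed

text \<open>On a child cell both interpolants are affine, so the deviation of their difference is at
  most its maximum times \<open>W\<close>. To this end \<open>G i\<close> is rewritten over the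
  finer cells, with \<open>k div 2\<close> as the index of the parent.\<close>

lemma dev_step: "\<bar>dev g n y (G (Suc i)) - dev g n y (G i)\<bar> \<le> (\<Sum>k<cnt (Suc i). X i k * W (Suc i) k)"
proof -
  let ?D = "\<lambda>k x. indicator (cell (Suc i) k) x * (aff (Suc i) k x - aff i (k div 2) x)"
  have Gi: "G i x = (\<Sum>k<cnt (Suc i). indicator (cell (Suc i) k) x * aff i (k div 2) x)" for x
  proof -
    have c: "cnt (Suc i) = 2 * cnt i" by (simp add: cnt_def)
    have ind: "indicator (cell i j) x = (indicator (cell (Suc i) (2 * j)) x + indicator (cell (Suc i) (Suc (2 * j))) x :: real)" for j
    proof -
      have e: "pt (Suc i) (Suc (Suc (2 * j))) = pt i (Suc j)" using pt_double[of i "Suc j"] by simp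
      have "pt (Suc i) (2*j) \<le> pt (Suc i) (Suc (2*j))" "pt (Suc i) (Suc (2*j)) \<le> pt (Suc i) (Suc (Suc (2*j)))"
        by (intro less_imp_le pt_less_Suc)+
      thus ?thesis unfolding cell_def e pt_double by (auto simp: indicator_def)
    qed
    have "(\<Sum>k<cnt (Suc i). indicator (cell (Suc i) k) x * aff i (k div 2) x)
       = (\<Sum>j<cnt i. indicator (cell i j) x * aff i j x)"
      unfolding c sum_pairs by (intro sum.cong refl) (simp add: ind distrib_right)
    thus ?thesis by (simp add: G_def)
  qed
  have int: "integrable lborel (\<lambda>x. ?D k x * g x)" for k
  proof -
    have "?D k = (\<lambda>x. indicator (cell (Suc i) k) x * ((fst (ip (Suc i) k) - fst (ip i (k div 2))) + (snd (ip (Suc i) k) - snd (ip i (k div 2))) * x))"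
      by (rule ext) (simp add: aff_def algebra_simps)
    hence "(\<lambda>x. ?D k x * g x) = (\<lambda>x. indicator (cell (Suc i) k) x * ((fst (ip (Suc i) k) - fst (ip i (k div 2))) +
       (snd (ip (Suc i) k) - snd (ip i (k div 2))) * x) * g x)"
      by (metis (no_types, lifting))
    thus ?thesis unfolding cell_def by (simp only: integrable_cell_affine)
  qed
  have "dev g n y (G (Suc i)) - dev g n y (G i) = dev g n y (\<lambda>x. G (Suc i) x - G i x)"
    by (rule dev_diff[OF integrable_G integrable_G, symmetric])
  also have "(\<lambda>x. G (Suc i) x - G i x) = (\<lambda>x. \<Sum>k<cnt (Suc i). ?D k x)"
    by (rule ext) (simp add: Gi, simp add: G_def right_diff_distrib sum_subtractf)
  finally have "dev g n y (G (Suc i)) - dev g n y (G i) = dev g n y (\<lambda>x. \<Sum>k<cnt (Suc i). ?D k x)" .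
  moreover have "dev g n y (\<lambda>x. \<Sum>k<cnt (Suc i). ?D k x) = (\<Sum>k<cnt (Suc i). dev g n y (?D k))"
    by (rule dev_sum) (rule int)
  ultimately have "\<bar>dev g n y (G (Suc i)) - dev g n y (G i)\<bar> \<le> (\<Sum>k<cnt (Suc i). \<bar>dev g n y (?D k)\<bar>)"
    by (simp only: sum_abs)
  also have "\<dots> \<le> (\<Sum>k<cnt (Suc i). X i k * W (Suc i) k)"
  proof (rule sum_mono)
    fix k assume "k \<in> {..<cnt (Suc i)}"
    hence k: "k < cnt (Suc i)" by simp
    have bnd: "\<bar>aff (Suc i) k x - aff i (k div 2) x\<bar> \<le> X i k" if x: "x \<in> {pt (Suc i) k..pt (Suc i) (Suc k)}" for x
    proof -
      have x': "x \<in> {pt i (k div 2)..pt i (Suc (k div 2))}" using x child(2,3)[OF k] by auto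
      have "sqrt (S (Suc i) k / wid (Suc i)) \<le> sqrt (S i (k div 2) / wid (Suc i))"
        using child(4)[OF k] wid_pos[of "Suc i"] by (intro real_sqrt_le_mono divide_right_mono) auto
      moreover have "sqrt (S i (k div 2) / wid i) \<le> sqrt (S i (k div 2) / wid (Suc i))"
        using S_nonneg wid_pos[of i] by (intro real_sqrt_le_mono divide_left_mono) (auto simp: wid_Suc)
      ultimately have "\<bar>aff (Suc i) k x - aff i (k div 2) x\<bar> \<le> 28 * sqrt (S i (k div 2) / wid (Suc i))"
        using aff_bounds(1)[OF k x] aff_bounds(1)[OF child(1)[OF k] x'] by linarith
      moreover have "\<bar>aff (Suc i) k x - aff i (k div 2) x\<bar> \<le> 8 * E (Suc i) k + 8 * E i (k div 2)"
        using aff_bounds(2)[OF k x] aff_bounds(2)[OF child(1)[OF k] x'] by linarith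
      ultimately show ?thesis by (simp add: X_def)
    qed
    let ?p = "fst (ip (Suc i) k) - fst (ip i (k div 2))" and ?q = "snd (ip (Suc i) k) - snd (ip i (k div 2))"
    have pq: "aff (Suc i) k x - aff i (k div 2) x = ?p + ?q * x" for x by (simp add: aff_def algebra_simps)
    show "\<bar>dev g n y (?D k)\<bar> \<le> X i k * W (Suc i) k"
      unfolding pq cell_def W_def
      by (rule abs_dev_affine_cell[OF dens pt_less_Suc])
         (use bnd[unfolded pq] pt_less_Suc[of "Suc i" k] in auto)
  qed
  finally show ?thesis .
qed

lemma integrable_block: "integrable lborel (\<lambda>x. indicator {\<alpha>..<\<alpha> + lam} x * h x * g x)"
proof -
  obtain C where C: "\<And>x. x \<in> {\<alpha>..\<alpha> + lam} \<Longrightarrow> \<bar>h x\<bar> \<le> C" by (rule h_bounded) blast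
  have "0 \<le> C" using C[of \<alpha>] lam by auto
  show ?thesis
  proof (rule integrable_mult_density[OF dens, of _ C])
    show "\<bar>indicator {\<alpha>..<\<alpha> + lam} x * h x\<bar> \<le> C" for x
      using C[of x] \<open>0 \<le> C\<close> by (cases "x \<in> {\<alpha>..<\<alpha> + lam}") auto
  qed measurable
qed

text \<open>Each single error at level \<open>L\<close> is at most the telescoped sum, that is
  \<open>V / cnt L\<close>; the crude bound by the masses of the block does the rest.\<close>

lemma dev_rest:
  "\<bar>dev g n y (\<lambda>x. indicator {\<alpha>..<\<alpha> + lam} x * h x) - dev g n y (G L)\<bar> \<le> 8 * V / real (cnt L) *
    ((\<Sum>i\<in>{1..n}. indicator {\<alpha>..<\<alpha> + lam} (y i)) / real n + (LINT x|lborel. indicator {\<alpha>..<\<alpha> + lam} x * g x))"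
proof -
  have Epos: "0 \<le> E L k" if "k < cnt L" for k
    using order_trans[OF abs_ge_zero aff_bounds(2)[OF that, of "pt L k"]] pt_less_Suc[of L k] by auto
  have Ek: "E L k \<le> V / real (cnt L)" if k: "k < cnt L" for k
  proof -
    have "E L k \<le> (\<Sum>k<cnt L. E L k)" by (rule member_le_sum) (use k Epos in auto)
    thus ?thesis using sum_E[of L] by simp
  qed
  have V0: "0 \<le> V / real (cnt L)" using Ek[OF cnt_pos] Epos[OF cnt_pos] by linarith
  have "dev g n y (\<lambda>x. indicator {\<alpha>..<\<alpha> + lam} x * h x) - dev g n y (G L)
     = dev g n y (\<lambda>x. indicator {\<alpha>..<\<alpha> + lam} x * h x - G L x)"
    by (rule dev_diff[OF integrable_block integrable_G, symmetric])
  moreover have "\<bar>dev g n y (\<lambda>x. indicator {\<alpha>..<\<alpha> + lam} x * h x - G L x)\<bar> \<le> 8 * V / real (cnt L) *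
    ((\<Sum>i\<in>{1..n}. indicator {\<alpha>..<\<alpha> + lam} (y i)) / real n + (LINT x|lborel. indicator {\<alpha>..<\<alpha> + lam} x * g x))"
  proof (rule abs_dev_le[OF dens])
    fix x
    have "indicator {\<alpha>..<\<alpha> + lam} x * h x - G L x = (\<Sum>k<cnt L. indicator (cell L k) x * (h x - aff L k x))"
    proof -
      have "indicator {\<alpha>..<\<alpha> + lam} x * h x = (\<Sum>k<cnt L. indicator (cell L k) x * h x)"
        using sum_distrib_right[of "\<lambda>k. indicator (cell L k) x" "{..<cnt L}" "h x"]
        unfolding sum_cells by simp
      thus ?thesis unfolding G_def by (simp only: right_diff_distrib sum_subtractf)
    qed
    hence "\<bar>indicator {\<alpha>..<\<alpha> + lam} x * h x - G L x\<bar> \<le> (\<Sum>k<cnt L. \<bar>indicator (cell L k) x * (h x - aff L k x)\<bar>)"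
      by (simp only: sum_abs)
    also have "\<dots> \<le> (\<Sum>k<cnt L. 8 * V / real (cnt L) * indicator (cell L k) x)"
    proof (rule sum_mono)
      fix k assume "k \<in> {..<cnt L}"
      hence k: "k < cnt L" by simp
      show "\<bar>indicator (cell L k) x * (h x - aff L k x)\<bar> \<le> 8 * V / real (cnt L) * indicator (cell L k) x"
        using aff_bounds(2)[OF k, of x] Ek[OF k] by (cases "x \<in> cell L k") (auto simp: cell_def)
    qed
    also have "\<dots> = 8 * V / real (cnt L) * indicator {\<alpha>..<\<alpha> + lam} x"
      using sum_distrib_left[of "8 * V / real (cnt L)" "\<lambda>k. indicator (cell L k) x" "{..<cnt L}"]
      unfolding sum_cells by simp
    finally show "\<bar>indicator {\<alpha>..<\<alpha> + lam} x * h x - G L x\<bar> \<le> 8 * V / real (cnt L) * indicator {\<alpha>..<\<alpha> + lam} x" .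
  qed (use V0 in auto)
  ultimately show ?thesis by simp
qed

lemma E_nonneg: "k < cnt i \<Longrightarrow> 0 \<le> E i k"
  using order_trans[OF abs_ge_zero aff_bounds(2)[of k i "pt i k"]] pt_less_Suc[of i k] by auto

lemma V_nonneg: "0 \<le> V"
proof -
  have "0 \<le> (\<Sum>k<cnt 0. E 0 k)" by (rule sum_nonneg) (simp add: E_nonneg)
  hence "0 \<le> V / real (cnt 0)" using sum_E[of 0] by linarith
  thus ?thesis using cnt_pos[of 0] by (simp add: zero_le_divide_iff)
qed

lemma SB_nonneg: "0 \<le> SB"
  unfolding SB_def set_lebesgue_integral_def by (intro integral_nonneg_AE AE_I2) auto

lemma sum_parent: "(\<Sum>k<cnt (Suc i). F (k div 2)) = 2 * (\<Sum>j<cnt i. F j)" for F :: "nat \<Rightarrow> real"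
proof -
  have c: "cnt (Suc i) = 2 * cnt i" by (simp add: cnt_def)
  show ?thesis unfolding c sum_pairs by (simp flip: sum_distrib_left)
qed

text \<open>\<open>product_threshold_bound\<close> summed over a level. Every parent is met twice
  and \<open>cnt\<close> doubles, whence 40 = 8 + 8 * 2 * 2 and 1568 = 2 * 28^2.\<close>

lemma level_bound:
  assumes "0 < \<tau>" "0 < \<beta>"
  shows "(\<Sum>k<cnt (Suc i). X i k * W (Suc i) k) \<le> 40 * V / real (cnt (Suc i)) * \<tau>
     + \<beta> * (1568 * SB / wid (Suc i)) + 1 / (4 * \<beta> * \<tau>\<^sup>2) * (\<Sum>k<cnt (Suc i). W (Suc i) k ^ 4)"
proof -
  let ?a = "\<lambda>k. 28 * sqrt (S i (k div 2) / wid (Suc i))" and ?b = "\<lambda>k. 8 * E (Suc i) k + 8 * E i (k div 2)"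
  have "(\<Sum>k<cnt (Suc i). X i k * W (Suc i) k)
     \<le> (\<Sum>k<cnt (Suc i). ?b k * \<tau> + \<beta> * (?a k)\<^sup>2 + W (Suc i) k ^ 4 / (4 * \<beta> * \<tau>\<^sup>2))"
  proof (rule sum_mono)
    fix k assume "k \<in> {..<cnt (Suc i)}"
    hence k: "k < cnt (Suc i)" by simp
    have "0 \<le> S i (k div 2) / wid (Suc i)" using S_nonneg[of i "k div 2"] wid_pos[of "Suc i"] by simp
    hence "0 \<le> X i k" unfolding X_def using E_nonneg[OF k] E_nonneg[OF child(1)[OF k]] by simp
    thus "X i k * W (Suc i) k \<le> ?b k * \<tau> + \<beta> * (?a k)\<^sup>2 + W (Suc i) k ^ 4 / (4 * \<beta> * \<tau>\<^sup>2)"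
      by (rule product_threshold_bound) (use assms W_nonneg in \<open>auto simp: X_def\<close>)
  qed
  also have "\<dots> = (\<Sum>k<cnt (Suc i). ?b k) * \<tau> + \<beta> * (\<Sum>k<cnt (Suc i). (?a k)\<^sup>2)
      + 1 / (4 * \<beta> * \<tau>\<^sup>2) * (\<Sum>k<cnt (Suc i). W (Suc i) k ^ 4)"
  proof -
    have 1: "(\<Sum>k<cnt (Suc i). ?b k) * \<tau> = (\<Sum>k<cnt (Suc i). ?b k * \<tau>)" by (rule sum_distrib_right)
    have 2: "\<beta> * (\<Sum>k<cnt (Suc i). (?a k)\<^sup>2) = (\<Sum>k<cnt (Suc i). \<beta> * (?a k)\<^sup>2)" by (rule sum_distrib_left)
    have 3: "1 / (4 * \<beta> * \<tau>\<^sup>2) * (\<Sum>k<cnt (Suc i). W (Suc i) k ^ 4)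
        = (\<Sum>k<cnt (Suc i). W (Suc i) k ^ 4 / (4 * \<beta> * \<tau>\<^sup>2))"
      unfolding sum_distrib_left by simp
    show ?thesis unfolding 1 2 3 sum.distrib[symmetric] ..
  qed
  also have "\<dots> \<le> 40 * V / real (cnt (Suc i)) * \<tau> + \<beta> * (1568 * SB / wid (Suc i))
      + 1 / (4 * \<beta> * \<tau>\<^sup>2) * (\<Sum>k<cnt (Suc i). W (Suc i) k ^ 4)"
  proof (intro add_mono mult_right_mono mult_left_mono order_refl)
    have "(\<Sum>k<cnt (Suc i). ?b k) = 8 * (\<Sum>k<cnt (Suc i). E (Suc i) k) + 8 * (2 * (\<Sum>k<cnt i. E i k))"
      unfolding sum.distrib sum_distrib_left[symmetric] sum_parent ..
    also have "\<dots> \<le> 8 * (V / real (cnt (Suc i))) + 8 * (2 * (V / real (cnt i)))"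
      using sum_E[of "Suc i"] sum_E[of i] by linarith
    also have "V / real (cnt i) = 2 * (V / real (cnt (Suc i)))" by (simp add: cnt_def)
    finally show "(\<Sum>k<cnt (Suc i). ?b k) \<le> 40 * V / real (cnt (Suc i))" by simp
    have "(\<Sum>k<cnt (Suc i). (?a k)\<^sup>2) = (\<Sum>k<cnt (Suc i). 784 * (S i (k div 2) / wid (Suc i)))"
      using S_nonneg wid_pos[of "Suc i"] by (intro sum.cong refl) (simp add: power_mult_distrib)
    also have "\<dots> = 784 * (2 * (\<Sum>j<cnt i. S i j / wid (Suc i)))"
      unfolding sum_distrib_left[symmetric] by (simp only: sum_parent[of "\<lambda>j. S i j / wid (Suc i)"])
    also have "\<dots> = 1568 * SB / wid (Suc i)" unfolding sum_divide_distrib[symmetric] sum_S by simp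
    finally show "(\<Sum>k<cnt (Suc i). (?a k)\<^sup>2) \<le> 1568 * SB / wid (Suc i)" by simp
  qed (use assms in \<open>auto intro!: sum_nonneg\<close>)
  finally show ?thesis .
qed

text \<open>The term \<open>N * \<tau>^2 / (4 * \<beta>)\<close> is the price of \<open>N\<close>
  free coefficients and becomes the N / n part of the rate; 392 = 2 * 14^2.\<close>

lemma base_bound:
  assumes "0 < \<tau>" "0 < \<beta>"
  shows "\<bar>dev g n y (G 0)\<bar> \<le> \<beta> * (392 * SB / wid 0) + real N * (\<tau>\<^sup>2 / (4 * \<beta>))
     + 1 / (4 * \<beta> * \<tau>\<^sup>2) * (\<Sum>k<cnt 0. W 0 k ^ 4)"
proof -
  let ?a = "\<lambda>k. 14 * sqrt (S 0 k / wid 0)"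
  have c: "cnt 0 = N" by (simp add: cnt_def)
  have nn: "0 \<le> S 0 k / wid 0" for k using S_nonneg[of 0 k] wid_pos[of 0] by simp
  have "\<bar>dev g n y (G 0)\<bar> \<le> (\<Sum>k<N. ?a k * W 0 k)" by (rule dev_G0)
  also have "\<dots> \<le> (\<Sum>k<N. 2 * (\<beta> * (?a k)\<^sup>2) + \<tau>\<^sup>2 / (4 * \<beta>) + W 0 k ^ 4 / (4 * \<beta> * \<tau>\<^sup>2))"
    by (intro sum_mono product_threshold_bound') (use assms nn W_nonneg in auto)
  also have "\<dots> = 2 * \<beta> * (\<Sum>k<N. (?a k)\<^sup>2) + real N * (\<tau>\<^sup>2 / (4 * \<beta>)) + 1 / (4 * \<beta> * \<tau>\<^sup>2) * (\<Sum>k<N. W 0 k ^ 4)"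
    by (simp only: sum.distrib sum_distrib_left sum_distrib_right sum_constant card_lessThan) (simp add: mult.assoc)
  also have "(\<Sum>k<N. (?a k)\<^sup>2) = (\<Sum>k<N. 196 * (S 0 k / wid 0))"
    using nn by (intro sum.cong refl) (simp add: power_mult_distrib del: real_sqrt_divide)
  also have "\<dots> = 196 * (SB / wid 0)"
    unfolding sum_distrib_left[symmetric] sum_divide_distrib[symmetric] using sum_S[of 0] by (simp add: c)
  finally show ?thesis by (simp add: c)
qed

theorem block_bound:
  assumes "0 < \<kappa>" "0 < \<epsilon>" "0 < p"
  shows "\<bar>dev g n y (\<lambda>x. indicator {\<alpha>..<\<alpha> + lam} x * h x)\<bar> \<le>
      5100 * \<epsilon> * (p / lam * SB) + \<kappa> * real N / (4 * \<epsilon> * real n) + 120 * V * sqrt (\<kappa> * p / (real N ^ 3 * real n))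
    + (\<Sum>i\<le>L. real n * (real N)\<^sup>2 / (4 * \<epsilon> * \<kappa> * p\<^sup>2) * (32/27) ^ i * (\<Sum>k<cnt i. W i k ^ 4))
    + 8 * V / real (cnt L) * ((\<Sum>i\<in>{1..n}. indicator {\<alpha>..<\<alpha> + lam} (y i)) / real n
        + (LINT x|lborel. indicator {\<alpha>..<\<alpha> + lam} x * g x))" (is "_ \<le> ?rhs")
proof -
  \<comment> \<open>\<open>\<tau>0\<close> is the standard deviation scale of a cell of mass p / N,
    inflated by sqrt \<kappa>. Per level the threshold grows by 3/2 and \<open>\<beta>\<close>
    shrinks by 3/8: the interpolation term changes by (3/2) / 2 = 3/4 and the energy term by 2 *
    (3/8) = 3/4, both summable, while \<open>1 / (4 * \<beta> * \<tau>^2)\<close> grows by only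
    32/27. This is less than 2, the factor by which the summed fourth moments of the cells
    fall.\<close>
  define \<tau>0 where "\<tau>0 = sqrt (\<kappa> * p / (real N * real n))"
  define \<tau> where "\<tau> = (\<lambda>i::nat. (3/2) ^ i * \<tau>0)"
  define \<beta> where "\<beta> = (\<lambda>i::nat. \<epsilon> * p / real N * (3/8) ^ i)"
  define c where "c = (\<lambda>i::nat. real n * (real N)\<^sup>2 / (4 * \<epsilon> * \<kappa> * p\<^sup>2) * (32/27) ^ i)"
  have pos: "0 < real N" "0 < real n" using N1 n1 by auto
  have t0: "0 < \<tau>0" "\<tau>0\<^sup>2 = \<kappa> * p / (real N * real n)" using assms pos by (auto simp: \<tau>0_def)
  have tp: "0 < \<tau> i" and bp: "0 < \<beta> i" for i using t0 assms pos by (auto simp: \<tau>_def \<beta>_def)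
  have pw: "(4::real) ^ i * ((3/8) ^ i * ((3/2) ^ i)\<^sup>2) = (27/8) ^ i" for i :: nat
    by (simp add: power2_eq_square flip: power_mult_distrib)
  have c_eq: "1 / (4 * \<beta> i * (\<tau> i)\<^sup>2) = c i" for i
  proof -
    have "(3/8) ^ i * ((3/2) ^ i)\<^sup>2 = (27/32 :: real) ^ i"
      by (simp add: power2_eq_square flip: power_mult_distrib)
    hence "4 * \<beta> i * (\<tau> i)\<^sup>2 = 4 * (\<epsilon> * p / real N) * (\<kappa> * p / (real N * real n)) * (27/32) ^ i"
      unfolding \<beta>_def \<tau>_def power_mult_distrib t0(2) by (simp add: mult_ac)
    hence "1 / (4 * \<beta> i * (\<tau> i)\<^sup>2) = 1 / (4 * (\<epsilon> * p / real N) * (\<kappa> * p / (real N * real n))) * (1 / (27/32) ^ i)"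
      by simp
    also have "1 / (27/32 :: real) ^ i = (32/27) ^ i" by (simp add: power_one_over[symmetric] power_divide)
    also have "1 / (4 * (\<epsilon> * p / real N) * (\<kappa> * p / (real N * real n))) = real n * (real N)\<^sup>2 / (4 * \<epsilon> * \<kappa> * p\<^sup>2)"
      using pos assms by (simp add: field_simps power2_eq_square)
    finally show ?thesis by (simp add: c_def)
  qed
  have base: "\<bar>dev g n y (G 0)\<bar> \<le> 392 * \<epsilon> * (p / lam * SB) + \<kappa> * real N / (4 * \<epsilon> * real n) + c 0 * (\<Sum>k<cnt 0. W 0 k ^ 4)"
  proof -
    have "\<beta> 0 * (392 * SB / wid 0) = 392 * \<epsilon> * (p / lam * SB)" using pos lam by (simp add: \<beta>_def wid_def cnt_def)
    moreover have "real N * ((\<tau> 0)\<^sup>2 / (4 * \<beta> 0)) = \<kappa> * real N / (4 * \<epsilon> * real n)"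
      unfolding \<tau>_def \<beta>_def using t0(2) pos assms by (simp add: field_simps)
    ultimately show ?thesis using base_bound[OF tp[of 0] bp[of 0]] unfolding c_eq by linarith
  qed
  have step: "\<bar>dev g n y (G (Suc i)) - dev g n y (G i)\<bar> \<le> (3/4) ^ Suc i * (40 * V * (\<tau>0 / real N) + 1568 * \<epsilon> * (p / lam * SB))
      + c (Suc i) * (\<Sum>k<cnt (Suc i). W (Suc i) k ^ 4)" for i
  proof -
    have "40 * V / real (cnt (Suc i)) * \<tau> (Suc i) = 40 * V * (\<tau>0 / real N) * ((3/2) ^ Suc i / 2 ^ Suc i)"
      using pos unfolding \<tau>_def cnt_def by (simp add: field_simps)
    also have "(3/2) ^ Suc i / 2 ^ Suc i = (3/4 :: real) ^ Suc i" by (simp add: power_divide[symmetric] del: power_Suc)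
    finally have 1: "40 * V / real (cnt (Suc i)) * \<tau> (Suc i) = (3/4) ^ Suc i * (40 * V * (\<tau>0 / real N))" by (simp only: mult_ac)
    have "\<beta> (Suc i) * (1568 * SB / wid (Suc i)) = 1568 * \<epsilon> * (p / lam * SB) * ((3/8) ^ Suc i * 2 ^ Suc i)"
      using pos lam unfolding \<beta>_def wid_def cnt_def by (simp add: field_simps)
    also have "(3/8) ^ Suc i * 2 ^ Suc i = (3/4 :: real) ^ Suc i" by (simp add: power_mult_distrib[symmetric] del: power_Suc)
    finally have 2: "\<beta> (Suc i) * (1568 * SB / wid (Suc i)) = (3/4) ^ Suc i * (1568 * \<epsilon> * (p / lam * SB))" by (simp only: mult_ac)
    have "\<bar>dev g n y (G (Suc i)) - dev g n y (G i)\<bar> \<le> 40 * V / real (cnt (Suc i)) * \<tau> (Suc i)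
      + \<beta> (Suc i) * (1568 * SB / wid (Suc i)) + c (Suc i) * (\<Sum>k<cnt (Suc i). W (Suc i) k ^ 4)"
      using order_trans[OF dev_step level_bound[OF tp[of "Suc i"] bp[of "Suc i"]]] unfolding c_eq .
    thus ?thesis unfolding 1 2 distrib_left .
  qed
  have all: "\<bar>dev g n y (G L)\<bar> \<le> 392 * \<epsilon> * (p / lam * SB) + \<kappa> * real N / (4 * \<epsilon> * real n)
      + (\<Sum>i<L. (3/4) ^ Suc i) * (40 * V * (\<tau>0 / real N) + 1568 * \<epsilon> * (p / lam * SB))
      + (\<Sum>i\<le>L. c i * (\<Sum>k<cnt i. W i k ^ 4))" for L
  proof (induction L)
    case 0
    then show ?case using base by simp
  next
    case (Suc L)
    show ?case unfolding sum.lessThan_Suc sum.atMost_Suc distrib_right using Suc step[of L] by linarith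
  qed
  \<comment> \<open>The geometric factor 3 gives 120 = 3 * 40 and 5100 \<ge> 392 + 3 * 1568.\<close>
  have geo: "(\<Sum>i<L. (3/4) ^ Suc i) \<le> (3::real)"
  proof -
    have "(\<Sum>i<L. (3/4) ^ Suc i) = 3 * (1 - (3/4 :: real) ^ L)" by (induction L) auto
    thus ?thesis by simp
  qed
  have nn: "0 \<le> 40 * V * (\<tau>0 / real N)" "0 \<le> \<epsilon> * (p / lam * SB)"
    using V_nonneg t0 pos assms lam SB_nonneg by auto
  have tN: "\<tau>0 / real N = sqrt (\<kappa> * p / (real N ^ 3 * real n))"
  proof -
    have "\<kappa> * p / (real N ^ 3 * real n) = (\<kappa> * p / (real N * real n)) / (real N)\<^sup>2"
      using pos by (simp add: power2_eq_square power3_eq_cube mult_ac)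
    hence "sqrt (\<kappa> * p / (real N ^ 3 * real n)) = sqrt (\<kappa> * p / (real N * real n)) / sqrt ((real N)\<^sup>2)"
      by (simp only: real_sqrt_divide)
    thus ?thesis unfolding \<tau>0_def by simp
  qed
  define A where "A = V * (\<tau>0 / real N)"
  define B where "B = \<epsilon> * (p / lam * SB)"
  define R where "R = (\<Sum>i\<le>L. c i * (\<Sum>k<cnt i. W i k ^ 4))"
  have AB: "40 * V * (\<tau>0 / real N) = 40 * A" "1568 * \<epsilon> * (p / lam * SB) = 1568 * B"
    "392 * \<epsilon> * (p / lam * SB) = 392 * B" by (simp_all add: A_def B_def)
  have "(\<Sum>i<L. (3/4) ^ Suc i) * (40 * A + 1568 * B) \<le> 3 * (40 * A + 1568 * B)"
    using geo nn unfolding AB A_def[symmetric] B_def[symmetric] by (intro mult_right_mono) auto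
  hence D: "(\<Sum>i<L. (3/4) ^ Suc i) * (40 * A + 1568 * B) \<le> 120 * A + 4704 * B" by simp
  have "392 * B + K + D + R \<le> 5100 * B + K + 120 * A + R" if "D \<le> 120 * A + 4704 * B" for K D
    using that nn(2) unfolding B_def[symmetric] by linarith
  from order_trans[OF all[of L, unfolded AB, folded A_def B_def R_def] this[OF D]]
  have "\<bar>dev g n y (G L)\<bar> \<le> 5100 * B + \<kappa> * real N / (4 * \<epsilon> * real n) + 120 * A + R" .
  moreover have "5100 * B = 5100 * \<epsilon> * (p / lam * SB)"
    "120 * A = 120 * V * sqrt (\<kappa> * p / (real N ^ 3 * real n))" unfolding A_def B_def tN by simp_all
  ultimately show ?thesis using dev_rest[of L] unfolding R_def c_def by linarith
qed

end

section \<open>Dyadic quantile blocks of a symmetric log-concave density\<close>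

lemma set_integral_bounds_const:
  fixes f :: "real \<Rightarrow> real"
  assumes int: "set_integrable lborel {a..<b} f" and "a \<le> b"
  shows "(\<And>u. a \<le> u \<Longrightarrow> u < b \<Longrightarrow> c \<le> f u) \<Longrightarrow> c * (b - a) \<le> (LINT u:{a..<b}|lborel. f u)"
    and "(\<And>u. a \<le> u \<Longrightarrow> u < b \<Longrightarrow> f u \<le> c) \<Longrightarrow> (LINT u:{a..<b}|lborel. f u) \<le> c * (b - a)"
proof -
  have c: "set_integrable lborel {a..<b} (\<lambda>_. c)" unfolding set_integrable_def
    by (intro integrable_scaleR_left integrable_real_indicator) (use \<open>a \<le> b\<close> in auto)
  have e: "(LINT u:{a..<b}|lborel. c) = c * (b - a)" using \<open>a \<le> b\<close> by (simp add: set_lebesgue_integral_def)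
  show "(\<And>u. a \<le> u \<Longrightarrow> u < b \<Longrightarrow> c \<le> f u) \<Longrightarrow> c * (b - a) \<le> (LINT u:{a..<b}|lborel. f u)"
    unfolding e[symmetric] by (rule set_integral_mono[OF c int]) auto
  show "(\<And>u. a \<le> u \<Longrightarrow> u < b \<Longrightarrow> f u \<le> c) \<Longrightarrow> (LINT u:{a..<b}|lborel. f u) \<le> c * (b - a)"
    unfolding e[symmetric] by (rule set_integral_mono[OF int c]) auto
qed

text \<open>Continuity will be derived from the absolute continuity contained in finite Fisher
  information. It excludes jumps at the ends of the support, on which \<open>q_small\<close>
  rests.\<close>

locale symmetric_log_concave =
  fixes g :: "real \<Rightarrow> real"
  assumes dens: "density_fun g" and sym: "\<And>x. g (- x) = g x" and lc: "log_concave g"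
    and cont: "\<And>x. isCont g x"
begin

lemma g_measurable[measurable]: "g \<in> borel_measurable borel"
  and g_nonneg: "0 \<le> g x" and g_int: "integrable lborel g" and g_total: "(LINT x|lborel. g x) = 1"
  using dens by (auto simp: density_fun_def)

lemma g_set_int: "A \<in> sets borel \<Longrightarrow> set_integrable lborel A g"
  unfolding set_integrable_def using g_int by (intro integrable_mult_indicator) auto

lemma g_antimono: "0 \<le> x \<Longrightarrow> x \<le> y \<Longrightarrow> g y \<le> g x"
  using log_concave_min[OF lc, of "- y" x y] by (simp add: sym)

lemma g_le_0: "g x \<le> g 0"
  using g_antimono[of 0 "\<bar>x\<bar>"] sym[of x] by (cases "0 \<le> x") auto

definition T :: "real \<Rightarrow> real" where "T x = (LINT u:{x..}|lborel. g u)"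

lemma T_split: "x \<le> y \<Longrightarrow> T x = (LINT u:{x..<y}|lborel. g u) + T y"
proof -
  assume "x \<le> y"
  hence e: "{x..} = {x..<y} \<union> {y..}" by auto
  show ?thesis unfolding T_def e by (rule set_integral_Un) (auto intro!: g_set_int)
qed

lemma seg_nonneg: "0 \<le> (LINT u:A|lborel. g u)"
  unfolding set_lebesgue_integral_def by (intro integral_nonneg_AE AE_I2) (simp add: g_nonneg)

lemma T_nonneg: "0 \<le> T x" unfolding T_def by (rule seg_nonneg)

lemma T_antimono: "x \<le> y \<Longrightarrow> T y \<le> T x" using T_split[of x y] seg_nonneg[of "{x..<y}"] by simp

lemma T_0: "T 0 = 1/2"
proof -
  have "T 0 = (LINT u|lborel. indicator {0..} (- u) * g (- u))"
    unfolding T_def set_lebesgue_integral_def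
    by (subst lborel_integral_real_affine[of "-1" _ 0]) auto
  also have "\<dots> = (LINT u|lborel. indicator {..<0} u *\<^sub>R g u)"
  proof (rule integral_cong_AE)
    have "AE u in lborel. u \<noteq> (0::real)" by (rule AE_lborel_singleton)
    thus "AE u in lborel. indicator {0..} (- u) * g (- u) = indicator {..<0} u *\<^sub>R g u"
      by eventually_elim (auto simp: indicator_def sym)
  qed auto
  finally have e: "T 0 = (LINT u:{..<0}|lborel. g u)" by (simp add: set_lebesgue_integral_def)
  have "(LINT u:{..<0} \<union> {0..}|lborel. g u) = (LINT u:{..<0}|lborel. g u) + T 0"
    unfolding T_def by (rule set_integral_Un) (auto intro!: g_set_int)
  moreover have "{..<0} \<union> {0..} = (UNIV :: real set)" by auto
  ultimately show ?thesis using e g_total by (simp add: set_lebesgue_integral_def)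
qed

lemma T_lim: assumes "0 < c" shows "\<exists>x\<ge>0. T x < c"
proof -
  have "(\<lambda>n. LINT u|lborel. indicator {real n..} u *\<^sub>R g u) \<longlonglongrightarrow> (LINT u|(lborel :: real measure). (0::real))"
  proof (rule integral_dominated_convergence[where w = g and f = "\<lambda>_. 0" and s = "\<lambda>n u. indicator {real n..} u *\<^sub>R g u"])
    show "AE u in lborel. (\<lambda>n. indicator {real n..} u *\<^sub>R g u) \<longlonglongrightarrow> 0"
    proof (rule AE_I2)
      fix u :: real
      obtain m where "u < real m" using reals_Archimedean2 by blast
      hence "\<forall>\<^sub>F n in sequentially. indicator {real n..} u *\<^sub>R g u = 0"
        unfolding eventually_sequentially by (intro exI[of _ m]) (auto simp: indicator_def)
      thus "(\<lambda>n. indicator {real n..} u *\<^sub>R g u) \<longlonglongrightarrow> 0" by (rule tendsto_eventually)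
    qed
    show "AE u in lborel. norm (indicator {real n..} u *\<^sub>R g u) \<le> g u" for n
      by (rule AE_I2) (auto simp: indicator_def g_nonneg)
  qed (use g_int in auto)
  hence "(\<lambda>n. T (real n)) \<longlonglongrightarrow> 0" by (simp add: T_def set_lebesgue_integral_def)
  hence "\<forall>\<^sub>F n in sequentially. T (real n) < c" by (rule order_tendstoD) fact
  then obtain n where "T (real n) < c" by (auto simp: eventually_sequentially)
  thus ?thesis by (intro exI[of _ "real n"]) auto
qed

lemma T_lipschitz: "x \<le> y \<Longrightarrow> T x - T y \<le> g 0 * (y - x)"
  using T_split[of x y] set_integral_bounds_const(2)[OF g_set_int[of "{x..<y}"], of "g 0"] g_le_0 by auto

lemma T_cont: "continuous_on UNIV T"
proof (rule continuous_on_eq[OF _ refl], unfold continuous_on_iff, intro ballI allI impI)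
  fix x e :: real assume "0 < e"
  have g0: "0 \<le> g 0" by (rule g_nonneg)
  have *: "\<bar>T y - T x\<bar> \<le> g 0 * \<bar>y - x\<bar>" for y
    using T_lipschitz[of x y] T_lipschitz[of y x] T_antimono[of x y] T_antimono[of y x] by (cases "x \<le> y") auto
  show "\<exists>d>0. \<forall>y\<in>UNIV. dist y x < d \<longrightarrow> dist (T y) (T x) < e"
  proof (intro exI[of _ "e / (g 0 + 1)"] conjI ballI impI)
    show "0 < e / (g 0 + 1)" using \<open>0 < e\<close> g0 by simp
    fix y assume "dist y x < e / (g 0 + 1)"
    hence "(g 0 + 1) * \<bar>y - x\<bar> < e" using g0 by (simp add: dist_real_def field_simps)
    moreover have "g 0 * \<bar>y - x\<bar> \<le> (g 0 + 1) * \<bar>y - x\<bar>" by (intro mult_right_mono) auto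
    ultimately show "dist (T y) (T x) < e" using *[of y] by (simp add: dist_real_def)
  qed
qed

lemma T_pos: assumes "0 < g x" shows "0 < T x"
proof -
  have "\<exists>d>0. \<forall>u. dist u x < d \<longrightarrow> dist (g u) (g x) < g x / 2"
    using cont[of x] assms unfolding continuous_at_eps_delta by (metis dist_real_def half_gt_zero)
  then obtain d where d: "0 < d" "\<And>u. \<bar>u - x\<bar> < d \<Longrightarrow> \<bar>g u - g x\<bar> < g x / 2"
    by (auto simp: dist_real_def)
  have "g x / 2 * (x + d - x) \<le> (LINT u:{x..<x+d}|lborel. g u)"
  proof (rule set_integral_bounds_const(1))
    show "g x / 2 \<le> g u" if "x \<le> u" "u < x + d" for u using d(2)[of u] that by linarith
  qed (use d in \<open>auto intro!: g_set_int\<close>)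
  moreover have "0 < g x / 2 * (x + d - x)" using assms d by simp
  ultimately show ?thesis using T_split[of x "x + d"] T_nonneg[of "x + d"] d by linarith
qed

lemma T_surj: assumes "0 < c" "c \<le> 1/2" shows "\<exists>x\<ge>0. T x = c"
proof -
  obtain b where b: "0 \<le> b" "T b < c" using T_lim[OF assms(1)] by blast
  have "\<exists>x. 0 \<le> x \<and> x \<le> b \<and> T x = c"
    by (rule IVT2') (use b assms T_0 T_cont in \<open>auto intro: continuous_on_subset\<close>)
  thus ?thesis by auto
qed

text \<open>Boundaries at the tail masses 2^(-(l+1)). The value at 0 is fixed as the centre, so that
  the blocks tile the half line starting exactly there.\<close>

definition t :: "nat \<Rightarrow> real" where
  "t l = (if l = 0 then 0 else SOME x. 0 \<le> x \<and> T x = (1/2) ^ (l + 1))"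

lemma t_nonneg: "0 \<le> t l" and T_t: "T (t l) = (1/2) ^ (l + 1)"
proof -
  have "0 \<le> t l \<and> T (t l) = (1/2) ^ (l + 1)"
  proof (cases "l = 0")
    case True
    thus ?thesis by (simp add: t_def T_0)
  next
    case False
    have "(1/2::real) ^ (l + 1) \<le> (1/2) ^ 1" by (rule power_decreasing) auto
    hence "\<exists>x. 0 \<le> x \<and> T x = (1/2) ^ (l + 1)" using T_surj[of "(1/2) ^ (l + 1)"] by auto
    from someI_ex[OF this] show ?thesis using False by (simp add: t_def)
  qed
  thus "0 \<le> t l" "T (t l) = (1/2) ^ (l + 1)" by auto
qed

lemma t_0: "t 0 = 0" by (simp add: t_def)

lemma less_t: "(1/2) ^ (l + 1) < T x \<Longrightarrow> x < t l"
  using T_antimono[of "t l" x] T_t[of l] by linarith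

lemma t_less_Suc: "t l < t (Suc l)"
  by (rule less_t) (simp only: T_t, rule power_strict_decreasing, auto)

lemma t_mono: "l \<le> m \<Longrightarrow> t l \<le> t m"
  by (rule lift_Suc_mono_le[of t]) (auto intro: less_imp_le t_less_Suc)

lemma exists_less_t: assumes "0 < g x" shows "\<exists>l. x < t l"
proof -
  obtain l where "(1/2::real) ^ l < T x" using real_arch_pow_inv[OF T_pos[OF assms], of "1/2"] by auto
  moreover have "(1/2::real) ^ (l+1) \<le> (1/2) ^ l" by (rule power_decreasing) auto
  ultimately have "(1/2) ^ (l + 1) < T x" by linarith
  thus ?thesis using less_t by blast
qed

text \<open>The hazard rate \<open>g / T\<close> is nondecreasing: integrate
  \<open>log_concave_cross\<close> over \<open>u \<ge> 0\<close>.\<close>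

lemma hazard: assumes "a \<le> b" shows "g a * T b \<le> g b * T a"
proof -
  have e: "T c = (LINT u|lborel. indicator {0..} u * g (c + u))" for c
  proof -
    have "T c = (LINT u|lborel. indicator {c..} (c + 1 * u) *\<^sub>R g (c + 1 * u))"
      unfolding T_def set_lebesgue_integral_def
      by (subst lborel_integral_real_affine[of 1 _ c]) auto
    thus ?thesis by (simp add: indicator_def)
  qed
  have i: "integrable lborel (\<lambda>u. indicator {0..} u * g (c + u))" for c
  proof -
    have "integrable lborel (\<lambda>u. g (c + 1 * u))" by (subst lborel_integrable_real_affine_iff) (auto intro: g_int)
    from integrable_mult_indicator[OF _ this, of "{0..}"] show ?thesis by simp
  qed
  have "g a * T b = (LINT u|lborel. g a * (indicator {0..} u * g (b + u)))" unfolding e by simp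
  also have "\<dots> \<le> (LINT u|lborel. g b * (indicator {0..} u * g (a + u)))"
  proof (rule integral_mono)
    fix u :: real
    show "g a * (indicator {0..} u * g (b + u)) \<le> g b * (indicator {0..} u * g (a + u))"
      using log_concave_cross[OF lc assms, of u] by (auto simp: indicator_def mult.commute)
  qed (use i in auto)
  also have "\<dots> = g b * T a" unfolding e by simp
  finally show ?thesis .
qed

definition q :: "nat \<Rightarrow> real" where "q l = g (t l)"
definition lam :: "nat \<Rightarrow> real" where "lam l = t (Suc l) - t l"
definition p :: "nat \<Rightarrow> real" where "p l = (1/2) ^ (l + 2)"

lemma lam_pos: "0 < lam l" using t_less_Suc by (simp add: lam_def)
lemma p_pos: "0 < p l" by (simp add: p_def)
lemma p_Suc: "p (Suc l) = p l / 2" by (simp add: p_def)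

lemma q_pos: "0 < q l"
proof (rule ccontr)
  assume "\<not> 0 < q l"
  hence 0: "g (t l) = 0" using g_nonneg[of "t l"] by (simp add: q_def)
  have "g u = 0" if "t l \<le> u" for u using g_antimono[OF t_nonneg that] g_nonneg[of u] 0 by simp
  hence "(LINT u|lborel. indicator {t l..} u *\<^sub>R g u) = (LINT u|(lborel :: real measure). (0::real))"
    by (intro Bochner_Integration.integral_cong refl) (auto simp: indicator_def)
  hence "T (t l) = 0" by (simp add: T_def set_lebesgue_integral_def)
  thus False using T_t[of l] by simp
qed

text \<open>The tail mass halves from one boundary to the next and the hazard rate does not fall, so
  the density loses at most a factor 2. Hence all blocks look alike after rescaling.\<close>

lemma q_Suc: "q l / 2 \<le> q (Suc l)"
proof -
  have "g (t l) * T (t (Suc l)) \<le> g (t (Suc l)) * T (t l)" by (rule hazard) (rule less_imp_le[OF t_less_Suc])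
  hence "q l * ((1/2) ^ (l + 1)) / 2 \<le> q (Suc l) * (1/2) ^ (l + 1)" unfolding T_t q_def by simp
  thus ?thesis by (simp add: field_simps)
qed

lemma q_antimono: "l \<le> m \<Longrightarrow> q m \<le> q l"
  unfolding q_def by (rule g_antimono[OF t_nonneg t_mono])

lemma q_ratio: "q l \<le> 2 ^ k * q (l + k)"
proof (induction k)
  case (Suc k)
  have "q (l + k) \<le> 2 * q (l + Suc k)" using q_Suc[of "l + k"] by simp
  hence "2 ^ k * q (l + k) \<le> 2 ^ k * (2 * q (l + Suc k))" by (intro mult_left_mono) auto
  hence "q l \<le> 2 ^ k * (2 * q (l + Suc k))" using Suc by (rule order_trans[rotated])
  thus ?case by simp
qed simp

lemma block_mass: "(LINT u:{t l..<t (Suc l)}|lborel. g u) = p l"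
  using T_split[OF less_imp_le[OF t_less_Suc[of l]]] by (simp add: T_t p_def)

lemma g_block: "t l \<le> u \<Longrightarrow> u \<le> t (Suc l) \<Longrightarrow> q l / 2 \<le> g u \<and> g u \<le> q l"
  using g_antimono[of u "t (Suc l)"] g_antimono[of "t l" u] q_Suc[of l] t_nonneg[of l] by (simp add: q_def)

lemma p_bounds: "q (Suc l) * lam l \<le> p l" "p l \<le> q l * lam l"
proof -
  have "q (Suc l) \<le> g u \<and> g u \<le> q l" if "t l \<le> u" "u < t (Suc l)" for u
    using that g_antimono[of u "t (Suc l)"] g_antimono[of "t l" u] t_nonneg[of l] by (simp add: q_def)
  thus "q (Suc l) * lam l \<le> p l" "p l \<le> q l * lam l"
    unfolding block_mass[symmetric] lam_def
    using set_integral_bounds_const[OF g_set_int[of "{t l..<t (Suc l)}"] less_imp_le[OF t_less_Suc]] by auto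
qed

lemma q_lam_le: "q l * lam l \<le> 2 * p l"
proof -
  have "q l / 2 * lam l \<le> q (Suc l) * lam l" using q_Suc[of l] lam_pos[of l] by (intro mult_right_mono) auto
  thus ?thesis using p_bounds(1)[of l] by simp
qed

text \<open>A block length is mass over density up to a factor 2. The mass halves and the density
  does not rise, so the next block is at least a quarter as long.\<close>

lemma lam_le_Suc: "lam l \<le> 4 * lam (Suc l)"
proof -
  have "q l * lam l \<le> 4 * p (Suc l)" using q_lam_le[of l] by (simp add: p_Suc)
  also have "\<dots> \<le> 4 * (q (Suc l) * lam (Suc l))" using p_bounds(2)[of "Suc l"] by simp
  also have "\<dots> \<le> 4 * (q l * lam (Suc l))" using q_antimono[of l "Suc l"] lam_pos[of "Suc l"] by (intro mult_left_mono mult_right_mono) auto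
  finally have "q l * lam l \<le> q l * (4 * lam (Suc l))" by simp
  thus ?thesis using q_pos[of l] by simp
qed

text \<open>Over \<open>l\<close> blocks the density falls by at most 2^l, the mass by exactly
  2^l.\<close>

lemma lam_le_0: "lam l \<le> 2 * lam 0"
proof -
  have "q 0 * lam l \<le> 2 ^ l * q l * lam l" using q_ratio[of 0 l] lam_pos[of l] by (intro mult_right_mono) auto
  also have "\<dots> \<le> 2 ^ l * (2 * p l)" using q_lam_le[of l] by (simp add: mult.assoc)
  also have "\<dots> = 2 * p 0" by (simp add: p_def power_add power_one_over)
  also have "\<dots> \<le> 2 * (q 0 * lam 0)" using p_bounds(2)[of 0] by simp
  finally have "q 0 * lam l \<le> q 0 * (2 * lam 0)" by simp
  thus ?thesis using q_pos[of 0] by simp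
qed

text \<open>If \<open>q\<close> stayed above \<open>c\<close>, the lengths
  \<open>lam l \<le> p l / c\<close> would be summable and the boundaries would converge to a point
  \<open>b\<close> with tail mass 0; but \<open>g b \<ge> c\<close> by continuity, against
  \<open>T_pos\<close>. The uniform density, which jumps at its end point, shows what continuity
  prevents.\<close>

lemma q_small: assumes "0 < c" shows "\<exists>L. \<forall>l\<ge>L. q l < c"
proof (rule ccontr)
  assume "\<not> ?thesis"
  hence "\<forall>L. \<exists>l\<ge>L. c \<le> q l" by (auto simp: not_less)
  hence qc: "c \<le> q l" for l using q_antimono by (meson order_trans)
  have bnd: "t l \<le> (1 - (1/2) ^ l) / (2 * c)" for l
  proof (induction l)
    case (Suc l)
    have "c * lam l \<le> q (Suc l) * lam l" using qc[of "Suc l"] lam_pos[of l] by (intro mult_right_mono) auto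
    hence "c * lam l \<le> p l" using p_bounds(1)[of l] by linarith
    hence "lam l \<le> p l / c" using assms by (simp add: field_simps)
    hence "t (Suc l) \<le> (1 - (1/2) ^ l) / (2 * c) + p l / c" using Suc by (simp add: lam_def)
    also have "\<dots> = (1 - (1/2) ^ Suc l) / (2 * c)" using assms by (simp add: p_def field_simps)
    finally show ?case .
  qed (simp add: t_0)
  have "incseq t" by (intro monoI t_mono)
  moreover have "t l \<le> 1 / (2 * c)" for l
    using bnd[of l] assms by (smt (verit) divide_right_mono zero_le_power half_gt_zero)
  ultimately obtain b where b: "t \<longlonglongrightarrow> b" "\<And>l. t l \<le> b" using incseq_convergent[of t] by blast
  have "(\<lambda>l. g (t l)) \<longlonglongrightarrow> g b" using isCont_tendsto_compose[OF cont b(1)] .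
  hence "c \<le> g b" using qc by (intro LIMSEQ_le_const) (auto simp: q_def)
  hence "0 < T b" using assms by (intro T_pos) auto
  then obtain l where "(1/2::real) ^ l < T b" using real_arch_pow_inv[of "T b" "1/2"] by auto
  moreover have "T b \<le> (1/2) ^ (l+1)" using T_antimono[OF b(2)[of l]] T_t[of l] by simp
  moreover have "(1/2::real) ^ (l+1) \<le> (1/2) ^ l" by (rule power_decreasing) auto
  ultimately show False by linarith
qed

end

lemma set_integral_Icc_eq_Ico:
  fixes f :: "real \<Rightarrow> real"
  assumes [measurable]: "f \<in> borel_measurable borel"
  shows "(LINT u:{a..b}|lborel. f u) = (LINT u:{a..<b}|lborel. f u)"
  unfolding set_lebesgue_integral_def
proof (rule integral_cong_AE)
  have "AE u in lborel. u \<noteq> b" by (rule AE_lborel_singleton)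
  thus "AE u in lborel. indicator {a..b} u *\<^sub>R f u = indicator {a..<b} u *\<^sub>R f u"
    by eventually_elim (auto simp: indicator_def)
qed measurable

text \<open>Mass at most 1 instead of exactly 1, because the geometric path between a fit and
  \<open>g\<close> is not normalized. A mass defect has the favourable sign in the basic
  inequality.\<close>

definition lc_subdensity :: "(real \<Rightarrow> real) \<Rightarrow> bool" where
  "lc_subdensity f \<longleftrightarrow> log_concave f \<and> f \<in> borel_measurable borel \<and> integrable lborel f \<and> (LINT x|lborel. f x) \<le> 1"

definition hellinger_sq :: "(real \<Rightarrow> real) \<Rightarrow> (real \<Rightarrow> real) \<Rightarrow> real" where
  "hellinger_sq f g = 1/2 * (LINT x|lborel. (sqrt (f x) - sqrt (g x))\<^sup>2)"

lemma sqrt_diff_sq_le: "0 \<le> a \<Longrightarrow> 0 \<le> b \<Longrightarrow> (sqrt a - sqrt b)\<^sup>2 \<le> a + b"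
  by (simp add: power2_diff)

lemma integrable_sqrt_diff:
  assumes "integrable lborel f" "integrable lborel g" "\<And>x. 0 \<le> f x" "\<And>x. 0 \<le> (g x :: real)"
  shows "integrable lborel (\<lambda>x::real. (sqrt (f x) - sqrt (g x))\<^sup>2)"
proof (rule Bochner_Integration.integrable_bound)
  show "integrable lborel (\<lambda>x. f x + g x)" using assms by simp
  show "(\<lambda>x. (sqrt (f x) - sqrt (g x))\<^sup>2) \<in> borel_measurable lborel"
    using assms(1,2)[THEN borel_measurable_integrable] by measurable
  show "AE x in lborel. norm ((sqrt (f x) - sqrt (g x))\<^sup>2) \<le> norm (f x + g x)"
    by (rule AE_I2) (use assms sqrt_diff_sq_le in auto)
qed

lemma hellinger_sq_nonneg: "0 \<le> hellinger_sq f g"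
  unfolding hellinger_sq_def by simp

text \<open>Pointwise \<open>f \<le> 2 * (sqrt f - sqrt g)^2 + 2 * g\<close>, from
  \<open>0 \<le> (sqrt f - 2 * sqrt g)^2\<close>. So the masses of a set under \<open>f\<close> and
  \<open>g\<close> are comparable once they exceed a multiple of the squared Hellinger
  distance.\<close>

lemma set_integral_le_hellinger:
  assumes f: "integrable lborel f" "\<And>x. 0 \<le> f x" and g: "integrable lborel g" "\<And>x. 0 \<le> (g x :: real)"
    and A[measurable]: "A \<in> sets borel"
  shows "(LINT x:A|lborel. f x) \<le> 4 * hellinger_sq f g + 2 * (LINT x:A|lborel. g x)"
proof -
  note i = integrable_sqrt_diff[OF f(1) g(1) f(2) g(2)]
  have si: "integrable lborel (\<lambda>x. indicator A x *\<^sub>R g x)" "integrable lborel (\<lambda>x. indicator A x *\<^sub>R f x)"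
    by (rule integrable_mult_indicator[OF _ g(1)], simp, rule integrable_mult_indicator[OF _ f(1)], simp)
  have "(LINT x:A|lborel. f x) \<le> (LINT x|lborel. 2 * (sqrt (f x) - sqrt (g x))\<^sup>2 + 2 * (indicator A x *\<^sub>R g x))"
    unfolding set_lebesgue_integral_def
  proof (rule integral_mono)
    fix x
    have "f x \<le> 2 * (sqrt (f x) - sqrt (g x))\<^sup>2 + 2 * g x"
    proof -
      have "0 \<le> (sqrt (f x) - 2 * sqrt (g x))\<^sup>2" by simp
      hence "4 * (sqrt (f x) * sqrt (g x)) \<le> f x + 4 * g x"
        using f(2)[of x] g(2)[of x] by (simp add: power2_diff power_mult_distrib mult_ac)
      thus ?thesis using f(2)[of x] g(2)[of x] by (simp add: power2_diff)
    qed
    thus "indicator A x *\<^sub>R f x \<le> 2 * (sqrt (f x) - sqrt (g x))\<^sup>2 + 2 * (indicator A x *\<^sub>R g x)"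
      by (cases "x \<in> A") auto
  qed (use i si in auto)
  also have "\<dots> = 4 * hellinger_sq f g + 2 * (LINT x:A|lborel. g x)"
    using i si by (simp add: hellinger_sq_def set_lebesgue_integral_def)
  finally show ?thesis .
qed

lemma hellinger_sq_commute: "hellinger_sq f g = hellinger_sq g f"
  unfolding hellinger_sq_def by (simp add: power2_commute)

context symmetric_log_concave
begin

section \<open>Shape of a nearby subdensity on a block of sufficient mass\<close>

context
  fixes f l
  assumes f: "lc_subdensity f" and small: "8 * hellinger_sq f g \<le> p (l + 2)"
begin

lemma f_lc: "log_concave f" and f_meas: "f \<in> borel_measurable borel"
  and f_int: "integrable lborel f" and f_nonneg: "0 \<le> f x"
  using f by (auto simp: lc_subdensity_def log_concave_nonneg)

lemma f_set_int: "A \<in> sets borel \<Longrightarrow> set_integrable lborel A f"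
  unfolding set_integrable_def using f_int by (intro integrable_mult_indicator) auto

lemma f_mass_le: "A \<in> sets borel \<Longrightarrow> (LINT x:A|lborel. f x) \<le> 4 * hellinger_sq f g + 2 * (LINT x:A|lborel. g x)"
  by (rule set_integral_le_hellinger) (auto simp: f_int f_nonneg g_int g_nonneg)

lemma f_mass_ge: "A \<in> sets borel \<Longrightarrow> (LINT x:A|lborel. g x) \<le> 4 * hellinger_sq f g + 2 * (LINT x:A|lborel. f x)"
  unfolding hellinger_sq_commute[of f] by (rule set_integral_le_hellinger) (auto simp: f_int f_nonneg g_int g_nonneg)

text \<open>The smallness assumption leaves \<open>f\<close> a quarter of the mass
  \<open>p (l + 2)\<close> on block \<open>l + 2\<close>, and some point there carries the mean. The
  block in between gives room for the slope bound on block \<open>l\<close>. The constant is 32 = 4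
  * 2^3.\<close>

lemma right_point: obtains z where "t (l + 2) \<le> z" "q l / 32 \<le> f z"
proof -
  let ?a = "t (l + 2)" and ?b = "t (Suc (l + 2))"
  have "(LINT x:{?a..<?b}|lborel. g x) \<le> 4 * hellinger_sq f g + 2 * (LINT x:{?a..<?b}|lborel. f x)"
    by (rule f_mass_ge) auto
  hence F: "p (l + 2) / 4 \<le> (LINT x:{?a..?b}|lborel. f x)"
    using small unfolding set_integral_Icc_eq_Ico[OF f_meas] block_mass by linarith
  obtain z where z: "z \<in> {?a..?b}" "(LINT x:{?a..?b}|lborel. f x) \<le> f z * (?b - ?a)"
    by (rule exists_ge_mean[OF t_less_Suc f_set_int]) auto
  have "q (Suc (l + 2)) * lam (l + 2) \<le> 4 * (f z * lam (l + 2))"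
    using p_bounds(1)[of "l + 2"] F z(2) unfolding lam_def by linarith
  hence "q (Suc (l + 2)) \<le> 4 * f z" using lam_pos[of "l + 2"] by simp
  moreover have "q l \<le> 8 * q (Suc (l + 2))" using q_ratio[of l 3] by (simp add: numeral_3_eq_3)
  ultimately have "q l / 32 \<le> f z" by linarith
  thus ?thesis using that z by auto
qed

text \<open>An anchor beyond the centre, at distance at least \<open>t 1 = lam 0\<close> from every
  point of the positive half line. It has to be found separately because \<open>f\<close> is not
  symmetric about 0.\<close>

lemma left_point: obtains y where "y \<le> - t 1" "q 0 / 32 \<le> f y"
proof -
  let ?a = "- t 2" and ?b = "- t 1"
  have l1: "t 1 < t 2" "t 2 - t 1 = lam 1" using t_less_Suc[of 1] by (auto simp: lam_def numeral_2_eq_2)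
  have gq: "q 2 \<le> g u" if "?a \<le> u" "u < ?b" for u
  proof -
    have "g (t 2) \<le> g (- u)" by (rule g_antimono) (use that t_nonneg[of 1] in auto)
    thus ?thesis by (simp add: sym q_def)
  qed
  have "q 2 * (?b - ?a) \<le> (LINT x:{?a..<?b}|lborel. g x)"
    by (rule set_integral_bounds_const(1)) (use l1 gq in \<open>auto intro!: g_set_int\<close>)
  also have "\<dots> \<le> 4 * hellinger_sq f g + 2 * (LINT x:{?a..<?b}|lborel. f x)"
    by (rule f_mass_ge) auto
  also have "4 * hellinger_sq f g \<le> p 1 / 4"
  proof -
    have "p (l + 2) \<le> p 2" unfolding p_def by (rule power_decreasing) auto
    moreover have "p 2 = p 1 / 2" using p_Suc[of 1] by (simp add: numeral_2_eq_2)
    ultimately show ?thesis using small by linarith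
  qed
  also have "p 1 / 4 \<le> q 2 * lam 1 / 2"
  proof -
    have "p 1 \<le> q 1 * lam 1" by (rule p_bounds(2))
    also have "\<dots> \<le> 2 * q 2 * lam 1" using q_Suc[of 1] lam_pos[of 1] by (intro mult_right_mono) (auto simp: numeral_2_eq_2)
    finally show ?thesis by simp
  qed
  finally have F: "q 2 * lam 1 / 4 \<le> (LINT x:{?a..?b}|lborel. f x)"
    using l1 unfolding set_integral_Icc_eq_Ico[OF f_meas] by simp
  have ab: "?a < ?b" using l1 by simp
  obtain y where y: "y \<in> {?a..?b}" "(LINT x:{?a..?b}|lborel. f x) \<le> f y * (?b - ?a)"
    by (rule exists_ge_mean[OF ab f_set_int]) auto
  have e: "?b - ?a = lam 1" using l1(2) by linarith
  have "q 2 * lam 1 / 4 \<le> f y * lam 1" using order_trans[OF F y(2)] unfolding e .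
  hence "q 2 * lam 1 \<le> 4 * f y * lam 1" by linarith
  hence "q 2 \<le> 4 * f y" using lam_pos[of 1] by simp
  moreover have "q 0 \<le> 4 * q 2" using q_ratio[of 0 2] by (simp add: numeral_2_eq_2)
  ultimately have "q 0 / 32 \<le> f y" using f_nonneg[of y] by linarith
  thus ?thesis using that y by auto
qed

text \<open>Unimodality between the left and the right anchor.\<close>

lemma f_block_lower: assumes "t l \<le> x" "x \<le> t (Suc l)" shows "q l / 32 \<le> f x"
proof -
  obtain z where z: "t (l + 2) \<le> z" "q l / 32 \<le> f z" by (rule right_point)
  obtain y where y: "y \<le> - t 1" "q 0 / 32 \<le> f y" by (rule left_point)
  have "t (Suc l) \<le> t (l + 2)" by (rule t_mono) auto
  hence "min (f y) (f z) \<le> f x" using assms z y t_nonneg[of 1] t_nonneg[of l]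
    by (intro log_concave_min[OF f_lc]) auto
  moreover have "q l \<le> q 0" by (rule q_antimono) auto
  ultimately show ?thesis using z y by auto
qed

lemma block_mass_le: "(LINT x:{t l..<t (Suc l)}|lborel. f x) \<le> 4 * p l"
proof -
  have "(LINT x:{t l..<t (Suc l)}|lborel. f x) \<le> 4 * hellinger_sq f g + 2 * (LINT x:{t l..<t (Suc l)}|lborel. g x)"
    by (rule f_mass_le) auto
  moreover have "p (l + 2) \<le> p l" unfolding p_def by (rule power_decreasing) auto
  ultimately show ?thesis using small p_pos[of l] unfolding block_mass by linarith
qed

text \<open>By \<open>log_concave_midpoint\<close>, \<open>f\<close> stays above the geometric mean
  \<open>c\<close> of \<open>f x\<close> and \<open>q l / 32\<close> on at least a quarter of the
  block. The block mass, at most \<open>4 * q l * lam l\<close>, gives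
  \<open>c \<le> 16 * q l\<close>, and squaring gives 8192 = 32 * 16^2.\<close>

lemma f_block_upper: assumes x: "t l \<le> x" "x \<le> t (Suc l)" shows "f x \<le> 8192 * q l"
proof -
  define c where "c = sqrt (f x * (q l / 32))"
  have q: "0 < q l" by (rule q_pos)
  have fx: "q l / 32 \<le> f x" by (rule f_block_lower[OF x])
  have c0: "0 \<le> c" using fx q by (simp add: c_def)
  have "\<exists>a b. t l \<le> a \<and> a \<le> b \<and> b \<le> t (Suc l) \<and> lam l / 4 \<le> b - a \<and> (\<forall>u. a \<le> u \<and> u < b \<longrightarrow> c \<le> f u)"
  proof -
    have *: "c \<le> f u" if e: "t l \<le> e" "e \<le> t (Suc l)" and u: "x \<le> u \<and> u \<le> (x + e) / 2 \<or> (x + e) / 2 \<le> u \<and> u \<le> x" for e u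
    proof -
      have fe: "q l / 32 \<le> f e" by (rule f_block_lower[OF e])
      have fu: "0 \<le> f u" by (rule f_nonneg)
      have "f x * (q l / 32) \<le> (f u)\<^sup>2"
      proof (cases "f e \<le> f x")
        case True
        have "f x * (q l / 32) \<le> f x * f e" using fe fx q by (intro mult_left_mono) auto
        also have "\<dots> \<le> (f u)\<^sup>2" by (rule log_concave_midpoint[OF f_lc]) (use fe q True u in auto)
        finally show ?thesis .
      next
        case False
        have "min (f x) (f e) \<le> f u"
        proof (cases "x \<le> e")
          case True
          thus ?thesis using u by (intro log_concave_min[OF f_lc]) auto
        next
          case F: False
          have "min (f e) (f x) \<le> f u" using u F by (intro log_concave_min[OF f_lc]) auto
          thus ?thesis by (simp add: min.commute)
        qed
        hence "f x \<le> f u" using False by simp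
        moreover have "q l / 32 \<le> f u" using fx \<open>f x \<le> f u\<close> by simp
        ultimately show ?thesis unfolding power2_eq_square using q fx by (intro mult_mono) auto
      qed
      hence "c \<le> sqrt ((f u)\<^sup>2)" unfolding c_def by (rule real_sqrt_le_mono)
      thus ?thesis using fu by simp
    qed
    show ?thesis
    proof (cases "x \<le> (t l + t (Suc l)) / 2")
      case True
      show ?thesis
        by (rule exI[of _ x], rule exI[of _ "(x + t (Suc l)) / 2"])
           (use x True *[of "t (Suc l)"] t_less_Suc[of l] in \<open>auto simp: lam_def field_simps\<close>)
    next
      case False
      show ?thesis
        by (rule exI[of _ "(x + t l) / 2"], rule exI[of _ x])
           (use x False *[of "t l"] t_less_Suc[of l] in \<open>auto simp: lam_def field_simps\<close>)
    qed
  qed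
  then obtain a b where ab: "t l \<le> a" "a \<le> b" "b \<le> t (Suc l)" "lam l / 4 \<le> b - a" "\<And>u. a \<le> u \<Longrightarrow> u < b \<Longrightarrow> c \<le> f u"
    by blast
  have "c * (lam l / 4) \<le> c * (b - a)" using c0 ab by (intro mult_left_mono) auto
  also have "\<dots> \<le> (LINT x:{a..<b}|lborel. f x)"
    by (rule set_integral_bounds_const(1)) (use ab in \<open>auto intro!: f_set_int\<close>)
  also have "\<dots> \<le> (LINT x:{t l..<t (Suc l)}|lborel. f x)"
    by (rule set_integral_mono_subset) (use ab f_nonneg in \<open>auto intro!: f_set_int\<close>)
  also have "\<dots> \<le> 4 * (q l * lam l)" using block_mass_le p_bounds(2)[of l] by linarith
  finally have "c * lam l \<le> 16 * q l * lam l" by simp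
  hence "c \<le> 16 * q l" using lam_pos[of l] by simp
  hence "c\<^sup>2 \<le> (16 * q l)\<^sup>2" using c0 by (rule power_mono)
  hence "f x * (q l / 32) \<le> 256 * (q l)\<^sup>2" using fx q by (simp add: c_def power_mult_distrib)
  hence "f x * q l \<le> (8192 * q l) * q l" by (simp add: power2_eq_square)
  thus ?thesis using q by simp
qed

text \<open>From a point of the block to an anchor \<open>ln f\<close> falls by at most 18, since
  8192 * 32 = 2^18 and ln 2 < 1. The anchors are at distance at least \<open>lam l / 2\<close> on
  the left and \<open>lam l / 4\<close> on the right, so slopes of either sign are limited; 72 = 18
  * 4.\<close>

lemma f_supergradient:
  assumes x: "t l \<le> x" "x \<le> t (Suc l)"
  shows "\<exists>s. \<bar>s\<bar> \<le> 72 / lam l \<and> (\<forall>v. 0 < f v \<longrightarrow> ln (f v) \<le> ln (f x) + s * (v - x))"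
proof -
  obtain z where z: "t (l + 2) \<le> z" "q l / 32 \<le> f z" by (rule right_point)
  obtain y where y: "y \<le> - t 1" "q 0 / 32 \<le> f y" by (rule left_point)
  have q: "0 < q l" "q l \<le> q 0" by (auto intro: q_pos q_antimono)
  have yp: "q l / 32 \<le> f y" using y q by simp
  have zx: "lam (Suc l) \<le> z - x" using z(1) x(2) by (simp add: lam_def)
  have xy: "lam 0 \<le> x - y" using y(1) x(1) t_nonneg[of l] by (simp add: lam_def t_0)
  have "0 < f z" "0 < f y" "y < x" "x < z" using z yp q zx xy lam_pos[of "Suc l"] lam_pos[of 0] by linarith+
  then obtain s where s: "\<And>v. 0 < f v \<Longrightarrow> ln (f v) \<le> ln (f x) + s * (v - x)"
    using log_concave_supergradient[OF f_lc, of y z x] by blast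
  have gap: "ln (f x) - ln (f v) \<le> 18" if v: "q l / 32 \<le> f v" for v
  proof -
    have fv: "0 < f v" using v q by linarith
    have "f x \<le> 2 ^ 18 * f v" using f_block_upper[OF x] v by simp
    moreover have "0 < f x" using f_block_lower[OF x] q by linarith
    ultimately have "ln (f x) \<le> ln (2 ^ 18 * f v)" using fv by (subst ln_le_cancel_iff) auto
    also have "\<dots> = ln (2 ^ 18) + ln (f v)" using fv by (subst ln_mult) auto
    also have "ln (2 ^ 18) = 18 * ln (2::real)" by (subst ln_realpow) auto
    finally show ?thesis using ln_2_less_1 by linarith
  qed
  have "\<bar>s\<bar> \<le> 72 / lam l"
  proof -
    have "s * (x - y) \<le> 18"
    proof -
      have "s * (y - x) = - (s * (x - y))" by (simp add: algebra_simps)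
      thus ?thesis using s[OF \<open>0 < f y\<close>] gap[OF yp] by linarith
    qed
    hence *: "\<bar>s\<bar> * lam l \<le> 72" if "0 \<le> s"
    proof -
      have "s * (lam l / 2) \<le> s * (x - y)" using that xy lam_le_0[of l] by (intro mult_left_mono) auto
      hence "s * lam l \<le> 36" using \<open>s * (x - y) \<le> 18\<close> by linarith
      thus ?thesis using that by simp
    qed
    have "\<bar>s\<bar> * lam l \<le> 72" if "s \<le> 0"
    proof -
      have "- s * (z - x) \<le> 18" using s[OF \<open>0 < f z\<close>] gap[OF z(2)] by simp
      moreover have "- s * (lam l / 4) \<le> - s * (z - x)"
        using that zx lam_le_Suc[of l] by (intro mult_left_mono) auto
      ultimately have "- s * lam l \<le> 72" by linarith
      thus ?thesis using that by simp
    qed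
    hence "\<bar>s\<bar> * lam l \<le> 72" using * by linarith
    thus ?thesis using lam_pos[of l] by (simp add: field_simps)
  qed
  thus ?thesis using s by blast
qed

text \<open>Some value of \<open>f\<close> on the block is at most \<open>4 * q l\<close>. Once
  \<open>g\<close> has dropped by the factor 128 this is below \<open>q 0 / 32\<close>, hence below
  the value at the left anchor, and unimodality makes \<open>f\<close> antitone from there
  on.\<close>

lemma f_tail:
  assumes q: "128 * q l < q 0"
  shows "t (Suc l) \<le> a \<Longrightarrow> a \<le> b \<Longrightarrow> f b \<le> f a" and "t (Suc l) \<le> a \<Longrightarrow> f a \<le> 4 * q l"
proof -
  obtain w where w: "w \<in> {t l..t (Suc l)}" "f w * (t (Suc l) - t l) \<le> (LINT x:{t l..t (Suc l)}|lborel. f x)"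
    by (rule exists_le_mean[OF t_less_Suc f_set_int]) auto
  have "f w * lam l \<le> 4 * (q l * lam l)"
    using w(2) block_mass_le p_bounds(2)[of l] unfolding set_integral_Icc_eq_Ico[OF f_meas] lam_def by linarith
  hence fw: "f w \<le> 4 * q l" using lam_pos[of l] by simp
  obtain y where y: "y \<le> - t 1" "q 0 / 32 \<le> f y" by (rule left_point)
  have yw: "y \<le> w" using y w t_nonneg[of 1] t_nonneg[of l] by auto
  have less: "f w < f y" using fw q y by linarith
  show "f b \<le> f a" if "t (Suc l) \<le> a" "a \<le> b"
    by (rule log_concave_antimono_after(1)[OF f_lc yw less]) (use w that in auto)
  show "f a \<le> 4 * q l" if "t (Suc l) \<le> a"
    using log_concave_antimono_after(2)[OF f_lc yw less, of a a] w that fw by auto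
qed

end

end

section \<open>The log likelihood ratio on blocks\<close>

definition softplus2 :: "real \<Rightarrow> real" where "softplus2 z = 2 * ln ((1 + exp z) / 2)"

text \<open>The derivative lies between 0 and 2 and the second derivative is at most 1. The bounded
  slope passes estimates for \<open>ln f\<close> and \<open>ln g\<close> on to the ratio; the
  quadratic remainder is harmless as the logarithms have bounded slopes on a block.\<close>

lemma softplus2_taylor:
  "\<exists>d. 0 \<le> d \<and> d \<le> 2 \<and> (\<forall>z. \<bar>softplus2 z - softplus2 a - d * (z - a)\<bar> \<le> (z - a)\<^sup>2)"
proof -
  define H' where "H' = (\<lambda>z::real. 2 * exp z / (1 + exp z))"
  have pos: "0 < 1 + exp z" for z :: real by (simp add: add_pos_pos)
  have d1: "(softplus2 has_real_derivative H' z) (at z)" for z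
    unfolding softplus2_def[abs_def] H'_def
    by (rule derivative_eq_intros refl | use pos in \<open>simp add: field_simps\<close>)+
  have d2: "(H' has_real_derivative 2 * exp z / (1 + exp z)\<^sup>2) (at z)" for z
    unfolding H'_def using pos[of z]
    by (auto intro!: derivative_eq_intros simp: field_simps power2_eq_square)
  have b2: "\<bar>2 * exp z / (1 + exp z)\<^sup>2\<bar> \<le> 1" for z :: real
  proof -
    have "2 * exp z \<le> (1 + exp z)\<^sup>2" by (simp add: power2_eq_square algebra_simps)
    thus ?thesis using pos[of z] by (simp add: divide_le_eq)
  qed
  have lip: "\<bar>H' z - H' w\<bar> \<le> \<bar>z - w\<bar>" for z w
  proof -
    have "norm (H' z - H' w) \<le> 1 * norm (z - w)"
      by (rule field_differentiable_bound[OF convex_UNIV]) (use d2 b2 in \<open>auto simp: has_field_derivative_at_within\<close>)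
    thus ?thesis by simp
  qed
  have "\<bar>softplus2 z - softplus2 a - H' a * (z - a)\<bar> \<le> (z - a)\<^sup>2" for z
  proof -
    define S where "S = {min a z..max a z}"
    define G where "G = (\<lambda>x. softplus2 x - H' a * x)"
    have "norm (G z - G a) \<le> \<bar>z - a\<bar> * norm (z - a)"
    proof (rule field_differentiable_bound[where S = S and f' = "\<lambda>x. H' x - H' a"])
      show "convex S" by (simp add: S_def)
      show "(G has_field_derivative H' x - H' a) (at x within S)" if "x \<in> S" for x
        unfolding G_def by (rule derivative_eq_intros d1[THEN has_field_derivative_at_within] refl | simp)+
      show "norm (H' x - H' a) \<le> \<bar>z - a\<bar>" if "x \<in> S" for x
        using lip[of x a] that unfolding S_def by (auto simp: min_def max_def split: if_splits)
    qed (auto simp: S_def)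
    moreover have "\<bar>z - a\<bar> * norm (z - a) = (z - a)\<^sup>2" by (simp add: power2_eq_square)
    moreover have "G z - G a = softplus2 z - softplus2 a - H' a * (z - a)" by (simp add: G_def algebra_simps)
    ultimately show ?thesis by simp
  qed
  moreover have "0 \<le> H' a" "H' a \<le> 2" using pos[of a] by (auto simp: H'_def divide_le_eq)
  ultimately show ?thesis by blast
qed

lemma logmix_softplus2: "0 < a \<Longrightarrow> 0 < b \<Longrightarrow> logmix a b = softplus2 (ln a - ln b)"
  by (simp add: logmix_def softplus2_def exp_diff field_simps)

text \<open>A supergradient \<open>s\<close> of a concave function is antitone, so \<open>s a - s b\<close> bounds the deviation from
  the tangent at \<open>a\<close> on \<open>{a..b}\<close> relative to the length of the interval.\<close>
lemma supergradient_tangent: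
  fixes \<phi> s :: "real \<Rightarrow> real"
  assumes sg: "\<And>x v. x \<in> {\<alpha>..\<beta>} \<Longrightarrow> v \<in> {\<alpha>..\<beta>} \<Longrightarrow> \<phi> v \<le> \<phi> x + s x * (v - x)"
    and bd: "\<And>x. x \<in> {\<alpha>..\<beta>} \<Longrightarrow> \<bar>s x\<bar> \<le> A"
    and ab: "\<alpha> \<le> a" "a < b" "b \<le> \<beta>" and x: "x \<in> {a..b}"
  shows "\<bar>\<phi> x - \<phi> a - s a * (x - a)\<bar> \<le> (s a - s b) * (b - a)" "\<bar>\<phi> x - \<phi> a\<bar> \<le> A * (b - a)"
proof -
  have anti: "s v \<le> s u" if "u \<in> {\<alpha>..\<beta>}" "v \<in> {\<alpha>..\<beta>}" "u \<le> v" for u v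
  proof (cases "u = v")
    case False
    have "0 \<le> (s u - s v) * (v - u)" using sg[of u v] sg[of v u] that by (simp add: algebra_simps)
    thus ?thesis using that False by (simp add: zero_le_mult_iff)
  qed simp
  have "\<phi> x \<le> \<phi> a + s a * (x - a)" by (rule sg) (use ab x in auto)
  moreover have "\<phi> a \<le> \<phi> x + s x * (a - x)" by (rule sg) (use ab x in auto)
  moreover have "s x * (a - x) \<le> s b * (a - x)"
    using anti[of x b] x ab by (intro mult_right_mono_neg) auto
  moreover have "(s a - s b) * (x - a) \<le> (s a - s b) * (b - a)"
    using anti[of a b] x ab by (intro mult_left_mono) auto
  ultimately show "\<bar>\<phi> x - \<phi> a - s a * (x - a)\<bar> \<le> (s a - s b) * (b - a)"
    by (simp add: algebra_simps abs_le_iff)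
  have A0: "0 \<le> A" using bd[of a] ab by force
  have "\<bar>s a * (x - a)\<bar> \<le> A * (b - a)" "\<bar>s x * (a - x)\<bar> \<le> A * (b - a)"
    unfolding abs_mult using bd[of a] bd[of x] x ab A0 by (auto intro!: mult_mono)
  thus "\<bar>\<phi> x - \<phi> a\<bar> \<le> A * (b - a)"
    using \<open>\<phi> x \<le> \<phi> a + s a * (x - a)\<close> \<open>\<phi> a \<le> \<phi> x + s x * (a - x)\<close> by linarith
qed

text \<open>Each concave function contributes its drop of slope times the bound 2 on the derivative
  of \<open>softplus2\<close>. The Taylor remainder is at most \<open>4 * A^2 * (b - a)\<close>
  times the length, and this factor is additive over intervals, so it fits into \<open>\<nu>\<close>
  as a linear term.\<close>

lemma near_affine_softplus2:
  fixes \<phi> \<phi>0 s s0 :: "real \<Rightarrow> real"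
  assumes sg: "\<And>x v. x \<in> {\<alpha>..\<beta>} \<Longrightarrow> v \<in> {\<alpha>..\<beta>} \<Longrightarrow> \<phi> v \<le> \<phi> x + s x * (v - x)"
    and bd: "\<And>x. x \<in> {\<alpha>..\<beta>} \<Longrightarrow> \<bar>s x\<bar> \<le> A"
    and sg0: "\<And>x v. x \<in> {\<alpha>..\<beta>} \<Longrightarrow> v \<in> {\<alpha>..\<beta>} \<Longrightarrow> \<phi>0 v \<le> \<phi>0 x + s0 x * (v - x)"
    and bd0: "\<And>x. x \<in> {\<alpha>..\<beta>} \<Longrightarrow> \<bar>s0 x\<bar> \<le> A"
    and h: "\<And>x. x \<in> {\<alpha>..\<beta>} \<Longrightarrow> h x = softplus2 (\<phi> x - \<phi>0 x)"
  shows "near_affine h (\<lambda>x. 2 * s x + 2 * s0 x - 4 * A\<^sup>2 * x) \<alpha> \<beta>"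
  unfolding near_affine_def
proof (intro allI impI)
  fix a b assume ab: "\<alpha> \<le> a" "a < b" "b \<le> \<beta>"
  define z where "z = (\<lambda>x. \<phi> x - \<phi>0 x)"
  obtain d where d: "0 \<le> d" "d \<le> 2" "\<And>w. \<bar>softplus2 w - softplus2 (z a) - d * (w - z a)\<bar> \<le> (w - z a)\<^sup>2"
    using softplus2_taylor[of "z a"] by blast
  define c1 where "c1 = d * (s a - s0 a)"
  define c0 where "c0 = softplus2 (z a) - c1 * a"
  show "\<exists>c d. \<forall>x\<in>{a..b}. \<bar>h x - (c + d * x)\<bar>
     \<le> (2 * s a + 2 * s0 a - 4 * A\<^sup>2 * a - (2 * s b + 2 * s0 b - 4 * A\<^sup>2 * b)) * (b - a)"
  proof (intro exI ballI)
    fix x assume x: "x \<in> {a..b}"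
    note t = supergradient_tangent[OF sg bd ab x] and t0 = supergradient_tangent[OF sg0 bd0 ab x]
    define r where "r = (\<phi> x - \<phi> a - s a * (x - a)) - (\<phi>0 x - \<phi>0 a - s0 a * (x - a))"
    have r: "\<bar>r\<bar> \<le> (s a - s b) * (b - a) + (s0 a - s0 b) * (b - a)" using t(1) t0(1) unfolding r_def by linarith
    have "\<bar>z x - z a\<bar> \<le> 2 * A * (b - a)" using t(2) t0(2) unfolding z_def by linarith
    hence "\<bar>z x - z a\<bar>\<^sup>2 \<le> (2 * A * (b - a))\<^sup>2" by (rule power_mono) simp
    moreover have "(2 * A * (b - a))\<^sup>2 = 4 * A\<^sup>2 * (b - a) * (b - a)"
      unfolding power_mult_distrib by (simp add: power2_eq_square[of "b - a"] mult.assoc)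
    ultimately have zz: "(z x - z a)\<^sup>2 \<le> 4 * A\<^sup>2 * (b - a) * (b - a)" by simp
    have dr: "\<bar>d * r\<bar> \<le> 2 * ((s a - s b) * (b - a) + (s0 a - s0 b) * (b - a))"
      unfolding abs_mult using d r by (intro mult_mono) auto
    have "h x - (c0 + c1 * x) = (softplus2 (z x) - softplus2 (z a) - d * (z x - z a)) + d * r"
    proof -
      have "h x = softplus2 (z x)" using h[of x] x ab by (simp add: z_def)
      moreover have "d * (z x - z a) = d * r + c1 * (x - a)"
        by (simp add: r_def c1_def z_def algebra_simps)
      ultimately show ?thesis by (simp add: c0_def algebra_simps)
    qed
    hence "\<bar>h x - (c0 + c1 * x)\<bar> \<le> 4 * A\<^sup>2 * (b - a) * (b - a) + 2 * ((s a - s b) * (b - a) + (s0 a - s0 b) * (b - a))"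
      using d(3)[of "z x"] zz dr by linarith
    also have "\<dots> = (2 * s a + 2 * s0 a - 4 * A\<^sup>2 * a - (2 * s b + 2 * s0 b - 4 * A\<^sup>2 * b)) * (b - a)"
      by (simp add: algebra_simps)
    finally show "\<bar>h x - (c0 + c1 * x)\<bar> \<le> \<dots>" .
  qed
qed

context symmetric_log_concave
begin

lemma g_lc_subdensity: "lc_subdensity g"
  using lc g_int g_total by (simp add: lc_subdensity_def)

text \<open>The slope bound is used for \<open>g\<close> too, a subdensity at distance 0 from
  itself. With \<open>A = 72 / lam l\<close> the drop of \<open>\<nu>\<close> is at most
  \<open>8 * A + 4 * A^2 * lam l\<close>, which is (576 + 20736) / lam l.\<close>

lemma near_affine_logmix:
  assumes f: "lc_subdensity f" and small: "8 * hellinger_sq f g \<le> p (l + 2)"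
  shows "\<exists>\<nu>. near_affine (\<lambda>x. logmix (f x) (g x)) \<nu> (t l) (t l + lam l) \<and>
     \<nu> (t l) - \<nu> (t l + lam l) \<le> 22000 / lam l"
proof -
  have tl: "t l + lam l = t (Suc l)" by (simp add: lam_def)
  have g8: "8 * hellinger_sq g g \<le> p (l + 2)" using p_pos[of "l+2"] by (simp add: hellinger_sq_def)
  have sup: "\<exists>s. \<forall>x\<in>{t l..t (Suc l)}. \<bar>s x\<bar> \<le> 72 / lam l \<and> 0 < u x \<and>
      (\<forall>v. 0 < u v \<longrightarrow> ln (u v) \<le> ln (u x) + s x * (v - x))"
    if u: "lc_subdensity u" "8 * hellinger_sq u g \<le> p (l + 2)" for u
  proof -
    have "\<forall>x\<in>{t l..t (Suc l)}. \<exists>s. \<bar>s\<bar> \<le> 72 / lam l \<and> 0 < u x \<and>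
      (\<forall>v. 0 < u v \<longrightarrow> ln (u v) \<le> ln (u x) + s * (v - x))"
    proof
      fix x assume x: "x \<in> {t l..t (Suc l)}"
      have "q l / 32 \<le> u x" using f_block_lower[OF u] x by auto
      hence "0 < u x" using q_pos[of l] by linarith
      thus "\<exists>s. \<bar>s\<bar> \<le> 72 / lam l \<and> 0 < u x \<and> (\<forall>v. 0 < u v \<longrightarrow> ln (u v) \<le> ln (u x) + s * (v - x))"
        using f_supergradient[OF u] x by auto
    qed
    thus ?thesis by (rule bchoice)
  qed
  obtain s where s: "\<And>x. x \<in> {t l..t (Suc l)} \<Longrightarrow> \<bar>s x\<bar> \<le> 72 / lam l \<and> 0 < f x \<and>
      (\<forall>v. 0 < f v \<longrightarrow> ln (f v) \<le> ln (f x) + s x * (v - x))" using sup[OF f small] by blast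
  obtain s0 where s0: "\<And>x. x \<in> {t l..t (Suc l)} \<Longrightarrow> \<bar>s0 x\<bar> \<le> 72 / lam l \<and> 0 < g x \<and>
      (\<forall>v. 0 < g v \<longrightarrow> ln (g v) \<le> ln (g x) + s0 x * (v - x))" using sup[OF g_lc_subdensity g8] by blast
  define A where "A = 72 / lam l"
  have na: "near_affine (\<lambda>x. logmix (f x) (g x)) (\<lambda>x. 2 * s x + 2 * s0 x - 4 * A\<^sup>2 * x) (t l) (t (Suc l))"
  proof (rule near_affine_softplus2[where \<phi> = "\<lambda>x. ln (f x)" and \<phi>0 = "\<lambda>x. ln (g x)"])
    show "logmix (f x) (g x) = softplus2 (ln (f x) - ln (g x))" if "x \<in> {t l..t (Suc l)}" for x
      using s[OF that] s0[OF that] by (intro logmix_softplus2) auto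
  qed (use s s0 in \<open>auto simp: A_def\<close>)
  have 1: "t l \<in> {t l..t (Suc l)}" "t (Suc l) \<in> {t l..t (Suc l)}" using t_less_Suc[of l] by auto
  have b: "\<bar>s (t l)\<bar> \<le> A" "\<bar>s (t (Suc l))\<bar> \<le> A" "\<bar>s0 (t l)\<bar> \<le> A" "\<bar>s0 (t (Suc l))\<bar> \<le> A"
    using s[OF 1(1)] s[OF 1(2)] s0[OF 1(1)] s0[OF 1(2)] by (auto simp: A_def)
  have "(2 * s (t l) + 2 * s0 (t l) - 4 * A\<^sup>2 * t l) - (2 * s (t (Suc l)) + 2 * s0 (t (Suc l)) - 4 * A\<^sup>2 * t (Suc l))
     = 2 * (s (t l) - s (t (Suc l))) + 2 * (s0 (t l) - s0 (t (Suc l))) + 4 * A\<^sup>2 * lam l"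
    by (simp add: lam_def algebra_simps)
  also have "\<dots> \<le> 8 * A + 4 * A\<^sup>2 * lam l"
  proof (rule add_right_mono)
    show "2 * (s (t l) - s (t (Suc l))) + 2 * (s0 (t l) - s0 (t (Suc l))) \<le> 8 * A"
      using b(1,3)[THEN abs_le_D1] b(2,4)[THEN abs_le_D2] by simp
  qed
  also have "\<dots> \<le> 22000 / lam l" using lam_pos[of l] by (simp add: A_def field_simps power2_eq_square)
  finally show ?thesis using na unfolding tl by (intro exI[of _ "\<lambda>x. 2 * s x + 2 * s0 x - 4 * A\<^sup>2 * x"]) simp
qed

end

text \<open>Closed forms by induction; 234 and 14 are the limits. The two series collect
  fluctuations and bracketing errors over the tail blocks.\<close>

lemma arith_geo_sums:
  "(\<Sum>j\<in>{1..m}. (2 * real j + 6) * (9/10) ^ j) \<le> 234"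
  "(\<Sum>j\<in>{1..m}. (2 * real j + 10) * (1/2) ^ j) \<le> 14"
proof -
  have "(\<Sum>j\<in>{1..m}. (2 * real j + 6) * (9/10) ^ j) = 234 - (18 * real m + 234) * (9/10) ^ m"
  proof (induction m)
    case (Suc m)
    have e: "(\<Sum>j\<in>{1..Suc m}. (2 * real j + 6) * (9/10) ^ j)
       = (\<Sum>j\<in>{1..m}. (2 * real j + 6) * (9/10) ^ j) + (2 * real (Suc m) + 6) * (9/10) ^ Suc m" by simp
    have "234 - (18 * real m + 234) * x + (2 * (real m + 1) + 6) * (9/10 * x)
      = 234 - (18 * (real m + 1) + 234) * (9/10 * x)" for x :: real by (simp add: field_simps)
    from this[of "(9/10) ^ m"] show ?case unfolding e Suc.IH power_Suc of_nat_Suc by (simp only: add.commute)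
  qed simp
  thus "(\<Sum>j\<in>{1..m}. (2 * real j + 6) * (9/10) ^ j) \<le> 234" by simp
  have "(\<Sum>j\<in>{1..m}. (2 * real j + 10) * (1/2) ^ j) = 14 - (2 * real m + 14) * (1/2) ^ m"
  proof (induction m)
    case (Suc m)
    have e: "(\<Sum>j\<in>{1..Suc m}. (2 * real j + 10) * (1/2) ^ j)
       = (\<Sum>j\<in>{1..m}. (2 * real j + 10) * (1/2) ^ j) + (2 * real (Suc m) + 10) * (1/2) ^ Suc m" by simp
    have "14 - (2 * real m + 14) * x + (2 * (real m + 1) + 10) * (1/2 * x)
      = 14 - (2 * (real m + 1) + 14) * (1/2 * x)" for x :: real by (simp add: field_simps)
    from this[of "(1/2) ^ m"] show ?case unfolding e Suc.IH power_Suc of_nat_Suc by (simp only: add.commute)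
  qed simp
  thus "(\<Sum>j\<in>{1..m}. (2 * real j + 10) * (1/2) ^ j) \<le> 14" by simp
qed

text \<open>One-sided on purpose: the basic inequality asks only for an upper bound, so the
  empirical part takes \<open>hi\<close> and the true part \<open>lo\<close>.\<close>

lemma dev_bracket:
  assumes g: "density_fun g" and n: "1 \<le> n" and [measurable]: "h \<in> borel_measurable borel" "J \<in> sets borel"
    and int: "integrable lborel (\<lambda>x. indicator J x * h x * g x)"
    and lo: "\<And>x. x \<in> J \<Longrightarrow> lo \<le> h x" and hi: "\<And>x. x \<in> J \<Longrightarrow> h x \<le> hi"
  shows "dev g n y (\<lambda>x. indicator J x * h x) \<le> hi * dev g n y (indicator J) + (hi - lo) * (LINT x:J|lborel. g x)"
proof -
  have iJ: "integrable lborel (\<lambda>x. indicator J x * g x)"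
    by (rule integrable_mult_density[OF g, of _ 1]) (auto simp: indicator_def)
  have "(\<Sum>i\<in>{1..n}. indicator J (y i) * h (y i)) \<le> (\<Sum>i\<in>{1..n}. hi * indicator J (y i))"
    by (intro sum_mono) (use hi in \<open>auto simp: indicator_def\<close>)
  hence "(\<Sum>i\<in>{1..n}. indicator J (y i) * h (y i)) / real n \<le> hi * ((\<Sum>i\<in>{1..n}. indicator J (y i)) / real n)"
    by (simp add: sum_distrib_left divide_right_mono)
  moreover have "lo * (LINT x|lborel. indicator J x * g x) \<le> (LINT x|lborel. indicator J x * h x * g x)"
  proof -
    have "(LINT x|lborel. lo * (indicator J x * g x)) \<le> (LINT x|lborel. indicator J x * h x * g x)"
    proof (rule integral_mono)
      show "lo * (indicator J x * g x) \<le> indicator J x * h x * g x" for x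
        using lo[of x] g by (auto simp: indicator_def density_fun_def intro!: mult_right_mono)
    qed (use iJ int in auto)
    thus ?thesis by simp
  qed
  moreover have "(LINT x:J|lborel. g x) = (LINT x|lborel. indicator J x * g x)"
    by (simp add: set_lebesgue_integral_def)
  ultimately show ?thesis unfolding dev_def by (simp add: algebra_simps)
qed

section \<open>Moments of the mixture ratio, tail blocks, and their assembly on a half line\<close>

context symmetric_log_concave
begin

definition llr :: "(real \<Rightarrow> real) \<Rightarrow> real \<Rightarrow> real" where "llr f x = logmix (f x) (g x)"

lemma lc_subdensityD:
  assumes "lc_subdensity f"
  shows "log_concave f" "f \<in> borel_measurable borel" "integrable lborel f" "0 \<le> f x" "(LINT x|lborel. f x) \<le> 1"
  using assms log_concave_nonneg[of f x] unfolding lc_subdensity_def by blast+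

lemma llr_measurable: "lc_subdensity f \<Longrightarrow> llr f \<in> borel_measurable borel"
proof -
  assume "lc_subdensity f"
  hence [measurable]: "f \<in> borel_measurable borel" by (rule lc_subdensityD)
  show ?thesis unfolding llr_def[abs_def] logmix_def by measurable
qed

lemma llr_sq_le: assumes "lc_subdensity f" shows "(llr f x)\<^sup>2 * g x \<le> 16 * (sqrt (f x) - sqrt (g x))\<^sup>2"
proof (cases "g x = 0")
  case False
  hence g: "0 < g x" using g_nonneg[of x] by simp
  have "(\<bar>llr f x\<bar> * sqrt (g x))\<^sup>2 \<le> (4 * \<bar>sqrt (f x) - sqrt (g x)\<bar>)\<^sup>2"
    unfolding llr_def by (intro power_mono abs_logmix_le) (use g lc_subdensityD(4)[OF assms] in auto)
  thus ?thesis using g by (simp add: power_mult_distrib)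
qed simp

text \<open>This is the energy budget: the charges of all blocks together are paid from 32 times the
  squared Hellinger distance.\<close>

lemma llr_sq_integral:
  assumes f: "lc_subdensity f"
  shows "integrable lborel (\<lambda>x. (llr f x)\<^sup>2 * g x)" "(LINT x|lborel. (llr f x)\<^sup>2 * g x) \<le> 32 * hellinger_sq f g"
proof -
  note m[measurable] = llr_measurable[OF f]
  note i = integrable_sqrt_diff[OF lc_subdensityD(3)[OF f] g_int lc_subdensityD(4)[OF f] g_nonneg]
  show int: "integrable lborel (\<lambda>x. (llr f x)\<^sup>2 * g x)"
  proof (rule Bochner_Integration.integrable_bound)
    show "integrable lborel (\<lambda>x. 16 * (sqrt (f x) - sqrt (g x))\<^sup>2)" using i by simp
    show "AE x in lborel. norm ((llr f x)\<^sup>2 * g x) \<le> norm (16 * (sqrt (f x) - sqrt (g x))\<^sup>2)"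
      by (rule AE_I2) (use llr_sq_le[OF f] g_nonneg in simp)
  qed measurable
  have "(LINT x|lborel. (llr f x)\<^sup>2 * g x) \<le> (LINT x|lborel. 16 * (sqrt (f x) - sqrt (g x))\<^sup>2)"
    by (rule integral_mono) (use int i llr_sq_le[OF f] in auto)
  thus "(LINT x|lborel. (llr f x)\<^sup>2 * g x) \<le> 32 * hellinger_sq f g" by (simp add: hellinger_sq_def)
qed

lemma llr_integrable: assumes f: "lc_subdensity f" shows "integrable lborel (\<lambda>x. llr f x * g x)"
proof -
  note m[measurable] = llr_measurable[OF f]
  show ?thesis
proof (rule Bochner_Integration.integrable_bound)
  show "integrable lborel (\<lambda>x. (llr f x)\<^sup>2 * g x + g x)" using llr_sq_integral(1)[OF f] g_int by simp
  show "AE x in lborel. norm (llr f x * g x) \<le> norm ((llr f x)\<^sup>2 * g x + g x)"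
  proof (rule AE_I2)
    fix x
    have "\<bar>llr f x\<bar> \<le> (llr f x)\<^sup>2 + 1"
    proof -
      have "0 \<le> (\<bar>llr f x\<bar> - 1)\<^sup>2" by simp
      hence "2 * \<bar>llr f x\<bar> \<le> (llr f x)\<^sup>2 + 1" by (simp add: power2_diff)
      thus ?thesis by simp
    qed
    hence "\<bar>llr f x\<bar> * g x \<le> ((llr f x)\<^sup>2 + 1) * g x" using g_nonneg by (intro mult_right_mono) auto
    thus "norm (llr f x * g x) \<le> norm ((llr f x)\<^sup>2 * g x + g x)" using g_nonneg[of x]
      by (simp add: abs_mult distrib_right)
  qed
qed measurable
qed

lemma llr_set_integrable:
  assumes f: "lc_subdensity f" and "A \<in> sets borel"
  shows "integrable lborel (\<lambda>x. indicator A x * llr f x * g x)"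
  using integrable_mult_indicator[of A lborel, OF _ llr_integrable[OF f]] assms(2) by (simp add: mult.assoc)

lemma llr_ge: assumes "lc_subdensity f" shows "- (2 * ln 2) \<le> llr f x"
proof (cases "g x = 0")
  case False
  thus ?thesis unfolding llr_def using g_nonneg[of x] lc_subdensityD(4)[OF assms, of x] by (intro logmix_ge) auto
\<comment> \<open>Where \<open>g x = 0\<close> the ratio is 0, since division by 0 and
  \<open>ln 0\<close> both give 0.\<close>
qed (simp add: llr_def logmix_def)

text \<open>In the tail a monotone bracketing of the likelihood ratio over \<open>M\<close> equal pieces of a block
  replaces the multiscale bound.\<close>
definition M :: nat where "M = 2 ^ 18"
definition piece :: "nat \<Rightarrow> nat \<Rightarrow> real set" where
  "piece l k = {t l + real k * (lam l / real M)..<t l + real (Suc k) * (lam l / real M)}"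

lemma M_pos: "0 < M" by (simp add: M_def)

lemma sum_pieces: "(\<Sum>k<M. indicator (piece l k) x) = (indicator {t l..<t (Suc l)} x :: real)"
proof -
  have m: "mono (\<lambda>k. t l + real k * (lam l / real M))" using lam_pos[of l] by (intro monoI) (auto intro!: mult_right_mono divide_right_mono)
  show ?thesis unfolding piece_def
    using sum_indicator_consecutive[OF m, where m = M and x = x] M_pos by (simp add: lam_def)
qed

lemma piece_measurable[measurable]: "piece l k \<in> sets borel" by (simp add: piece_def)

lemma piece_ends:
  fixes l k
  assumes "k < M"
  defines "a \<equiv> t l + real k * (lam l / real M)" and "b \<equiv> t l + real (Suc k) * (lam l / real M)"
  shows "t l \<le> a" "a \<le> b" "b \<le> t (Suc l)" "b - a = lam l / real M"
proof -
  have "real (Suc k) * (lam l / real M) \<le> real M * (lam l / real M)"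
    using assms(1) lam_pos[of l] by (intro mult_right_mono) auto
  also have "\<dots> = lam l" using M_pos by simp
  finally show "b \<le> t (Suc l)" by (simp add: b_def lam_def)
  show "t l \<le> a" "a \<le> b" "b - a = lam l / real M"
    using lam_pos[of l] by (auto simp: a_def b_def algebra_simps add_divide_distrib)
qed

lemma piece_mass: "k < M \<Longrightarrow> (LINT x:piece l k|lborel. g x) \<le> 2 * p l / real M"
proof -
  assume k: "k < M"
  note e = piece_ends[OF k, of l]
  have "(LINT x:piece l k|lborel. g x) \<le> q l * (t l + real (Suc k) * (lam l / real M) - (t l + real k * (lam l / real M)))"
    unfolding piece_def
    by (rule set_integral_bounds_const(2)) (use e g_block[of l] in \<open>auto intro!: g_set_int\<close>)
  also have "\<dots> = q l * lam l / real M" using e(4) by simp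
  also have "\<dots> \<le> 2 * p l / real M" using q_lam_le[of l] by (intro divide_right_mono) auto
  finally show ?thesis .
qed

text \<open>Beyond block \<open>l0\<close> both \<open>f + g\<close> and \<open>g\<close> are
  antitone, so on a piece the ratio is bracketed by end values, and the widths of the brackets
  telescope to the falls of \<open>U\<close> and \<open>V\<close> over the block. Here
  \<open>f + g\<close> lies between \<open>q (Suc l)\<close> and \<open>5 * q l0\<close>, whose
  ratio grows at most like 2^j; hence the growth is linear in \<open>j\<close>.\<close>

lemma dev_tail_block:
  assumes f: "lc_subdensity f" and small: "8 * hellinger_sq f g \<le> p (l0 + 2)" and q0: "128 * q l0 < q 0"
    and n: "1 \<le> n" and l: "l = l0 + j" "1 \<le> j"
    and D: "\<And>k. k < M \<Longrightarrow> \<bar>dev g n y (indicator (piece l k))\<bar> \<le> d"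
  shows "dev g n y (\<lambda>x. indicator {t l..<t (Suc l)} x * llr f x)
     \<le> real M * (2 * real j + 6) * d + (2 * p l / real M) * (2 * real j + 10)"
proof -
  note fm[measurable] = lc_subdensityD(2)[OF f] and f0 = lc_subdensityD(4)[OF f]
  note lm[measurable] = llr_measurable[OF f]
  have tl: "t (Suc l0) \<le> t l" using l by (intro t_mono) auto
  have fanti: "f b \<le> f a" if "t l \<le> a" "a \<le> b" for a b using f_tail(1)[OF f small q0, of a b] that tl by simp
  have fle: "f a \<le> 4 * q l0" if "t l \<le> a" for a using f_tail(2)[OF f small q0, of a] that tl by simp
  have ganti: "g b \<le> g a" if "t l \<le> a" "a \<le> b" for a b using g_antimono[of a b] that t_nonneg[of l] by simp
  have gpos: "0 < g a" if "t l \<le> a" "a \<le> t (Suc l)" for a using g_block[OF that] q_pos[of l] by linarith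
  have ql: "q l0 \<le> 2 ^ (j + 1) * q (Suc l)" using q_ratio[of l0 "j + 1"] l by simp
  have qpos: "0 < q l0" "0 < q (Suc l)" by (rule q_pos)+
  define U where "U = (\<lambda>x. 2 * ln (f x + g x))"
  define V where "V = (\<lambda>x. 2 * ln (2 * g x))"
  have UV: "llr f x = U x - V x" if "t l \<le> x" "x \<le> t (Suc l)" for x
    using gpos[OF that] f0[of x] by (simp add: llr_def logmix_def U_def V_def ln_div add_nonneg_pos)
  have Uanti: "U b \<le> U a" and Vanti: "V b \<le> V a" if "t l \<le> a" "a \<le> b" "b \<le> t (Suc l)" for a b
  proof -
    have "0 < g b" "0 < g a" using gpos[of a] gpos[of b] that by auto
    moreover have "0 \<le> f b" "f b \<le> f a" "g b \<le> g a" using f0 fanti ganti that by auto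
    ultimately show "U b \<le> U a" "V b \<le> V a" by (auto simp: U_def V_def intro!: ln_mono)
  qed
  have Ule: "U a \<le> 2 * ln (5 * q l0)" if "t l \<le> a" "a \<le> t (Suc l)" for a
  proof -
    have "g a \<le> q l" using g_block[OF that] by simp
    also have "\<dots> \<le> q l0" using l by (intro q_antimono) auto
    finally have "f a + g a \<le> 5 * q l0" using fle[OF that(1)] by simp
    moreover have "0 < f a + g a" using gpos[OF that] f0[of a] by simp
    ultimately show ?thesis unfolding U_def by (intro mult_left_mono ln_mono) auto
  qed
  have gge: "q (Suc l) \<le> g a" if "t l \<le> a" "a \<le> t (Suc l)" for a
    using ganti[OF that] by (simp add: q_def)
  have lnq: "ln (q l0) \<le> (real j + 1) + ln (q (Suc l))"
  proof -
    have "ln (q l0) \<le> ln (2 ^ (j + 1) * q (Suc l))" using ql qpos by (intro ln_mono) auto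
    also have "\<dots> = real (j + 1) * ln 2 + ln (q (Suc l))" using qpos by (simp add: ln_mult ln_realpow del: power_Suc)
    also have "real (j + 1) * ln 2 \<le> real (j + 1) * 1" using ln_2_less_1 by (intro mult_left_mono) auto
    finally show ?thesis by simp
  qed
  have ln5: "ln (5 * q l0) \<le> 2 + ln (q l0)"
  proof -
    have "(5::real) \<le> exp 2"
    proof -
      have "1 + 2 + (2::real)\<^sup>2 / 2 \<le> exp 2" by (rule exp_lower_Taylor_quadratic) simp
      thus ?thesis by (simp add: power2_eq_square)
    qed
    hence "ln 5 \<le> ln (exp (2::real))" by (intro ln_mono) auto
    hence "ln 5 \<le> (2::real)" by simp
    thus ?thesis using qpos by (simp add: ln_mult)
  qed
  have Uge: "2 * ln (q (Suc l)) \<le> U a" and Vge: "2 * ln (q (Suc l)) \<le> V a" if "t l \<le> a" "a \<le> t (Suc l)" for a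
    using gge[OF that] f0[of a] qpos by (auto simp: U_def V_def intro!: ln_mono)
  have Vran: "V (t l) - V (t (Suc l)) \<le> 2"
  proof -
    have "q l \<le> 2 * q (Suc l)" using q_Suc[of l] by simp
    hence "ln (2 * q l) \<le> ln (2 * (2 * q (Suc l)))" using q_pos[of l] by (intro ln_mono) auto
    also have "\<dots> = ln 2 + ln (2 * q (Suc l))" using qpos by (subst ln_mult) auto
    finally show ?thesis using ln_2_less_1 by (simp add: V_def q_def)
  qed
  have Uran: "U (t l) - U (t (Suc l)) \<le> 2 * real j + 6"
    using Ule[of "t l"] Uge[of "t (Suc l)"] t_less_Suc[of l] ln5 lnq by simp
  define a where "a = (\<lambda>k. t l + real k * (lam l / real M))"
  have aS: "t l \<le> a k" "a k \<le> a (Suc k)" "a (Suc k) \<le> t (Suc l)" "a k \<le> t (Suc l)" if "k < M" for k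
    using piece_ends[OF that, of l] unfolding a_def by auto
  have each: "dev g n y (\<lambda>x. indicator (piece l k) x * llr f x) \<le> (2 * real j + 6) * d
     + (2 * p l / real M) * ((U (a k) - U (a (Suc k))) + (V (a k) - V (a (Suc k))))" if k: "k < M" for k
  proof -
    let ?hi = "U (a k) - V (a (Suc k))" and ?lo = "U (a (Suc k)) - V (a k)"
    have rng: "t l \<le> x" "x \<le> t (Suc l)" "a k \<le> x" "x \<le> a (Suc k)" if "x \<in> piece l k" for x
      using that aS[OF k] by (auto simp: piece_def a_def)
    have hi: "?lo \<le> llr f x \<and> llr f x \<le> ?hi" if x: "x \<in> piece l k" for x
      using Uanti[of "a k" x] Uanti[of x "a (Suc k)"] Vanti[of "a k" x] Vanti[of x "a (Suc k)"] rng[OF x] aS[OF k] UV[of x] by simp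
    have "0 < lam l / real M" using lam_pos[of l] M_pos by simp
    hence "a k \<in> piece l k" using piece_ends(4)[OF k, of l] by (auto simp: piece_def a_def)
    hence "- (2 * ln 2) \<le> ?hi" using hi[of "a k"] llr_ge[OF f, of "a k"] by linarith
    moreover have "?hi \<le> 2 * real j + 6"
      using Ule[of "a k"] Vge[of "a (Suc k)"] aS[OF k] ln5 lnq by auto
    ultimately have ah: "\<bar>?hi\<bar> \<le> 2 * real j + 6" using ln_2_less_1 by auto
    have "dev g n y (\<lambda>x. indicator (piece l k) x * llr f x) \<le> ?hi * dev g n y (indicator (piece l k)) + (?hi - ?lo) * (LINT x:piece l k|lborel. g x)"
      by (rule dev_bracket[OF dens n]) (use hi llr_set_integrable[OF f] in auto)
    also have "\<dots> \<le> (2 * real j + 6) * d + (?hi - ?lo) * (2 * p l / real M)"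
    proof (rule add_mono)
      have "?hi * dev g n y (indicator (piece l k)) \<le> \<bar>?hi\<bar> * \<bar>dev g n y (indicator (piece l k))\<bar>"
        unfolding abs_mult[symmetric] by (rule abs_ge_self)
      also have "\<dots> \<le> (2 * real j + 6) * d" using ah D[OF k] by (intro mult_mono) auto
      finally show "?hi * dev g n y (indicator (piece l k)) \<le> (2 * real j + 6) * d" .
      have "0 \<le> ?hi - ?lo" using hi[OF \<open>a k \<in> piece l k\<close>] by linarith
      thus "(?hi - ?lo) * (LINT x:piece l k|lborel. g x) \<le> (?hi - ?lo) * (2 * p l / real M)"
        by (intro mult_left_mono piece_mass k)
    qed
    also have "(?hi - ?lo) * (2 * p l / real M) = (2 * p l / real M) * ((U (a k) - U (a (Suc k))) + (V (a k) - V (a (Suc k))))"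
      by (subst mult.commute) simp
    finally show ?thesis .
  qed
  have "(\<lambda>x. indicator {t l..<t (Suc l)} x * llr f x) = (\<lambda>x. \<Sum>k<M. indicator (piece l k) x * llr f x)"
    by (rule ext) (simp add: sum_pieces flip: sum_distrib_right)
  hence "dev g n y (\<lambda>x. indicator {t l..<t (Suc l)} x * llr f x) = (\<Sum>k<M. dev g n y (\<lambda>x. indicator (piece l k) x * llr f x))"
    by (simp only:) (rule dev_sum, rule llr_set_integrable[OF f], simp)
  also have "\<dots> \<le> (\<Sum>k<M. (2 * real j + 6) * d
     + (2 * p l / real M) * ((U (a k) - U (a (Suc k))) + (V (a k) - V (a (Suc k)))))"
    by (rule sum_mono) (use each in auto)
  also have "\<dots> = real M * ((2 * real j + 6) * d) + (2 * p l / real M) * ((U (a 0) - U (a M)) + (V (a 0) - V (a M)))"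
  proof -
    have tel: "(\<Sum>k<M. F (a k) - F (a (Suc k))) = F (a 0) - F (a M)" for F :: "real \<Rightarrow> real"
      using sum_lessThan_telescope'[of "\<lambda>k. F (a k)" M] .
    show ?thesis by (simp only: sum.distrib sum_distrib_left[symmetric] tel sum_constant card_lessThan)
      (simp only: mult.assoc mult.commute mult.left_commute)
  qed
  also have "a 0 = t l" by (simp add: a_def)
  also have "a M = t (Suc l)" using M_pos by (simp add: a_def lam_def)
  finally have "dev g n y (\<lambda>x. indicator {t l..<t (Suc l)} x * llr f x) \<le> real M * ((2 * real j + 6) * d)
      + (2 * p l / real M) * ((U (t l) - U (t (Suc l))) + (V (t l) - V (t (Suc l))))" .
  also have "\<dots> \<le> real M * ((2 * real j + 6) * d) + (2 * p l / real M) * (2 * real j + 10)"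
    using Uran Vran p_pos[of l] by (intro add_left_mono mult_left_mono) auto
  finally show ?thesis by (simp add: mult.assoc)
qed

definition cell_dev4 :: "nat \<Rightarrow> (nat \<Rightarrow> real) \<Rightarrow> nat \<Rightarrow> nat \<Rightarrow> nat \<Rightarrow> real" where
  "cell_dev4 n y m l k = cell_dev g n y (t l + real k * (lam l / real m)) (t l + real (Suc k) * (lam l / real m)) ^ 4"

text \<open>The remainder collects the normalized fluctuations that exceed the threshold of the multiscale bound;
  only fourth moments are needed to control it.\<close>
definition remainder :: "nat \<Rightarrow> (nat \<Rightarrow> real) \<Rightarrow> real \<Rightarrow> (nat \<Rightarrow> nat) \<Rightarrow> (nat \<Rightarrow> nat) \<Rightarrow> nat \<Rightarrow> real" where
  "remainder n y \<kappa> N Lv l = (\<Sum>i\<le>Lv l. real n * (real (N l))\<^sup>2 / (4 * (1/2^25) * \<kappa> * (p l)\<^sup>2) * (32/27) ^ i *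
     (\<Sum>k<N l * 2 ^ i. cell_dev4 n y (N l * 2 ^ i) l k))"

lemma cell_dev4_nonneg: "0 \<le> cell_dev4 n y m l k" unfolding cell_dev4_def by simp

lemma remainder_nonneg: "0 < \<kappa> \<Longrightarrow> 0 \<le> remainder n y \<kappa> N Lv l"
  unfolding remainder_def by (intro sum_nonneg mult_nonneg_nonneg cell_dev4_nonneg) auto

text \<open>\<open>block_bound\<close> with the charge 2^(-25) and \<open>V = 22000\<close>. On the
  block \<open>p / lam \<le> q \<le> 2 * g\<close>, which turns Lebesgue energy into energy under
  \<open>g\<close> and gives 10200 = 2 * 5100. Further 2640000 = 120 * 22000, and 528000 = 8 * 22000
  * 3, where 3 bounds the empirical plus the true mass in units of \<open>p l\<close>.\<close>

lemma dev_main_block: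
  assumes f: "lc_subdensity f" and small: "8 * hellinger_sq f g \<le> p (l + 2)"
    and n: "1 \<le> n" and k: "0 < \<kappa>" and N: "1 \<le> N l" and Lv: "real n * p l \<le> real (N l) * 2 ^ Lv l"
    and mass: "(\<Sum>i\<in>{1..n}. indicator {t l..<t (Suc l)} (y i)) / real n \<le> 2 * p l"
  shows "dev g n y (\<lambda>x. indicator {t l..<t (Suc l)} x * llr f x)
    \<le> 10200 * (1/2^25) * (LINT x|lborel. indicator {t l..<t (Suc l)} x * (llr f x)\<^sup>2 * g x)
     + (\<kappa> * real (N l) / (4 * (1/2^25) * real n) + 2640000 * sqrt (\<kappa> * p l / (real (N l) ^ 3 * real n))
     + remainder n y \<kappa> N Lv l + 528000 / real n)"
proof -
  note lm[measurable] = llr_measurable[OF f]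
  have tl: "t l + lam l = t (Suc l)" by (simp add: lam_def)
  obtain \<nu> where \<nu>: "near_affine (llr f) \<nu> (t l) (t l + lam l)" "\<nu> (t l) - \<nu> (t l + lam l) \<le> 22000 / lam l"
    using near_affine_logmix[OF f small] by (auto simp: llr_def[abs_def])
  interpret B: near_affine_block g n y "t l" "lam l" "N l" "llr f" \<nu> 22000
    by unfold_locales (use dens n lam_pos N lm \<nu> in auto)
  have W: "(B.W i k)^4 = cell_dev4 n y (N l * 2 ^ i) l k" for i k
    by (simp add: B.W_def cell_dev4_def B.pt_def B.cnt_def)
  have R: "(\<Sum>i\<le>Lv l. real n * (real (N l))\<^sup>2 / (4 * (1/2^25) * \<kappa> * (p l)\<^sup>2) * (32/27) ^ i * (\<Sum>k<B.cnt i. B.W i k ^ 4)) = remainder n y \<kappa> N Lv l"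
    unfolding remainder_def W B.cnt_def ..
  have SB: "p l / lam l * B.SB \<le> 2 * (LINT x|lborel. indicator {t l..<t (Suc l)} x * (llr f x)\<^sup>2 * g x)"
  proof -
    have i1: "integrable lborel (\<lambda>x. indicator {t l..<t (Suc l)} x * (llr f x)\<^sup>2)"
    proof -
      have sub: "{t l..<t (Suc l)} \<subseteq> {t l..t l + lam l}" by (auto simp: tl)
      show ?thesis using B.set_integrable_h2[OF _ sub] by (simp add: set_integrable_def)
    qed
    have i2: "integrable lborel (\<lambda>x. indicator {t l..<t (Suc l)} x * (llr f x)\<^sup>2 * g x)"
      using integrable_mult_indicator[of "{t l..<t (Suc l)}" lborel, OF _ llr_sq_integral(1)[OF f]] by (simp add: mult.assoc)
    have pq: "p l / lam l \<le> q l" using p_bounds(2)[of l] lam_pos[of l] by (simp add: divide_le_eq)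
    have "p l / lam l * B.SB = (LINT x|lborel. p l / lam l * (indicator {t l..<t (Suc l)} x * (llr f x)\<^sup>2))"
      by (simp add: B.SB_def tl set_lebesgue_integral_def)
    also have "\<dots> \<le> (LINT x|lborel. 2 * (indicator {t l..<t (Suc l)} x * (llr f x)\<^sup>2 * g x))"
    proof (rule integral_mono)
      show "integrable lborel (\<lambda>x. p l / lam l * (indicator {t l..<t (Suc l)} x * (llr f x)\<^sup>2))"
        by (rule integrable_mult_right[OF i1])
      show "integrable lborel (\<lambda>x. 2 * (indicator {t l..<t (Suc l)} x * (llr f x)\<^sup>2 * g x))"
        by (rule integrable_mult_right[OF i2])
      fix x
      show "p l / lam l * (indicator {t l..<t (Suc l)} x * (llr f x)\<^sup>2) \<le> 2 * (indicator {t l..<t (Suc l)} x * (llr f x)\<^sup>2 * g x)"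
      proof (cases "x \<in> {t l..<t (Suc l)}")
        case True
        hence "p l / lam l \<le> 2 * g x" using pq g_block[of l x] by auto
        hence "p l / lam l * (llr f x)\<^sup>2 \<le> 2 * g x * (llr f x)\<^sup>2" by (intro mult_right_mono) auto
        thus ?thesis using True by (simp add: mult_ac)
      qed simp
    qed
    finally show ?thesis by simp
  qed
  have cL: "8 * 22000 / real (B.cnt (Lv l)) * ((\<Sum>i\<in>{1..n}. indicator {t l..<t l + lam l} (y i)) / real n
        + (LINT x|lborel. indicator {t l..<t l + lam l} x * g x)) \<le> 528000 / real n"
  proof -
    have mb: "(LINT x|lborel. indicator {t l..<t (Suc l)} x * g x) = p l"
      using block_mass[of l] by (simp add: set_lebesgue_integral_def)
    have cp: "0 < real (B.cnt (Lv l))" using B.cnt_pos by simp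
    have "8 * 22000 / real (B.cnt (Lv l)) * ((\<Sum>i\<in>{1..n}. indicator {t l..<t l + lam l} (y i)) / real n
        + (LINT x|lborel. indicator {t l..<t l + lam l} x * g x)) \<le> 8 * 22000 / real (B.cnt (Lv l)) * (3 * p l)"
      unfolding tl mb using mass cp by (intro mult_left_mono) auto
    also have "\<dots> \<le> 528000 / real n"
      using Lv n cp unfolding B.cnt_def by (simp add: field_simps)
    finally show ?thesis .
  qed
  have main: "\<bar>dev g n y (\<lambda>x. indicator {t l..<t l + lam l} x * llr f x)\<bar> \<le>
      5100 * (1/2^25) * (p l / lam l * B.SB) + \<kappa> * real (N l) / (4 * (1/2^25) * real n)
    + 120 * 22000 * sqrt (\<kappa> * p l / (real (N l) ^ 3 * real n)) + remainder n y \<kappa> N Lv l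
    + 8 * 22000 / real (B.cnt (Lv l)) * ((\<Sum>i\<in>{1..n}. indicator {t l..<t l + lam l} (y i)) / real n
        + (LINT x|lborel. indicator {t l..<t l + lam l} x * g x))"
    unfolding R[symmetric] by (rule B.block_bound) (use k p_pos in auto)
  have SB': "5100 * (1/2^25) * (p l / lam l * B.SB)
     \<le> 10200 * (1/2^25) * (LINT x|lborel. indicator {t l..<t (Suc l)} x * (llr f x)\<^sup>2 * g x)"
    using mult_left_mono[OF SB, of "5100 * (1/2^25)"] by simp
  have "d \<le> A' + (B + 2640000 * C + R + E')"
    if "d \<le> A + B + 120 * 22000 * C + R + E" "A \<le> A'" "E \<le> E'" for d A A' B C R E E' :: real
    using that by simp
  from this[OF abs_le_D1[OF main] SB' cL] show ?thesis unfolding tl .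
qed

definition block_error :: "nat \<Rightarrow> (nat \<Rightarrow> real) \<Rightarrow> real \<Rightarrow> (nat \<Rightarrow> nat) \<Rightarrow> (nat \<Rightarrow> nat) \<Rightarrow> nat \<Rightarrow> real" where
  "block_error n y \<kappa> N Lv l = \<kappa> * real (N l) / (4 * (1/2^25) * real n)
     + 2640000 * sqrt (\<kappa> * p l / (real (N l) ^ 3 * real n)) + remainder n y \<kappa> N Lv l + 528000 / real n"

lemma block_error_nonneg: "0 < \<kappa> \<Longrightarrow> 0 \<le> block_error n y \<kappa> N Lv l"
  unfolding block_error_def using remainder_nonneg[of \<kappa> n y N Lv l] p_pos[of l] by simp

lemma dev_block_indicator:
  "dev g n y (indicator {t l..<t (Suc l)}) = (\<Sum>k<M. dev g n y (indicator (piece l k)))"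
proof -
  have "dev g n y (\<lambda>x. \<Sum>k<M. indicator (piece l k) x) = (\<Sum>k<M. dev g n y (indicator (piece l k)))"
    by (rule dev_sum) (rule integrable_mult_density[OF dens, of _ 1], auto simp: indicator_def)
  thus ?thesis by (simp add: sum_pieces)
qed

lemma empirical_block_mass:
  "(\<Sum>i\<in>{1..n}. indicator {t l..<t (Suc l)} (y i)) / real n = dev g n y (indicator {t l..<t (Suc l)}) + p l"
  using block_mass[of l] by (simp add: dev_def set_lebesgue_integral_def)

text \<open>The thresholds of the pieces add up to 2^18 * 2^(-44) times 2^(-l), far below half the
  block mass; whole blocks are thus controlled by the same event as the pieces.\<close>

lemma block_dev_small:
  assumes good: "\<And>k. k < M \<Longrightarrow> \<bar>dev g n y (indicator (piece l k))\<bar> \<le> (1/2)^44 * (1/2) ^ l"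
  shows "\<bar>dev g n y (indicator {t l..<t (Suc l)})\<bar> \<le> p l / 2"
proof -
  have "\<bar>dev g n y (indicator {t l..<t (Suc l)})\<bar> \<le> (\<Sum>k<M. \<bar>dev g n y (indicator (piece l k))\<bar>)"
    unfolding dev_block_indicator by (rule sum_abs)
  also have "\<dots> \<le> (\<Sum>k<M. (1/2)^44 * (1/2) ^ l)" by (rule sum_mono) (use good in auto)
  also have "\<dots> = (1/2)^26 * (1/2) ^ l" by (simp add: M_def power_divide)
  also have "\<dots> \<le> 1/8 * (1/2) ^ l" by (intro mult_right_mono) (auto simp: power_divide)
  also have "\<dots> = p l / 2" by (simp add: p_def)
  finally show ?thesis .
qed

text \<open>\<open>l0\<close> is the block whose mass is comparable to the squared Hellinger
  distance. Up to \<open>l0\<close> the multiscale bound applies; the blocks after it have total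
  mass of the order of that distance and are bracketed. Each group is charged 1/64 of the distance.
  The condition \<open>good\<close> covers every candidate \<open>l'\<close> because
  \<open>l0\<close> depends on the fit.\<close>

lemma dev_one_sided:
  assumes f: "lc_subdensity f" and n: "1 \<le> n" and k: "0 < \<kappa>" and l0: "l0 \<le> lmax"
    and small: "8 * hellinger_sq f g \<le> p (l0 + 2)" and big: "(1/2) ^ l0 \<le> 256 * hellinger_sq f g"
    and q0: "128 * q l0 < q 0"
    and N: "\<And>l. 1 \<le> N l" and Lv: "\<And>l. l \<le> lmax \<Longrightarrow> real n * p l \<le> real (N l) * 2 ^ Lv l"
    and good: "\<And>l l' k. l' \<le> lmax \<Longrightarrow> l' \<le> l \<Longrightarrow> k < M \<Longrightarrow>
       \<bar>dev g n y (indicator (piece l k))\<bar> \<le> (1/2)^44 * (1/2) ^ l' * (9/10) ^ (l - l')"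
    and data: "\<And>i. i \<in> {1..n} \<Longrightarrow> 0 < g (y i)"
  shows "dev g n y (\<lambda>x. indicator {0..} x * llr f x) \<le> hellinger_sq f g / 32 + (\<Sum>l\<le>lmax. block_error n y \<kappa> N Lv l)"
proof -
  let ?H = "hellinger_sq f g"
  have H0: "0 \<le> ?H" by (rule hellinger_sq_nonneg)
  define D where "D = (\<lambda>l. dev g n y (\<lambda>x. indicator {t l..<t (Suc l)} x * llr f x))"
  define I where "I = (\<lambda>l. LINT x|lborel. indicator {t l..<t (Suc l)} x * (llr f x)\<^sup>2 * g x)"
  have mono: "mono t" by (intro monoI t_mono)
  have main: "D l \<le> 10200 * (1/2^25) * I l + block_error n y \<kappa> N Lv l" if l: "l \<le> l0" for l
    unfolding D_def I_def block_error_def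
  proof (rule dev_main_block[where l = l and N = N, OF f _ n k N])
    have "p (l0 + 2) \<le> p (l + 2)" unfolding p_def using l by (intro power_decreasing) auto
    thus "8 * ?H \<le> p (l + 2)" using small by simp
    show "real n * p l \<le> real (N l) * 2 ^ Lv l" using Lv l l0 by auto
    have "\<bar>dev g n y (indicator {t l..<t (Suc l)})\<bar> \<le> p l / 2"
      by (rule block_dev_small) (use good[of l l] l l0 in auto)
    thus "(\<Sum>i\<in>{1..n}. indicator {t l..<t (Suc l)} (y i)) / real n \<le> 2 * p l"
      unfolding empirical_block_mass using p_pos[of l] by linarith
  qed
  have sumI: "(\<Sum>l<Suc l0. I l) \<le> 32 * ?H"
  proof -
    have ii: "integrable lborel (\<lambda>x. indicator {t l..<t (Suc l)} x * (llr f x)\<^sup>2 * g x)" for l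
      using integrable_mult_indicator[of "{t l..<t (Suc l)}" lborel, OF _ llr_sq_integral(1)[OF f]] by (simp add: mult.assoc)
    have "(\<Sum>l<Suc l0. I l) = (LINT x|lborel. (\<Sum>l<Suc l0. indicator {t l..<t (Suc l)} x * (llr f x)\<^sup>2 * g x))"
      unfolding I_def by (rule Bochner_Integration.integral_sum[symmetric]) (rule ii)
    also have "\<dots> \<le> (LINT x|lborel. (llr f x)\<^sup>2 * g x)"
    proof (rule integral_mono)
      show "integrable lborel (\<lambda>x. \<Sum>l<Suc l0. indicator {t l..<t (Suc l)} x * (llr f x)\<^sup>2 * g x)"
        by (rule Bochner_Integration.integrable_sum) (rule ii)
      show "integrable lborel (\<lambda>x. (llr f x)\<^sup>2 * g x)" by (rule llr_sq_integral(1)[OF f])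
      fix x
      have "(\<Sum>l<Suc l0. indicator {t l..<t (Suc l)} x * (llr f x)\<^sup>2 * g x)
         = (\<Sum>l<Suc l0. indicator {t l..<t (Suc l)} x) * ((llr f x)\<^sup>2 * g x)"
        by (simp only: sum_distrib_right mult.assoc)
      also have "(\<Sum>l<Suc l0. indicator {t l..<t (Suc l)} x) = (indicator {t 0..<t (Suc l0)} x :: real)"
        by (rule sum_indicator_consecutive[OF mono])
      also have "\<dots> * ((llr f x)\<^sup>2 * g x) \<le> (llr f x)\<^sup>2 * g x"
        by (rule mult_left_le_one_le) (auto simp: indicator_def g_nonneg)
      finally show "(\<Sum>l<Suc l0. indicator {t l..<t (Suc l)} x * (llr f x)\<^sup>2 * g x) \<le> (llr f x)\<^sup>2 * g x" .
    qed
    also have "\<dots> \<le> 32 * ?H" by (rule llr_sq_integral(2)[OF f])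
    finally show ?thesis .
  qed
  have sum_main: "(\<Sum>l<Suc l0. D l) \<le> ?H / 64 + (\<Sum>l\<le>lmax. block_error n y \<kappa> N Lv l)"
  proof -
    have "(\<Sum>l<Suc l0. D l) \<le> (\<Sum>l<Suc l0. 10200 * (1/2^25) * I l + block_error n y \<kappa> N Lv l)"
      by (rule sum_mono) (use main in auto)
    also have "\<dots> = 10200 * (1/2^25) * (\<Sum>l<Suc l0. I l) + (\<Sum>l<Suc l0. block_error n y \<kappa> N Lv l)"
      by (simp only: sum.distrib sum_distrib_left)
    also have "\<dots> \<le> 10200 * (1/2^25) * (32 * ?H) + (\<Sum>l\<le>lmax. block_error n y \<kappa> N Lv l)"
    proof (intro add_mono mult_left_mono sumI)
      show "(\<Sum>l<Suc l0. block_error n y \<kappa> N Lv l) \<le> (\<Sum>l\<le>lmax. block_error n y \<kappa> N Lv l)"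
        by (rule sum_mono2) (use l0 block_error_nonneg[OF k] in auto)
    qed simp
    also have "10200 * (1/2^25) * (32 * ?H) \<le> ?H / 64" using H0 by simp
    finally show ?thesis by simp
  qed
  have sum_tail: "(\<Sum>j\<in>{1..m}. D (l0 + j)) \<le> ?H / 64" for m
  proof -
    let ?c = "(1/2::real) ^ l0"
    have "D (l0 + j) \<le> ?c * (1/2)^26 * ((2 * real j + 6) * (9/10) ^ j) + ?c * (1/2)^19 * ((2 * real j + 10) * (1/2) ^ j)"
      if j: "j \<in> {1..m}" for j
    proof -
      have "D (l0 + j) \<le> real M * (2 * real j + 6) * ((1/2)^44 * (1/2) ^ l0 * (9/10) ^ j) + (2 * p (l0 + j) / real M) * (2 * real j + 10)"
        unfolding D_def by (rule dev_tail_block[OF f small q0 n]) (use j good[of l0 "l0 + j"] l0 in auto)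
      also have "\<dots> = ?c * (1/2)^26 * ((2 * real j + 6) * (9/10) ^ j) + ?c * (1/2)^19 * ((2 * real j + 10) * (1/2) ^ j)"
      proof -
        have MM: "real M * (1/2)^44 = (1/2)^26" by (simp add: M_def power_divide)
        have "2 * p (l0 + j) = (1/2) * (?c * (1/2) ^ j)" by (simp add: p_def power_add)
        hence PP: "2 * p (l0 + j) / real M = ?c * (1/2)^19 * (1/2) ^ j" by (simp add: M_def power_divide[of 1 2 19])
        have "real M * (2 * real j + 6) * ((1/2)^44 * (1/2) ^ l0 * (9/10) ^ j)
           = ?c * (real M * (1/2)^44) * ((2 * real j + 6) * (9/10) ^ j)" by (simp only: mult.assoc mult.commute mult.left_commute)
        thus ?thesis unfolding MM PP by (simp only: mult.assoc mult.commute mult.left_commute)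
      qed
      finally show ?thesis .
    qed
    hence "(\<Sum>j\<in>{1..m}. D (l0 + j)) \<le> (\<Sum>j\<in>{1..m}. ?c * (1/2)^26 * ((2 * real j + 6) * (9/10) ^ j) + ?c * (1/2)^19 * ((2 * real j + 10) * (1/2) ^ j))"
      by (rule sum_mono)
    also have "\<dots> = ?c * (1/2)^26 * (\<Sum>j\<in>{1..m}. (2 * real j + 6) * (9/10) ^ j) + ?c * (1/2)^19 * (\<Sum>j\<in>{1..m}. (2 * real j + 10) * (1/2) ^ j)"
      by (simp only: sum.distrib sum_distrib_left)
    also have "\<dots> \<le> ?c * (1/2)^26 * 234 + ?c * (1/2)^19 * 14"
      by (intro add_mono mult_left_mono arith_geo_sums) auto
    also have "\<dots> = ?c * ((1/2)^26 * 234 + (1/2)^19 * 14)" by (simp only: distrib_left mult.assoc)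
    also have "\<dots> \<le> (256 * ?H) * ((1/2)^26 * 234 + (1/2)^19 * 14)" by (rule mult_right_mono[OF big]) simp
    also have "\<dots> \<le> ?H / 64" using H0 by (simp add: power_divide)
    finally show ?thesis .
  qed
  \<comment> \<open>Beyond all observations the empirical part vanishes and \<open>llr_ge\<close>
    bounds the true part by a tail mass. So the blocks are cut at a finite index, and
    \<open>m\<close> tends to infinity at the end.\<close>
  have "\<exists>l2. \<forall>i\<in>{1..n}. y i < t l2"
  proof -
    have "\<forall>i\<in>{1..n}. \<exists>l. y i < t l" using data exists_less_t by blast
    then obtain l where l: "\<forall>i\<in>{1..n}. y i < t (l i)" by (auto dest: bchoice)
    have "y i < t (Max (l ` {1..n}))" if i: "i \<in> {1..n}" for i
    proof -
      have "t (l i) \<le> t (Max (l ` {1..n}))" using i by (intro t_mono Max_ge) auto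
      thus ?thesis using l i by (meson less_le_trans)
    qed
    thus ?thesis by blast
  qed
  then obtain l2 where l2: "\<And>i. i \<in> {1..n} \<Longrightarrow> y i < t l2" by blast
  define X where "X = ?H / 32 + (\<Sum>l\<le>lmax. block_error n y \<kappa> N Lv l)"
  have fin: "dev g n y (\<lambda>x. indicator {0..} x * llr f x) \<le> X + (1/2) ^ m" if m: "l2 \<le> m" for m
  proof -
    define m' where "m' = Suc l0 + m"
    have int: "integrable lborel (\<lambda>x. indicator A x * llr f x * g x)" if "A \<in> sets borel" for A
      by (rule llr_set_integrable[OF f that])
    have e1: "(\<lambda>x. indicator {0..} x * llr f x) = (\<lambda>x. (\<Sum>l<m'. indicator {t l..<t (Suc l)} x * llr f x) + indicator {t m'..} x * llr f x)"
    proof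
      fix x
      have "(\<Sum>l<m'. indicator {t l..<t (Suc l)} x * llr f x) = (\<Sum>l<m'. indicator {t l..<t (Suc l)} x) * llr f x"
        by (simp only: sum_distrib_right)
      also have "(\<Sum>l<m'. indicator {t l..<t (Suc l)} x) = (indicator {t 0..<t m'} x :: real)"
        by (rule sum_indicator_consecutive[OF mono])
      finally show "indicator {0..} x * llr f x = (\<Sum>l<m'. indicator {t l..<t (Suc l)} x * llr f x) + indicator {t m'..} x * llr f x"
        using t_nonneg[of m'] by (auto simp: indicator_def t_0)
    qed
    have e2: "dev g n y (\<lambda>x. (\<Sum>l<m'. indicator {t l..<t (Suc l)} x * llr f x) + indicator {t m'..} x * llr f x)
      = dev g n y (\<lambda>x. \<Sum>l<m'. indicator {t l..<t (Suc l)} x * llr f x) + dev g n y (\<lambda>x. indicator {t m'..} x * llr f x)"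
    proof (rule dev_add)
      show "integrable lborel (\<lambda>x. (\<Sum>l<m'. indicator {t l..<t (Suc l)} x * llr f x) * g x)"
        unfolding sum_distrib_right by (intro Bochner_Integration.integrable_sum int) simp
    qed (rule int, simp)
    have e3: "dev g n y (\<lambda>x. \<Sum>l<m'. indicator {t l..<t (Suc l)} x * llr f x) = (\<Sum>l<m'. D l)"
      unfolding D_def by (rule dev_sum) (rule int, simp)
    have e4: "(\<Sum>l<m'. D l) = (\<Sum>l<Suc l0. D l) + (\<Sum>j\<in>{1..m}. D (l0 + j))"
      unfolding m'_def by (induction m) auto
    have e5: "dev g n y (\<lambda>x. indicator {t m'..} x * llr f x) \<le> (1/2) ^ m"
    proof -
      have S0: "(\<Sum>i\<in>{1..n}. indicator {t m'..} (y i) * llr f (y i)) = 0"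
      proof (rule sum.neutral, rule ballI)
        fix i assume "i \<in> {1..n}"
        moreover have "t l2 \<le> t m'" using m by (intro t_mono) (simp add: m'_def)
        ultimately have "y i < t m'" using l2 by (meson less_le_trans)
        thus "indicator {t m'..} (y i) * llr f (y i) = 0" by simp
      qed
      have I1: "- (2 * ln 2) * T (t m') \<le> (LINT x|lborel. indicator {t m'..} x * llr f x * g x)"
      proof -
        have ig: "integrable lborel (\<lambda>x. indicator {t m'..} x * g x)"
          using g_set_int[of "{t m'..}"] by (simp add: set_integrable_def)
        have "(LINT x|lborel. - (2 * ln 2) * (indicator {t m'..} x * g x)) \<le> (LINT x|lborel. indicator {t m'..} x * llr f x * g x)"
        proof (rule integral_mono)
          fix x
          have "- (2 * ln 2) * g x \<le> llr f x * g x" by (rule mult_right_mono[OF llr_ge[OF f] g_nonneg])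
          thus "- (2 * ln 2) * (indicator {t m'..} x * g x) \<le> indicator {t m'..} x * llr f x * g x"
            by (auto simp: indicator_def)
        qed (use ig int in auto)
        thus ?thesis by (simp add: T_def set_lebesgue_integral_def)
      qed
      moreover have "(2 * ln 2) * T (t m') \<le> 2 * T (t m')" using ln_2_less_1 T_nonneg by (intro mult_right_mono) auto
      moreover have "2 * T (t m') = (1/2) ^ m'" by (simp add: T_t)
      moreover have "(1/2::real) ^ m' \<le> (1/2) ^ m" by (rule power_decreasing) (auto simp: m'_def)
      moreover have "dev g n y (\<lambda>x. indicator {t m'..} x * llr f x) = - (LINT x|lborel. indicator {t m'..} x * llr f x * g x)"
        unfolding dev_def S0 by simp
      ultimately show ?thesis using I1 by linarith
    qed
    have "dev g n y (\<lambda>x. indicator {0..} x * llr f x)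
       = (\<Sum>l<Suc l0. D l) + (\<Sum>j\<in>{1..m}. D (l0 + j)) + dev g n y (\<lambda>x. indicator {t m'..} x * llr f x)"
      unfolding e1 e2 e3 e4 ..
    moreover have "a + b + c \<le> ?H / 32 + E + d" if "a \<le> ?H / 64 + E" "b \<le> ?H / 64" "c \<le> d" for a b c d E
      using that by simp
    ultimately show ?thesis using sum_main sum_tail[of m] e5 unfolding X_def by presburger
  qed
  have "(\<lambda>m. X + (1/2::real) ^ m) \<longlonglongrightarrow> X + 0" by (intro tendsto_intros LIMSEQ_power_zero) auto
  hence "dev g n y (\<lambda>x. indicator {0..} x * llr f x) \<le> X + 0"
    by (rule LIMSEQ_le_const) (use fin in blast)
  thus ?thesis by (simp add: X_def)
qed

end

section \<open>Good events\<close>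

lemma dev_measurable:
  assumes "iid_sample M Y g" "prob_space M" and [measurable]: "e \<in> borel_measurable borel"
  shows "(\<lambda>\<omega>. dev g n (\<lambda>i. Y i \<omega>) e) \<in> borel_measurable M"
proof -
  interpret prob_space M by fact
  have Y: "Y i \<in> borel_measurable M" if "1 \<le> i" for i
    using assms(1) that unfolding iid_sample_def indep_vars_def by auto
  have "(\<lambda>\<omega>. \<Sum>i\<in>{1..n}. e (Y i \<omega>)) \<in> borel_measurable M"
    by (intro borel_measurable_sum measurable_compose[OF Y]) auto
  thus ?thesis unfolding dev_def by measurable
qed

lemma (in prob_space) markov_fourth:
  assumes "integrable M (\<lambda>\<omega>. (Z \<omega>) ^ 4)" "0 < \<tau>" and [measurable]: "Z \<in> borel_measurable M"
  shows "prob {\<omega> \<in> space M. \<tau> < \<bar>Z \<omega>\<bar>} \<le> expectation (\<lambda>\<omega>. (Z \<omega>) ^ 4) / \<tau> ^ 4"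
proof -
  have "prob {\<omega> \<in> space M. \<tau> < \<bar>Z \<omega>\<bar>} \<le> prob {\<omega> \<in> space M. \<tau> ^ 4 \<le> (Z \<omega>) ^ 4}"
  proof (rule finite_measure_mono)
    show "{\<omega> \<in> space M. \<tau> < \<bar>Z \<omega>\<bar>} \<subseteq> {\<omega> \<in> space M. \<tau> ^ 4 \<le> (Z \<omega>) ^ 4}"
    proof safe
      fix \<omega> assume "\<tau> < \<bar>Z \<omega>\<bar>"
      hence "\<tau> ^ 4 \<le> \<bar>Z \<omega>\<bar> ^ 4" using assms(2) by (intro power_mono) auto
      thus "\<tau> ^ 4 \<le> (Z \<omega>) ^ 4" by (simp add: power_even_abs)
    qed
  qed measurable
  also have "\<dots> \<le> expectation (\<lambda>\<omega>. (Z \<omega>) ^ 4) / \<tau> ^ 4"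
    by (rule integral_Markov_inequality_measure[where A = "{}"]) (use assms in auto)
  finally show ?thesis .
qed

locale slc_sample = symmetric_log_concave g + prob_space \<Omega>
  for g :: "real \<Rightarrow> real" and \<Omega> :: "'w measure" +
  fixes Y :: "nat \<Rightarrow> 'w \<Rightarrow> real"
  assumes iid: "iid_sample \<Omega> Y g"
begin

abbreviation smp :: "'w \<Rightarrow> nat \<Rightarrow> real" where "smp \<omega> \<equiv> \<lambda>i. Y i \<omega>"

lemma dev_meas[measurable]: "e \<in> borel_measurable borel \<Longrightarrow> (\<lambda>\<omega>. dev g n (smp \<omega>) e) \<in> borel_measurable \<Omega>"
  by (rule dev_measurable[OF iid prob_space_axioms])

lemma dev4_interval:
  assumes n: "1 \<le> n" and [measurable]: "e \<in> borel_measurable borel" and e: "\<And>x. \<bar>e x\<bar> \<le> indicator {a..<b} x"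
    and q: "(LINT x:{a..<b}|lborel. g x) \<le> r"
  shows "integrable \<Omega> (\<lambda>\<omega>. (dev g n (smp \<omega>) e) ^ 4)"
    "expectation (\<lambda>\<omega>. (dev g n (smp \<omega>) e) ^ 4) \<le> 3 * r\<^sup>2 / (real n)\<^sup>2 + 4 * r / (real n) ^ 3"
proof -
  have e1: "\<bar>e x\<bar> \<le> 1" for x using e[of x] by (cases "x \<in> {a..<b}") auto
  have "(LINT x|lborel. \<bar>e x\<bar> * g x) \<le> (LINT x|lborel. indicator {a..<b} x * g x)"
  proof (rule integral_mono)
    show "integrable lborel (\<lambda>x. \<bar>e x\<bar> * g x)"
      by (rule integrable_mult_density[OF dens, of _ 1]) (use e1 in auto)
    show "integrable lborel (\<lambda>x. indicator {a..<b} x * g x)"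
      by (rule integrable_mult_density[OF dens, of _ 1]) (auto simp: indicator_def)
    show "\<bar>e x\<bar> * g x \<le> indicator {a..<b} x * g x" for x by (rule mult_right_mono[OF e g_nonneg])
  qed
  hence r: "(LINT x|lborel. \<bar>e x\<bar> * g x) \<le> r" using q by (simp add: set_lebesgue_integral_def)
  show "integrable \<Omega> (\<lambda>\<omega>. (dev g n (smp \<omega>) e) ^ 4)"
    "expectation (\<lambda>\<omega>. (dev g n (smp \<omega>) e) ^ 4) \<le> 3 * r\<^sup>2 / (real n)\<^sup>2 + 4 * r / (real n) ^ 3"
    by (rule fourth_moment_dev[OF dens iid _ e1 r n], simp)+
qed

lemma cell_dev4_moment:
  assumes n: "1 \<le> n" and ab: "a < b" and q: "(LINT x:{a..<b}|lborel. g x) \<le> r"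
  shows "integrable \<Omega> (\<lambda>\<omega>. cell_dev g n (smp \<omega>) a b ^ 4)"
    "expectation (\<lambda>\<omega>. cell_dev g n (smp \<omega>) a b ^ 4) \<le> 16 * (3 * r\<^sup>2 / (real n)\<^sup>2 + 4 * r / (real n) ^ 3)"
proof -
  define A where "A = (\<lambda>\<omega>. dev g n (smp \<omega>) (indicator {a..<b}))"
  define B where "B = (\<lambda>\<omega>. dev g n (smp \<omega>) (cell_e1 a b))"
  have [measurable]: "A \<in> borel_measurable \<Omega>" "B \<in> borel_measurable \<Omega>" unfolding A_def B_def by (rule dev_meas; simp)+
  have mA: "integrable \<Omega> (\<lambda>\<omega>. A \<omega> ^ 4)" "expectation (\<lambda>\<omega>. A \<omega> ^ 4) \<le> 3 * r\<^sup>2 / (real n)\<^sup>2 + 4 * r / (real n) ^ 3"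
    unfolding A_def by (rule dev4_interval[OF n _ _ q]; simp)+
  have mB: "integrable \<Omega> (\<lambda>\<omega>. B \<omega> ^ 4)" "expectation (\<lambda>\<omega>. B \<omega> ^ 4) \<le> 3 * r\<^sup>2 / (real n)\<^sup>2 + 4 * r / (real n) ^ 3"
    unfolding B_def by (rule dev4_interval[OF n _ abs_cell_e1_le q]; simp)+
  have pt: "cell_dev g n (smp \<omega>) a b ^ 4 \<le> 8 * (A \<omega> ^ 4 + B \<omega> ^ 4)" for \<omega>
  proof -
    have sq: "(u + v)\<^sup>2 \<le> 2 * (u\<^sup>2 + v\<^sup>2)" for u v :: real
    proof -
      have "0 \<le> (u - v)\<^sup>2" by simp
      thus ?thesis by (simp add: power2_sum power2_diff)
    qed
    have "(\<bar>A \<omega>\<bar> + \<bar>B \<omega>\<bar>) ^ 4 = ((\<bar>A \<omega>\<bar> + \<bar>B \<omega>\<bar>)\<^sup>2)\<^sup>2" by simp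
    also have "\<dots> \<le> (2 * (\<bar>A \<omega>\<bar>\<^sup>2 + \<bar>B \<omega>\<bar>\<^sup>2))\<^sup>2" by (rule power_mono[OF sq]) simp
    also have "\<dots> = 4 * (\<bar>A \<omega>\<bar>\<^sup>2 + \<bar>B \<omega>\<bar>\<^sup>2)\<^sup>2" by (simp only: power_mult_distrib) simp
    also have "\<dots> \<le> 4 * (2 * ((\<bar>A \<omega>\<bar>\<^sup>2)\<^sup>2 + (\<bar>B \<omega>\<bar>\<^sup>2)\<^sup>2))" by (rule mult_left_mono[OF sq]) simp
    also have "\<dots> = 8 * (A \<omega> ^ 4 + B \<omega> ^ 4)" by (simp flip: power_mult)
    finally show ?thesis by (simp add: cell_dev_def A_def B_def)
  qed
  show int: "integrable \<Omega> (\<lambda>\<omega>. cell_dev g n (smp \<omega>) a b ^ 4)"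
  proof (rule Bochner_Integration.integrable_bound)
    show "integrable \<Omega> (\<lambda>\<omega>. 8 * (A \<omega> ^ 4 + B \<omega> ^ 4))" using mA mB by simp
    have e: "(\<lambda>\<omega>. cell_dev g n (smp \<omega>) a b ^ 4) = (\<lambda>\<omega>. (\<bar>A \<omega>\<bar> + \<bar>B \<omega>\<bar>) ^ 4)"
      by (simp add: cell_dev_def A_def B_def)
    show "(\<lambda>\<omega>. cell_dev g n (smp \<omega>) a b ^ 4) \<in> borel_measurable \<Omega>" unfolding e by measurable
    show "AE \<omega> in \<Omega>. norm (cell_dev g n (smp \<omega>) a b ^ 4) \<le> norm (8 * (A \<omega> ^ 4 + B \<omega> ^ 4))"
      by (rule AE_I2) (use pt in simp)
  qed
  have "expectation (\<lambda>\<omega>. cell_dev g n (smp \<omega>) a b ^ 4) \<le> expectation (\<lambda>\<omega>. 8 * (A \<omega> ^ 4 + B \<omega> ^ 4))"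
    by (rule integral_mono) (use int mA mB pt in auto)
  also have "\<dots> = 8 * (expectation (\<lambda>\<omega>. A \<omega> ^ 4) + expectation (\<lambda>\<omega>. B \<omega> ^ 4))" using mA mB by simp
  also have "\<dots> \<le> 16 * (3 * r\<^sup>2 / (real n)\<^sup>2 + 4 * r / (real n) ^ 3)" using mA mB by simp
  finally show "expectation (\<lambda>\<omega>. cell_dev g n (smp \<omega>) a b ^ 4) \<le> 16 * (3 * r\<^sup>2 / (real n)\<^sup>2 + 4 * r / (real n) ^ 3)" .
qed

section \<open>Exceptional events for the tail blocks\<close>

text \<open>\<open>l'\<close> is a candidate for the cut block, \<open>j\<close> the distance from
  it. The threshold falls by 9/10 per block: since (9/10)^4 > 1/2, the fourth-moment bounds are
  summable over infinitely many blocks, and the thresholds remain summable against the linear growth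
  in \<open>dev_tail_block\<close>.\<close>

definition tail_bad :: "nat \<Rightarrow> nat \<Rightarrow> nat \<Rightarrow> nat \<Rightarrow> 'w set" where
  "tail_bad n l' j k = {\<omega> \<in> space \<Omega>. (1/2)^44 * (1/2) ^ l' * (9/10) ^ j < \<bar>dev g n (smp \<omega>) (indicator (piece (l' + j) k))\<bar>}"

lemma tail_bad_sets[measurable]: "tail_bad n l' j k \<in> sets \<Omega>"
proof -
  have [measurable]: "(\<lambda>\<omega>. dev g n (smp \<omega>) (indicator (piece (l' + j) k))) \<in> borel_measurable \<Omega>" by (rule dev_meas) simp
  show ?thesis unfolding tail_bad_def by measurable
qed

text \<open>Markov's inequality for the fourth power with mass at most 2^(-(l'+j)); 176 = 4 * 44,
  and (1/2) / (9/10)^4 \<le> 4/5.\<close>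

lemma prob_tail_bad:
  assumes n: "1 \<le> n" and k: "k < M"
  shows "prob (tail_bad n l' j k) \<le> 2 ^ 176 * (3 * 4 ^ l' / (real n)\<^sup>2 + 4 * 8 ^ l' / (real n) ^ 3) * (4/5) ^ j"
proof -
  let ?l = "l' + j"
  define r where "r = (1/2::real) ^ ?l"
  have "(LINT x:piece ?l k|lborel. g x) \<le> 2 * p ?l / real M" by (rule piece_mass[OF k])
  also have "\<dots> \<le> 2 * p ?l / 1" using M_pos p_pos[of ?l] by (intro divide_left_mono) auto
  also have "\<dots> \<le> r" by (simp add: p_def r_def)
  finally have q: "(LINT x:piece ?l k|lborel. g x) \<le> r" .
  define \<tau> where "\<tau> = (1/2)^44 * (1/2) ^ l' * (9/10::real) ^ j"
  have tp: "0 < \<tau>" by (simp add: \<tau>_def)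
  have mo: "integrable \<Omega> (\<lambda>\<omega>. (dev g n (smp \<omega>) (indicator (piece ?l k))) ^ 4)"
    "expectation (\<lambda>\<omega>. (dev g n (smp \<omega>) (indicator (piece ?l k))) ^ 4) \<le> 3 * r\<^sup>2 / (real n)\<^sup>2 + 4 * r / (real n) ^ 3"
    unfolding piece_def by (rule dev4_interval[OF n _ _ q[unfolded piece_def]]; simp)+
  have "prob (tail_bad n l' j k) \<le> expectation (\<lambda>\<omega>. (dev g n (smp \<omega>) (indicator (piece ?l k))) ^ 4) / \<tau> ^ 4"
    unfolding tail_bad_def \<tau>_def[symmetric] by (rule markov_fourth[OF mo(1) tp]) (rule dev_meas, simp)
  also have "\<dots> \<le> (3 * r\<^sup>2 / (real n)\<^sup>2 + 4 * r / (real n) ^ 3) / \<tau> ^ 4"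
    using mo(2) tp by (intro divide_right_mono) auto
  also have "\<dots> = 3 / (real n)\<^sup>2 * (r\<^sup>2 / \<tau> ^ 4) + 4 / (real n) ^ 3 * (r / \<tau> ^ 4)" by (simp add: add_divide_distrib)
  also have "\<dots> \<le> 3 / (real n)\<^sup>2 * (2 ^ 176 * 4 ^ l' * (4/5) ^ j) + 4 / (real n) ^ 3 * (2 ^ 176 * 8 ^ l' * (4/5) ^ j)"
  proof (intro add_mono mult_left_mono)
    have pwc: "(a ^ m) ^ i = (a ^ i) ^ m" for a :: real and m i :: nat
      unfolding power_mult[symmetric] by (simp only: mult.commute)
    have t4: "\<tau> ^ 4 = (1/2)^176 * ((1/16) ^ l' * (6561/10000) ^ j)"
    proof -
      have "((1/2::real) ^ l') ^ 4 = (1/16) ^ l'" "((9/10::real) ^ j) ^ 4 = (6561/10000) ^ j"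
        "((1/2::real) ^ 44) ^ 4 = (1/2)^176"
        unfolding pwc[of _ _ 4] by (simp_all add: power_divide)
      thus ?thesis unfolding \<tau>_def power_mult_distrib by simp
    qed
    have pw: "u ^ j / (6561/10000) ^ j \<le> (4/5 :: real) ^ j" if "0 \<le> u" "u \<le> 1/2" for u :: real
      unfolding power_divide[symmetric] using that by (intro power_mono) auto
    have "r\<^sup>2 = (1/4) ^ l' * (1/4) ^ j" unfolding r_def power_add power_mult_distrib
      pwc[of _ _ 2] by (simp add: power_divide)
    hence "r\<^sup>2 / \<tau> ^ 4 = 2 ^ 176 * ((1/4) ^ l' / (1/16) ^ l') * ((1/4) ^ j / (6561/10000) ^ j)"
      unfolding t4 by (simp add: power_one_over)
    also have "(1/4) ^ l' / (1/16) ^ l' = (4::real) ^ l'" by (simp flip: power_divide)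
    also have "2 ^ 176 * 4 ^ l' * ((1/4) ^ j / (6561/10000) ^ j) \<le> 2 ^ 176 * 4 ^ l' * (4/5 :: real) ^ j"
      by (intro mult_left_mono pw) auto
    finally show "r\<^sup>2 / \<tau> ^ 4 \<le> 2 ^ 176 * 4 ^ l' * (4/5) ^ j" .
    have "r / \<tau> ^ 4 = 2 ^ 176 * ((1/2) ^ l' / (1/16) ^ l') * ((1/2) ^ j / (6561/10000) ^ j)"
      unfolding t4 r_def power_add by (simp add: power_one_over)
    also have "(1/2) ^ l' / (1/16) ^ l' = (8::real) ^ l'" by (simp flip: power_divide)
    also have "2 ^ 176 * 8 ^ l' * ((1/2) ^ j / (6561/10000) ^ j) \<le> 2 ^ 176 * 8 ^ l' * (4/5 :: real) ^ j"
      by (intro mult_left_mono pw) auto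
    finally show "r / \<tau> ^ 4 \<le> 2 ^ 176 * 8 ^ l' * (4/5) ^ j" .
  qed auto
  also have "\<dots> = 2 ^ 176 * (3 * 4 ^ l' / (real n)\<^sup>2 + 4 * 8 ^ l' / (real n) ^ 3) * (4/5) ^ j"
    by (simp add: algebra_simps)
  finally show ?thesis .
qed

text \<open>The series over \<open>j\<close> contributes 5 = 1 / (1 - 4/5), and 5 * 2^18 \<le> 2^21,
  so 197 = 176 + 21. The factors 4^l' and 8^l' grow, which is why the number of candidate levels
  must be limited.\<close>

lemma prob_tail_bad_union:
  assumes n: "1 \<le> n"
  shows "prob (\<Union>l'\<le>lmax. \<Union>j. \<Union>k<M. tail_bad n l' j k)
    \<le> (\<Sum>l'\<le>lmax. 2 ^ 197 * (3 * 4 ^ l' / (real n)\<^sup>2 + 4 * 8 ^ l' / (real n) ^ 3))"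
proof -
  define c where "c = (\<lambda>l'. 2 ^ 176 * (3 * 4 ^ l' / (real n)\<^sup>2 + 4 * 8 ^ l' / (real n) ^ 3))"
  have c0: "0 \<le> c l'" for l' by (simp add: c_def)
  have 1: "prob (\<Union>k<M. tail_bad n l' j k) \<le> real M * (c l' * (4/5) ^ j)" for l' j
  proof -
    have "prob (\<Union>k<M. tail_bad n l' j k) \<le> (\<Sum>k<M. prob (tail_bad n l' j k))"
      by (rule finite_measure_subadditive_finite) auto
    also have "\<dots> \<le> (\<Sum>k<M. c l' * (4/5) ^ j)" by (rule sum_mono) (use prob_tail_bad[OF n] in \<open>auto simp: c_def\<close>)
    finally show ?thesis by simp
  qed
  have 2: "prob (\<Union>j. \<Union>k<M. tail_bad n l' j k) \<le> 2 ^ 21 * c l'" for l'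
  proof -
    have gs: "(\<lambda>j. real M * (c l' * (4/5) ^ j)) sums (real M * (c l' * (1 / (1 - 4/5))))"
      by (intro sums_mult geometric_sums) auto
    have sm: "summable (\<lambda>j. prob (\<Union>k<M. tail_bad n l' j k))"
      by (rule summable_comparison_test'[OF sums_summable[OF gs], of 0]) (use 1 in auto)
    have "prob (\<Union>j. \<Union>k<M. tail_bad n l' j k) \<le> (\<Sum>j. prob (\<Union>k<M. tail_bad n l' j k))"
      by (rule finite_measure_subadditive_countably) (use sm in auto)
    also have "\<dots> \<le> (\<Sum>j. real M * (c l' * (4/5) ^ j))" by (rule suminf_le[OF 1 sm sums_summable[OF gs]])
    also have "\<dots> = real M * (c l' * 5)" using gs by (simp add: sums_iff)
    also have "\<dots> \<le> 2 ^ 21 * c l'" using c0[of l'] by (simp add: M_def)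
    finally show ?thesis .
  qed
  have "prob (\<Union>l'\<le>lmax. \<Union>j. \<Union>k<M. tail_bad n l' j k) \<le> (\<Sum>l'\<le>lmax. prob (\<Union>j. \<Union>k<M. tail_bad n l' j k))"
    by (rule finite_measure_subadditive_finite) auto
  also have "\<dots> \<le> (\<Sum>l'\<le>lmax. 2 ^ 21 * c l')" by (rule sum_mono) (rule 2)
  also have "\<dots> = (\<Sum>l'\<le>lmax. 2 ^ 197 * (3 * 4 ^ l' / (real n)\<^sup>2 + 4 * 8 ^ l' / (real n) ^ 3))" by (simp add: c_def)
  finally show ?thesis .
qed

end

section \<open>Choice of the mesh and the good event\<close>

context slc_sample
begin

context
  fixes n :: nat and \<nu> \<kappa> :: real and lmax :: nat
  assumes n: "1 \<le> n" and \<nu>: "0 < \<nu>" "\<nu> ^ 5 = real n" and \<kappa>: "1 \<le> \<kappa>" and lmax: "2 ^ lmax * \<kappa> \<le> \<nu> ^ 4"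
begin

text \<open>About n^(1/5) base cells in the central block and fewer outwards. The ratio 9/10 keeps
  the total number of cells \<open>O(\<nu>)\<close>, and (1/2) / (9/10)^3 < 1 makes the terms
  \<open>sqrt (p / NN^3)\<close> summable.\<close>

definition NN :: "nat \<Rightarrow> nat" where "NN l = nat \<lceil>\<nu> * (9/10) ^ l\<rceil>"
text \<open>The first level whose residual over the block is O(1/n). Being the first, it does not
  make the cells too small; see \<open>LL_le\<close>.\<close>

definition LL :: "nat \<Rightarrow> nat" where "LL l = (LEAST L. real n * p l \<le> real (NN l) * 2 ^ L)"

lemma nu_ge_1: "1 \<le> \<nu>"
proof (rule ccontr)
  assume "\<not> 1 \<le> \<nu>"
  hence "\<nu> ^ 5 < 1" using \<nu>(1) by (simp add: power_less_one_iff)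
  thus False using n \<nu>(2) by simp
qed

lemma NN_pos: "1 \<le> NN l" 
proof -
  have "0 < \<lceil>\<nu> * (9/10) ^ l\<rceil>" using \<nu>(1) by simp
  thus ?thesis by (simp add: NN_def Suc_le_eq)
qed

lemma NN_bounds: "\<nu> * (9/10) ^ l \<le> real (NN l)" "real (NN l) \<le> \<nu> * (9/10) ^ l + 1"
proof -
  have "0 \<le> \<nu> * (9/10) ^ l" using \<nu>(1) by simp
  thus "\<nu> * (9/10) ^ l \<le> real (NN l)" "real (NN l) \<le> \<nu> * (9/10) ^ l + 1"
    unfolding NN_def using ceiling_correct[of "\<nu> * (9/10) ^ l"] by (auto simp: of_nat_nat)
qed

lemma LL_ge: "real n * p l \<le> real (NN l) * 2 ^ LL l"
proof -
  obtain L :: nat where "real n * p l < 2 ^ L" using real_arch_pow[of 2] by auto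
  also have "(2::real) ^ L \<le> real (NN l) * 2 ^ L" using NN_pos[of l] by simp
  finally have "\<exists>L. real n * p l \<le> real (NN l) * 2 ^ L" using less_imp_le by blast
  thus ?thesis unfolding LL_def by (rule LeastI_ex)
qed

text \<open>At every level in use a cell expects at least 1/8 of an observation in the sense of
  \<open>n * p\<close> per cell, so that the Poissonian part of the fourth moment is absorbed by the
  Gaussian part. If level 0 already suffices, \<open>lmax\<close> gives
  \<open>\<nu> * 2^l \<le> n\<close> in place of minimality.\<close>

lemma LL_le:
  assumes l: "l \<le> lmax" and i: "i \<le> LL l"
  shows "real (NN l) * 2 ^ i \<le> 8 * (real n * p l)"
proof (cases "LL l")
  case 0
  have "2 ^ l * 1 \<le> 2 ^ lmax * \<kappa>" using l \<kappa> by (intro mult_mono power_increasing) auto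
  hence "(2::real) ^ l \<le> \<nu> ^ 4" using lmax by linarith
  hence "\<nu> * 2 ^ l \<le> \<nu> * \<nu> ^ 4" using \<nu> by (intro mult_left_mono) auto
  hence "\<nu> * 2 ^ l \<le> real n" using \<nu>(2) by (simp add: power_numeral_reduce)
  hence "\<nu> \<le> real n / 2 ^ l" by (simp add: field_simps)
  hence "\<nu> \<le> 4 * (real n * p l)" by (simp add: p_def power_one_over)
  moreover have "\<nu> * (9/10) ^ l \<le> \<nu> * 1" using \<nu> by (intro mult_left_mono power_le_one) auto
  hence "real (NN l) \<le> 2 * \<nu>" using NN_bounds(2)[of l] nu_ge_1 by linarith
  ultimately show ?thesis using 0 i by simp
next
  case (Suc L')
  hence "L' < LL l" by simp
  hence "\<not> real n * p l \<le> real (NN l) * 2 ^ L'" unfolding LL_def by (rule not_less_Least)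
  hence "real (NN l) * 2 ^ Suc L' \<le> 2 * (real n * p l)" by simp
  moreover have "real (NN l) * 2 ^ i \<le> real (NN l) * 2 ^ Suc L'" using i Suc by (intro mult_left_mono power_increasing) auto
  moreover have "0 \<le> real n * p l" using p_pos[of l] by simp
  ultimately show ?thesis by linarith
qed

lemma lmax_le: "real lmax + 1 \<le> 8 * \<nu>"
proof -
  have "2 ^ lmax * 1 \<le> 2 ^ lmax * \<kappa>" using \<kappa> by (intro mult_left_mono) auto
  hence "(2::real) ^ lmax \<le> \<nu> ^ 4" using lmax by linarith
  hence "ln ((2::real) ^ lmax) \<le> ln (\<nu> ^ 4)" by (intro ln_mono) auto
  hence "real lmax * ln 2 \<le> 4 * ln \<nu>" using \<nu> by (simp add: ln_realpow)
  moreover have "ln \<nu> \<le> \<nu> - 1" using \<nu> by (intro ln_le_minus_one) auto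
  moreover have "real lmax * (1/2) \<le> real lmax * ln 2" using ln2_ge_two_thirds by (intro mult_left_mono) auto
  ultimately show ?thesis by linarith
qed

text \<open>18 = 10 + 8: a geometric series, and one unit of rounding per block, counted by
  \<open>lmax_le\<close>.\<close>

lemma sum_NN: "(\<Sum>l\<le>lmax. real (NN l)) \<le> 18 * \<nu>"
proof -
  have "(\<Sum>l\<le>lmax. real (NN l)) \<le> (\<Sum>l\<le>lmax. \<nu> * (9/10) ^ l + 1)" by (rule sum_mono) (rule NN_bounds(2))
  also have "\<dots> = \<nu> * (\<Sum>l\<le>lmax. (9/10) ^ l) + (real lmax + 1)" by (simp add: sum.distrib sum_distrib_left)
  also have "(\<Sum>l\<le>lmax. (9/10) ^ l) \<le> (10::real)"
  proof -
    have "(\<Sum>l\<le>lmax. (9/10) ^ l) = 10 * (1 - (9/10 :: real) ^ Suc lmax)" by (induction lmax) auto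
    thus ?thesis by simp
  qed
  finally show ?thesis using lmax_le \<nu> by (simp add: mult_left_mono)
qed

text \<open>The \<open>NN l * 2^i\<close> cells of level \<open>i\<close> have summed fourth moments
  proportional to 2^(-i); against the weight (32/27)^i there remains (16/27)^i. The constants are
  1216 = 16 * (12 + 64), 304 = 1216 / 4, and 304 * 3 < 2^10.\<close>

lemma remainder_moment:
  assumes l: "l \<le> lmax"
  shows "integrable \<Omega> (\<lambda>\<omega>. remainder n (smp \<omega>) \<kappa> NN LL l)"
    "expectation (\<lambda>\<omega>. remainder n (smp \<omega>) \<kappa> NN LL l) \<le> 2 ^ 35 * (real (NN l) / (\<kappa> * real n))"
proof -
  let ?N = "real (NN l)"
  have Np: "0 < ?N" using NN_pos[of l] by simp
  have np: "0 < real n" and pp: "0 < p l" and kp: "0 < \<kappa>" using n p_pos \<kappa> by auto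
  have cell: "integrable \<Omega> (\<lambda>\<omega>. cell_dev4 n (smp \<omega>) (NN l * 2 ^ i) l k) \<and>
     expectation (\<lambda>\<omega>. cell_dev4 n (smp \<omega>) (NN l * 2 ^ i) l k) \<le> 1216 * (p l / (?N * 2 ^ i))\<^sup>2 / (real n)\<^sup>2"
    if i: "i \<le> LL l" and k: "k < NN l * 2 ^ i" for i k
  proof -
    define m where "m = real (NN l * 2 ^ i)"
    have mp: "0 < m" using Np by (simp add: m_def)
    define \<rho> where "\<rho> = p l / m"
    have \<rho>: "0 < \<rho>" "1 \<le> 8 * (real n * \<rho>)"
      using LL_le[OF l i] mp pp by (auto simp: \<rho>_def m_def field_simps)
    define a b where "a = t l + real k * (lam l / m)" and "b = t l + real (Suc k) * (lam l / m)"
    have lm: "0 < lam l / m" using lam_pos[of l] mp by simp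
    have ba: "b - a = lam l / m" by (simp add: a_def b_def algebra_simps add_divide_distrib)
    have at: "t l \<le> a" using mult_nonneg_nonneg[of "real k" "lam l / m"] lm unfolding a_def by linarith
    have bt: "b \<le> t (Suc l)"
    proof -
      have "real (Suc k) \<le> m" using k unfolding m_def of_nat_le_iff by simp
      hence "real (Suc k) * (lam l / m) \<le> m * (lam l / m)" using lm by (intro mult_right_mono) auto
      thus ?thesis using mp by (simp add: b_def lam_def)
    qed
    have "(LINT x:{a..<b}|lborel. g x) \<le> q l * (b - a)"
      by (rule set_integral_bounds_const(2)) (use ba lm at bt g_block[of l] in \<open>auto intro!: g_set_int\<close>)
    also have "\<dots> = q l * lam l / m" unfolding ba by simp
    also have "\<dots> \<le> 2 * p l / m" using q_lam_le[of l] mp by (intro divide_right_mono) auto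
    finally have q: "(LINT x:{a..<b}|lborel. g x) \<le> 2 * \<rho>" by (simp add: \<rho>_def)
    have ab: "a < b" using ba lm by linarith
    note mo = cell_dev4_moment[OF n ab q]
    have e: "cell_dev4 n (smp \<omega>) (NN l * 2 ^ i) l k = cell_dev g n (smp \<omega>) a b ^ 4" for \<omega>
      by (simp add: cell_dev4_def a_def b_def m_def)
    have "4 * (2 * \<rho>) / (real n) ^ 3 \<le> 64 * \<rho>\<^sup>2 / (real n)\<^sup>2"
    proof -
      have "8 * \<rho> * 1 \<le> 8 * \<rho> * (8 * (real n * \<rho>))" using \<rho> by (intro mult_left_mono) auto
      hence "8 * \<rho> / (real n) ^ 3 \<le> 8 * \<rho> * (8 * (real n * \<rho>)) / (real n) ^ 3" by (intro divide_right_mono) auto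
      also have "\<dots> = 64 * \<rho>\<^sup>2 / (real n)\<^sup>2" using np by (simp add: power2_eq_square power3_eq_cube)
      finally show ?thesis by simp
    qed
    hence "16 * (3 * (2 * \<rho>)\<^sup>2 / (real n)\<^sup>2 + 4 * (2 * \<rho>) / (real n) ^ 3) \<le> 16 * (12 * \<rho>\<^sup>2 / (real n)\<^sup>2 + 64 * \<rho>\<^sup>2 / (real n)\<^sup>2)"
      by (intro mult_left_mono add_mono) (auto simp: power_mult_distrib)
    also have "\<dots> = 1216 * \<rho>\<^sup>2 / (real n)\<^sup>2" by (simp add: add_divide_distrib[symmetric])
    finally show ?thesis using mo unfolding e \<rho>_def m_def by simp
  qed
  define c where "c = (\<lambda>i::nat. real n * ?N\<^sup>2 / (4 * (1/2^25) * \<kappa> * (p l)\<^sup>2) * (32/27) ^ i)"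
  have c0: "0 \<le> c i" for i using kp by (simp add: c_def)
  show "integrable \<Omega> (\<lambda>\<omega>. remainder n (smp \<omega>) \<kappa> NN LL l)" unfolding remainder_def
    by (intro Bochner_Integration.integrable_sum integrable_mult_right) (use cell in auto)
  have "expectation (\<lambda>\<omega>. remainder n (smp \<omega>) \<kappa> NN LL l)
     = (\<Sum>i\<le>LL l. c i * (\<Sum>k<NN l * 2 ^ i. expectation (\<lambda>\<omega>. cell_dev4 n (smp \<omega>) (NN l * 2 ^ i) l k)))"
  proof -
    have int: "integrable \<Omega> (\<lambda>\<omega>. c i * (\<Sum>k<NN l * 2 ^ i. cell_dev4 n (smp \<omega>) (NN l * 2 ^ i) l k))" if "i \<le> LL l" for i
      by (intro Bochner_Integration.integrable_sum integrable_mult_right) (use cell that in auto)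
    have "expectation (\<lambda>\<omega>. remainder n (smp \<omega>) \<kappa> NN LL l)
      = expectation (\<lambda>\<omega>. \<Sum>i\<le>LL l. c i * (\<Sum>k<NN l * 2 ^ i. cell_dev4 n (smp \<omega>) (NN l * 2 ^ i) l k))"
      unfolding remainder_def c_def ..
    also have "\<dots> = (\<Sum>i\<le>LL l. expectation (\<lambda>\<omega>. c i * (\<Sum>k<NN l * 2 ^ i. cell_dev4 n (smp \<omega>) (NN l * 2 ^ i) l k)))"
      by (rule Bochner_Integration.integral_sum) (use int in auto)
    also have "\<dots> = (\<Sum>i\<le>LL l. c i * (\<Sum>k<NN l * 2 ^ i. expectation (\<lambda>\<omega>. cell_dev4 n (smp \<omega>) (NN l * 2 ^ i) l k)))"
    proof (rule sum.cong[OF refl])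
      fix i assume "i \<in> {..LL l}"
      hence i: "i \<le> LL l" by simp
      have "expectation (\<lambda>\<omega>. \<Sum>k<NN l * 2 ^ i. cell_dev4 n (smp \<omega>) (NN l * 2 ^ i) l k)
        = (\<Sum>k<NN l * 2 ^ i. expectation (\<lambda>\<omega>. cell_dev4 n (smp \<omega>) (NN l * 2 ^ i) l k))"
        by (rule Bochner_Integration.integral_sum) (use cell[OF i] in auto)
      thus "expectation (\<lambda>\<omega>. c i * (\<Sum>k<NN l * 2 ^ i. cell_dev4 n (smp \<omega>) (NN l * 2 ^ i) l k))
        = c i * (\<Sum>k<NN l * 2 ^ i. expectation (\<lambda>\<omega>. cell_dev4 n (smp \<omega>) (NN l * 2 ^ i) l k))"
        by (simp only: integral_mult_right_zero)
    qed
    finally show ?thesis .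
  qed
  also have "\<dots> \<le> (\<Sum>i\<le>LL l. 304 * 2 ^ 25 * (?N / (\<kappa> * real n)) * (16/27) ^ i)"
  proof (rule sum_mono)
    fix i assume "i \<in> {..LL l}"
    hence i: "i \<le> LL l" by simp
    have "(\<Sum>k<NN l * 2 ^ i. expectation (\<lambda>\<omega>. cell_dev4 n (smp \<omega>) (NN l * 2 ^ i) l k))
       \<le> (\<Sum>k<NN l * 2 ^ i. 1216 * (p l / (?N * 2 ^ i))\<^sup>2 / (real n)\<^sup>2)"
      by (rule sum_mono) (use cell[OF i] in auto)
    also have "\<dots> = ?N * 2 ^ i * (1216 * (p l / (?N * 2 ^ i))\<^sup>2 / (real n)\<^sup>2)" by simp
    finally have "c i * (\<Sum>k<NN l * 2 ^ i. expectation (\<lambda>\<omega>. cell_dev4 n (smp \<omega>) (NN l * 2 ^ i) l k))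
       \<le> c i * (?N * 2 ^ i * (1216 * (p l / (?N * 2 ^ i))\<^sup>2 / (real n)\<^sup>2))" by (rule mult_left_mono[OF _ c0])
    also have "\<dots> = 304 * 2 ^ 25 * (?N / (\<kappa> * real n)) * ((32/27) ^ i / 2 ^ i)"
      unfolding c_def using Np np pp kp by (simp add: field_simps power2_eq_square)
    also have "(32/27) ^ i / 2 ^ i = (16/27 :: real) ^ i" by (simp flip: power_divide)
    finally show "c i * (\<Sum>k<NN l * 2 ^ i. expectation (\<lambda>\<omega>. cell_dev4 n (smp \<omega>) (NN l * 2 ^ i) l k))
       \<le> 304 * 2 ^ 25 * (?N / (\<kappa> * real n)) * (16/27) ^ i" .
  qed
  also have "\<dots> = 304 * 2 ^ 25 * (?N / (\<kappa> * real n)) * (\<Sum>i\<le>LL l. (16/27) ^ i)" by (simp only: sum_distrib_left)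
  also have "\<dots> \<le> 304 * 2 ^ 25 * (?N / (\<kappa> * real n)) * 3"
  proof (rule mult_left_mono)
    have "(\<Sum>i\<le>m. (16/27) ^ i) = 27/11 * (1 - (16/27 :: real) ^ Suc m)" for m by (induction m) auto
    hence "(\<Sum>i\<le>LL l. (16/27) ^ i) \<le> (27/11::real)" by simp
    thus "(\<Sum>i\<le>LL l. (16/27) ^ i) \<le> (3::real)" by (rule order_trans) simp
  qed (use kp Np np in auto)
  also have "\<dots> \<le> 2 ^ 35 * (?N / (\<kappa> * real n))" using kp Np np by (simp add: divide_right_mono)
  finally show "expectation (\<lambda>\<omega>. remainder n (smp \<omega>) \<kappa> NN LL l) \<le> 2 ^ 35 * (?N / (\<kappa> * real n))" .
qed

lemma nu4: "\<nu> / real n = 1 / \<nu> ^ 4"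
  using \<nu> by (simp add: \<nu>(2)[symmetric] power_numeral_reduce)

text \<open>The cost \<open>\<kappa> * NN / n\<close> of free coefficients and the cost
  \<open>sqrt (\<kappa> * p / (NN^3 * n))\<close> of interpolation are balanced by
  \<open>\<nu>^5 = n\<close>: both sum to a multiple of \<open>\<kappa> / \<nu>^4\<close>.\<close>

lemma deterministic_error:
  "(\<Sum>l\<le>lmax. \<kappa> * real (NN l) / (4 * (1/2^25) * real n)
     + 2640000 * sqrt (\<kappa> * p l / (real (NN l) ^ 3 * real n)) + 528000 / real n) \<le> 2 ^ 28 * (\<kappa> / \<nu> ^ 4)"
proof -
  have np: "0 < real n" using n by simp
  have n4: "0 < \<nu> ^ 4" using \<nu> by simp
  have 1: "(\<Sum>l\<le>lmax. \<kappa> * real (NN l) / (4 * (1/2^25) * real n)) \<le> 2 ^ 23 * 18 * (\<kappa> / \<nu> ^ 4)"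
  proof -
    have "(\<Sum>l\<le>lmax. \<kappa> * real (NN l) / (4 * (1/2^25) * real n)) = 2 ^ 23 * \<kappa> / real n * (\<Sum>l\<le>lmax. real (NN l))"
      unfolding sum_distrib_left by (rule sum.cong) auto
    also have "\<dots> \<le> 2 ^ 23 * \<kappa> / real n * (18 * \<nu>)" using \<kappa> np by (intro mult_left_mono sum_NN) auto
    also have "\<dots> = 2 ^ 23 * 18 * \<kappa> * (\<nu> / real n)" by simp
    finally show ?thesis unfolding nu4 by simp
  qed
  have 2: "(\<Sum>l\<le>lmax. 2640000 * sqrt (\<kappa> * p l / (real (NN l) ^ 3 * real n))) \<le> 2640000 * 6 * (\<kappa> / \<nu> ^ 4)"
  proof -
    \<comment> \<open>Squared form of the claim: \<open>\<kappa> \<le> \<kappa>^2\<close>, and (1/2)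
      / (9/10)^3 = 1000/1458 lies below (83/100)^2.\<close>
    have "sqrt (\<kappa> * p l / (real (NN l) ^ 3 * real n)) \<le> \<kappa> / \<nu> ^ 4 * (83/100) ^ l" for l
    proof (rule real_le_lsqrt)
      have pw: "(x ^ l) ^ k = (x ^ k) ^ l" for x :: real and k :: nat
        unfolding power_mult[symmetric] by (simp only: mult.commute)
      have "(\<nu> * (9/10) ^ l) ^ 3 \<le> real (NN l) ^ 3" using \<nu> by (intro power_mono NN_bounds) auto
      hence "\<nu> ^ 3 * (729/1000) ^ l \<le> real (NN l) ^ 3" unfolding power_mult_distrib pw by (simp add: power_divide)
      hence "\<kappa> * p l / (real (NN l) ^ 3 * real n) \<le> \<kappa> * p l / (\<nu> ^ 3 * (729/1000) ^ l * real n)"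
        using \<nu> \<kappa> np p_pos[of l] NN_pos[of l] by (intro divide_left_mono mult_right_mono mult_pos_pos) auto
      also have "\<dots> \<le> \<kappa>\<^sup>2 * (1/2) ^ l / (\<nu> ^ 3 * (729/1000) ^ l * \<nu> ^ 5)"
        unfolding \<nu>(2)
      proof (intro divide_right_mono mult_mono)
        show "\<kappa> \<le> \<kappa>\<^sup>2" using \<kappa> by (simp add: power2_eq_square)
        show "p l \<le> (1/2) ^ l" by (simp add: p_def)
      qed (use \<nu> \<kappa> in \<open>auto simp: p_def\<close>)
      also have "\<dots> = \<kappa>\<^sup>2 / \<nu> ^ 8 * ((1/2) ^ l / (729/1000) ^ l)"
        using \<nu>(1) by (simp add: field_simps flip: power_add)
      also have "(1/2) ^ l / (729/1000) ^ l = (1000/1458 :: real) ^ l" by (simp flip: power_divide)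
      also have "\<kappa>\<^sup>2 / \<nu> ^ 8 * (1000/1458) ^ l \<le> \<kappa>\<^sup>2 / \<nu> ^ 8 * (6889/10000) ^ l"
        using \<nu> by (intro mult_left_mono power_mono) auto
      also have "\<dots> = (\<kappa> / \<nu> ^ 4 * (83/100) ^ l)\<^sup>2"
        unfolding power_mult_distrib pw power_divide[of \<kappa>] by (simp add: power_divide flip: power_mult)
      finally show "\<kappa> * p l / (real (NN l) ^ 3 * real n) \<le> (\<kappa> / \<nu> ^ 4 * (83/100) ^ l)\<^sup>2" .
    qed (use \<kappa> \<nu> in auto)
    hence "(\<Sum>l\<le>lmax. 2640000 * sqrt (\<kappa> * p l / (real (NN l) ^ 3 * real n))) \<le> (\<Sum>l\<le>lmax. 2640000 * (\<kappa> / \<nu> ^ 4 * (83/100) ^ l))"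
      by (intro sum_mono mult_left_mono) auto
    also have "\<dots> = 2640000 * (\<kappa> / \<nu> ^ 4) * (\<Sum>l\<le>lmax. (83/100) ^ l)" by (simp add: sum_distrib_left mult.assoc)
    also have "\<dots> \<le> 2640000 * (\<kappa> / \<nu> ^ 4) * 6"
    proof (rule mult_left_mono)
      have "(\<Sum>l\<le>m. (83/100) ^ l) = 100/17 * (1 - (83/100 :: real) ^ Suc m)" for m by (induction m) auto
      hence "(\<Sum>l\<le>lmax. (83/100) ^ l) \<le> (100/17::real)" by simp
      thus "(\<Sum>l\<le>lmax. (83/100) ^ l) \<le> (6::real)" by simp
    qed (use \<kappa> \<nu> in auto)
    finally show ?thesis by simp
  qed
  have 3: "(\<Sum>l\<le>lmax. 528000 / real n) \<le> 528000 * 8 * (\<kappa> / \<nu> ^ 4)"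
  proof -
    have "(\<Sum>l\<le>lmax. 528000 / real n) = 528000 * ((real lmax + 1) / real n)" by simp
    also have "\<dots> \<le> 528000 * (8 * \<nu> / real n)" using lmax_le np by (intro mult_left_mono divide_right_mono) auto
    also have "\<dots> = 528000 * 8 * (1 / \<nu> ^ 4)" using nu4 by simp
    also have "\<dots> \<le> 528000 * 8 * (\<kappa> / \<nu> ^ 4)" using \<kappa> n4 by (intro mult_left_mono divide_right_mono) auto
    finally show ?thesis .
  qed
  have "0 \<le> \<kappa> / \<nu> ^ 4" using \<kappa> \<nu> by simp
  thus ?thesis unfolding sum.distrib using 1 2 3 by simp
qed

text \<open>Both exceptional probabilities fall like \<open>\<kappa>^(-2)\<close>. For the tail,
  \<open>2^lmax \<le> \<nu>^4 / \<kappa>\<close> bounds \<open>4^lmax / n^2\<close> and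
  \<open>8^lmax / n^3\<close> by it. For the remainder one factor \<open>1 / \<kappa>\<close> sits
  in its definition and the other comes from Markov's inequality at
  \<open>\<kappa> / \<nu>^4\<close>.\<close>

lemma good_event:
  obtains G where "G \<in> events" "prob (space \<Omega> - G) \<le> 2 ^ 202 / \<kappa>\<^sup>2"
    "\<forall>\<omega>\<in>G. \<forall>l l' k. l' \<le> lmax \<longrightarrow> l' \<le> l \<longrightarrow> k < M \<longrightarrow>
       \<bar>dev g n (smp \<omega>) (indicator (piece l k))\<bar> \<le> (1/2)^44 * (1/2) ^ l' * (9/10) ^ (l - l')"
    "\<forall>\<omega>\<in>G. (\<Sum>l\<le>lmax. block_error n (smp \<omega>) \<kappa> NN LL l) \<le> 2 ^ 29 * (\<kappa> / \<nu> ^ 4)"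
proof -
  define R where "R = (\<lambda>\<omega>. \<Sum>l\<le>lmax. remainder n (smp \<omega>) \<kappa> NN LL l)"
  define B1 where "B1 = (\<Union>l'\<le>lmax. \<Union>j. \<Union>k<M. tail_bad n l' j k)"
  define B2 where "B2 = {\<omega> \<in> space \<Omega>. \<kappa> / \<nu> ^ 4 \<le> R \<omega>}"
  have np: "0 < real n" and kp: "0 < \<kappa>" and n4: "0 < \<nu> ^ 4" using n \<kappa> \<nu> by auto
  have Rint: "integrable \<Omega> R" unfolding R_def by (rule Bochner_Integration.integrable_sum) (use remainder_moment in auto)
  have ER: "expectation R \<le> 2 ^ 40 / (\<kappa> * \<nu> ^ 4)"
  proof -
    have "expectation R = (\<Sum>l\<le>lmax. expectation (\<lambda>\<omega>. remainder n (smp \<omega>) \<kappa> NN LL l))"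
      unfolding R_def by (rule Bochner_Integration.integral_sum) (use remainder_moment in auto)
    also have "\<dots> \<le> (\<Sum>l\<le>lmax. 2 ^ 35 * (real (NN l) / (\<kappa> * real n)))" by (rule sum_mono) (use remainder_moment in auto)
    also have "\<dots> = 2 ^ 35 / (\<kappa> * real n) * (\<Sum>l\<le>lmax. real (NN l))" by (simp add: sum_distrib_left)
    also have "\<dots> \<le> 2 ^ 35 / (\<kappa> * real n) * (18 * \<nu>)" using kp np by (intro mult_left_mono sum_NN) auto
    also have "\<dots> = 18 * 2 ^ 35 / \<kappa> * (\<nu> / real n)" by simp
    also have "\<dots> \<le> 2 ^ 40 / (\<kappa> * \<nu> ^ 4)" unfolding nu4 using kp n4 by (simp add: divide_right_mono)
    finally show ?thesis .
  qed
  have B2m[measurable]: "B2 \<in> events" unfolding B2_def using borel_measurable_integrable[OF Rint] by measurable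
  have B1m[measurable]: "B1 \<in> events" unfolding B1_def by measurable
  have PB2: "prob B2 \<le> 2 ^ 40 / \<kappa>\<^sup>2"
  proof -
    have "prob B2 \<le> expectation R / (\<kappa> / \<nu> ^ 4)" unfolding B2_def
      by (rule integral_Markov_inequality_measure[where A = "{}", OF Rint])
         (use kp n4 in \<open>auto simp: R_def intro!: sum_nonneg remainder_nonneg\<close>)
    also have "\<dots> \<le> 2 ^ 40 / (\<kappa> * \<nu> ^ 4) / (\<kappa> / \<nu> ^ 4)" using kp n4 by (intro divide_right_mono ER) auto
    also have "\<dots> = 2 ^ 40 / \<kappa>\<^sup>2" using kp n4 by (simp add: power2_eq_square)
    finally show ?thesis .
  qed
  have PB1: "prob B1 \<le> 2 ^ 197 * 14 / \<kappa>\<^sup>2"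
  proof -
    have geo: "(\<Sum>l\<le>m. c ^ l) \<le> 2 * c ^ m" if "2 \<le> c" for c :: real and m
    proof (induction m)
      case (Suc m)
      have "2 * c ^ m \<le> c * c ^ m" using that by (intro mult_right_mono) auto
      thus ?case using Suc by simp
    qed (use that in auto)
    have x: "2 ^ lmax \<le> \<nu> ^ 4 / \<kappa>" using lmax kp by (simp add: field_simps)
    have e4: "(4::real) ^ lmax = (2 ^ lmax)\<^sup>2" and e8: "(8::real) ^ lmax = (2 ^ lmax) ^ 3"
      by (simp_all add: power_mult[symmetric] mult.commute[of lmax] power_mult)
    have 4: "4 ^ lmax / (real n)\<^sup>2 \<le> 1 / \<kappa>\<^sup>2"
    proof -
      have "4 ^ lmax \<le> (\<nu> ^ 4 / \<kappa>)\<^sup>2" unfolding e4 by (rule power_mono[OF x]) simp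
      also have "\<dots> = \<nu> ^ 8 / \<kappa>\<^sup>2" by (simp add: power_divide flip: power_mult)
      also have "\<dots> \<le> \<nu> ^ 10 / \<kappa>\<^sup>2" using nu_ge_1 by (intro divide_right_mono power_increasing) auto
      also have "\<nu> ^ 10 = (real n)\<^sup>2" unfolding \<nu>(2)[symmetric] by (simp flip: power_mult)
      finally show ?thesis using np by (simp add: field_simps)
    qed
    have 8: "8 ^ lmax / (real n) ^ 3 \<le> 1 / \<kappa>\<^sup>2"
    proof -
      have "8 ^ lmax \<le> (\<nu> ^ 4 / \<kappa>) ^ 3" unfolding e8 by (rule power_mono[OF x]) simp
      also have "\<dots> = \<nu> ^ 12 / \<kappa> ^ 3" by (simp add: power_divide flip: power_mult)
      also have "\<dots> \<le> \<nu> ^ 15 / \<kappa>\<^sup>2" using nu_ge_1 \<kappa> by (intro frac_le power_increasing) auto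
      also have "\<nu> ^ 15 = (real n) ^ 3" unfolding \<nu>(2)[symmetric] by (simp flip: power_mult)
      finally show ?thesis using np by (simp add: field_simps)
    qed
    have "prob B1 \<le> (\<Sum>l'\<le>lmax. 2 ^ 197 * (3 * 4 ^ l' / (real n)\<^sup>2 + 4 * 8 ^ l' / (real n) ^ 3))"
      unfolding B1_def by (rule prob_tail_bad_union[OF n])
    also have "\<dots> = 2 ^ 197 * (3 / (real n)\<^sup>2 * (\<Sum>l'\<le>lmax. 4 ^ l') + 4 / (real n) ^ 3 * (\<Sum>l'\<le>lmax. 8 ^ l'))"
      unfolding sum_distrib_left[symmetric] sum.distrib by (simp add: sum_distrib_left)
    also have "\<dots> \<le> 2 ^ 197 * (3 / (real n)\<^sup>2 * (2 * 4 ^ lmax) + 4 / (real n) ^ 3 * (2 * 8 ^ lmax))"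
      by (intro mult_left_mono add_mono geo) auto
    also have "\<dots> = 2 ^ 197 * (6 * (4 ^ lmax / (real n)\<^sup>2) + 8 * (8 ^ lmax / (real n) ^ 3))" by simp
    also have "\<dots> \<le> 2 ^ 197 * (6 * (1 / \<kappa>\<^sup>2) + 8 * (1 / \<kappa>\<^sup>2))" by (intro mult_left_mono add_mono 4 8) auto
    finally show ?thesis by simp
  qed
  show thesis
  proof (rule that[of "space \<Omega> - (B1 \<union> B2)"]; (intro ballI allI impI)?)
    have e: "space \<Omega> - (space \<Omega> - (B1 \<union> B2)) = B1 \<union> B2" using sets.sets_into_space[OF B1m] sets.sets_into_space[OF B2m] by blast
    have "prob (B1 \<union> B2) \<le> 2 ^ 197 * 14 / \<kappa>\<^sup>2 + 2 ^ 40 / \<kappa>\<^sup>2"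
      by (rule order_trans[OF measure_Un_le add_mono[OF PB1 PB2]]) auto
    also have "2 ^ 197 * 14 / \<kappa>\<^sup>2 + 2 ^ 40 / \<kappa>\<^sup>2 \<le> 2 ^ 202 / \<kappa>\<^sup>2"
      unfolding add_divide_distrib[symmetric] by (rule divide_right_mono) auto
    finally show "prob (space \<Omega> - (space \<Omega> - (B1 \<union> B2))) \<le> 2 ^ 202 / \<kappa>\<^sup>2" unfolding e .
    fix \<omega> assume \<omega>: "\<omega> \<in> space \<Omega> - (B1 \<union> B2)"
    show "\<bar>dev g n (smp \<omega>) (indicator (piece l k))\<bar> \<le> (1/2)^44 * (1/2) ^ l' * (9/10) ^ (l - l')"
      if "l' \<le> lmax" "l' \<le> l" "k < M" for l l' k
    proof -
      have "\<omega> \<notin> tail_bad n l' (l - l') k" using \<omega> that by (auto simp: B1_def)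
      thus ?thesis using \<omega> that by (auto simp: tail_bad_def)
    qed
    have "R \<omega> \<le> \<kappa> / \<nu> ^ 4" using \<omega> by (auto simp: B2_def)
    moreover have "(\<Sum>l\<le>lmax. block_error n (smp \<omega>) \<kappa> NN LL l) = (\<Sum>l\<le>lmax. \<kappa> * real (NN l) / (4 * (1/2^25) * real n)
     + 2640000 * sqrt (\<kappa> * p l / (real (NN l) ^ 3 * real n)) + 528000 / real n) + R \<omega>"
      unfolding R_def block_error_def sum.distrib[symmetric] by (rule sum.cong) auto
    moreover have "0 \<le> \<kappa> / \<nu> ^ 4" using kp n4 by simp
    ultimately show "(\<Sum>l\<le>lmax. block_error n (smp \<omega>) \<kappa> NN LL l) \<le> 2 ^ 29 * (\<kappa> / \<nu> ^ 4)"
      using deterministic_error by simp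
  qed auto
qed

end

end

section \<open>The rate near the true density\<close>

context symmetric_log_concave
begin

text \<open>\<open>logmix_mult_le\<close> integrated; the mass of \<open>f\<close> minus that of
  \<open>g\<close> is at most 0.\<close>

lemma llr_integral_le:
  assumes f: "lc_subdensity f"
  shows "(LINT x|lborel. llr f x * g x) \<le> - (hellinger_sq f g / 4)"
proof -
  note i = integrable_sqrt_diff[OF lc_subdensityD(3)[OF f] g_int lc_subdensityD(4)[OF f] g_nonneg]
  note fi = lc_subdensityD(3)[OF f]
  have "(LINT x|lborel. llr f x * g x) \<le> (LINT x|lborel. f x - g x - (sqrt (f x) - sqrt (g x))\<^sup>2 / 8)"
  proof (rule integral_mono[OF llr_integrable[OF f]])
    fix x
    show "llr f x * g x \<le> f x - g x - (sqrt (f x) - sqrt (g x))\<^sup>2 / 8"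
    proof (cases "g x = 0")
      case True
      thus ?thesis using lc_subdensityD(4)[OF f, of x] by simp
    next
      case False
      hence "0 < g x" using g_nonneg[of x] by simp
      thus ?thesis unfolding llr_def using logmix_mult_le[OF lc_subdensityD(4)[OF f, of x]] by fastforce
    qed
  qed (use i fi g_int in auto)
  also have "\<dots> = (LINT x|lborel. f x) - 1 - hellinger_sq f g / 4"
    using i fi g_int g_total by (simp add: hellinger_sq_def)
  finally show ?thesis using lc_subdensityD(5)[OF f] by simp
qed

lemma lc_subdensity_reflect: assumes f: "lc_subdensity f" shows "lc_subdensity (\<lambda>x. f (- x))"
proof -
  have lcf: "log_concave f" and [measurable]: "f \<in> borel_measurable borel" and fi: "integrable lborel f" "(LINT x|lborel. f x) \<le> 1"
    using f by (auto simp: lc_subdensity_def)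
  have "log_concave (\<lambda>x. f (- x))" unfolding log_concave_def
  proof (intro conjI allI impI)
    show "0 \<le> f (- x)" for x by (rule log_concave_nonneg[OF lcf])
    fix x y u :: real assume "0 \<le> u" "u \<le> 1" "0 < f (- x)" "0 < f (- y)"
    moreover have "- ((1 - u) * x + u * y) = (1 - u) * (- x) + u * (- y)" by (simp add: algebra_simps)
    ultimately show "0 < f (- ((1 - u) * x + u * y))"
      "(1 - u) * ln (f (- x)) + u * ln (f (- y)) \<le> ln (f (- ((1 - u) * x + u * y)))"
      using lcf unfolding log_concave_def by metis+
  qed
  moreover have "integrable lborel (\<lambda>x. f (0 + -1 * x))"
    by (subst lborel_integrable_real_affine_iff) (use fi in auto)
  moreover have "(LINT x|lborel. f (0 + -1 * x)) = (LINT x|lborel. f x)"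
    by (subst lborel_integral_real_affine[of "-1" f 0]) auto
  ultimately show ?thesis using fi by (simp add: lc_subdensity_def)
qed

lemma hellinger_sq_reflect: "hellinger_sq (\<lambda>x. f (- x)) g = hellinger_sq f g"
proof -
  have "(LINT x|lborel. (sqrt (f x) - sqrt (g x))\<^sup>2) = (LINT x|lborel. (sqrt (f (0 + -1 * x)) - sqrt (g (0 + -1 * x)))\<^sup>2)"
    by (subst lborel_integral_real_affine[of "-1" _ 0]) auto
  thus ?thesis by (simp add: hellinger_sq_def sym)
qed

text \<open>The left half line is the right half line of the reflected sample and fit. An
  observation at 0 would be counted on both sides.\<close>

lemma dev_two_sided:
  assumes f: "lc_subdensity f" and y: "\<And>i. i \<in> {1..n} \<Longrightarrow> y i \<noteq> 0"
  shows "dev g n y (llr f) = dev g n y (\<lambda>x. indicator {0..} x * llr f x)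
     + dev g n (\<lambda>i. - y i) (\<lambda>x. indicator {0..} x * llr (\<lambda>x. f (- x)) x)"
proof -
  have refl: "llr (\<lambda>x. f (- x)) (- x) = llr f x" for x by (simp add: llr_def sym)
  have "(\<Sum>i\<in>{1..n}. llr f (y i)) = (\<Sum>i\<in>{1..n}. indicator {0..} (y i) * llr f (y i))
     + (\<Sum>i\<in>{1..n}. indicator {0..} (- y i) * llr (\<lambda>x. f (- x)) (- y i))"
    unfolding sum.distrib[symmetric] refl by (rule sum.cong) (use y in \<open>force simp: indicator_def\<close>)+
  moreover have "(LINT x|lborel. llr f x * g x) = (LINT x|lborel. indicator {0..} x * llr f x * g x)
      + (LINT x|lborel. indicator {0..} x * llr (\<lambda>x. f (- x)) x * g x)"
  proof -
    note [measurable] = llr_measurable[OF f]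
    have "(LINT x|lborel. indicator {0..} x * llr (\<lambda>x. f (- x)) x * g x)
      = (LINT x|lborel. indicator {0..} (0 + -1 * x) * llr (\<lambda>x. f (- x)) (0 + -1 * x) * g (0 + -1 * x))"
      by (subst lborel_integral_real_affine[of "-1" _ 0]) auto
    also have "\<dots> = (LINT x|lborel. indicator {0..} (- x) * llr f x * g x)" by (simp add: refl sym)
    also have "\<dots> = (LINT x|lborel. indicator {..<0} x * llr f x * g x)"
    proof (rule integral_cong_AE)
      have "AE x in lborel. x \<noteq> (0::real)" by (rule AE_lborel_singleton)
      thus "AE x in lborel. indicator {0..} (- x) * llr f x * g x = indicator {..<0} x * llr f x * g x"
        by eventually_elim (auto simp: indicator_def)
    qed auto
    finally have e: "(LINT x|lborel. indicator {0..} x * llr (\<lambda>x. f (- x)) x * g x) = (LINT x|lborel. indicator {..<0} x * llr f x * g x)" .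
    have "(LINT x|lborel. indicator {0..} x * llr f x * g x) + (LINT x|lborel. indicator {..<0} x * llr f x * g x)
       = (LINT x|lborel. indicator {0..} x * llr f x * g x + indicator {..<0} x * llr f x * g x)"
      by (rule Bochner_Integration.integral_add[symmetric]) (auto intro!: llr_set_integrable[OF f])
    also have "\<dots> = (LINT x|lborel. llr f x * g x)"
      by (rule Bochner_Integration.integral_cong) (auto simp: indicator_def)
    finally show ?thesis unfolding e by simp
  qed
  ultimately show ?thesis unfolding dev_def by (simp add: add_divide_distrib)
qed

end

context slc_sample
begin

lemma reflected: "slc_sample g \<Omega> (\<lambda>i \<omega>. - Y i \<omega>)"
proof -
  have ind: "indep_vars (\<lambda>_. borel) Y {1..}" and dist: "\<And>i. i \<ge> 1 \<Longrightarrow> distributed \<Omega> lborel (Y i) (\<lambda>x. ennreal (g x))"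
    using iid by (auto simp: iid_sample_def)
  have "indep_vars (\<lambda>_. borel) (\<lambda>i \<omega>. - Y i \<omega>) {1..}"
    by (rule indep_vars_compose2[OF ind]) auto
  moreover have "distributed \<Omega> lborel (\<lambda>\<omega>. - Y i \<omega>) (\<lambda>x. ennreal (g x))" if "i \<ge> 1" for i
    using distributed_affine[OF dist[OF that], of "-1" 0] by (simp add: sym divide_ennreal_def)
  ultimately show ?thesis by unfold_locales (auto simp: iid_sample_def)
qed

text \<open>The empirical mass of block \<open>L\<close> is at least half of \<open>p L\<close>, so
  the block is not empty. Applied on both sides, this forces a fit to be positive on a fixed central
  interval.\<close>

lemma spread:
  assumes good: "\<And>k. k < M \<Longrightarrow> \<bar>dev g n (smp \<omega>) (indicator (piece L k))\<bar> \<le> (1/2)^44 * (1/2) ^ L"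
  shows "\<exists>i\<in>{1..n}. t L \<le> Y i \<omega>"
proof (rule ccontr)
  assume "\<not> ?thesis"
  hence "(\<Sum>i\<in>{1..n}. indicator {t L..<t (Suc L)} (Y i \<omega>) :: real) = 0" by (intro sum.neutral) auto
  hence "dev g n (smp \<omega>) (indicator {t L..<t (Suc L)}) + p L = 0"
    unfolding empirical_block_mass[symmetric] by simp
  moreover have "\<bar>dev g n (smp \<omega>) (indicator {t L..<t (Suc L)})\<bar> \<le> p L / 2" by (rule block_dev_small[OF good])
  ultimately show False using p_pos[of L] by linarith
qed

text \<open>Closeness to \<open>g\<close> puts the cut block so far out that \<open>g\<close> has
  fallen by 128 and the fit is past its mode. \<open>\<delta>\<close> depends on \<open>g\<close>
  alone and is chosen before \<open>L\<close>, so that \<open>uniform_rate\<close> can pick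
  \<open>L\<close> in terms of \<open>\<delta>\<close>; only \<open>D\<close> depends on
  \<open>L\<close>.\<close>

lemma local_rate:
  "\<exists>\<delta>>0. \<forall>L. \<exists>D\<ge>1. \<forall>n \<nu> \<kappa>. 1 \<le> n \<longrightarrow> 0 < \<nu> \<longrightarrow> \<nu> ^ 5 = real n \<longrightarrow> 1 \<le> \<kappa> \<longrightarrow> D * \<kappa> \<le> \<nu> ^ 4 \<longrightarrow>
    (\<exists>G\<in>events. prob (space \<Omega> - G) \<le> 2 ^ 203 / \<kappa>\<^sup>2 \<and> (\<forall>\<omega>\<in>G. (\<forall>i\<in>{1..n}. 0 < g (Y i \<omega>) \<and> Y i \<omega> \<noteq> 0) \<longrightarrow>
      (\<exists>i\<in>{1..n}. t L \<le> Y i \<omega>) \<and> (\<exists>i\<in>{1..n}. Y i \<omega> \<le> - t L) \<and>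
      (\<forall>f. lc_subdensity f \<longrightarrow> (\<forall>i\<in>{1..n}. 0 < f (Y i \<omega>)) \<longrightarrow>
        (\<Sum>i\<in>{1..n}. ln (g (Y i \<omega>))) \<le> (\<Sum>i\<in>{1..n}. ln (f (Y i \<omega>))) \<longrightarrow>
        hellinger_sq f g \<le> \<delta> \<longrightarrow> hellinger_sq f g \<le> 2 ^ 33 * (\<kappa> / \<nu> ^ 4))))"
proof -
  interpret R: slc_sample g \<Omega> "\<lambda>i \<omega>. - Y i \<omega>" by (rule reflected)
  obtain Ls where Ls: "\<And>l. Ls \<le> l \<Longrightarrow> q l < q 0 / 128" using q_small[of "q 0 / 128"] q_pos[of 0] by auto
  define \<delta> where "\<delta> = (1/2::real) ^ Ls / 256"
  have \<delta>0: "0 < \<delta>" "\<delta> \<le> 1/256" by (auto simp: \<delta>_def power_le_one)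
  show ?thesis
  proof (rule exI[of _ \<delta>], rule conjI[OF \<delta>0(1)], rule allI)
    fix L
    define D where "D = (2::real) ^ L"
    show "\<exists>D\<ge>1. \<forall>n \<nu> \<kappa>. 1 \<le> n \<longrightarrow> 0 < \<nu> \<longrightarrow> \<nu> ^ 5 = real n \<longrightarrow> 1 \<le> \<kappa> \<longrightarrow> D * \<kappa> \<le> \<nu> ^ 4 \<longrightarrow>
    (\<exists>G\<in>events. prob (space \<Omega> - G) \<le> 2 ^ 203 / \<kappa>\<^sup>2 \<and> (\<forall>\<omega>\<in>G. (\<forall>i\<in>{1..n}. 0 < g (Y i \<omega>) \<and> Y i \<omega> \<noteq> 0) \<longrightarrow>
      (\<exists>i\<in>{1..n}. t L \<le> Y i \<omega>) \<and> (\<exists>i\<in>{1..n}. Y i \<omega> \<le> - t L) \<and>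
      (\<forall>f. lc_subdensity f \<longrightarrow> (\<forall>i\<in>{1..n}. 0 < f (Y i \<omega>)) \<longrightarrow>
        (\<Sum>i\<in>{1..n}. ln (g (Y i \<omega>))) \<le> (\<Sum>i\<in>{1..n}. ln (f (Y i \<omega>))) \<longrightarrow>
        hellinger_sq f g \<le> \<delta> \<longrightarrow> hellinger_sq f g \<le> 2 ^ 33 * (\<kappa> / \<nu> ^ 4))))"
    proof (intro exI[of _ D] conjI allI impI)
      show "1 \<le> D" by (simp add: D_def)
      fix n :: nat and \<nu> \<kappa> :: real
      assume n: "1 \<le> n" and \<nu>: "0 < \<nu>" "\<nu> ^ 5 = real n" and \<kappa>: "1 \<le> \<kappa>" and DK: "D * \<kappa> \<le> \<nu> ^ 4"
      define \<Lambda> where "\<Lambda> = {l::nat. 2 ^ l * \<kappa> \<le> \<nu> ^ 4}"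
      have fin: "finite \<Lambda>"
      proof -
        obtain m :: nat where m: "\<nu> ^ 4 < 2 ^ m" using real_arch_pow[of 2 "\<nu> ^ 4"] by auto
        have "l < m" if "l \<in> \<Lambda>" for l
        proof (rule ccontr)
          assume "\<not> l < m"
          hence "2 ^ m * 1 \<le> 2 ^ l * \<kappa>" using \<kappa> by (intro mult_mono power_increasing) auto
          thus False using that m by (simp add: \<Lambda>_def)
        qed
        thus ?thesis by (meson finite_nat_set_iff_bounded)
      qed
      have LL: "L \<in> \<Lambda>" using DK by (simp add: \<Lambda>_def D_def)
      define lmax where "lmax = Max \<Lambda>"
      have lm: "2 ^ lmax * \<kappa> \<le> \<nu> ^ 4" using Max_in[OF fin] LL by (auto simp: lmax_def \<Lambda>_def)
      have lme: "l \<le> lmax" if "2 ^ l * \<kappa> \<le> \<nu> ^ 4" for l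
        unfolding lmax_def by (rule Max_ge[OF fin]) (use that in \<open>simp add: \<Lambda>_def\<close>)
      have Lle: "L \<le> lmax" using LL by (intro lme) (simp add: \<Lambda>_def)
      obtain G1 where G1: "G1 \<in> events" "prob (space \<Omega> - G1) \<le> 2 ^ 202 / \<kappa>\<^sup>2"
         "\<forall>\<omega>\<in>G1. \<forall>l l' k. l' \<le> lmax \<longrightarrow> l' \<le> l \<longrightarrow> k < M \<longrightarrow>
           \<bar>dev g n (smp \<omega>) (indicator (piece l k))\<bar> \<le> (1/2)^44 * (1/2) ^ l' * (9/10) ^ (l - l')"
         "\<forall>\<omega>\<in>G1. (\<Sum>l\<le>lmax. block_error n (smp \<omega>) \<kappa> (NN \<nu>) (LL n \<nu>) l) \<le> 2 ^ 29 * (\<kappa> / \<nu> ^ 4)"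
        by (rule good_event[OF n \<nu> \<kappa> lm])
      obtain G2 where G2: "G2 \<in> events" "prob (space \<Omega> - G2) \<le> 2 ^ 202 / \<kappa>\<^sup>2"
         "\<forall>\<omega>\<in>G2. \<forall>l l' k. l' \<le> lmax \<longrightarrow> l' \<le> l \<longrightarrow> k < M \<longrightarrow>
           \<bar>dev g n (\<lambda>i. - Y i \<omega>) (indicator (piece l k))\<bar> \<le> (1/2)^44 * (1/2) ^ l' * (9/10) ^ (l - l')"
         "\<forall>\<omega>\<in>G2. (\<Sum>l\<le>lmax. block_error n (\<lambda>i. - Y i \<omega>) \<kappa> (NN \<nu>) (LL n \<nu>) l) \<le> 2 ^ 29 * (\<kappa> / \<nu> ^ 4)"
        by (rule R.good_event[OF n \<nu> \<kappa> lm])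
      have PG: "prob (space \<Omega> - G1 \<inter> G2) \<le> 2 ^ 203 / \<kappa>\<^sup>2"
      proof -
        have "prob (space \<Omega> - G1 \<inter> G2) = prob ((space \<Omega> - G1) \<union> (space \<Omega> - G2))" by (rule arg_cong[where f = prob]) auto
        also have "\<dots> \<le> 2 ^ 202 / \<kappa>\<^sup>2 + 2 ^ 202 / \<kappa>\<^sup>2"
          by (rule order_trans[OF measure_Un_le add_mono[OF G1(2) G2(2)]]) (use G1 G2 in auto)
        also have "\<dots> = 2 ^ 203 / \<kappa>\<^sup>2" by simp
        finally show ?thesis .
      qed
      have kp: "0 < \<kappa>" and k4: "0 < \<kappa> / \<nu> ^ 4" using \<kappa> \<nu> by auto
      have key: "hellinger_sq f g \<le> 2 ^ 33 * (\<kappa> / \<nu> ^ 4)"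
        if w: "\<omega> \<in> G1" "\<omega> \<in> G2" and dat: "\<And>i. i \<in> {1..n} \<Longrightarrow> 0 < g (Y i \<omega>) \<and> Y i \<omega> \<noteq> 0"
          and f: "lc_subdensity f" and fp: "\<And>i. i \<in> {1..n} \<Longrightarrow> 0 < f (Y i \<omega>)"
          and lik: "(\<Sum>i\<in>{1..n}. ln (g (Y i \<omega>))) \<le> (\<Sum>i\<in>{1..n}. ln (f (Y i \<omega>)))"
          and H\<delta>: "hellinger_sq f g \<le> \<delta>" for \<omega> f
      proof (cases "hellinger_sq f g \<le> \<kappa> / \<nu> ^ 4")
        case True
        thus ?thesis using k4 by simp
      next
        case False
        define H where "H = hellinger_sq f g"
        have Hk: "\<kappa> / \<nu> ^ 4 < H" using False by (simp add: H_def)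
        have H0: "0 < H" using Hk k4 by linarith
        \<comment> \<open>Minimality gives \<open>128 * H \<le> (1/2)^l0\<close>, the defining
          property \<open>(1/2)^l0 < 256 * H\<close>: the two comparisons that
          \<open>dev_one_sided\<close> asks for. That \<open>H\<close> exceeds
          \<open>\<kappa> / \<nu>^4\<close> puts \<open>l0\<close> below
          \<open>lmax\<close>.\<close>
        define l0 where "l0 = (LEAST l. (1/2) ^ (l + 1) < 128 * H)"
        have ex: "\<exists>l. (1/2) ^ (l + 1) < 128 * H"
        proof -
          obtain m where "(1/2::real) ^ m < 128 * H" using real_arch_pow_inv[of "128 * H" "1/2"] H0 by auto
          moreover have "(1/2::real) ^ (m + 1) \<le> (1/2) ^ m" by (rule power_decreasing) auto
          ultimately show ?thesis by (intro exI[of _ m]) linarith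
        qed
        have l0a: "(1/2) ^ (l0 + 1) < 128 * H" unfolding l0_def by (rule LeastI_ex[OF ex])
        have l0b: "128 * H \<le> (1/2) ^ l0"
        proof (cases l0)
          case 0
          thus ?thesis using H\<delta> \<delta>0 by (simp add: H_def)
        next
          case (Suc m)
          hence "\<not> (1/2) ^ (m + 1) < 128 * H" unfolding l0_def by (intro not_less_Least) simp
          thus ?thesis using Suc by simp
        qed
        have big: "(1/2) ^ l0 \<le> 256 * H" using l0a by simp
        have small: "8 * H \<le> p (l0 + 2)" using l0b by (simp add: p_def power_add)
        have l0m: "l0 \<le> lmax"
        proof (rule lme)
          have "2 ^ l0 * (128 * H) \<le> 2 ^ l0 * (1/2) ^ l0" using l0b by (intro mult_left_mono) auto
          hence 1: "2 ^ l0 * (128 * H) \<le> 1" by (simp add: power_one_over)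
          have "2 ^ l0 * (\<kappa> / \<nu> ^ 4) \<le> 2 ^ l0 * (128 * H)" using Hk H0 by (intro mult_left_mono) auto
          hence "2 ^ l0 * (\<kappa> / \<nu> ^ 4) \<le> 1" using 1 by linarith
          thus "2 ^ l0 * \<kappa> \<le> \<nu> ^ 4" using \<nu> by (simp add: field_simps)
        qed
        have q0: "128 * q l0 < q 0"
        proof -
          have "Ls \<le> l0"
          proof (rule ccontr)
            assume "\<not> Ls \<le> l0"
            hence "(1/2::real) ^ Ls < (1/2) ^ l0" by (intro power_strict_decreasing) auto
            moreover have "256 * H \<le> (1/2) ^ Ls" using H\<delta> by (simp add: \<delta>_def H_def)
            ultimately show False using big by linarith
          qed
          thus ?thesis using Ls[of l0] by simp
        qed
        let ?f = "\<lambda>x. f (- x)"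
        have NLg: "1 \<le> NN \<nu> l" "real n * p l \<le> real (NN \<nu> l) * 2 ^ LL n \<nu> l" for l
          using NN_pos[OF n \<nu> \<kappa> lm, of l] LL_ge[OF n \<nu> \<kappa> lm, of l] by auto
        have r1: "dev g n (smp \<omega>) (\<lambda>x. indicator {0..} x * llr f x) \<le> H / 32 + (\<Sum>l\<le>lmax. block_error n (smp \<omega>) \<kappa> (NN \<nu>) (LL n \<nu>) l)"
          unfolding H_def
          by (rule dev_one_sided[OF f n kp l0m small[unfolded H_def] big[unfolded H_def] q0]) (use NLg G1(3)[rule_format, OF w(1)] dat in auto)
        have r2: "dev g n (\<lambda>i. - Y i \<omega>) (\<lambda>x. indicator {0..} x * llr ?f x) \<le> H / 32 + (\<Sum>l\<le>lmax. block_error n (\<lambda>i. - Y i \<omega>) \<kappa> (NN \<nu>) (LL n \<nu>) l)"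
          unfolding H_def hellinger_sq_reflect[of f, symmetric]
          by (rule dev_one_sided[OF lc_subdensity_reflect[OF f] n kp l0m _ _ q0])
             (use small big NLg G2(3)[rule_format, OF w(2)] dat in \<open>auto simp: H_def hellinger_sq_reflect sym\<close>)
        have d: "dev g n (smp \<omega>) (llr f) \<le> H / 16 + 2 ^ 30 * (\<kappa> / \<nu> ^ 4)"
          using dev_two_sided[OF f, of n "smp \<omega>"] dat r1 r2 G1(4)[rule_format, OF w(1)] G2(4)[rule_format, OF w(2)] by simp
        have "0 \<le> (\<Sum>i\<in>{1..n}. llr f (Y i \<omega>)) / real n"
        proof -
          have "(\<Sum>i\<in>{1..n}. ln (f (Y i \<omega>)) - ln (g (Y i \<omega>))) \<le> (\<Sum>i\<in>{1..n}. llr f (Y i \<omega>))"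
            unfolding llr_def by (intro sum_mono logmix_ge_ln) (use dat fp in auto)
          thus ?thesis using lik by (simp add: sum_subtractf)
        qed
        moreover have "dev g n (smp \<omega>) (llr f) = (\<Sum>i\<in>{1..n}. llr f (Y i \<omega>)) / real n - (LINT x|lborel. llr f x * g x)"
          by (simp add: dev_def)
        \<comment> \<open>The gain 1/4 against twice the charge 1/32; solving for \<open>H\<close>
          leaves the factor (16/3) * 2^30 < 2^33.\<close>
        ultimately have "H / 4 \<le> H / 16 + 2 ^ 30 * (\<kappa> / \<nu> ^ 4)"
          using d llr_integral_le[OF f] by (simp add: H_def)
        hence "H \<le> 2 ^ 33 * (\<kappa> / \<nu> ^ 4)" using k4 by simp
        thus ?thesis by (simp add: H_def)
      qed
      have sp1: "\<exists>i\<in>{1..n}. t L \<le> Y i \<omega>" if "\<omega> \<in> G1" for \<omega>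
        by (rule spread) (use G1(3)[rule_format, OF that Lle, of L] in auto)
      have sp2: "\<exists>i\<in>{1..n}. Y i \<omega> \<le> - t L" if "\<omega> \<in> G2" for \<omega>
      proof -
        have "\<exists>i\<in>{1..n}. t L \<le> - Y i \<omega>" by (rule R.spread) (use G2(3)[rule_format, OF that Lle, of L] in auto)
        thus ?thesis by force
      qed
      show "\<exists>G\<in>events. prob (space \<Omega> - G) \<le> 2 ^ 203 / \<kappa>\<^sup>2 \<and> (\<forall>\<omega>\<in>G. (\<forall>i\<in>{1..n}. 0 < g (Y i \<omega>) \<and> Y i \<omega> \<noteq> 0) \<longrightarrow>
      (\<exists>i\<in>{1..n}. t L \<le> Y i \<omega>) \<and> (\<exists>i\<in>{1..n}. Y i \<omega> \<le> - t L) \<and>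
      (\<forall>f. lc_subdensity f \<longrightarrow> (\<forall>i\<in>{1..n}. 0 < f (Y i \<omega>)) \<longrightarrow>
        (\<Sum>i\<in>{1..n}. ln (g (Y i \<omega>))) \<le> (\<Sum>i\<in>{1..n}. ln (f (Y i \<omega>))) \<longrightarrow>
        hellinger_sq f g \<le> \<delta> \<longrightarrow> hellinger_sq f g \<le> 2 ^ 33 * (\<kappa> / \<nu> ^ 4)))"
      proof (intro bexI[of _ "G1 \<inter> G2"] conjI ballI impI allI)
        show "prob (space \<Omega> - G1 \<inter> G2) \<le> 2 ^ 203 / \<kappa>\<^sup>2" by (rule PG)
        show "G1 \<inter> G2 \<in> events" using G1 G2 by auto
      qed (use sp1 sp2 key in auto)
    qed
  qed
qed

end

section \<open>From the local to the global rate\<close>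

text \<open>The log likelihood is affine along this path, and the squared Hellinger distance to \<open>g\<close> is
  continuous. Hence a maximizer outside the neighbourhood of the local rate bound would produce a point on
  its boundary that contradicts that bound; no separate consistency proof is needed.\<close>
definition geo_path :: "(real \<Rightarrow> real) \<Rightarrow> (real \<Rightarrow> real) \<Rightarrow> real \<Rightarrow> real \<Rightarrow> real" where
  "geo_path g f s x = f x powr s * g x powr (1 - s)"

text \<open>Weighted arithmetic-geometric means; this keeps the mass along the path at most
  1.\<close>

lemma powr_mean_le:
  fixes a b s :: real
  assumes "0 \<le> a" "0 \<le> b" "0 \<le> s" "s \<le> 1"
  shows "a powr s * b powr (1 - s) \<le> s * a + (1 - s) * b"
proof (cases "a = 0 \<or> b = 0")
  case True
  thus ?thesis using assms by auto
next
  case False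
  hence ab: "0 < a" "0 < b" using assms by auto
  have "exp ((1 - s) *\<^sub>R ln b + s *\<^sub>R ln a) \<le> (1 - s) * exp (ln b) + s * exp (ln a)"
    by (rule convex_onD[OF exp_convex]) (use assms in auto)
  thus ?thesis using ab by (simp add: powr_def exp_add mult_ac add_ac)
qed

context symmetric_log_concave
begin

context
  fixes f assumes f: "lc_subdensity f"
begin

abbreviation (input) "Q \<equiv> geo_path g f"

lemma fnn: "0 \<le> f x" and fm: "f \<in> borel_measurable borel" and fint: "integrable lborel f" and flc: "log_concave f"
  and fle: "(LINT x|lborel. f x) \<le> 1"
  using lc_subdensityD[OF f] by auto

lemma Q_nonneg: "0 \<le> Q s x" by (simp add: geo_path_def)
lemma Q_measurable: "Q s \<in> borel_measurable borel"
proof -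
  note [measurable] = fm
  show ?thesis unfolding geo_path_def[abs_def] by measurable
qed

lemma Q_le: "0 \<le> s \<Longrightarrow> s \<le> 1 \<Longrightarrow> Q s x \<le> s * f x + (1 - s) * g x"
  unfolding geo_path_def by (rule powr_mean_le) (auto simp: fnn g_nonneg)

lemma Q_integrable: assumes "0 \<le> s" "s \<le> 1" shows "integrable lborel (Q s)"
proof (rule Bochner_Integration.integrable_bound)
  show "integrable lborel (\<lambda>x. s * f x + (1 - s) * g x)" using fint g_int by simp
  show "AE x in lborel. norm (Q s x) \<le> norm (s * f x + (1 - s) * g x)"
    by (rule AE_I2) (use Q_le[OF assms] Q_nonneg in \<open>smt (verit) real_norm_def\<close>)
  show "Q s \<in> borel_measurable lborel" using Q_measurable by simp
qed

lemma Q_total: assumes "0 \<le> s" "s \<le> 1" shows "(LINT x|lborel. Q s x) \<le> 1"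
proof -
  have "(LINT x|lborel. Q s x) \<le> (LINT x|lborel. s * f x + (1 - s) * g x)"
    by (rule integral_mono) (use Q_integrable[OF assms] Q_le[OF assms] fint g_int in auto)
  also have "\<dots> = s * (LINT x|lborel. f x) + (1 - s) * 1" using fint g_int g_total by simp
  also have "\<dots> \<le> s * 1 + (1 - s) * 1" using fle assms by (intro add_mono mult_left_mono) auto
  finally show ?thesis by simp
qed

lemma Q_pos_iff: "0 < Q s x \<longleftrightarrow> 0 < f x \<and> 0 < g x"
  using fnn[of x] g_nonneg[of x] by (auto simp: geo_path_def zero_less_mult_iff less_le)

lemma Q_ln: "0 < f x \<Longrightarrow> 0 < g x \<Longrightarrow> ln (Q s x) = s * ln (f x) + (1 - s) * ln (g x)"
  by (simp add: geo_path_def ln_mult ln_powr)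

lemma Q_log_concave: assumes s: "0 \<le> s" "s \<le> 1" shows "log_concave (Q s)"
  unfolding log_concave_def
proof (intro conjI allI impI)
  show "0 \<le> Q s x" for x by (rule Q_nonneg)
  fix x y u :: real assume u: "0 \<le> u" "u \<le> 1" and p: "0 < Q s x" "0 < Q s y"
  let ?z = "(1 - u) * x + u * y"
  have pf: "0 < f x" "0 < f y" "0 < g x" "0 < g y" using p by (auto simp: Q_pos_iff)
  have zf: "0 < f ?z" "(1 - u) * ln (f x) + u * ln (f y) \<le> ln (f ?z)" using flc u pf unfolding log_concave_def by blast+
  have zg: "0 < g ?z" "(1 - u) * ln (g x) + u * ln (g y) \<le> ln (g ?z)" using lc u pf unfolding log_concave_def by blast+
  show "0 < Q s ?z" using zf zg by (simp add: Q_pos_iff)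
  have "(1 - u) * ln (Q s x) + u * ln (Q s y) = s * ((1 - u) * ln (f x) + u * ln (f y)) + (1 - s) * ((1 - u) * ln (g x) + u * ln (g y))"
    using pf by (simp add: Q_ln algebra_simps)
  also have "\<dots> \<le> s * ln (f ?z) + (1 - s) * ln (g ?z)" using zf zg s by (intro add_mono mult_left_mono) auto
  also have "\<dots> = ln (Q s ?z)" using zf zg by (simp add: Q_ln)
  finally show "(1 - u) * ln (Q s x) + u * ln (Q s y) \<le> ln (Q s ?z)" .
qed

lemma Q_lc_subdensity: "0 \<le> s \<Longrightarrow> s \<le> 1 \<Longrightarrow> lc_subdensity (Q s)"
  unfolding lc_subdensity_def using Q_log_concave Q_measurable Q_integrable Q_total by blast

definition Z :: "real \<Rightarrow> real" where "Z s = (LINT x|lborel. Q s x)"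

text \<open>\<open>sqrt (Q s) * sqrt g = Q (s / 2)\<close>: the Hellinger affinity with
  \<open>g\<close> is the mass at half the parameter, so continuity of the distance reduces to
  continuity of the mass \<open>Z\<close>.\<close>

lemma Q_hellinger: assumes s: "0 \<le> s" "s \<le> 1" shows "hellinger_sq (Q s) g = (Z s + 1) / 2 - Z (s / 2)"
proof -
  have sq: "sqrt (Q s x) * sqrt (g x) = Q (s / 2) x" for x
  proof -
    have "sqrt (Q s x) * sqrt (g x) = (f x powr s * g x powr (1 - s)) powr (1/2) * g x powr (1/2)"
      using fnn g_nonneg by (simp add: geo_path_def powr_half_sqrt)
    also have "\<dots> = f x powr (s/2) * (g x powr ((1 - s)/2) * g x powr (1/2))"
      using fnn g_nonneg by (simp add: powr_mult powr_powr mult.assoc)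
    also have "g x powr ((1 - s)/2) * g x powr (1/2) = g x powr (1 - s/2)"
      by (subst powr_add[symmetric]) (simp add: field_simps)
    finally show ?thesis by (simp add: geo_path_def)
  qed
  have "(sqrt (Q s x) - sqrt (g x))\<^sup>2 = Q s x + g x - 2 * Q (s / 2) x" for x
    using Q_nonneg[of s x] g_nonneg[of x] by (simp add: power2_diff mult.assoc sq)
  hence "hellinger_sq (Q s) g = 1/2 * (LINT x|lborel. Q s x + g x - 2 * Q (s / 2) x)" by (simp add: hellinger_sq_def)
  also have "\<dots> = (Z s + 1) / 2 - Z (s / 2)"
    using Q_integrable[OF s] Q_integrable[of "s/2"] s g_int g_total by (simp add: Z_def field_simps)
  finally show ?thesis .
qed

text \<open>Dominated convergence under \<open>f + g\<close>. Where \<open>f\<close> or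
  \<open>g\<close> vanishes, the path is 0 for every \<open>s\<close>, even at the ends, because
  \<open>0 powr 0 = 0\<close>.\<close>

lemma Z_cont: "continuous_on {0..1} Z"
  unfolding Z_def continuous_on_sequentially
proof (intro allI ballI impI, unfold comp_def)
  fix u :: "nat \<Rightarrow> real" and a :: real assume a: "a \<in> {0..1}" and u: "(\<forall>n. u n \<in> {0..1}) \<and> u \<longlonglongrightarrow> a"
  show "(\<lambda>n. LINT x|lborel. Q (u n) x) \<longlonglongrightarrow> (LINT x|lborel. Q a x)"
  proof (rule integral_dominated_convergence[where w = "\<lambda>x. f x + g x"])
    show "Q a \<in> borel_measurable lborel" "Q (u n) \<in> borel_measurable lborel" for n using Q_measurable by auto
    show "integrable lborel (\<lambda>x. f x + g x)" using fint g_int by simp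
    show "AE x in lborel. (\<lambda>n. Q (u n) x) \<longlonglongrightarrow> Q a x"
    proof (rule AE_I2)
      fix x
      show "(\<lambda>n. Q (u n) x) \<longlonglongrightarrow> Q a x"
      proof (cases "f x = 0 \<or> g x = 0")
        case True
        thus ?thesis by (auto simp: geo_path_def)
      next
        case False
        thus ?thesis unfolding geo_path_def using u by (intro tendsto_intros) auto
      qed
    qed
    show "AE x in lborel. norm (Q (u n) x) \<le> f x + g x" for n
    proof (rule AE_I2)
      fix x
      have un: "0 \<le> u n" "u n \<le> 1" using u by auto
      have "Q (u n) x \<le> u n * f x + (1 - u n) * g x" by (rule Q_le[OF un])
      also have "\<dots> \<le> 1 * f x + 1 * g x" using un fnn[of x] g_nonneg[of x] by (intro add_mono mult_right_mono) auto
      finally show "norm (Q (u n) x) \<le> f x + g x" using Q_nonneg by simp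
    qed
  qed
qed

lemma path_ivt:
  assumes "hellinger_sq (Q 0) g \<le> v" "v \<le> hellinger_sq (Q 1) g"
  shows "\<exists>s. 0 \<le> s \<and> s \<le> 1 \<and> hellinger_sq (Q s) g = v"
proof -
  have "continuous_on {0..1} (\<lambda>s. (Z s + 1) / 2 - Z (s / 2))"
    by (intro continuous_intros Z_cont continuous_on_compose2[OF Z_cont]) auto
  hence "continuous_on {0..1} (\<lambda>s. hellinger_sq (Q s) g)"
    by (rule continuous_on_eq) (use Q_hellinger in auto)
  thus ?thesis using IVT'[of "\<lambda>s. hellinger_sq (Q s) g" 0 v 1] assms by auto
qed

text \<open>As \<open>0 powr 0 = 0\<close>, the path starts at \<open>g\<close> cut to the support
  of \<open>f\<close> and not at \<open>g\<close>. The part cut off lies outside the central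
  interval and has mass at most twice a tail.\<close>

lemma path_start:
  assumes "\<And>x. \<bar>x\<bar> < t L \<Longrightarrow> 0 < f x"
  shows "hellinger_sq (Q 0) g \<le> (1/2) ^ (L + 1)"
proof -
  have i: "integrable lborel (\<lambda>x. indicator {t L..} x *\<^sub>R g x)" "integrable lborel (\<lambda>x. indicator {t L..} (- x) *\<^sub>R g x)"
  proof -
    show "integrable lborel (\<lambda>x. indicator {t L..} x *\<^sub>R g x)" using g_set_int[of "{t L..}"] by (simp add: set_integrable_def)
    have "(\<lambda>x. indicator {t L..} (- x) *\<^sub>R g x) = (\<lambda>x. indicator {..- t L} x *\<^sub>R g x)" by (auto simp: indicator_def)
    thus "integrable lborel (\<lambda>x. indicator {t L..} (- x) *\<^sub>R g x)" using g_set_int[of "{..- t L}"] by (simp add: set_integrable_def)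
  qed
  have "(LINT x|lborel. (sqrt (Q 0 x) - sqrt (g x))\<^sup>2) \<le> (LINT x|lborel. indicator {t L..} x *\<^sub>R g x + indicator {t L..} (- x) *\<^sub>R g x)"
  proof (rule integral_mono)
    show "integrable lborel (\<lambda>x. (sqrt (Q 0 x) - sqrt (g x))\<^sup>2)"
      by (rule integrable_sqrt_diff[OF Q_integrable g_int Q_nonneg g_nonneg]) auto
    show "integrable lborel (\<lambda>x. indicator {t L..} x *\<^sub>R g x + indicator {t L..} (- x) *\<^sub>R g x)" using i by simp
    fix x
    show "(sqrt (Q 0 x) - sqrt (g x))\<^sup>2 \<le> indicator {t L..} x *\<^sub>R g x + indicator {t L..} (- x) *\<^sub>R g x"
    proof (cases "\<bar>x\<bar> < t L")
      case True
      thus ?thesis using assms[OF True] by (auto simp: geo_path_def g_nonneg)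
    next
      case False
      have "(sqrt (Q 0 x) - sqrt (g x))\<^sup>2 \<le> g x"
        using g_nonneg[of x] fnn[of x] by (cases "f x = 0") (auto simp: geo_path_def)
      thus ?thesis using False g_nonneg[of x] by (auto simp: indicator_def abs_if split: if_splits)
    qed
  qed
  also have "\<dots> = (LINT x|lborel. indicator {t L..} x *\<^sub>R g x) + (LINT x|lborel. indicator {t L..} (- x) *\<^sub>R g x)" using i by simp
  also have "(LINT x|lborel. indicator {t L..} (- x) *\<^sub>R g x) = (LINT x|lborel. indicator {t L..} x *\<^sub>R g x)"
    by (subst lborel_integral_real_affine[of "-1" _ 0]) (auto simp: sym)
  also have "(LINT x|lborel. indicator {t L..} x *\<^sub>R g x) = (1/2) ^ (L + 1)"
    using T_t[of L] by (simp add: T_def set_lebesgue_integral_def)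
  finally show ?thesis by (simp add: hellinger_sq_def)
qed

text \<open>The path ends at \<open>f\<close> cut to the support of \<open>g\<close>. The mass of
  \<open>f\<close> off that support is at most the mass by which \<open>Q 1\<close> falls short of
  \<open>g\<close>, and Young's inequality with free parameter \<open>\<eta>\<close> bounds this
  shortfall by the distance of \<open>Q 1\<close> from \<open>g\<close>.\<close>

lemma path_end:
  assumes \<eta>: "0 < \<eta>"
  shows "hellinger_sq f g \<le> hellinger_sq (Q 1) g + 1/2 * (\<eta> + 2 / \<eta> * hellinger_sq (Q 1) g)"
proof -
  let ?v = "hellinger_sq (Q 1) g"
  have Q1: "Q 1 x = (if g x = 0 then 0 else f x)" for x using fnn[of x] by (simp add: geo_path_def)
  have i1: "integrable lborel (\<lambda>x. (sqrt (Q 1 x) - sqrt (g x))\<^sup>2)"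
    by (rule integrable_sqrt_diff[OF Q_integrable g_int Q_nonneg g_nonneg]) auto
  have if1: "integrable lborel (\<lambda>x. f x - Q 1 x)" using fint Q_integrable[of 1] by simp
  have "(sqrt (f x) - sqrt (g x))\<^sup>2 = (sqrt (Q 1 x) - sqrt (g x))\<^sup>2 + (f x - Q 1 x)" for x
    using fnn[of x] by (simp add: Q1)
  hence "hellinger_sq f g = ?v + 1/2 * (LINT x|lborel. f x - Q 1 x)"
    using i1 if1 by (simp add: hellinger_sq_def)
  also have "(LINT x|lborel. f x - Q 1 x) \<le> \<eta> + 2 / \<eta> * ?v"
  proof -
    have "(LINT x|lborel. f x - Q 1 x) = (LINT x|lborel. f x) - (LINT x|lborel. Q 1 x)" using fint Q_integrable[of 1] by simp
    also have "\<dots> \<le> (LINT x|lborel. g x - Q 1 x)" using fle g_total g_int Q_integrable[of 1] by simp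
    also have "\<dots> \<le> (LINT x|lborel. \<eta> * g x + 1 / \<eta> * (sqrt (Q 1 x) - sqrt (g x))\<^sup>2)"
    proof (rule integral_mono)
      fix x
      define a b where "a = sqrt (Q 1 x)" and "b = sqrt (g x)"
      have ab: "Q 1 x = a\<^sup>2" "g x = b\<^sup>2" using Q_nonneg[of 1 x] g_nonneg[of x] by (auto simp: a_def b_def)
      have "0 \<le> (\<eta> * b - (b - a))\<^sup>2 / \<eta>" using \<eta> by simp
      also have "\<dots> = \<eta> * b\<^sup>2 - 2 * b * (b - a) + 1 / \<eta> * (a - b)\<^sup>2" using \<eta> by (simp add: power2_eq_square field_simps)
      also have "\<dots> \<le> \<eta> * b\<^sup>2 - (b\<^sup>2 - a\<^sup>2) + 1 / \<eta> * (a - b)\<^sup>2"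
      proof -
        have "0 \<le> (b - a)\<^sup>2" by simp
        hence "b\<^sup>2 - a\<^sup>2 \<le> 2 * b * (b - a)" by (simp add: power2_eq_square algebra_simps)
        thus ?thesis by simp
      qed
      finally have "b\<^sup>2 - a\<^sup>2 \<le> \<eta> * b\<^sup>2 + 1 / \<eta> * (a - b)\<^sup>2" by simp
      thus "g x - Q 1 x \<le> \<eta> * g x + 1 / \<eta> * (sqrt (Q 1 x) - sqrt (g x))\<^sup>2"
        by (simp add: a_def b_def Q_nonneg g_nonneg)
    qed (use g_int Q_integrable[of 1] i1 in auto)
    also have "\<dots> = \<eta> + 2 / \<eta> * ?v" using g_int i1 g_total by (simp add: hellinger_sq_def)
    finally show ?thesis .
  qed
  finally show ?thesis by simp
qed

end

end

context slc_sample
begin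

text \<open>Every point of the path has likelihood at least that of \<open>g\<close>, so
  \<open>local_rate\<close> applies as soon as its distance is at most \<open>\<delta>\<close>. If
  the path passed the level \<open>v\<close>, a point at distance exactly \<open>v\<close> would
  violate the local rate, which \<open>D'\<close> makes smaller than \<open>v\<close>.\<close>

theorem uniform_rate:
  "\<exists>D\<ge>1. \<forall>n \<nu> \<kappa>. 1 \<le> n \<longrightarrow> 0 < \<nu> \<longrightarrow> \<nu> ^ 5 = real n \<longrightarrow> 1 \<le> \<kappa> \<longrightarrow> D * \<kappa> \<le> \<nu> ^ 4 \<longrightarrow>
    (\<exists>G\<in>events. prob (space \<Omega> - G) \<le> 2 ^ 203 / \<kappa>\<^sup>2 \<and> (\<forall>\<omega>\<in>G. (\<forall>i\<in>{1..n}. 0 < g (Y i \<omega>) \<and> Y i \<omega> \<noteq> 0) \<longrightarrow>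
      (\<forall>f. lc_subdensity f \<longrightarrow> (\<forall>i\<in>{1..n}. 0 < f (Y i \<omega>)) \<longrightarrow>
        (\<Sum>i\<in>{1..n}. ln (g (Y i \<omega>))) \<le> (\<Sum>i\<in>{1..n}. ln (f (Y i \<omega>))) \<longrightarrow>
        hellinger_sq f g \<le> 2 ^ 33 * (\<kappa> / \<nu> ^ 4))))"
proof -
  obtain \<delta> where \<delta>: "0 < \<delta>" and loc: "\<forall>L. \<exists>D\<ge>1. \<forall>n \<nu> \<kappa>. 1 \<le> n \<longrightarrow> 0 < \<nu> \<longrightarrow> \<nu> ^ 5 = real n \<longrightarrow> 1 \<le> \<kappa> \<longrightarrow> D * \<kappa> \<le> \<nu> ^ 4 \<longrightarrow>
    (\<exists>G\<in>events. prob (space \<Omega> - G) \<le> 2 ^ 203 / \<kappa>\<^sup>2 \<and> (\<forall>\<omega>\<in>G. (\<forall>i\<in>{1..n}. 0 < g (Y i \<omega>) \<and> Y i \<omega> \<noteq> 0) \<longrightarrow>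
      (\<exists>i\<in>{1..n}. t L \<le> Y i \<omega>) \<and> (\<exists>i\<in>{1..n}. Y i \<omega> \<le> - t L) \<and>
      (\<forall>f. lc_subdensity f \<longrightarrow> (\<forall>i\<in>{1..n}. 0 < f (Y i \<omega>)) \<longrightarrow>
        (\<Sum>i\<in>{1..n}. ln (g (Y i \<omega>))) \<le> (\<Sum>i\<in>{1..n}. ln (f (Y i \<omega>))) \<longrightarrow>
        hellinger_sq f g \<le> \<delta> \<longrightarrow> hellinger_sq f g \<le> 2 ^ 33 * (\<kappa> / \<nu> ^ 4))))"
    using local_rate by blast
  \<comment> \<open>Chosen for \<open>path_end\<close> with \<open>\<eta> = \<delta> / 2\<close>:
    the bound there becomes \<open>\<delta> / 2 + \<delta> / 4 + \<delta> / 4\<close>.\<close>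
  define v where "v = min (\<delta> / 2) (\<delta>\<^sup>2 / 8)"
  have v: "0 < v" "v \<le> \<delta> / 2" "v \<le> \<delta>\<^sup>2 / 8" using \<delta> by (auto simp: v_def)
  obtain L where "(1/2::real) ^ L < v" using real_arch_pow_inv[OF v(1), of "1/2"] by auto
  moreover have "(1/2::real) ^ (L + 1) \<le> (1/2) ^ L" by (rule power_decreasing) auto
  ultimately have L: "(1/2::real) ^ (L + 1) \<le> v" by linarith
  obtain D where D: "1 \<le> D" and locD: "\<And>n \<nu> \<kappa>. 1 \<le> n \<Longrightarrow> 0 < \<nu> \<Longrightarrow> \<nu> ^ 5 = real n \<Longrightarrow> 1 \<le> \<kappa> \<Longrightarrow> D * \<kappa> \<le> \<nu> ^ 4 \<Longrightarrow>
    (\<exists>G\<in>events. prob (space \<Omega> - G) \<le> 2 ^ 203 / \<kappa>\<^sup>2 \<and> (\<forall>\<omega>\<in>G. (\<forall>i\<in>{1..n}. 0 < g (Y i \<omega>) \<and> Y i \<omega> \<noteq> 0) \<longrightarrow>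
      (\<exists>i\<in>{1..n}. t L \<le> Y i \<omega>) \<and> (\<exists>i\<in>{1..n}. Y i \<omega> \<le> - t L) \<and>
      (\<forall>f. lc_subdensity f \<longrightarrow> (\<forall>i\<in>{1..n}. 0 < f (Y i \<omega>)) \<longrightarrow>
        (\<Sum>i\<in>{1..n}. ln (g (Y i \<omega>))) \<le> (\<Sum>i\<in>{1..n}. ln (f (Y i \<omega>))) \<longrightarrow>
        hellinger_sq f g \<le> \<delta> \<longrightarrow> hellinger_sq f g \<le> 2 ^ 33 * (\<kappa> / \<nu> ^ 4))))"
    using loc[rule_format, of L] by blast
  define D' where "D' = D + 2 ^ 34 / v"
  show ?thesis
  proof (intro exI[of _ D'] conjI allI impI)
    have "0 \<le> 2 ^ 34 / v" using v by simp
    thus "1 \<le> D'" using D unfolding D'_def by linarith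
    fix n :: nat and \<nu> \<kappa> :: real
    assume n: "1 \<le> n" and \<nu>: "0 < \<nu>" "\<nu> ^ 5 = real n" and \<kappa>: "1 \<le> \<kappa>" and DK: "D' * \<kappa> \<le> \<nu> ^ 4"
    have DK1: "D * \<kappa> \<le> \<nu> ^ 4" and DK2: "2 ^ 34 / v * \<kappa> \<le> \<nu> ^ 4"
    proof -
      have "0 \<le> 2 ^ 34 / v * \<kappa>" "0 \<le> D * \<kappa>" using v \<kappa> D by auto
      moreover have "D' * \<kappa> = D * \<kappa> + 2 ^ 34 / v * \<kappa>" unfolding D'_def by (rule distrib_right)
      ultimately show "D * \<kappa> \<le> \<nu> ^ 4" "2 ^ 34 / v * \<kappa> \<le> \<nu> ^ 4" using DK by linarith+
    qed
    have "2 * (2 ^ 33 * (\<kappa> / \<nu> ^ 4)) \<le> v" using DK2 v \<nu> by (simp add: field_simps)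
    hence small: "2 ^ 33 * (\<kappa> / \<nu> ^ 4) < v" using v by linarith
    obtain G where G: "G \<in> events" "prob (space \<Omega> - G) \<le> 2 ^ 203 / \<kappa>\<^sup>2"
      and Gp: "\<And>\<omega>. \<omega> \<in> G \<Longrightarrow> (\<forall>i\<in>{1..n}. 0 < g (Y i \<omega>) \<and> Y i \<omega> \<noteq> 0) \<Longrightarrow>
      (\<exists>i\<in>{1..n}. t L \<le> Y i \<omega>) \<and> (\<exists>i\<in>{1..n}. Y i \<omega> \<le> - t L) \<and>
      (\<forall>f. lc_subdensity f \<longrightarrow> (\<forall>i\<in>{1..n}. 0 < f (Y i \<omega>)) \<longrightarrow>
        (\<Sum>i\<in>{1..n}. ln (g (Y i \<omega>))) \<le> (\<Sum>i\<in>{1..n}. ln (f (Y i \<omega>))) \<longrightarrow>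
        hellinger_sq f g \<le> \<delta> \<longrightarrow> hellinger_sq f g \<le> 2 ^ 33 * (\<kappa> / \<nu> ^ 4))"
      using locD[OF n \<nu> \<kappa> DK1] by blast
    show "\<exists>G\<in>events. prob (space \<Omega> - G) \<le> 2 ^ 203 / \<kappa>\<^sup>2 \<and> (\<forall>\<omega>\<in>G. (\<forall>i\<in>{1..n}. 0 < g (Y i \<omega>) \<and> Y i \<omega> \<noteq> 0) \<longrightarrow>
      (\<forall>f. lc_subdensity f \<longrightarrow> (\<forall>i\<in>{1..n}. 0 < f (Y i \<omega>)) \<longrightarrow>
        (\<Sum>i\<in>{1..n}. ln (g (Y i \<omega>))) \<le> (\<Sum>i\<in>{1..n}. ln (f (Y i \<omega>))) \<longrightarrow>
        hellinger_sq f g \<le> 2 ^ 33 * (\<kappa> / \<nu> ^ 4)))"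
    proof (intro bexI[of _ G] conjI ballI impI allI G)
      fix \<omega> f
      assume w: "\<omega> \<in> G" and dat: "\<forall>i\<in>{1..n}. 0 < g (Y i \<omega>) \<and> Y i \<omega> \<noteq> 0" and f: "lc_subdensity f"
        and fp: "\<forall>i\<in>{1..n}. 0 < f (Y i \<omega>)" and lik: "(\<Sum>i\<in>{1..n}. ln (g (Y i \<omega>))) \<le> (\<Sum>i\<in>{1..n}. ln (f (Y i \<omega>)))"
      note Gw = Gp[OF w dat]
      obtain i1 i2 where i12: "i1 \<in> {1..n}" "t L \<le> Y i1 \<omega>" "i2 \<in> {1..n}" "Y i2 \<omega> \<le> - t L" using Gw by blast
      have fpos: "0 < f x" if "\<bar>x\<bar> < t L" for x
        by (rule log_concave_between(1)[OF lc_subdensityD(1)[OF f], of "Y i2 \<omega>" x "Y i1 \<omega>"]) (use that i12 fp in auto)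
      have start: "hellinger_sq (geo_path g f 0) g \<le> v" using path_start[OF f, of L] fpos L by fastforce
      have end1: "hellinger_sq (geo_path g f 1) g \<le> v"
      proof (rule ccontr)
        assume "\<not> ?thesis"
        then obtain s where s: "0 \<le> s" "s \<le> 1" "hellinger_sq (geo_path g f s) g = v"
          using path_ivt[OF f start] by auto
        have "(\<Sum>i\<in>{1..n}. ln (g (Y i \<omega>))) \<le> (\<Sum>i\<in>{1..n}. ln (geo_path g f s (Y i \<omega>)))"
        proof -
          have "(\<Sum>i\<in>{1..n}. ln (geo_path g f s (Y i \<omega>))) = (\<Sum>i\<in>{1..n}. s * ln (f (Y i \<omega>)) + (1 - s) * ln (g (Y i \<omega>)))"
            by (rule sum.cong) (use Q_ln[OF f] fp dat in auto)
          also have "\<dots> = s * (\<Sum>i\<in>{1..n}. ln (f (Y i \<omega>))) + (1 - s) * (\<Sum>i\<in>{1..n}. ln (g (Y i \<omega>)))"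
            by (simp add: sum.distrib sum_distrib_left)
          also have "\<dots> \<ge> s * (\<Sum>i\<in>{1..n}. ln (g (Y i \<omega>))) + (1 - s) * (\<Sum>i\<in>{1..n}. ln (g (Y i \<omega>)))"
            using lik s by (intro add_mono mult_left_mono) auto
          finally show ?thesis by (simp add: algebra_simps)
        qed
        moreover have "\<forall>i\<in>{1..n}. 0 < geo_path g f s (Y i \<omega>)" using Q_pos_iff[OF f] fp dat by auto
        moreover have "hellinger_sq (geo_path g f s) g \<le> \<delta>" using s v \<delta> by simp
        ultimately have "hellinger_sq (geo_path g f s) g \<le> 2 ^ 33 * (\<kappa> / \<nu> ^ 4)"
          using Gw Q_lc_subdensity[OF f s(1,2)] by blast
        thus False using s small by linarith
      qed
      have "hellinger_sq f g \<le> \<delta>"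
      proof -
        let ?v = "hellinger_sq (geo_path g f 1) g"
        have "hellinger_sq f g \<le> ?v + 1/2 * (\<delta> / 2 + 2 / (\<delta> / 2) * ?v)" by (rule path_end[OF f]) (use \<delta> in simp)
        also have "\<dots> \<le> \<delta> / 2 + 1/2 * (\<delta> / 2 + 2 / (\<delta> / 2) * (\<delta>\<^sup>2 / 8))"
          using end1 v \<delta> by (intro add_mono mult_left_mono) auto
        also have "\<dots> = \<delta>" using \<delta> by (simp add: power2_eq_square field_simps)
        finally show ?thesis .
      qed
      thus "hellinger_sq f g \<le> 2 ^ 33 * (\<kappa> / \<nu> ^ 4)" using Gw f fp lik by blast
    qed
  qed
qed

end

section \<open>Maximum likelihood estimates\<close>

lemma exp_ext_pos_iff: "0 < exp_ext y \<longleftrightarrow> \<bar>y\<bar> \<noteq> \<infinity>"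
  by (simp add: exp_ext_def)

lemma exp_ext_nonneg: "0 \<le> exp_ext y" by (simp add: exp_ext_def)

lemma exp_ext_ln: "0 < exp_ext y \<Longrightarrow> y = ereal (ln (exp_ext y))"
  by (auto simp: exp_ext_def ereal_real split: if_splits)

lemma exp_ext_log_ext: "0 \<le> y \<Longrightarrow> exp_ext (log_ext y) = y"
  by (auto simp: exp_ext_def log_ext_def)

text \<open>A superlevel set at positive height is a section of the hypograph and hence closed; this
  is how closedness of \<open>\<psi>\<close> yields measurability.\<close>

lemma closed_proper_concave_exp:
  assumes \<psi>: "\<psi> \<in> closed_proper_concave"
  shows "log_concave (\<lambda>x. exp_ext (\<psi> x))" "(\<lambda>x. exp_ext (\<psi> x)) \<in> borel_measurable borel"
proof -
  have cv: "convex (hypograph \<psi>)" and cl: "closed (hypograph \<psi>)" and fin: "\<And>x. \<psi> x < \<infinity>"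
    using \<psi> by (auto simp: closed_proper_concave_def)
  have pos: "0 < exp_ext (\<psi> x) \<longleftrightarrow> \<psi> x \<noteq> -\<infinity>" for x
    using fin[of x] by (auto simp: exp_ext_pos_iff)
  show "log_concave (\<lambda>x. exp_ext (\<psi> x))" unfolding log_concave_def
  proof (intro conjI allI impI)
    show "0 \<le> exp_ext (\<psi> x)" for x by (rule exp_ext_nonneg)
    fix x y u :: real assume u: "0 \<le> u" "u \<le> 1" and p: "0 < exp_ext (\<psi> x)" "0 < exp_ext (\<psi> y)"
    let ?z = "(1 - u) * x + u * y" and ?r = "(1 - u) * ln (exp_ext (\<psi> x)) + u * ln (exp_ext (\<psi> y))"
    have "(x, ln (exp_ext (\<psi> x))) \<in> hypograph \<psi>" "(y, ln (exp_ext (\<psi> y))) \<in> hypograph \<psi>"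
      using exp_ext_ln[OF p(1)] exp_ext_ln[OF p(2)] by (auto simp: hypograph_def)
    hence "(1 - u) *\<^sub>R (x, ln (exp_ext (\<psi> x))) + u *\<^sub>R (y, ln (exp_ext (\<psi> y))) \<in> hypograph \<psi>"
      using u by (intro convexD_alt[OF cv]) auto
    hence z: "ereal ?r \<le> \<psi> ?z" by (simp add: hypograph_def)
    hence "\<psi> ?z \<noteq> -\<infinity>" by auto
    thus pz: "0 < exp_ext (\<psi> ?z)" by (simp add: pos)
    have "ereal ?r \<le> ereal (ln (exp_ext (\<psi> ?z)))" using z exp_ext_ln[OF pz] by simp
    thus "?r \<le> ln (exp_ext (\<psi> ?z))" by simp
  qed
  show "(\<lambda>x. exp_ext (\<psi> x)) \<in> borel_measurable borel"
    unfolding borel_measurable_iff_ge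
  proof
    fix c :: real
    show "{x \<in> space borel. c \<le> exp_ext (\<psi> x)} \<in> sets borel"
    proof (cases "0 < c")
      case True
      have "c \<le> exp_ext (\<psi> x) \<longleftrightarrow> (x, ln c) \<in> hypograph \<psi>" for x
      proof (cases "0 < exp_ext (\<psi> x)")
        case p: True
        have "(x, ln c) \<in> hypograph \<psi> \<longleftrightarrow> ereal (ln c) \<le> ereal (ln (exp_ext (\<psi> x)))"
          using exp_ext_ln[OF p] by (simp add: hypograph_def)
        also have "\<dots> \<longleftrightarrow> c \<le> exp_ext (\<psi> x)" using p True by simp
        finally show ?thesis by simp
      next
        case False
        thus ?thesis using True pos[of x] exp_ext_nonneg[of "\<psi> x"] by (auto simp: hypograph_def)
      qed
      hence "{x \<in> space borel. c \<le> exp_ext (\<psi> x)} = (\<lambda>x. (x, ln c)) -` hypograph \<psi>" by auto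
      moreover have "closed ((\<lambda>x. (x, ln c)) -` hypograph \<psi>)"
        by (intro closed_vimage cl continuous_intros)
      ultimately show ?thesis by simp
    next
      case False
      hence "{x \<in> space borel. c \<le> exp_ext (\<psi> x)} = UNIV" by (auto intro: order_trans[OF _ exp_ext_nonneg])
      thus ?thesis by simp
    qed
  qed
qed

lemma log_concave_shift: assumes "log_concave f" shows "log_concave (\<lambda>x. f (x - \<theta>))"
  unfolding log_concave_def
proof (intro conjI allI impI)
  show "0 \<le> f (x - \<theta>)" for x by (rule log_concave_nonneg[OF assms])
  fix x y u :: real assume "0 \<le> u" "u \<le> 1" "0 < f (x - \<theta>)" "0 < f (y - \<theta>)"
  moreover have "(1 - u) * x + u * y - \<theta> = (1 - u) * (x - \<theta>) + u * (y - \<theta>)" by (simp add: algebra_simps)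
  ultimately show "0 < f ((1 - u) * x + u * y - \<theta>)"
    "(1 - u) * ln (f (x - \<theta>)) + u * ln (f (y - \<theta>)) \<le> ln (f ((1 - u) * x + u * y - \<theta>))"
    using assms unfolding log_concave_def by metis+
qed

text \<open>A vertical translation of the hypograph. These competitors force the maximizer to have
  total mass 1.\<close>

lemma SC0_add_const: assumes \<psi>: "\<psi> \<in> SC0" shows "(\<lambda>x. \<psi> x + ereal c) \<in> SC0"
proof -
  have cv: "convex (hypograph \<psi>)" and cl: "closed (hypograph \<psi>)" and fin: "\<And>x. \<psi> x < \<infinity>" and ne: "\<exists>x. - \<infinity> < \<psi> x"
    and sy: "\<And>x. \<psi> (- x) = \<psi> x" using \<psi> by (auto simp: SC0_def closed_proper_concave_def)
  have eq: "hypograph (\<lambda>x. \<psi> x + ereal c) = (\<lambda>z. (0, c) + z) ` hypograph \<psi>"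
  proof (rule set_eqI)
    fix z :: "real \<times> real"
    obtain x r where z: "z = (x, r)" by (cases z)
    have "z \<in> hypograph (\<lambda>x. \<psi> x + ereal c) \<longleftrightarrow> (x, r - c) \<in> hypograph \<psi>"
      unfolding z by (cases "\<psi> x") (auto simp: hypograph_def)
    also have "\<dots> \<longleftrightarrow> z \<in> (\<lambda>z. (0, c) + z) ` hypograph \<psi>" unfolding z by force
    finally show "z \<in> hypograph (\<lambda>x. \<psi> x + ereal c) \<longleftrightarrow> z \<in> (\<lambda>z. (0, c) + z) ` hypograph \<psi>" .
  qed
  have "convex (hypograph (\<lambda>x. \<psi> x + ereal c))" unfolding eq by (rule convex_translation[OF cv])
  moreover have "closed (hypograph (\<lambda>x. \<psi> x + ereal c))" unfolding eq by (rule closed_translation[OF cl])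
  moreover have "\<psi> x + ereal c < \<infinity>" for x using fin[of x] by (cases "\<psi> x") auto
  moreover have "\<exists>x. - \<infinity> < \<psi> x + ereal c"
  proof -
    obtain x where "- \<infinity> < \<psi> x" using ne by blast
    hence "- \<infinity> < \<psi> x + ereal c" by (cases "\<psi> x") auto
    thus ?thesis by blast
  qed
  ultimately show ?thesis using sy by (auto simp: SC0_def closed_proper_concave_def)
qed

lemma exp_ext_add: "y < \<infinity> \<Longrightarrow> exp_ext (y + ereal c) = exp c * exp_ext y"
  by (cases y) (auto simp: exp_ext_def exp_add)

lemma sum_ereal_eq: "(\<And>i. i \<in> A \<Longrightarrow> a i = ereal (b i)) \<Longrightarrow> (\<Sum>i\<in>A. a i) = ereal (\<Sum>i\<in>A. b i)"
  using sum.cong[of A A a "\<lambda>i. ereal (b i)"] by (simp add: sum_ereal)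

lemma SLC0_SC0: "g \<in> SLC0 \<Longrightarrow> (\<lambda>x. log_ext (g x)) \<in> SC0"
  by (auto simp: SLC0_def SC0_def)

text \<open>Compared with \<open>\<psi> + c\<close>, the objective changes by way of
  \<open>c - exp c * S\<close>, which must be largest at \<open>c = 0\<close>; this forces
  \<open>S = 1\<close>. The penalty terms of fit and truth then agree, so comparing objectives means
  comparing likelihoods. The finite objective of the truth excludes the value -infinity at the
  data.\<close>

lemma MLE_density:
  assumes mle: "is_MLE n x \<theta> \<psi>" and n: "1 \<le> n" and g: "g \<in> SLC0" and gp: "\<And>i. i \<in> {1..n} \<Longrightarrow> 0 < g (x i - \<theta>0)"
  defines "f \<equiv> \<lambda>y. exp_ext (\<psi> (y - \<theta>))"
  shows "lc_subdensity f" "\<And>i. i \<in> {1..n} \<Longrightarrow> 0 < f (x i)"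
    "(\<Sum>i\<in>{1..n}. ln (g (x i - \<theta>0))) \<le> (\<Sum>i\<in>{1..n}. ln (f (x i)))"
proof -
  have \<psi>: "\<psi> \<in> SC0" and opt: "\<And>\<theta>' \<psi>'. \<psi>' \<in> SC0 \<Longrightarrow> log_lik n x \<theta>' \<psi>' \<le> log_lik n x \<theta> \<psi>"
    using mle by (auto simp: is_MLE_def)
  have \<psi>c: "\<psi> \<in> closed_proper_concave" and fin: "\<And>x. \<psi> x < \<infinity>" using \<psi> by (auto simp: SC0_def closed_proper_concave_def)
  have np: "0 < real n" using n by simp
  have lcf: "log_concave f" unfolding f_def by (rule log_concave_shift[OF closed_proper_concave_exp(1)[OF \<psi>c]])
  have fm[measurable]: "f \<in> borel_measurable borel"
    unfolding f_def by (rule measurable_compose[OF _ closed_proper_concave_exp(2)[OF \<psi>c]]) simp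
  have f0: "0 \<le> f y" for y by (simp add: f_def exp_ext_nonneg)
  define L0 where "L0 = (1 / real n) * (\<Sum>i\<in>{1..n}. ln (g (x i - \<theta>0)))"
  have ll0: "log_lik n x \<theta>0 (\<lambda>x. log_ext (g x)) = ereal (L0 - 1)"
  proof -
    have gd: "g \<in> borel_measurable borel" "\<And>x. 0 \<le> g x" "(\<integral>\<^sup>+ x. ennreal (g x) \<partial>lborel) = 1"
      using g by (auto simp: SLC0_def is_density_def)
    have "(\<Sum>i\<in>{1..n}. log_ext (g (x i - \<theta>0))) = ereal (\<Sum>i\<in>{1..n}. ln (g (x i - \<theta>0)))"
      by (rule sum_ereal_eq) (use gp in \<open>force simp: log_ext_def\<close>)
    moreover have "(\<integral>\<^sup>+ y. ennreal (exp_ext (log_ext (g (y - \<theta>0)))) \<partial>lborel) = (\<integral>\<^sup>+ y. ennreal (g (- \<theta>0 + 1 * y)) \<partial>lborel)"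
      by (simp add: exp_ext_log_ext gd add.commute)
    moreover have "\<dots> = (\<integral>\<^sup>+ y. ennreal (g y) \<partial>lborel)"
      using nn_integral_real_affine[of "\<lambda>y. ennreal (g y)" 1 "- \<theta>0"] gd by simp
    ultimately have "log_lik n x \<theta>0 (\<lambda>x. log_ext (g x)) = ereal (1 / real n) * ereal (\<Sum>i\<in>{1..n}. ln (g (x i - \<theta>0))) - enn2ereal 1"
      unfolding log_lik_def by (simp only: gd)
    thus ?thesis unfolding L0_def by (simp add: one_ennreal.rep_eq one_ereal_def)
  qed
  have ge: "ereal (L0 - 1) \<le> log_lik n x \<theta> \<psi>" using opt[OF SLC0_SC0[OF g], of \<theta>0] unfolding ll0 .
  show fp: "0 < f (x i)" if i: "i \<in> {1..n}" for i
  proof (rule ccontr)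
    assume "\<not> 0 < f (x i)"
    hence m: "\<psi> (x i - \<theta>) = -\<infinity>" using fin[of "x i - \<theta>"] by (auto simp: f_def exp_ext_pos_iff)
    have "(\<Sum>i\<in>{1..n} - {i}. \<psi> (x i - \<theta>)) \<noteq> \<infinity>"
      using fin by (auto simp: sum_Pinfty dest: less_imp_neq)
    hence "(\<Sum>i\<in>{1..n}. \<psi> (x i - \<theta>)) = -\<infinity>"
      using sum.remove[OF _ i, of "\<lambda>i. \<psi> (x i - \<theta>)"] 
      by (cases "\<Sum>i\<in>{1..n} - {i}. \<psi> (x i - \<theta>)") (simp_all add: m)
    hence "log_lik n x \<theta> \<psi> = -\<infinity>"
      using np enn2ereal_nonneg[of "\<integral>\<^sup>+ y. ennreal (exp_ext (\<psi> (y - \<theta>))) \<partial>lborel"] unfolding log_lik_def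
      by (cases "enn2ereal (\<integral>\<^sup>+ y. ennreal (exp_ext (\<psi> (y - \<theta>))) \<partial>lborel)") auto
    thus False using ge by simp
  qed
  define L where "L = (1 / real n) * (\<Sum>i\<in>{1..n}. ln (f (x i)))"
  define I where "I = (\<integral>\<^sup>+ y. ennreal (f y) \<partial>lborel)"
  have ps: "\<psi> (x i - \<theta>) = ereal (ln (f (x i)))" if "i \<in> {1..n}" for i
    using exp_ext_ln[of "\<psi> (x i - \<theta>)"] fp[OF that] by (simp add: f_def)
  have "(\<Sum>i\<in>{1..n}. \<psi> (x i - \<theta>)) = ereal (\<Sum>i\<in>{1..n}. ln (f (x i)))" by (rule sum_ereal_eq) (rule ps)
  hence ll: "log_lik n x \<theta> \<psi> = ereal L - enn2ereal I" by (simp add: log_lik_def L_def I_def f_def)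
  have "I \<noteq> \<infinity>"
  proof
    assume I: "I = \<infinity>"
    show False using ge unfolding ll I by simp
  qed
  then obtain S where S: "0 \<le> S" "I = ennreal S" by (cases I) auto
  have llS: "log_lik n x \<theta> \<psi> = ereal (L - S)" unfolding ll S(2) using S(1) by (simp add: enn2ereal_ennreal)
  have shift: "log_lik n x \<theta> (\<lambda>x. \<psi> x + ereal c) = ereal (L + c - exp c * S)" for c
  proof -
    have "(\<Sum>i\<in>{1..n}. \<psi> (x i - \<theta>) + ereal c) = ereal (\<Sum>i\<in>{1..n}. ln (f (x i)) + c)"
      by (rule sum_ereal_eq) (simp add: ps)
    moreover have "(\<integral>\<^sup>+ y. ennreal (exp_ext (\<psi> (y - \<theta>) + ereal c)) \<partial>lborel) = ennreal (exp c * S)"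
    proof -
      have "(\<integral>\<^sup>+ y. ennreal (exp_ext (\<psi> (y - \<theta>) + ereal c)) \<partial>lborel) = (\<integral>\<^sup>+ y. ennreal (exp c) * ennreal (f y) \<partial>lborel)"
        by (simp add: exp_ext_add[OF fin] f_def ennreal_mult exp_ext_nonneg)
      also have "\<dots> = ennreal (exp c) * I" unfolding I_def by (rule nn_integral_cmult) simp
      finally show ?thesis using S by (simp add: ennreal_mult)
    qed
    ultimately show ?thesis using np S unfolding log_lik_def
      by (simp add: enn2ereal_ennreal sum.distrib L_def distrib_left)
  qed
  have le: "L + c - exp c * S \<le> L - S" for c
    using opt[OF SC0_add_const[OF \<psi>], of \<theta> c] unfolding shift llS by simp
  \<comment> \<open>\<open>c = 1\<close> excludes \<open>S = 0\<close>; then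
    \<open>c = - ln S\<close> gives \<open>S - 1 \<le> ln S\<close>, which holds only at 1.\<close>
  have Sp: "0 < S" using le[of 1] S(1) by (cases "S = 0") auto
  have "S - 1 \<le> ln S" using le[of "- ln S"] Sp by (simp add: exp_minus)
  hence "ln S = S - 1" using ln_le_minus_one[OF Sp] by simp
  hence S1: "S = 1" using ln_eq_minus_one[OF Sp] by simp
  have "integrable lborel f" by (rule integrableI_nonneg) (use f0 S in \<open>auto simp: I_def[symmetric]\<close>)
  moreover have "(LINT y|lborel. f y) = 1"
    by (subst integral_eq_nn_integral) (use f0 S S1 in \<open>auto simp: I_def[symmetric]\<close>)
  ultimately show "lc_subdensity f" using lcf fm by (simp add: lc_subdensity_def)
  have "L0 - 1 \<le> L - S" using ge unfolding llS by simp
  hence "(1 / real n) * (\<Sum>i\<in>{1..n}. ln (g (x i - \<theta>0))) \<le> (1 / real n) * (\<Sum>i\<in>{1..n}. ln (f (x i)))"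
    using S1 by (simp add: L0_def L_def)
  thus "(\<Sum>i\<in>{1..n}. ln (g (x i - \<theta>0))) \<le> (\<Sum>i\<in>{1..n}. ln (f (x i)))"
    using np by (simp add: divide_le_cancel)
qed

section \<open>Translates of the true density\<close>

context symmetric_log_concave
begin

text \<open>For \<open>w = sqrt g\<close> the integral of \<open>w x - w (x + h)\<close> reduces to
  two strips of width \<open>h\<close>, one at 0 where \<open>w\<close> is large and one beyond
  \<open>T0\<close> where it is small. Completing the square with the constant \<open>c\<close>,
  which is the Cauchy-Schwarz inequality, passes to the integral of the square.\<close>

lemma integral_sqrt_shift_sq_ge:
  assumes Tp: "0 < T0" and wT: "4 * sqrt (g T0) \<le> sqrt (g 0)" and h: "0 \<le> h" and wh: "sqrt (g 0) \<le> 2 * sqrt (g h)"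
  shows "h\<^sup>2 * g 0 / (16 * T0) \<le> integral {0..T0} (\<lambda>x. (sqrt (g x) - sqrt (g (x + h)))\<^sup>2)"
proof -
  define w where "w x = sqrt (g x)" for x
  have cg: "continuous_on UNIV g" using cont by (simp add: continuous_at_imp_continuous_on)
  have cw[continuous_intros]: "continuous_on A (\<lambda>x. w (k x))" if "continuous_on A k" for A :: "real set" and k
    unfolding w_def
    by (rule continuous_on_real_sqrt, rule continuous_on_compose2[OF cg that subset_UNIV])
  have io: "(\<lambda>x. w (x + k)) integrable_on {a..b}" "w integrable_on {a..b}" for a b k
    using cw[of "{a..b}" "\<lambda>x. x"] by (auto intro!: integrable_continuous_real cw continuous_intros)
  have wa: "w y \<le> w x" if "0 \<le> x" "x \<le> y" for x y using g_antimono[OF that] by (simp add: w_def)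
  have "integral {0..h} w + integral {h..T0 + h} w = integral {0..T0 + h} w"
    using h Tp by (intro Henstock_Kurzweil_Integration.integral_combine io) auto
  moreover have "integral {0..T0} w + integral {T0..T0 + h} w = integral {0..T0 + h} w"
    using h Tp by (intro Henstock_Kurzweil_Integration.integral_combine io) auto
  moreover have "integral {0..T0} (\<lambda>x. w (x + h)) = integral {h..T0 + h} w"
    using integral_shift_Icc_real[of 0 T0 w h] by (simp add: add.commute o_def)
  moreover have "integral {0..h} (\<lambda>x. w h) \<le> integral {0..h} w"
    by (rule integral_le) (use wa in \<open>auto intro: io\<close>)
  moreover have "integral {T0..T0 + h} w \<le> integral {T0..T0 + h} (\<lambda>x. w T0)"
    by (rule integral_le) (use wa Tp in \<open>auto intro: io\<close>)
  ultimately have "h * w h - h * w T0 \<le> integral {0..T0} w - integral {0..T0} (\<lambda>x. w (x + h))"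
    using h by simp
  also have "\<dots> = integral {0..T0} (\<lambda>x. w x - w (x + h))"
    by (rule Henstock_Kurzweil_Integration.integral_diff[symmetric]) (rule io)+
  finally have D: "h * (w h - w T0) \<le> integral {0..T0} (\<lambda>x. w x - w (x + h))" by (simp add: algebra_simps)
  have "h * (w 0 / 4) \<le> h * (w h - w T0)" using h wT wh by (intro mult_left_mono) (auto simp: w_def)
  with D have D': "h * w 0 / 4 \<le> integral {0..T0} (\<lambda>x. w x - w (x + h))" by simp
  define c where "c = h * w 0 / (4 * T0)"
  have c0: "0 \<le> c" using h Tp by (simp add: c_def w_def g_nonneg)
  have cT: "c * T0 = h * w 0 / 4" using Tp by (simp add: c_def)
  have dio: "(\<lambda>x. w x - w (x + h)) integrable_on {0..T0}" by (auto intro!: integrable_continuous_real continuous_intros)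
  have "c * (c * T0) = 2 * c * (h * w 0 / 4) - c\<^sup>2 * T0" using cT[symmetric] by (simp add: power2_eq_square algebra_simps)
  also have "\<dots> \<le> 2 * c * integral {0..T0} (\<lambda>x. w x - w (x + h)) - c\<^sup>2 * T0"
    using D' c0 by (intro diff_right_mono mult_left_mono) auto
  also have "\<dots> = integral {0..T0} (\<lambda>x. 2 * c * (w x - w (x + h)) - c\<^sup>2)"
    using Tp dio by (subst Henstock_Kurzweil_Integration.integral_diff) (auto intro: integrable_on_mult_right)
  also have "\<dots> \<le> integral {0..T0} (\<lambda>x. (w x - w (x + h))\<^sup>2)"
  proof (rule integral_le)
    fix x
    have "0 \<le> (w x - w (x + h) - c)\<^sup>2" by simp
    thus "2 * c * (w x - w (x + h)) - c\<^sup>2 \<le> (w x - w (x + h))\<^sup>2"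
      by (simp add: power2_eq_square algebra_simps)
  qed (auto intro!: integrable_continuous_real continuous_intros)
  also have "c * (c * T0) = h\<^sup>2 * g 0 / (16 * T0)"
  proof -
    have "w 0 * w 0 = g 0" by (simp add: w_def g_nonneg)
    hence "h * h * (w 0 * w 0) = h * h * g 0" by simp
    thus ?thesis unfolding cT using Tp by (simp add: c_def power2_eq_square field_simps)
  qed
  finally show ?thesis by (simp add: w_def)
qed

lemma hellinger_shift_eq:
  "hellinger_sq (\<lambda>x. g (x - h)) g = hellinger_sq (\<lambda>x. g (x + \<bar>h\<bar>)) g"
proof (cases "0 \<le> h")
  case True
  have "g (- x - h) = g (x + h)" for x using sym[of "x + h"] by simp
  thus ?thesis using hellinger_sq_reflect[of "\<lambda>x. g (x - h)"] True by simp
qed simp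

text \<open>The cap \<open>h0\<close> is there because the distance is bounded while the shift is
  not. A larger shift is compared with the capped one by monotonicity of \<open>g\<close> on the
  positive half line.\<close>

lemma hellinger_shift_ge:
  "\<exists>c>0. \<exists>h0>0. \<forall>h. c * (min \<bar>h\<bar> h0)\<^sup>2 \<le> hellinger_sq (\<lambda>x. g (x - h)) g"
proof -
  have q0: "0 < q 0" by (rule q_pos)
  obtain L where L: "\<And>l. L \<le> l \<Longrightarrow> q l < q 0 / 16" using q_small[of "q 0 / 16"] q0 by auto
  define T0 where "T0 = t (Suc L)"
  have g0: "0 < g 0" using q0 by (simp add: q_def t_0)
  have Tp: "0 < T0" using t_less_Suc[of L] t_nonneg[of L] by (simp add: T0_def)
  have h0: "0 < t 1" using t_less_Suc[of 0] by (simp add: t_0)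
  have "16 * g T0 \<le> g 0" using L[of "Suc L"] by (simp add: q_def T0_def t_0)
  hence "sqrt (16 * g T0) \<le> sqrt (g 0)" by simp
  hence wT: "4 * sqrt (g T0) \<le> sqrt (g 0)" by (simp add: real_sqrt_mult)
  have "g 0 \<le> 4 * g (t 1)" using q_Suc[of 0] q0 by (simp add: q_def t_0)
  hence "sqrt (g 0) \<le> sqrt (4 * g (t 1))" by simp
  hence w1: "sqrt (g 0) \<le> 2 * sqrt (g (t 1))" by (simp add: real_sqrt_mult)
  have main: "g 0 / (32 * T0) * (min \<bar>h\<bar> (t 1))\<^sup>2 \<le> hellinger_sq (\<lambda>x. g (x - h)) g" for h
  proof -
    define k where "k = min \<bar>h\<bar> (t 1)"
    have k: "0 \<le> k" "k \<le> \<bar>h\<bar>" "k \<le> t 1" using h0 by (auto simp: k_def)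
    have "sqrt (g (t 1)) \<le> sqrt (g k)" using g_antimono k by simp
    hence wk: "sqrt (g 0) \<le> 2 * sqrt (g k)" using w1 by linarith
    let ?D = "\<lambda>x. (sqrt (g x) - sqrt (g (x + k)))\<^sup>2" and ?E = "\<lambda>x. (sqrt (g (x + \<bar>h\<bar>)) - sqrt (g x))\<^sup>2"
    have gi: "integrable lborel (\<lambda>x. g (x + a))" for a
      using lborel_integrable_real_affine[OF g_int, of 1 a] by (simp add: add.commute)
    have cg: "continuous_on A g" for A using cont by (simp add: continuous_at_imp_continuous_on)
    have cD: "continuous_on {0..T0} ?D"
      by (intro continuous_intros continuous_on_compose2[OF cg]) auto
    have "k\<^sup>2 * g 0 / (16 * T0) \<le> integral {0..T0} ?D"
      by (rule integral_sqrt_shift_sq_ge[OF Tp wT k(1) wk])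
    also have "\<dots> = (LINT x:{0..T0}|lborel. ?D x)"
      by (rule set_borel_integral_eq_integral(2)[symmetric]) (rule borel_integrable_atLeastAtMost', rule cD)
    also have "\<dots> \<le> (LINT x|lborel. ?E x)"
      unfolding set_lebesgue_integral_def
    proof (rule integral_mono')
      show "integrable lborel ?E" by (rule integrable_sqrt_diff[OF gi g_int]) (auto simp: g_nonneg)
      show "indicator {0..T0} x *\<^sub>R ?D x \<le> ?E x" for x
      proof (cases "x \<in> {0..T0}")
        case True
        hence "sqrt (g (x + \<bar>h\<bar>)) \<le> sqrt (g (x + k))" "sqrt (g (x + k)) \<le> sqrt (g x)"
          using k by (auto intro!: g_antimono)
        hence "?D x \<le> (sqrt (g x) - sqrt (g (x + \<bar>h\<bar>)))\<^sup>2" by (intro power_mono) auto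
        thus ?thesis using True by (simp add: power2_commute)
      qed simp
    qed simp
    also have "\<dots> = 2 * hellinger_sq (\<lambda>x. g (x - h)) g"
      unfolding hellinger_shift_eq by (simp add: hellinger_sq_def)
    finally show ?thesis by (simp add: k_def mult.commute)
  qed
  show ?thesis using main g0 Tp h0 by (intro exI[of _ "g 0 / (32 * T0)"] conjI exI[of _ "t 1"] allI) auto
qed

text \<open>Minus a supergradient of \<open>ln g\<close> on the positive half of the support, and 0 elsewhere. The slopes are
  antitone, so no differentiability has to be assumed: \<open>deriv g\<close> is \<open>- g * sg\<close> off a countable set.\<close>
definition sg :: "real \<Rightarrow> real" where
  "sg x = (if 0 < x \<and> 0 < g x then SOME s. \<forall>y. 0 < g y \<longrightarrow> ln (g y) \<le> ln (g x) - s * (y - x) else 0)"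

lemma g_cont: "continuous_on A g" using cont by (simp add: continuous_at_imp_continuous_on)

lemma open_pos: "open {x. 0 < x \<and> 0 < g x}"
  by (intro open_Collect_conj open_Collect_less continuous_intros g_cont)

lemma sg_supergradient:
  assumes x: "0 < x" "0 < g x" and y: "0 < g y"
  shows "ln (g y) \<le> ln (g x) - sg x * (y - x)"
proof -
  obtain e where e: "0 < e" "ball x e \<subseteq> {x. 0 < x \<and> 0 < g x}"
    using openE[OF open_pos, of x] x by auto
  have "x + e / 2 \<in> ball x e" using e(1) by (simp add: dist_real_def)
  hence b: "0 < g (x + e / 2)" using e(2) by auto
  have a: "0 < g 0" using x g_le_0[of x] by linarith
  obtain s where s: "\<And>y. 0 < g y \<Longrightarrow> ln (g y) \<le> ln (g x) + s * (y - x)"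
    using log_concave_supergradient[OF lc a b x(1)] e(1) by auto
  have "\<exists>s. \<forall>y. 0 < g y \<longrightarrow> ln (g y) \<le> ln (g x) - s * (y - x)"
    by (rule exI[of _ "- s"]) (use s in auto)
  from someI_ex[OF this] show ?thesis using x y by (simp add: sg_def)
qed

lemma sg_nonneg: "0 \<le> sg x"
proof (cases "0 < x \<and> 0 < g x")
  case True
  have g0: "g x \<le> g 0" "0 < g 0" using True g_le_0[of x] by linarith+
  have "ln (g x) \<le> ln (g 0)" using True g0 by simp
  moreover have "ln (g 0) \<le> ln (g x) - sg x * (0 - x)" using True g0 by (intro sg_supergradient) auto
  ultimately have "0 \<le> sg x * x" by simp
  thus ?thesis using True by (simp add: zero_le_mult_iff)
qed (auto simp: sg_def)

lemma sg_mono: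
  assumes x: "0 < x" "x \<le> y" "0 < g y" shows "sg x \<le> sg y"
proof (cases "x = y")
  case False
  hence xy: "x < y" using x by simp
  have gx: "0 < g x" using x g_antimono[of x y] by linarith
  have "ln (g y) \<le> ln (g x) - sg x * (y - x)" by (rule sg_supergradient) (use x gx in auto)
  moreover have "ln (g x) \<le> ln (g y) - sg y * (x - y)" by (rule sg_supergradient) (use x xy gx in auto)
  ultimately have "sg x * (y - x) \<le> sg y * (y - x)" by (simp add: algebra_simps)
  thus ?thesis using xy by simp
qed simp

lemma sg_mono_on: "mono_on {x. 0 < x \<and> 0 < g x} sg"
  by (rule mono_onI) (auto intro: sg_mono)

lemma sg_measurable[measurable]: "sg \<in> borel_measurable borel"
proof -
  have b: "{x. 0 < x \<and> 0 < g x} \<in> sets borel" using open_pos by simp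
  have "sg \<in> borel_measurable (restrict_space borel {x. 0 < x \<and> 0 < g x})"
    by (rule borel_measurable_mono_on_fnc[OF sg_mono_on])
  hence "(\<lambda>x. indicator {x. 0 < x \<and> 0 < g x} x *\<^sub>R sg x) \<in> borel_measurable borel"
    using b by (subst (asm) borel_measurable_restrict_space_iff) auto
  moreover have "(\<lambda>x. indicator {x. 0 < x \<and> 0 < g x} x *\<^sub>R sg x) = sg"
    by (auto simp: fun_eq_iff sg_def indicator_def)
  ultimately show ?thesis by simp
qed

text \<open>By the two supergradient inequalities the difference quotient of \<open>ln g\<close>
  lies between \<open>- sg x\<close> and \<open>- sg y\<close>; continuity of \<open>sg\<close> at
  \<open>x\<close> then gives the derivative.\<close>

lemma deriv_sg:
  assumes x: "0 < x" "0 < g x" and c: "isCont sg x"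
  shows "deriv g x = - (g x * sg x)"
proof -
  obtain e where e: "0 < e" "ball x e \<subseteq> {x. 0 < x \<and> 0 < g x}"
    using openE[OF open_pos, of x] x by auto
  hence pos: "0 < y" "0 < g y" if "dist x y < e" for y using that by auto
  have ev: "\<forall>\<^sub>F y in at x. dist x y < e \<and> y \<noteq> x"
    using e(1) by (auto simp: eventually_at dist_commute intro!: exI[of _ e])
  have "((\<lambda>y. (ln (g y) - ln (g x)) / (y - x) + sg x) \<longlongrightarrow> 0) (at x)"
  proof (rule Lim_null_comparison)
    have "((\<lambda>y. \<bar>sg y - sg x\<bar>) \<longlongrightarrow> \<bar>sg x - sg x\<bar>) (at x)"
      using c by (intro tendsto_intros) (simp add: isCont_def)
    thus "((\<lambda>y. \<bar>sg y - sg x\<bar>) \<longlongrightarrow> 0) (at x)" by simp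
    show "\<forall>\<^sub>F y in at x. norm ((ln (g y) - ln (g x)) / (y - x) + sg x) \<le> \<bar>sg y - sg x\<bar>"
      using ev
    proof eventually_elim
      case (elim y)
      define r where "r = (ln (g y) - ln (g x)) / (y - x)"
      have r: "ln (g y) - ln (g x) = r * (y - x)" using elim by (simp add: r_def)
      have "ln (g y) \<le> ln (g x) - sg x * (y - x)" using x pos elim by (intro sg_supergradient) auto
      hence 1: "(r + sg x) * (y - x) \<le> 0" using r by (simp add: algebra_simps)
      have "ln (g x) \<le> ln (g y) - sg y * (x - y)" using x pos elim by (intro sg_supergradient) auto
      hence 2: "0 \<le> (r + sg y) * (y - x)" using r by (simp add: algebra_simps)
      have "\<bar>r + sg x\<bar> \<le> \<bar>sg y - sg x\<bar>"
      proof (cases "x < y")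
        case True
        hence "r + sg x \<le> 0" "0 \<le> r + sg y" using 1 2 by (auto simp: mult_le_0_iff zero_le_mult_iff)
        thus ?thesis by linarith
      next
        case False
        hence "y < x" using elim by auto
        hence "0 \<le> r + sg x" "r + sg y \<le> 0" using 1 2 by (auto simp: mult_le_0_iff zero_le_mult_iff)
        thus ?thesis by linarith
      qed
      thus ?case by (simp add: r_def)
    qed
  qed
  from tendsto_add[OF this tendsto_const[of "- sg x"]]
  have "((\<lambda>y. (ln (g y) - ln (g x)) / (y - x)) \<longlongrightarrow> - sg x) (at x)" by simp
  hence "((\<lambda>y. ln (g y)) has_real_derivative - sg x) (at x)" by (simp add: has_field_derivative_iff)
  hence "((\<lambda>y. exp (ln (g y))) has_real_derivative exp (ln (g x)) * (- sg x)) (at x)" by (rule DERIV_fun_exp)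
  hence "(g has_real_derivative exp (ln (g x)) * (- sg x)) (at x)"
  proof (rule has_field_derivative_transform_within_open)
    show "open (ball x e)" "x \<in> ball x e" using e(1) by auto
    show "exp (ln (g y)) = g y" if "y \<in> ball x e" for y using pos[of y] that by simp
  qed
  from DERIV_imp_deriv[OF this] show ?thesis using x by simp
qed

text \<open>A monotone function has countably many discontinuities, so \<open>deriv_sg\<close>
  applies almost everywhere on the positive part of the support; elsewhere \<open>sg\<close> is
  0.\<close>

lemma fisher_sg_le:
  "(\<integral>\<^sup>+ x. ennreal (g x * (sg x)\<^sup>2) \<partial>lborel)
    \<le> (\<integral>\<^sup>+ x. ennreal ((deriv g (x - a) / g (x - a))\<^sup>2 * g (x - a)) \<partial>lborel)"
proof -
  let ?N = "{x \<in> {x. 0 < x \<and> 0 < g x}. \<not> isCont sg x}"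
  have "countable ((+) a ` ?N)"
    by (intro countable_image mono_on_ctble_discont_open open_pos sg_mono_on)
  hence "AE x in lborel. x \<notin> (+) a ` ?N"
    by (intro AE_not_in countable_imp_null_set_lborel)
  hence "AE x in lborel. ennreal (g (x - a) * (sg (x - a))\<^sup>2) \<le> ennreal ((deriv g (x - a) / g (x - a))\<^sup>2 * g (x - a))"
  proof eventually_elim
    case (elim x)
    define z where "z = x - a"
    have "z \<notin> ?N"
    proof
      assume "z \<in> ?N"
      moreover have "x = a + z" by (simp add: z_def)
      ultimately show False using elim by blast
    qed
    show ?case unfolding z_def[symmetric]
    proof (cases "0 < z \<and> 0 < g z")
      case True
      hence "deriv g z = - (g z * sg z)" using \<open>z \<notin> ?N\<close> by (intro deriv_sg) auto
      hence "(deriv g z / g z)\<^sup>2 * g z = g z * (sg z)\<^sup>2" using True by (simp add: power2_eq_square)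
      thus "ennreal (g z * (sg z)\<^sup>2) \<le> ennreal ((deriv g z / g z)\<^sup>2 * g z)" by (auto simp: mult.commute)
    qed (auto simp: sg_def)
  qed
  hence "(\<integral>\<^sup>+ x. ennreal (g (x - a) * (sg (x - a))\<^sup>2) \<partial>lborel)
      \<le> (\<integral>\<^sup>+ x. ennreal ((deriv g (x - a) / g (x - a))\<^sup>2 * g (x - a)) \<partial>lborel)"
    by (rule nn_integral_mono_AE)
  moreover have "(\<integral>\<^sup>+ x. ennreal (g x * (sg x)\<^sup>2) \<partial>lborel) = (\<integral>\<^sup>+ x. ennreal (g (x - a) * (sg (x - a))\<^sup>2) \<partial>lborel)"
    by (subst nn_integral_real_affine[where c = 1 and t = "- a"]) auto
  ultimately show ?thesis by simp
qed

lemma bounded_integrable_on: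
  fixes f :: "real \<Rightarrow> real"
  assumes [measurable]: "f \<in> borel_measurable borel" and b: "\<And>x. x \<in> {a..b} \<Longrightarrow> \<bar>f x\<bar> \<le> B"
  shows "f integrable_on {a..b}"
proof -
  have "set_integrable lborel {a..b} f" unfolding set_integrable_def
  proof (rule integrableI_bounded_set_indicator[where B = B])
    show "AE x in lborel. x \<in> {a..b} \<longrightarrow> norm (f x) \<le> B" using b by simp
  qed (auto simp: emeasure_lborel_Icc_eq)
  thus ?thesis by (rule set_borel_integral_eq_integral)
qed

lemma
  assumes a: "0 < a" and b: "0 < g b"
  shows sqrt_sg_integrable: "(\<lambda>x. sqrt (g x) * sg x) integrable_on {a..b}"
    and g_sg_sq_integrable: "(\<lambda>x. g x * (sg x)\<^sup>2) integrable_on {a..b}"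
proof -
  have s: "\<bar>sg x\<bar> \<le> sg b" if "x \<in> {a..b}" for x using sg_mono[of x b] sg_nonneg[of x] that a b by auto
  have w: "\<bar>sqrt (g x)\<bar> \<le> sqrt (g 0)" for x using g_le_0 g_nonneg by simp
  show "(\<lambda>x. sqrt (g x) * sg x) integrable_on {a..b}"
  proof (rule bounded_integrable_on[where B = "sqrt (g 0) * sg b"])
    show "\<bar>sqrt (g x) * sg x\<bar> \<le> sqrt (g 0) * sg b" if "x \<in> {a..b}" for x
      unfolding abs_mult using s[OF that] w by (intro mult_mono) (auto simp: g_nonneg)
  qed simp
  show "(\<lambda>x. g x * (sg x)\<^sup>2) integrable_on {a..b}"
  proof (rule bounded_integrable_on[where B = "g 0 * (sg b)\<^sup>2"])
    show "\<bar>g x * (sg x)\<^sup>2\<bar> \<le> g 0 * (sg b)\<^sup>2" if "x \<in> {a..b}" for x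
      unfolding abs_mult using s[OF that] g_le_0[of x] g_nonneg
      by (intro mult_mono) (auto intro!: power_mono simp: sg_nonneg)
  qed simp
qed

text \<open>Averaging the increment of \<open>sqrt g\<close> over windows of length \<open>d\<close> replaces the fundamental theorem of
  calculus; the exponential factor disappears as \<open>d\<close> tends to 0.\<close>
lemma sqrt_diff_le_shift:
  assumes ab: "0 < a" "0 < d" "a + d \<le> b - d" and b: "0 < g b"
  shows "sqrt (g (a + d)) - sqrt (g (b - d)) \<le> exp (d * sg b / 2) / 2 * integral {a..b} (\<lambda>x. sqrt (g x) * sg x)"
proof -
  define w where "w x = sqrt (g x)" for x
  define E where "E = exp (d * sg b / 2)"
  define k where "k x = w x * sg x" for x
  have E: "1 \<le> E" using ab sg_nonneg by (simp add: E_def)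
  have ki: "k integrable_on {a..b}" using sqrt_sg_integrable[OF ab(1) b] by (simp add: k_def[abs_def] w_def)
  have k0: "0 \<le> k x" for x by (simp add: k_def w_def g_nonneg sg_nonneg)
  have ki': "k integrable_on {a + d..b}" using ki by (rule integrable_on_subinterval) (use ab in auto)
  have cw: "continuous_on A w" for A unfolding w_def by (intro continuous_on_real_sqrt g_cont)
  have io: "w integrable_on {u..v}" for u v by (rule integrable_continuous_real[OF cw])
  have wa: "w y \<le> w x" if "0 \<le> x" "x \<le> y" for x y using g_antimono[OF that] by (simp add: w_def)
  have cws: "continuous_on A (\<lambda>x. w (d + x))" for A
    by (rule continuous_on_compose2[OF cw[of UNIV]]) (auto intro: continuous_intros)
  have ios: "(\<lambda>x. w (d + x)) integrable_on {u..v}" for u v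
    by (rule integrable_continuous_real[OF cws])
  have 1: "integral {a..b - d} (\<lambda>x. w (d + x)) = integral {a + d..b} w"
    using integral_shift_Icc_real[of a "b - d" w d] by (simp add: o_def)
  have kd: "((\<lambda>x. k (d + x)) has_integral integral {a + d..b} k) {a..b - d}"
    using has_integral_shift_Icc_real[of k d "integral {a + d..b} k" a "b - d"] ki' by (simp add: o_def integrable_integral)
  have "integral {a..a + d} w + integral {a + d..b} w = integral {a..b} w"
    using ab by (intro Henstock_Kurzweil_Integration.integral_combine io) auto
  moreover have "integral {a..b - d} w + integral {b - d..b} w = integral {a..b} w"
    using ab by (intro Henstock_Kurzweil_Integration.integral_combine io) auto
  moreover have "integral {a..a + d} (\<lambda>x. w (a + d)) \<le> integral {a..a + d} w"
    by (rule integral_le) (use wa ab in \<open>auto intro: io\<close>)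
  moreover have "integral {b - d..b} w \<le> integral {b - d..b} (\<lambda>x. w (b - d))"
    by (rule integral_le) (use wa ab in \<open>auto intro: io\<close>)
  ultimately have "d * (w (a + d) - w (b - d)) \<le> integral {a..b - d} w - integral {a..b - d} (\<lambda>x. w (d + x))"
    using ab unfolding 1 by (simp add: right_diff_distrib)
  also have "\<dots> = integral {a..b - d} (\<lambda>x. w x - w (d + x))"
    by (rule Henstock_Kurzweil_Integration.integral_diff[symmetric]) (rule io, rule ios)
  also have "\<dots> \<le> integral {a..b - d} (\<lambda>x. d * E / 2 * k (d + x))"
  proof (rule integral_le)
    show "(\<lambda>x. w x - w (d + x)) integrable_on {a..b - d}"
      by (rule Henstock_Kurzweil_Integration.integrable_diff[OF io ios])
    show "(\<lambda>x. d * E / 2 * k (d + x)) integrable_on {a..b - d}"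
      by (rule integrable_on_mult_right) (use kd in blast)
    fix x assume x: "x \<in> {a..b - d}"
    define z where "z = d * sg (d + x)"
    have gx: "0 < g (d + x)" "0 < g x"
      using g_antimono[of "d + x" b] g_antimono[of x b] x ab b by auto
    have "ln (g x) \<le> ln (g (d + x)) - sg (d + x) * (x - (d + x))"
      by (rule sg_supergradient) (use x ab gx in auto)
    hence "ln (g x) \<le> ln (g (d + x)) + z" by (simp add: z_def mult.commute)
    hence "exp (ln (g x) / 2) \<le> exp (ln (g (d + x)) / 2 + z / 2)" by simp
    hence 2: "w x \<le> w (d + x) * exp (z / 2)"
      using gx unfolding w_def exp_add by (simp add: ln_sqrt[symmetric])
    have z0: "0 \<le> z" using ab sg_nonneg by (simp add: z_def)
    have "z \<le> d * sg b" unfolding z_def using ab x b by (intro mult_left_mono sg_mono) auto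
    hence zE: "exp (z / 2) \<le> E" by (simp add: E_def)
    have "1 - z / 2 \<le> exp (- (z / 2))" using exp_ge_add_one_self[of "- (z / 2)"] by simp
    hence "(1 - z / 2) * exp (z / 2) \<le> exp (- (z / 2)) * exp (z / 2)" by (rule mult_right_mono) simp
    hence "exp (z / 2) - 1 \<le> z / 2 * exp (z / 2)" by (simp add: exp_minus algebra_simps)
    also have "\<dots> \<le> z / 2 * E" using zE z0 by (intro mult_left_mono) auto
    finally have "w (d + x) * (exp (z / 2) - 1) \<le> w (d + x) * (z / 2 * E)"
      by (rule mult_left_mono) (simp add: w_def g_nonneg)
    with 2 have "w x - w (d + x) \<le> w (d + x) * (z / 2 * E)" by (simp add: algebra_simps)
    thus "w x - w (d + x) \<le> d * E / 2 * k (d + x)" by (simp add: z_def k_def mult_ac)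
  qed
  also have "\<dots> = d * E / 2 * integral {a + d..b} k" using kd by (simp add: integral_unique)
  also have "\<dots> \<le> d * E / 2 * integral {a..b} k"
    using ab E k0 ki ki' by (intro mult_left_mono integral_subset_le) auto
  finally have "d * (w (a + d) - w (b - d)) \<le> d * (E / 2 * integral {a..b} k)" by (simp add: mult_ac)
  thus ?thesis using ab(2) by (simp add: w_def E_def k_def[abs_def])
qed

text \<open>\<open>d\<close> tends to 0 in \<open>sqrt_diff_le_shift\<close>; then Cauchy-Schwarz,
  by completing the square with the mean value \<open>c\<close>.\<close>

lemma sqrt_diff_sq_le_pos:
  assumes ab: "0 < a" "a < b" and b: "0 < g b"
  shows "(sqrt (g a) - sqrt (g b))\<^sup>2 \<le> (b - a) / 4 * integral {a..b} (\<lambda>x. g x * (sg x)\<^sup>2)"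
proof -
  define A where "A = integral {a..b} (\<lambda>x. sqrt (g x) * sg x)"
  define J where "J = integral {a..b} (\<lambda>x. g x * (sg x)\<^sup>2)"
  define f where "f d = sqrt (g (a + d)) - sqrt (g (b - d)) - exp (d * sg b / 2) / 2 * A" for d
  have "isCont f 0" unfolding f_def by (intro continuous_intros isCont_o2[OF _ cont]) auto
  hence "(f \<longlongrightarrow> f 0) (at_right 0)" unfolding isCont_def by (rule tendsto_mono[OF at_le, rotated]) simp
  moreover have "\<forall>\<^sub>F d in at_right 0. f d \<le> 0"
  proof -
    have "0 < (b - a) / 2" using ab by simp
    hence "\<forall>\<^sub>F d in at_right 0. d \<in> {0<..<(b - a) / 2}" by (rule eventually_at_right_real)
    thus ?thesis
    proof eventually_elim
      case (elim d)
      have "a + d \<le> b - d" using elim by (simp add: field_simps)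
      thus ?case using sqrt_diff_le_shift[OF ab(1) _ _ b, of d] elim by (simp add: f_def A_def)
    qed
  qed
  ultimately have "f 0 \<le> 0" by (rule tendsto_upperbound) simp
  hence 1: "sqrt (g a) - sqrt (g b) \<le> A / 2" by (simp add: f_def)
  have "sqrt (g b) \<le> sqrt (g a)" using g_antimono[of a b] ab by simp
  hence 2: "(sqrt (g a) - sqrt (g b))\<^sup>2 \<le> (A / 2)\<^sup>2" using 1 by (intro power_mono) auto
  define c where "c = A / (b - a)"
  have cA: "c * (b - a) = A" using ab by (simp add: c_def)
  have ki: "(\<lambda>x. sqrt (g x) * sg x) integrable_on {a..b}" by (rule sqrt_sg_integrable[OF ab(1) b])
  have ji: "(\<lambda>x. g x * (sg x)\<^sup>2) integrable_on {a..b}" by (rule g_sg_sq_integrable[OF ab(1) b])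
  have "2 * c * A - c\<^sup>2 * (b - a) = integral {a..b} (\<lambda>x. 2 * c * (sqrt (g x) * sg x) - c\<^sup>2)"
    using ab integrable_on_mult_right[OF ki, of "2 * c"] by (subst Henstock_Kurzweil_Integration.integral_diff) (auto simp: A_def)
  also have "\<dots> \<le> J" unfolding J_def
  proof (rule integral_le)
    show "(\<lambda>x. 2 * c * (sqrt (g x) * sg x) - c\<^sup>2) integrable_on {a..b}"
      by (rule Henstock_Kurzweil_Integration.integrable_diff[OF integrable_on_mult_right[OF ki]]) auto
    fix x
    have "0 \<le> (sqrt (g x) * sg x - c)\<^sup>2" by simp
    also have "\<dots> = (sqrt (g x))\<^sup>2 * (sg x)\<^sup>2 - 2 * c * (sqrt (g x) * sg x) + c\<^sup>2"
      by (simp add: power2_eq_square algebra_simps)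
    finally show "2 * c * (sqrt (g x) * sg x) - c\<^sup>2 \<le> g x * (sg x)\<^sup>2" using g_nonneg by simp
  qed (rule ji)
  finally have "2 * c * (c * (b - a)) - c\<^sup>2 * (b - a) \<le> J" using cA by simp
  hence "(b - a) * (c * (c * (b - a))) \<le> (b - a) * J" using ab by (intro mult_left_mono) (auto simp: power2_eq_square)
  moreover have "(b - a) * (c * (c * (b - a))) = A * A" unfolding cA[symmetric] by simp
  ultimately have "(A / 2)\<^sup>2 \<le> (b - a) / 4 * J" by (simp add: power2_eq_square)
  thus ?thesis using 2 by (simp add: J_def)
qed

text \<open>Extension to \<open>a = 0\<close> and to \<open>g b = 0\<close>, where the slopes may be
  unbounded. Were it false, the intermediate value theorem would give interior points
  \<open>a' < b'\<close> at which \<open>sqrt g\<close> still differs by more than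
  \<open>sqrt R\<close>, against \<open>sqrt_diff_sq_le_pos\<close>.\<close>

lemma sqrt_diff_sq_le_nn_integral:
  assumes ab: "0 \<le> a" "a \<le> b"
  shows "ennreal ((sqrt (g a) - sqrt (g b))\<^sup>2)
    \<le> ennreal ((b - a) / 4) * (\<integral>\<^sup>+ y. indicator {a..b} y * ennreal (g y * (sg y)\<^sup>2) \<partial>lborel)"
    (is "_ \<le> _ * ?N {a..b}")
proof (rule ccontr)
  assume "\<not> ?thesis"
  hence lt: "ennreal ((b - a) / 4) * ?N {a..b} < ennreal ((sqrt (g a) - sqrt (g b))\<^sup>2)" by simp
  hence "ennreal ((b - a) / 4) * ?N {a..b} \<noteq> top" using less_trans[OF _ ennreal_less_top] by auto
  then obtain R where R: "0 \<le> R" "ennreal ((b - a) / 4) * ?N {a..b} = ennreal R"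
    by (cases "ennreal ((b - a) / 4) * ?N {a..b}") auto
  define w where "w x = sqrt (g x)" for x
  have cw: "continuous_on A w" for A unfolding w_def by (intro continuous_on_real_sqrt g_cont)
  have "w b \<le> w a" using g_antimono[OF ab] by (simp add: w_def)
  moreover have "R < (w a - w b)\<^sup>2" using lt R by (simp add: w_def ennreal_less_iff)
  ultimately have gap: "sqrt R < w a - w b" by (metis abs_of_nonneg diff_ge_0_iff_ge real_sqrt_abs real_sqrt_less_iff)
  have R0: "0 \<le> sqrt R" using R(1) by simp
  define v where "v = (w a + sqrt R + w b) / 2"
  define u where "u = (w b + (v - sqrt R)) / 2"
  have v: "sqrt R < v - w b" "v < w a" using gap by (auto simp: v_def)
  have u: "w b < u" "sqrt R < v - u" using v by (auto simp: u_def field_simps)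
  obtain a' where a': "a \<le> a'" "a' \<le> b" "w a' = v"
    using IVT2'[of w b v a] v R0 ab cw by auto
  obtain b' where b': "a' \<le> b'" "b' \<le> b" "w b' = u"
    using IVT2'[of w b u a'] u R0 a' cw by auto
  have "a \<noteq> a'" using v a' by auto
  have "a' \<noteq> b'" using u R0 a' b' by auto
  have "0 < w b'" using u b' g_nonneg[of b] by (simp add: w_def le_less_trans[of 0 "sqrt (g b)"])
  hence gb: "0 < g b'" by (simp add: w_def)
  have a'0: "0 < a'" "a' < b'" using \<open>a \<noteq> a'\<close> \<open>a' \<noteq> b'\<close> a' b' ab by auto
  define J where "J = integral {a'..b'} (\<lambda>x. g x * (sg x)\<^sup>2)"
  have "((\<lambda>x. g x * (sg x)\<^sup>2) has_integral J) {a'..b'}"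
    unfolding J_def by (rule integrable_integral) (rule g_sg_sq_integrable[OF a'0(1) gb])
  hence J: "((\<lambda>x. if x \<in> {a'..b'} then g x * (sg x)\<^sup>2 else 0) has_integral J) UNIV"
    by (simp only: has_integral_restrict_UNIV)
  have "?N {a'..b'} = (\<integral>\<^sup>+ y. ennreal (if y \<in> {a'..b'} then g y * (sg y)\<^sup>2 else 0) \<partial>lborel)"
    by (intro nn_integral_cong) (auto simp: indicator_def)
  also have "\<dots> = ennreal J"
    by (rule nn_integral_has_integral_lborel[OF _ _ J]) (auto simp: g_nonneg)
  finally have JN: "?N {a'..b'} = ennreal J" .
  have J0: "0 \<le> J" unfolding J_def
    by (rule Henstock_Kurzweil_Integration.integral_nonneg[OF g_sg_sq_integrable[OF a'0(1) gb]]) (simp add: g_nonneg)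
  have "(w a' - w b')\<^sup>2 \<le> (b' - a') / 4 * J"
    using sqrt_diff_sq_le_pos[OF a'0 gb] by (simp add: w_def J_def)
  hence "ennreal ((w a' - w b')\<^sup>2) \<le> ennreal ((b' - a') / 4 * J)" by (rule ennreal_leI)
  also have "\<dots> = ennreal ((b' - a') / 4) * ?N {a'..b'}" unfolding JN by (rule ennreal_mult) (use a'0 J0 in auto)
  also have "\<dots> \<le> ennreal ((b - a) / 4) * ?N {a..b}"
    using a' b' g_nonneg by (intro mult_mono ennreal_leI nn_integral_mono) (auto simp: indicator_def)
  also have "\<dots> = ennreal R" by (rule R)
  finally have "(v - u)\<^sup>2 \<le> R" using R a' b' by simp
  moreover have "(sqrt R)\<^sup>2 < (v - u)\<^sup>2" using u R0 by (intro power_strict_mono) auto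
  ultimately show False using R by simp
qed

text \<open>Symmetry folds both arguments to the positive half line. The condition
  \<open>y \<in> {a..b}\<close> is weakened to two intervals for \<open>x\<close> at given
  \<open>y\<close>, the form in which the order of integration can be exchanged.\<close>

lemma sqrt_shift_sq_le:
  assumes h: "0 \<le> h"
  shows "ennreal ((sqrt (g (x + h)) - sqrt (g x))\<^sup>2)
    \<le> ennreal (h / 4) * (\<integral>\<^sup>+ y. ((if y - h \<le> x \<and> x \<le> y then 1 else 0) + (if - y - h \<le> x \<and> x \<le> - y then 1 else 0))
         * ennreal (g y * (sg y)\<^sup>2) \<partial>lborel)"
proof -
  define a b where "a = min \<bar>x\<bar> \<bar>x + h\<bar>" and "b = max \<bar>x\<bar> \<bar>x + h\<bar>"
  have ab: "0 \<le> a" "a \<le> b" "b - a \<le> h" using h by (auto simp: a_def b_def)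
  have ga: "g \<bar>z\<bar> = g z" for z using sym[of z] by (cases "0 \<le> z") auto
  have "ennreal ((sqrt (g (x + h)) - sqrt (g x))\<^sup>2) = ennreal ((sqrt (g a) - sqrt (g b))\<^sup>2)"
    using ga[of x] ga[of "x + h"] by (auto simp: a_def b_def min_def max_def power2_commute)
  also have "\<dots> \<le> ennreal ((b - a) / 4) * (\<integral>\<^sup>+ y. indicator {a..b} y * ennreal (g y * (sg y)\<^sup>2) \<partial>lborel)"
    by (rule sqrt_diff_sq_le_nn_integral[OF ab(1,2)])
  also have "\<dots> \<le> ennreal (h / 4) * (\<integral>\<^sup>+ y. ((if y - h \<le> x \<and> x \<le> y then 1 else 0) + (if - y - h \<le> x \<and> x \<le> - y then 1 else 0))
         * ennreal (g y * (sg y)\<^sup>2) \<partial>lborel)"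
  proof (intro mult_mono ennreal_leI nn_integral_mono)
    fix y
    have "y \<in> {a..b} \<Longrightarrow> (y - h \<le> x \<and> x \<le> y) \<or> (- y - h \<le> x \<and> x \<le> - y)"
      using h by (auto simp: a_def b_def min_def max_def abs_if split: if_splits)
    thus "indicator {a..b} y \<le> ((if y - h \<le> x \<and> x \<le> y then 1 else 0) + (if - y - h \<le> x \<and> x \<le> - y then 1 else 0) :: ennreal)"
      by (auto simp: indicator_def)
  qed (use ab g_nonneg in auto)
  finally show ?thesis .
qed

text \<open>After the exchange of integrals each \<open>y\<close> is weighted by two intervals of
  length \<open>h\<close>; with the factor \<open>h / 4\<close> this gives \<open>h^2 / 2\<close>
  times the integral of \<open>g * sg^2\<close>, which the Fisher information bounds.\<close>

lemma hellinger_shift_le: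
  assumes fin: "(\<integral>\<^sup>+ x. ennreal ((deriv g (x - a) / g (x - a))\<^sup>2 * g (x - a)) \<partial>lborel) < \<infinity>"
  shows "\<exists>C\<ge>0. \<forall>h. hellinger_sq (\<lambda>x. g (x - h)) g \<le> C * h\<^sup>2"
proof -
  define F where "F y = ennreal (g y * (sg y)\<^sup>2)" for y
  have [measurable]: "F \<in> borel_measurable borel" unfolding F_def by measurable
  have "(\<integral>\<^sup>+ y. F y \<partial>lborel) < \<infinity>" using le_less_trans[OF fisher_sg_le fin] by (simp add: F_def)
  then obtain S where S: "0 \<le> S" "(\<integral>\<^sup>+ y. F y \<partial>lborel) = ennreal S"
    by (cases "\<integral>\<^sup>+ y. F y \<partial>lborel") auto
  have bound: "hellinger_sq (\<lambda>x. g (x - h')) g \<le> S / 4 * h'\<^sup>2" for h'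
  proof -
    define h where "h = \<bar>h'\<bar>"
    have h: "0 \<le> h" by (simp add: h_def)
    define k :: "real \<Rightarrow> real \<Rightarrow> ennreal" where
      "k x y = (if y - h \<le> x \<and> x \<le> y then 1 else 0) + (if - y - h \<le> x \<and> x \<le> - y then 1 else 0)" for x y
    have km[measurable]: "case_prod k \<in> borel_measurable (borel \<Otimes>\<^sub>M borel)"
      unfolding k_def by measurable
    have kx: "(\<integral>\<^sup>+ x. k x y \<partial>lborel) = ennreal (2 * h)" for y
    proof -
      have "(\<integral>\<^sup>+ x. k x y \<partial>lborel) = (\<integral>\<^sup>+ x. indicator {y - h..y} x + indicator {- y - h..- y} x \<partial>lborel)"
        by (intro nn_integral_cong) (auto simp: k_def indicator_def)
      also have "\<dots> = emeasure lborel {y - h..y} + emeasure lborel {- y - h..- y}"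
        by (subst nn_integral_add) auto
      also have "\<dots> = ennreal (2 * h)" using h by (simp add: ennreal_plus[symmetric] del: ennreal_plus)
      finally show ?thesis .
    qed
    have "(\<integral>\<^sup>+ x. ennreal ((sqrt (g (x + h)) - sqrt (g x))\<^sup>2) \<partial>lborel)
        \<le> (\<integral>\<^sup>+ x. ennreal (h / 4) * (\<integral>\<^sup>+ y. k x y * F y \<partial>lborel) \<partial>lborel)"
      by (rule nn_integral_mono) (use sqrt_shift_sq_le[OF h] in \<open>simp add: k_def F_def\<close>)
    also have "\<dots> = ennreal (h / 4) * (\<integral>\<^sup>+ x. \<integral>\<^sup>+ y. k x y * F y \<partial>lborel \<partial>lborel)"
      by (rule nn_integral_cmult) measurable
    also have "(\<integral>\<^sup>+ x. \<integral>\<^sup>+ y. k x y * F y \<partial>lborel \<partial>lborel) = (\<integral>\<^sup>+ y. \<integral>\<^sup>+ x. k x y * F y \<partial>lborel \<partial>lborel)"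
      by (rule lborel_pair.Fubini'[symmetric]) measurable
    also have "\<dots> = (\<integral>\<^sup>+ y. ennreal (2 * h) * F y \<partial>lborel)"
      by (intro nn_integral_cong) (subst nn_integral_multc, auto simp: kx)
    also have "\<dots> = ennreal (2 * h) * ennreal S" by (simp add: nn_integral_cmult S)
    also have "ennreal (h / 4) * (ennreal (2 * h) * ennreal S) = ennreal (S / 2 * h\<^sup>2)"
      using h S by (simp add: ennreal_mult[symmetric] power2_eq_square)
    finally have "enn2real (\<integral>\<^sup>+ x. ennreal ((sqrt (g (x + h)) - sqrt (g x))\<^sup>2) \<partial>lborel) \<le> S / 2 * h\<^sup>2"
      by (rule enn2real_leI[rotated]) (use S in simp)
    hence "(LINT x|lborel. (sqrt (g (x + h)) - sqrt (g x))\<^sup>2) \<le> S / 2 * h\<^sup>2"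
      by (subst integral_eq_nn_integral) auto
    thus ?thesis unfolding hellinger_shift_eq[of h'] by (simp add: hellinger_sq_def h_def)
  qed
  show ?thesis by (rule exI[of _ "S / 4"]) (use bound S in auto)
qed

end

section \<open>Location and tightness\<close>

lemma hellinger_sq_shift: "hellinger_sq (\<lambda>x. f (x + a)) (\<lambda>x. g (x + a)) = hellinger_sq f g"
proof -
  have "(LINT x|lborel. (sqrt (f x) - sqrt (g x))\<^sup>2) = (LINT x|lborel. (sqrt (f (a + 1 * x)) - sqrt (g (a + 1 * x)))\<^sup>2)"
    by (subst lborel_integral_real_affine[of 1 _ a]) auto
  thus ?thesis by (simp add: hellinger_sq_def add.commute)
qed

lemma hellinger_sq_quasi_triangle:
  assumes "integrable lborel f" "\<And>x. 0 \<le> f x" "integrable lborel g" "\<And>x. 0 \<le> g x" "integrable lborel k" "\<And>x. 0 \<le> (k x :: real)"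
  shows "hellinger_sq f k \<le> 2 * hellinger_sq f g + 2 * hellinger_sq g k"
proof -
  note i = integrable_sqrt_diff
  have "(LINT x|lborel. (sqrt (f x) - sqrt (k x))\<^sup>2)
      \<le> (LINT x|lborel. 2 * (sqrt (f x) - sqrt (g x))\<^sup>2 + 2 * (sqrt (g x) - sqrt (k x))\<^sup>2)"
  proof (rule integral_mono)
    fix x
    have "(u - w)\<^sup>2 \<le> 2 * (u - v)\<^sup>2 + 2 * (v - w)\<^sup>2" for u v w :: real
      using zero_le_power2[of "(u - v) - (v - w)"] by (simp add: power2_eq_square algebra_simps)
    thus "(sqrt (f x) - sqrt (k x))\<^sup>2 \<le> 2 * (sqrt (f x) - sqrt (g x))\<^sup>2 + 2 * (sqrt (g x) - sqrt (k x))\<^sup>2" .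
  qed (use i[OF assms(1,3,2,4)] i[OF assms(3,5,4,6)] i[OF assms(1,5,2,6)] in auto)
  also have "\<dots> = 2 * (LINT x|lborel. (sqrt (f x) - sqrt (g x))\<^sup>2) + 2 * (LINT x|lborel. (sqrt (g x) - sqrt (k x))\<^sup>2)"
    using i[OF assms(1,3,2,4)] i[OF assms(3,5,4,6)] by simp
  finally show ?thesis by (simp add: hellinger_sq_def)
qed

text \<open>Reflection about \<open>\<theta>\<close> fixes \<open>f\<close> and moves \<open>g\<close> by \<open>2 * \<theta>\<close>, so \<open>g\<close> is Hellinger close to its own
  translate; this bounds \<open>\<theta>\<close>.\<close>
lemma (in symmetric_log_concave) location_separation:
  assumes fin: "(\<integral>\<^sup>+ x. ennreal ((deriv g (x - a) / g (x - a))\<^sup>2 * g (x - a)) \<partial>lborel) < \<infinity>"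
  shows "\<exists>\<eta>>0. \<exists>K\<ge>0. \<forall>f \<theta>. integrable lborel f \<longrightarrow> (\<forall>x. 0 \<le> f x) \<longrightarrow> (\<forall>x. f (2 * \<theta> - x) = f x) \<longrightarrow>
    hellinger_sq f g \<le> \<eta> \<longrightarrow> \<theta>\<^sup>2 \<le> K * hellinger_sq f g \<and> hellinger_sq (\<lambda>x. f (x + \<theta>)) g \<le> K * hellinger_sq f g"
proof -
  obtain C where C: "0 \<le> C" "\<And>h. hellinger_sq (\<lambda>x. g (x - h)) g \<le> C * h\<^sup>2" using hellinger_shift_le[OF fin] by auto
  obtain c h0 where c: "0 < c" "0 < h0" "\<And>h. c * (min \<bar>h\<bar> h0)\<^sup>2 \<le> hellinger_sq (\<lambda>x. g (x - h)) g"
    using hellinger_shift_ge by auto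
  have gi: "integrable lborel (\<lambda>x. g (x - a))" for a
    using lborel_integrable_real_affine[OF g_int, of 1 "- a"] by (simp add: add.commute)
  \<comment> \<open>The first entry serves the location, the second the recentred density.\<close>
  define K where "K = max (1 / c) (2 + 2 * C / c)"
  have main: "\<theta>\<^sup>2 \<le> K * H \<and> hellinger_sq (\<lambda>x. f (x + \<theta>)) g \<le> K * H"
    if f: "integrable lborel f" "\<And>x. 0 \<le> f x" "\<And>x. f (2 * \<theta> - x) = f x" and le: "H \<le> c * h0\<^sup>2 / 8" and H: "H = hellinger_sq f g"
    for f \<theta> H
  proof -
    have H0: "0 \<le> H" by (simp add: H hellinger_sq_nonneg)
    have refl: "hellinger_sq (\<lambda>x. g (x - 2 * \<theta>)) f = H"
    proof -
      have "g (- x) = g x" for x by (rule sym)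
      hence "(LINT x|lborel. (sqrt (g (x - 2 * \<theta>)) - sqrt (f x))\<^sup>2) = (LINT x|lborel. (sqrt (g x) - sqrt (f x))\<^sup>2)"
        by (subst lborel_integral_real_affine[of "-1" _ "2 * \<theta>"]) (auto simp: f(3))
      thus ?thesis unfolding H hellinger_sq_commute[of f g] by (simp add: hellinger_sq_def)
    qed
    have "c * (min \<bar>2 * \<theta>\<bar> h0)\<^sup>2 \<le> hellinger_sq (\<lambda>x. g (x - 2 * \<theta>)) g" by (rule c(3))
    also have "\<dots> \<le> 2 * hellinger_sq (\<lambda>x. g (x - 2 * \<theta>)) f + 2 * hellinger_sq f g"
      by (rule hellinger_sq_quasi_triangle) (auto simp: gi g_nonneg g_int f)
    finally have 1: "c * (min \<bar>2 * \<theta>\<bar> h0)\<^sup>2 \<le> 4 * H" by (simp add: refl H)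
    have "0 < c * h0\<^sup>2" using c by simp
    have "\<bar>2 * \<theta>\<bar> < h0"
    proof (rule ccontr)
      assume "\<not> \<bar>2 * \<theta>\<bar> < h0"
      hence "min \<bar>2 * \<theta>\<bar> h0 = h0" by simp
      hence "c * h0\<^sup>2 \<le> 4 * H" using 1 by simp
      thus False using le \<open>0 < c * h0\<^sup>2\<close> by linarith
    qed
    hence "min \<bar>2 * \<theta>\<bar> h0 = \<bar>2 * \<theta>\<bar>" by simp
    hence "c * \<theta>\<^sup>2 \<le> H" using 1 by (simp add: power_mult_distrib)
    hence t: "\<theta>\<^sup>2 \<le> 1 / c * H" using c(1) by (simp add: field_simps)
    have "hellinger_sq (\<lambda>x. f (x + \<theta>)) g = hellinger_sq f (\<lambda>x. g (x - \<theta>))"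
      using hellinger_sq_shift[of f \<theta> "\<lambda>x. g (x - \<theta>)"] by simp
    also have "\<dots> \<le> 2 * hellinger_sq f g + 2 * hellinger_sq g (\<lambda>x. g (x - \<theta>))"
      by (rule hellinger_sq_quasi_triangle) (auto simp: gi g_nonneg g_int f)
    also have "\<dots> \<le> 2 * H + 2 * (C * \<theta>\<^sup>2)"
      using C(2)[of \<theta>] unfolding hellinger_sq_commute[of g] H by simp
    also have "\<dots> \<le> 2 * H + 2 * (C * (1 / c * H))" using t C(1) by (intro add_left_mono mult_left_mono) auto
    also have "\<dots> = (2 + 2 * C / c) * H" by (simp add: algebra_simps)
    also have "\<dots> \<le> K * H" using H0 by (intro mult_right_mono) (auto simp: K_def)
    finally have "hellinger_sq (\<lambda>x. f (x + \<theta>)) g \<le> K * H" .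
    moreover have "1 / c * H \<le> K * H" using H0 by (intro mult_right_mono) (auto simp: K_def)
    ultimately show ?thesis using t by linarith
  qed
  have "0 < c * h0\<^sup>2 / 8" "0 \<le> K" using c by (auto simp: K_def le_max_iff_disj)
  thus ?thesis using main by blast
qed

section \<open>Stochastic boundedness and Borel-Cantelli for possibly nonmeasurable events\<close>

context prob_space
begin

text \<open>The set in question may be nonmeasurable; it is covered by the complement of
  \<open>G\<close> and a measurable null set, and the outer measure is monotone.\<close>

lemma bounded_in_probI:
  assumes "\<And>\<epsilon>. 0 < \<epsilon> \<Longrightarrow> \<exists>K. \<forall>\<^sub>F n in sequentially. \<exists>G\<in>events. prob (space M - G) \<le> \<epsilon> \<and> (AE \<omega> in M. \<omega> \<in> G \<longrightarrow> \<bar>Z n \<omega>\<bar> \<le> K * r n)"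
  shows "bounded_in_prob M Z r"
  unfolding bounded_in_prob_def
proof (intro allI impI)
  fix \<epsilon> :: real assume \<epsilon>: "0 < \<epsilon>"
  obtain K where K: "\<forall>\<^sub>F n in sequentially. \<exists>G\<in>events. prob (space M - G) \<le> \<epsilon> \<and> (AE \<omega> in M. \<omega> \<in> G \<longrightarrow> \<bar>Z n \<omega>\<bar> \<le> K * r n)"
    using assms[OF \<epsilon>] by blast
  show "\<exists>K. \<forall>\<^sub>F n in sequentially. outer_measure_of M {\<omega> \<in> space M. \<bar>Z n \<omega>\<bar> > K * r n} \<le> ennreal \<epsilon>"
  proof (rule exI[of _ K], rule eventually_mono[OF K])
    fix n assume "\<exists>G\<in>events. prob (space M - G) \<le> \<epsilon> \<and> (AE \<omega> in M. \<omega> \<in> G \<longrightarrow> \<bar>Z n \<omega>\<bar> \<le> K * r n)"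
    then obtain G where G: "G \<in> events" "prob (space M - G) \<le> \<epsilon>" and ae: "AE \<omega> in M. \<omega> \<in> G \<longrightarrow> \<bar>Z n \<omega>\<bar> \<le> K * r n"
      by blast
    obtain N where N: "{\<omega> \<in> space M. \<not> (\<omega> \<in> G \<longrightarrow> \<bar>Z n \<omega>\<bar> \<le> K * r n)} \<subseteq> N" "emeasure M N = 0" "N \<in> events"
      using AE_E[OF ae] by blast
    have S: "(space M - G) \<union> N \<in> events" using G N by auto
    have "outer_measure_of M {\<omega> \<in> space M. \<bar>Z n \<omega>\<bar> > K * r n} \<le> outer_measure_of M ((space M - G) \<union> N)"
      by (rule outer_measure_of_mono) (use N(1) in auto)
    also have "\<dots> = emeasure M ((space M - G) \<union> N)" using S by (rule outer_measure_of_eq)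
    also have "\<dots> \<le> emeasure M (space M - G) + emeasure M N" using G N by (intro emeasure_subadditive) auto
    also have "\<dots> \<le> ennreal \<epsilon>" using G N by (simp add: emeasure_eq_measure ennreal_leI)
    finally show "outer_measure_of M {\<omega> \<in> space M. \<bar>Z n \<omega>\<bar> > K * r n} \<le> ennreal \<epsilon>" .
  qed
qed

text \<open>Borel-Cantelli is applied to the measurable sets \<open>G n\<close> only; passing to
  \<open>P n\<close> costs countably many null sets.\<close>

lemma AE_eventually_summable:
  assumes b: "\<forall>\<^sub>F n in sequentially. \<exists>G\<in>events. prob (space M - G) \<le> b n \<and> (AE \<omega> in M. \<omega> \<in> G \<longrightarrow> P n \<omega>)"
    and s: "summable b"
  shows "AE \<omega> in M. \<forall>\<^sub>F n in sequentially. P n \<omega>"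
proof -
  obtain N where N: "\<And>n. N \<le> n \<Longrightarrow> \<exists>G\<in>events. prob (space M - G) \<le> b n \<and> (AE \<omega> in M. \<omega> \<in> G \<longrightarrow> P n \<omega>)"
    using b unfolding eventually_sequentially by blast
  have "\<forall>n. \<exists>G. G \<in> events \<and> (N \<le> n \<longrightarrow> prob (space M - G) \<le> b n \<and> (AE \<omega> in M. \<omega> \<in> G \<longrightarrow> P n \<omega>))"
    using N by (metis sets.empty_sets)
  then obtain G where G: "\<And>n. G n \<in> events"
    "\<And>n. N \<le> n \<Longrightarrow> prob (space M - G n) \<le> b n \<and> (AE \<omega> in M. \<omega> \<in> G n \<longrightarrow> P n \<omega>)" by metis
  have "summable (\<lambda>n. prob (space M - G n))"
    by (rule summable_comparison_test'[OF s, of N]) (use G(2) in auto)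
  hence "AE \<omega> in M. \<forall>\<^sub>F n in sequentially. \<omega> \<in> space M - (space M - G n)"
    using G(1) by (intro borel_cantelli_AE1) (auto simp: emeasure_eq_measure)
  moreover have "AE \<omega> in M. \<forall>n. N \<le> n \<longrightarrow> \<omega> \<in> G n \<longrightarrow> P n \<omega>"
    unfolding AE_all_countable using G(2) by auto
  ultimately show ?thesis
  proof eventually_elim
    case (elim \<omega>)
    show ?case using elim(1) eventually_ge_at_top[of N] by eventually_elim (use elim(2) in auto)
  qed
qed

end

text \<open>Families that consist of a single interval suffice.\<close>

lemma abs_cont_on_isCont:
  assumes f: "\<And>a b. abs_cont_on {a..b} f"
  shows "isCont f x"
  unfolding continuous_at_eps_delta
proof (intro allI impI)
  fix \<epsilon> :: real assume "0 < \<epsilon>"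
  then obtain d where d: "0 < d" and I: "\<And>I :: (real \<times> real) set. finite I \<Longrightarrow> (\<forall>(a, b) \<in> I. a \<le> b \<and> {a..b} \<subseteq> {x - 1..x + 1}) \<Longrightarrow>
    pairwise (\<lambda>p q. disjnt {fst p<..<snd p} {fst q<..<snd q}) I \<Longrightarrow>
    (\<Sum>(a, b) \<in> I. b - a) < d \<Longrightarrow> (\<Sum>(a, b) \<in> I. \<bar>f b - f a\<bar>) < \<epsilon>"
    using f[of "x - 1" "x + 1"] unfolding abs_cont_on_def by meson
  show "\<exists>d>0. \<forall>y. dist y x < d \<longrightarrow> dist (f y) (f x) < \<epsilon>"
  proof (intro exI[of _ "min d 1"] conjI allI impI)
    fix y assume "dist y x < min d 1"
    hence y: "\<bar>y - x\<bar> < d" "\<bar>y - x\<bar> < 1" by (auto simp: dist_real_def)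
    have "(\<Sum>(a, b) \<in> {(min x y, max x y)}. \<bar>f b - f a\<bar>) < \<epsilon>" by (rule I) (use y in auto)
    thus "dist (f y) (f x) < \<epsilon>" by (simp add: dist_real_def min_def max_def abs_minus_commute split: if_splits)
  qed (use d in simp)
qed

lemma deriv_translate: "deriv (\<lambda>x. f (x - a)) x = deriv f (x - a :: real)"
  unfolding deriv_def using DERIV_shift[of f _ x "- a"] by simp

lemma lc_subdensity_translate:
  assumes "lc_subdensity f" shows "lc_subdensity (\<lambda>x. f (x + a))"
proof -
  have f: "log_concave f" "f \<in> borel_measurable borel" "integrable lborel f" "(LINT x|lborel. f x) \<le> 1"
    using assms by (auto simp: lc_subdensity_def)
  have "log_concave (\<lambda>x. f (x + a))" using log_concave_shift[OF f(1), of "- a"] by simp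
  moreover have "(\<lambda>x. f (x + a)) \<in> borel_measurable borel" using f(2) by measurable
  moreover have "integrable lborel (\<lambda>x. f (x + a))"
    using lborel_integrable_real_affine[OF f(3), of 1 a] by (simp add: add.commute)
  moreover have "(LINT x|lborel. f (x + a)) = (LINT x|lborel. f x)"
    using lborel_integral_real_affine[of 1 f a] by (simp add: add.commute)
  ultimately show ?thesis using f(4) by (simp add: lc_subdensity_def)
qed

lemma SLC0_symmetric_log_concave:
  assumes g: "g \<in> SLC0" and cont: "\<And>x. isCont g x"
  shows "symmetric_log_concave g"
proof
  have d: "g \<in> borel_measurable borel" "\<And>x. 0 \<le> g x" "(\<integral>\<^sup>+ x. ennreal (g x) \<partial>lborel) = 1"
    and c: "(\<lambda>x. log_ext (g x)) \<in> closed_proper_concave" and s: "\<And>x. g (- x) = g x"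
    using g by (auto simp: SLC0_def is_density_def)
  have "integrable lborel g" by (rule integrableI_nonneg) (use d in auto)
  moreover have "(LINT x|lborel. g x) = 1" by (subst integral_eq_nn_integral) (use d in auto)
  ultimately show "density_fun g" using d by (simp add: density_fun_def)
  show "log_concave g" using closed_proper_concave_exp(1)[OF c] d(2) by (simp add: exp_ext_log_ext)
  show "g (- x) = g x" "isCont g x" for x by (rule s, rule cont)
qed

text \<open>\<open>uniform_rate\<close> for the estimator, in coordinates centred at the true
  location. Almost surely the data avoid 0 and the zeros of \<open>g\<close>, as is required there.
  A single observation admits no maximizer, since the likelihood is then unbounded; hence
  \<open>n \<ge> 2\<close>.\<close>

lemma (in slc_sample) MLE_rate:
  fixes \<theta> :: "nat \<Rightarrow> 'w \<Rightarrow> real" and \<psi> :: "nat \<Rightarrow> 'w \<Rightarrow> real \<Rightarrow> ereal"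
  assumes g: "g \<in> SLC0"
    and mle: "\<And>n. 2 \<le> n \<Longrightarrow> AE \<omega> in \<Omega>. is_MLE n (\<lambda>i. Y i \<omega> + \<theta>0) (\<theta> n \<omega>) (\<psi> n \<omega>)"
  defines "f n \<omega> x \<equiv> exp_ext (\<psi> n \<omega> (x + \<theta>0 - \<theta> n \<omega>))"
  shows "\<exists>D\<ge>1. \<forall>n \<kappa>. 2 \<le> n \<longrightarrow> 1 \<le> \<kappa> \<longrightarrow> D * \<kappa> \<le> real n powr (4/5) \<longrightarrow>
    (\<exists>G\<in>events. prob (space \<Omega> - G) \<le> 2 ^ 203 / \<kappa>\<^sup>2 \<and> (AE \<omega> in \<Omega>. \<omega> \<in> G \<longrightarrow>
      integrable lborel (f n \<omega>) \<and> (\<forall>x. f n \<omega> (2 * (\<theta> n \<omega> - \<theta>0) - x) = f n \<omega> x) \<and>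
      hellinger_sq (f n \<omega>) g \<le> 2 ^ 33 * \<kappa> * real n powr (- (4/5))))"
proof -
  obtain D where D: "1 \<le> D" and rate: "\<And>n \<nu> \<kappa>. 1 \<le> n \<Longrightarrow> 0 < \<nu> \<Longrightarrow> \<nu> ^ 5 = real n \<Longrightarrow> 1 \<le> \<kappa> \<Longrightarrow> D * \<kappa> \<le> \<nu> ^ 4 \<Longrightarrow>
    \<exists>G\<in>events. prob (space \<Omega> - G) \<le> 2 ^ 203 / \<kappa>\<^sup>2 \<and> (\<forall>\<omega>\<in>G. (\<forall>i\<in>{1..n}. 0 < g (Y i \<omega>) \<and> Y i \<omega> \<noteq> 0) \<longrightarrow>
      (\<forall>f. lc_subdensity f \<longrightarrow> (\<forall>i\<in>{1..n}. 0 < f (Y i \<omega>)) \<longrightarrow>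
        (\<Sum>i\<in>{1..n}. ln (g (Y i \<omega>))) \<le> (\<Sum>i\<in>{1..n}. ln (f (Y i \<omega>))) \<longrightarrow>
        hellinger_sq f g \<le> 2 ^ 33 * (\<kappa> / \<nu> ^ 4)))"
    using uniform_rate by blast
  have "AE \<omega> in \<Omega>. 0 < g (Y i \<omega>) \<and> Y i \<omega> \<noteq> 0" if "1 \<le> i" for i
  proof -
    have "distributed \<Omega> lborel (Y i) (\<lambda>x. ennreal (g x))" using iid that by (simp add: iid_sample_def)
    moreover have "AE y in lborel. 0 < ennreal (g y) \<longrightarrow> 0 < g y \<and> y \<noteq> (0::real)"
      using AE_lborel_singleton[of "0::real"] by eventually_elim simp
    ultimately show ?thesis by (subst distributed_AE2[where P = "\<lambda>y. 0 < g y \<and> y \<noteq> 0"]) auto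
  qed
  hence pos: "AE \<omega> in \<Omega>. \<forall>i. 1 \<le> i \<longrightarrow> 0 < g (Y i \<omega>) \<and> Y i \<omega> \<noteq> 0" by (simp add: AE_all_countable)
  have "\<exists>G\<in>events. prob (space \<Omega> - G) \<le> 2 ^ 203 / \<kappa>\<^sup>2 \<and> (AE \<omega> in \<Omega>. \<omega> \<in> G \<longrightarrow>
      integrable lborel (f n \<omega>) \<and> (\<forall>x. f n \<omega> (2 * (\<theta> n \<omega> - \<theta>0) - x) = f n \<omega> x) \<and>
      hellinger_sq (f n \<omega>) g \<le> 2 ^ 33 * \<kappa> * real n powr (- (4/5)))"
    if n: "2 \<le> n" and \<kappa>: "1 \<le> \<kappa>" "D * \<kappa> \<le> real n powr (4/5)" for n \<kappa>
  proof -
    define \<nu> where "\<nu> = real n powr (1/5)"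
    have \<nu>: "0 < \<nu>" "\<nu> ^ 5 = real n" "\<nu> ^ 4 = real n powr (4/5)"
      using n by (simp_all add: \<nu>_def powr_power)
    obtain G where G: "G \<in> events" "prob (space \<Omega> - G) \<le> 2 ^ 203 / \<kappa>\<^sup>2"
      and H: "\<And>\<omega> f. \<omega> \<in> G \<Longrightarrow> (\<forall>i\<in>{1..n}. 0 < g (Y i \<omega>) \<and> Y i \<omega> \<noteq> 0) \<Longrightarrow> lc_subdensity f \<Longrightarrow> (\<forall>i\<in>{1..n}. 0 < f (Y i \<omega>)) \<Longrightarrow>
        (\<Sum>i\<in>{1..n}. ln (g (Y i \<omega>))) \<le> (\<Sum>i\<in>{1..n}. ln (f (Y i \<omega>))) \<Longrightarrow>
        hellinger_sq f g \<le> 2 ^ 33 * (\<kappa> / \<nu> ^ 4)"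
      using rate[of n \<nu> \<kappa>] n \<nu> \<kappa> by auto
    have "AE \<omega> in \<Omega>. \<omega> \<in> G \<longrightarrow>
      integrable lborel (f n \<omega>) \<and> (\<forall>x. f n \<omega> (2 * (\<theta> n \<omega> - \<theta>0) - x) = f n \<omega> x) \<and>
      hellinger_sq (f n \<omega>) g \<le> 2 ^ 33 * \<kappa> * real n powr (- (4/5))"
      using pos mle[OF n]
    proof eventually_elim
      case (elim \<omega>)
      have gp: "0 < g (Y i \<omega> + \<theta>0 - \<theta>0)" if "i \<in> {1..n}" for i using elim(1) that by auto
      have n1: "1 \<le> n" using n by simp
      note M = MLE_density[OF elim(2) n1 g gp]
      have feq: "f n \<omega> = (\<lambda>x. exp_ext (\<psi> n \<omega> (x + \<theta>0 - \<theta> n \<omega>)))" by (simp add: f_def fun_eq_iff)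
      have lcf: "lc_subdensity (f n \<omega>)" unfolding feq using lc_subdensity_translate[OF M(1)] .
      have sy: "\<psi> n \<omega> (- z) = \<psi> n \<omega> z" for z using elim(2) by (simp add: is_MLE_def SC0_def)
      have "f n \<omega> (2 * (\<theta> n \<omega> - \<theta>0) - x) = f n \<omega> x" for x
      proof -
        have "2 * (\<theta> n \<omega> - \<theta>0) - x + \<theta>0 - \<theta> n \<omega> = - (x + \<theta>0 - \<theta> n \<omega>)" by simp
        thus ?thesis unfolding feq by (simp only: sy)
      qed
      moreover have "hellinger_sq (f n \<omega>) g \<le> 2 ^ 33 * (\<kappa> / \<nu> ^ 4)" if "\<omega> \<in> G"
      proof (rule H[OF that _ lcf])
        show "\<forall>i\<in>{1..n}. 0 < g (Y i \<omega>) \<and> Y i \<omega> \<noteq> 0" using elim(1) by simp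
        show "\<forall>i\<in>{1..n}. 0 < f n \<omega> (Y i \<omega>)" using M(2) by (simp add: feq)
        show "(\<Sum>i\<in>{1..n}. ln (g (Y i \<omega>))) \<le> (\<Sum>i\<in>{1..n}. ln (f n \<omega> (Y i \<omega>)))" using M(3) by (simp add: feq)
      qed
      moreover have "2 ^ 33 * (\<kappa> / \<nu> ^ 4) = 2 ^ 33 * \<kappa> * real n powr (- (4/5))" unfolding \<nu>(3)
        by (simp only: powr_minus divide_inverse mult.assoc)
      ultimately show ?case using lcf by (auto simp: lc_subdensity_def)
    qed
    thus ?thesis using G by blast
  qed
  thus ?thesis using D by blast
qed

theorem theorem9:
  fixes M :: "'w measure"
    and X :: "nat \<Rightarrow> 'w \<Rightarrow> real"
    and g0 f0 :: "real \<Rightarrow> real"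
    and \<theta>0 :: real
    and \<theta>hat :: "nat \<Rightarrow> 'w \<Rightarrow> real"
    and \<psi>hat :: "nat \<Rightarrow> 'w \<Rightarrow> real \<Rightarrow> ereal"
    and ghat fhat :: "nat \<Rightarrow> 'w \<Rightarrow> real \<Rightarrow> real"
  assumes "prob_space M"
    and "g0 \<in> SLC0"
    and "\<And>x. f0 x = g0 (x - \<theta>0)"
    and "finite_fisher_info_location f0"
    and "prob_space.indep_vars M (\<lambda>_. borel) X {1..}"
    and "\<And>i. i \<ge> 1 \<Longrightarrow> distributed M lborel (X i) (\<lambda>x. ennreal (f0 x))"
    and "\<And>n. n \<ge> 2 \<Longrightarrow> AE \<omega> in M. is_MLE n (\<lambda>i. X i \<omega>) (\<theta>hat n \<omega>) (\<psi>hat n \<omega>)"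
    and "\<And>n \<omega> x. ghat n \<omega> x = exp_ext (\<psi>hat n \<omega> x)"
    and "\<And>n \<omega> x. fhat n \<omega> x = ghat n \<omega> (x - \<theta>hat n \<omega>)"
  shows "(AE \<omega> in M. (\<lambda>n. hellinger (fhat n \<omega>) f0) \<longlonglongrightarrow> 0)
    \<and> (AE \<omega> in M. (\<lambda>n. hellinger (ghat n \<omega>) g0) \<longlonglongrightarrow> 0)
    \<and> bounded_in_prob M (\<lambda>n \<omega>. (hellinger (fhat n \<omega>) f0)\<^sup>2) (\<lambda>n. real n powr (- 4 / 5))
    \<and> bounded_in_prob M (\<lambda>n \<omega>. \<bar>\<theta>hat n \<omega> - \<theta>0\<bar>) (\<lambda>n. real n powr (- 2 / 5))
    \<and> bounded_in_prob M (\<lambda>n \<omega>. (hellinger (ghat n \<omega>) g0)\<^sup>2) (\<lambda>n. real n powr (- 4 / 5))"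
proof -
  interpret prob_space M by fact
  have f0: "f0 = (\<lambda>x. g0 (x - \<theta>0))" using assms(3) by (simp add: fun_eq_iff)
  \<comment> \<open>Log-concavity alone allows jumps at the ends of the support; absolute continuity
    removes them.\<close>
  have cont: "isCont g0 x" for x
  proof -
    have "isCont f0 (x + \<theta>0)"
      by (rule abs_cont_on_isCont) (use assms(4) in \<open>simp add: finite_fisher_info_location_def\<close>)
    hence "isCont (\<lambda>x. f0 (x + \<theta>0)) x" by (intro isCont_o2[of x "\<lambda>x. x + \<theta>0" f0] continuous_intros) auto
    thus ?thesis by (simp add: f0)
  qed
  interpret symmetric_log_concave g0 by (rule SLC0_symmetric_log_concave[OF assms(2) cont])
  define Y where "Y i \<omega> = X i \<omega> - \<theta>0" for i \<omega>
  have iid: "iid_sample M Y g0" unfolding iid_sample_def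
  proof (intro conjI allI impI)
    have "indep_vars (\<lambda>_. borel) (\<lambda>i \<omega>. (\<lambda>x. x - \<theta>0) (X i \<omega>)) {1..}"
      by (rule indep_vars_compose2[OF assms(5)]) simp
    thus "indep_vars (\<lambda>_. borel) Y {1..}" by (simp add: Y_def[abs_def])
    fix i :: nat assume "1 \<le> i"
    from distributed_affine[OF assms(6)[OF this], of 1 "- \<theta>0"]
    moreover have "ennreal (g0 x) / 1 = ennreal (g0 x)" for x using divide_ennreal[of "g0 x" 1] g_nonneg by simp
    ultimately show "distributed M lborel (Y i) (\<lambda>x. ennreal (g0 x))" by (simp add: Y_def[abs_def] f0)
  qed
  interpret slc_sample g0 M Y by unfold_locales (rule iid)
  define f where "f n \<omega> x = exp_ext (\<psi>hat n \<omega> (x + \<theta>0 - \<theta>hat n \<omega>))" for n \<omega> x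
  define h where "h n \<omega> = hellinger_sq (f n \<omega>) g0" for n \<omega>
  define E where "E n \<omega> \<longleftrightarrow> integrable lborel (f n \<omega>) \<and> (\<forall>x. f n \<omega> (2 * (\<theta>hat n \<omega> - \<theta>0) - x) = f n \<omega> x)" for n \<omega>
  have "\<And>n. 2 \<le> n \<Longrightarrow> AE \<omega> in M. is_MLE n (\<lambda>i. Y i \<omega> + \<theta>0) (\<theta>hat n \<omega>) (\<psi>hat n \<omega>)"
    using assms(7) by (simp add: Y_def)
  from MLE_rate[OF assms(2) this] obtain D where D: "1 \<le> D" and rate: "\<And>n \<kappa>. 2 \<le> n \<Longrightarrow> 1 \<le> \<kappa> \<Longrightarrow> D * \<kappa> \<le> real n powr (4/5) \<Longrightarrow>
    \<exists>G\<in>events. prob (space M - G) \<le> 2 ^ 203 / \<kappa>\<^sup>2 \<and> (AE \<omega> in M. \<omega> \<in> G \<longrightarrow> E n \<omega> \<and> h n \<omega> \<le> 2 ^ 33 * \<kappa> * real n powr (- (4/5)))"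
    unfolding E_def h_def f_def[abs_def] conj_assoc by blast
  have fisher: "(\<integral>\<^sup>+ x. ennreal ((deriv g0 (x - \<theta>0) / g0 (x - \<theta>0))\<^sup>2 * g0 (x - \<theta>0)) \<partial>lborel) < \<infinity>"
    using assms(4) unfolding finite_fisher_info_location_def f0 deriv_translate by simp
  obtain \<eta> K where \<eta>: "0 < \<eta>" and K: "0 \<le> K"
    and sep: "\<And>f \<theta>. integrable lborel f \<Longrightarrow> (\<forall>x. 0 \<le> f x) \<Longrightarrow> (\<forall>x. f (2 * \<theta> - x) = f x) \<Longrightarrow>
    hellinger_sq f g0 \<le> \<eta> \<Longrightarrow> \<theta>\<^sup>2 \<le> K * hellinger_sq f g0 \<and> hellinger_sq (\<lambda>x. f (x + \<theta>)) g0 \<le> K * hellinger_sq f g0"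
    using location_separation[OF fisher] by blast
  have h0: "0 \<le> h n \<omega>" for n \<omega> by (simp add: h_def hellinger_sq_nonneg)
  have hell: "hellinger u v = sqrt (hellinger_sq u v)" for u v by (simp add: hellinger_def hellinger_sq_def)
  have fh: "hellinger (fhat n \<omega>) f0 = sqrt (h n \<omega>)" for n \<omega>
    using hellinger_sq_shift[of "fhat n \<omega>" \<theta>0 f0] unfolding hell h_def
    by (simp add: f0 f_def[abs_def] assms(8,9))
  define k where "k n \<omega> = hellinger_sq (ghat n \<omega>) g0" for n \<omega>
  have k0: "0 \<le> k n \<omega>" for n \<omega> by (simp add: k_def hellinger_sq_nonneg)
  have gh: "hellinger (ghat n \<omega>) g0 = sqrt (k n \<omega>)" for n \<omega> by (simp add: hell k_def)
  \<comment> \<open>In centred coordinates the fit is symmetric about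
    \<open>\<theta>hat - \<theta>0\<close>, and shifting it by this amount gives
    \<open>ghat\<close>.\<close>
  have close: "(\<theta>hat n \<omega> - \<theta>0)\<^sup>2 \<le> K * h n \<omega>" "k n \<omega> \<le> K * h n \<omega>" if "E n \<omega>" "h n \<omega> \<le> \<eta>" for n \<omega>
  proof -
    have "ghat n \<omega> = (\<lambda>x. f n \<omega> (x + (\<theta>hat n \<omega> - \<theta>0)))" by (simp add: fun_eq_iff assms(8) f_def)
    thus "(\<theta>hat n \<omega> - \<theta>0)\<^sup>2 \<le> K * h n \<omega>" "k n \<omega> \<le> K * h n \<omega>"
      using sep[of "f n \<omega>" "\<theta>hat n \<omega> - \<theta>0"] that by (auto simp: E_def h_def k_def f_def exp_ext_nonneg)
  qed
  have null: "(\<lambda>n. real n powr (- (4/5))) \<longlonglongrightarrow> 0"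
    by (rule tendsto_neg_powr) (auto intro: filterlim_real_sequentially)
  have inv: "real n powr (4/5) * real n powr (- (4/5)) = 1" if "2 \<le> n" for n
    using that by (simp only: powr_add[symmetric]) simp
  \<comment> \<open>Here \<open>\<kappa>\<close> is fixed by
    \<open>2^203 / \<kappa>^2 \<le> \<epsilon>\<close>; for large \<open>n\<close> both
    \<open>D * \<kappa> \<le> n^(4/5)\<close> and \<open>h \<le> \<eta>\<close> follow.\<close>
  have tight: "\<exists>L\<ge>0. \<forall>\<^sub>F n in sequentially. \<exists>G\<in>events. prob (space M - G) \<le> \<epsilon> \<and>
      (AE \<omega> in M. \<omega> \<in> G \<longrightarrow> E n \<omega> \<and> h n \<omega> \<le> \<eta> \<and> h n \<omega> \<le> L * real n powr (- (4/5)))" if \<epsilon>: "0 < \<epsilon>" for \<epsilon>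
  proof -
    define \<kappa> where "\<kappa> = max 1 (sqrt (2 ^ 203 / \<epsilon>))"
    have \<kappa>: "1 \<le> \<kappa>" by (simp add: \<kappa>_def)
    have "(sqrt (2 ^ 203 / \<epsilon>))\<^sup>2 \<le> \<kappa>\<^sup>2" using \<epsilon> by (intro power_mono) (auto simp: \<kappa>_def)
    hence "2 ^ 203 / \<epsilon> \<le> \<kappa>\<^sup>2" using \<epsilon> by simp
    hence \<kappa>\<epsilon>: "2 ^ 203 / \<kappa>\<^sup>2 \<le> \<epsilon>" using \<epsilon> \<kappa> by (simp add: field_simps)
    define L where "L = 2 ^ 33 * \<kappa>"
    have L: "0 < L" using \<kappa> by (simp add: L_def)
    have "\<forall>\<^sub>F n in sequentially. real n powr (- (4/5)) < min (\<eta> / L) (1 / (D * \<kappa>))"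
      by (rule order_tendstoD(2)[OF null]) (use \<eta> L D \<kappa> in simp)
    hence "\<forall>\<^sub>F n in sequentially. \<exists>G\<in>events. prob (space M - G) \<le> \<epsilon> \<and>
      (AE \<omega> in M. \<omega> \<in> G \<longrightarrow> E n \<omega> \<and> h n \<omega> \<le> \<eta> \<and> h n \<omega> \<le> L * real n powr (- (4/5)))"
      using eventually_ge_at_top[of 2]
    proof eventually_elim
      case (elim n)
      have pos: "0 < real n powr (4/5)" using elim by simp
      have "D * \<kappa> * real n powr (- (4/5)) \<le> 1" using elim(1) D \<kappa> by (simp add: field_simps)
      hence "D * \<kappa> * real n powr (- (4/5)) * real n powr (4/5) \<le> 1 * real n powr (4/5)"
        by (rule mult_right_mono) simp
      hence "D * \<kappa> \<le> real n powr (4/5)" using inv[OF elim(2)] by (simp add: mult_ac)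
      from rate[OF elim(2) \<kappa> this] obtain G where G: "G \<in> events" "prob (space M - G) \<le> 2 ^ 203 / \<kappa>\<^sup>2"
        and ae: "AE \<omega> in M. \<omega> \<in> G \<longrightarrow> E n \<omega> \<and> h n \<omega> \<le> L * real n powr (- (4/5))" unfolding L_def by blast
      have "L * real n powr (- (4/5)) \<le> \<eta>" using elim(1) L by (simp add: field_simps)
      with ae have "AE \<omega> in M. \<omega> \<in> G \<longrightarrow> E n \<omega> \<and> h n \<omega> \<le> \<eta> \<and> h n \<omega> \<le> L * real n powr (- (4/5))"
        by (auto intro: order_trans)
      moreover have "prob (space M - G) \<le> \<epsilon>" using G(2) \<kappa>\<epsilon> by (rule order_trans)
      ultimately show ?case using G(1) by blast
    qed
    thus ?thesis using L by (intro exI[of _ L]) auto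
  qed
  \<comment> \<open>All three rates are deterministic consequences of one bound on
    \<open>h\<close>.\<close>
  have rates: "bounded_in_prob M Z (\<lambda>n. real n powr r)"
    if Z: "\<And>L. 0 \<le> L \<Longrightarrow> \<exists>C. \<forall>n \<omega>. E n \<omega> \<longrightarrow> h n \<omega> \<le> \<eta> \<longrightarrow> h n \<omega> \<le> L * real n powr (- (4/5)) \<longrightarrow> \<bar>Z n \<omega>\<bar> \<le> C * real n powr r" for Z r
  proof (rule bounded_in_probI)
    fix \<epsilon> :: real assume "0 < \<epsilon>"
    then obtain L where "0 \<le> L" and ev: "\<forall>\<^sub>F n in sequentially. \<exists>G\<in>events. prob (space M - G) \<le> \<epsilon> \<and>
      (AE \<omega> in M. \<omega> \<in> G \<longrightarrow> E n \<omega> \<and> h n \<omega> \<le> \<eta> \<and> h n \<omega> \<le> L * real n powr (- (4/5)))" using tight by blast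
    obtain C where C: "\<And>n \<omega>. E n \<omega> \<Longrightarrow> h n \<omega> \<le> \<eta> \<Longrightarrow> h n \<omega> \<le> L * real n powr (- (4/5)) \<Longrightarrow> \<bar>Z n \<omega>\<bar> \<le> C * real n powr r"
      using Z[OF \<open>0 \<le> L\<close>] by blast
    have "\<forall>\<^sub>F n in sequentially. \<exists>G\<in>events. prob (space M - G) \<le> \<epsilon> \<and> (AE \<omega> in M. \<omega> \<in> G \<longrightarrow> \<bar>Z n \<omega>\<bar> \<le> C * real n powr r)"
      using ev
    proof eventually_elim
      case (elim n)
      then obtain G where G: "G \<in> events" "prob (space M - G) \<le> \<epsilon>"
        and ae: "AE \<omega> in M. \<omega> \<in> G \<longrightarrow> E n \<omega> \<and> h n \<omega> \<le> \<eta> \<and> h n \<omega> \<le> L * real n powr (- (4/5))" by blast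
      have "AE \<omega> in M. \<omega> \<in> G \<longrightarrow> \<bar>Z n \<omega>\<bar> \<le> C * real n powr r" using ae by eventually_elim (use C in blast)
      thus ?case using G by blast
    qed
    thus "\<exists>C. \<forall>\<^sub>F n in sequentially. \<exists>G\<in>events. prob (space M - G) \<le> \<epsilon> \<and> (AE \<omega> in M. \<omega> \<in> G \<longrightarrow> \<bar>Z n \<omega>\<bar> \<le> C * real n powr r)" ..
  qed
  \<comment> \<open>Here \<open>\<kappa> = c * n^(4/5)\<close> grows with \<open>n\<close>: the
    bound on \<open>h\<close> becomes the constant \<open>\<epsilon>\<close>, and the exceptional
    probabilities, multiples of n^(-8/5), are summable. The condition
    \<open>D * \<epsilon> \<le> 2^33\<close> expresses
    \<open>D * \<kappa> \<le> n^(4/5)\<close>.\<close>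
  have "AE \<omega> in M. \<forall>\<^sub>F n in sequentially. E n \<omega> \<and> h n \<omega> \<le> \<epsilon>" if \<epsilon>: "0 < \<epsilon>" "D * \<epsilon> \<le> 2 ^ 33" for \<epsilon>
  proof (rule AE_eventually_summable)
    define c where "c = \<epsilon> / 2 ^ 33"
    have c: "0 < c" "D * c \<le> 1" "2 ^ 33 * c = \<epsilon>" using \<epsilon> by (auto simp: c_def)
    show "summable (\<lambda>n. 2 ^ 203 / c\<^sup>2 * real n powr (- (8/5)))"
      by (intro summable_mult) (simp add: summable_real_powr_iff)
    have "\<forall>\<^sub>F n in sequentially. real n powr (- (4/5)) < c"
      by (rule order_tendstoD(2)[OF null]) (use c in simp)
    thus "\<forall>\<^sub>F n in sequentially. \<exists>G\<in>events. prob (space M - G) \<le> 2 ^ 203 / c\<^sup>2 * real n powr (- (8/5)) \<and>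
        (AE \<omega> in M. \<omega> \<in> G \<longrightarrow> E n \<omega> \<and> h n \<omega> \<le> \<epsilon>)"
      using eventually_ge_at_top[of 2]
    proof eventually_elim
      case (elim n)
      define p where "p = real n powr (4/5)"
      define q where "q = real n powr (- (4/5))"
      have pq: "0 < p" "p * q = 1" "q < c" using elim inv[of n] by (auto simp: p_def q_def)
      have "q * p \<le> c * p" using pq by (intro mult_right_mono) auto
      hence 1: "1 \<le> c * p" using pq by (simp add: mult.commute)
      have "D * c * p \<le> 1 * p" using c pq by (intro mult_right_mono) auto
      hence 2: "D * (c * p) \<le> p" by simp
      have "2 ^ 33 * (c * p) * q = 2 ^ 33 * c * (p * q)" by (simp only: mult.assoc)
      hence 3: "2 ^ 33 * (c * p) * q = \<epsilon>" unfolding pq(2) c(3) by simp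
      have "real n powr (- (8/5)) = q * q" unfolding q_def by (simp add: powr_add[symmetric])
      moreover have "2 ^ 203 / (c * p)\<^sup>2 = 2 ^ 203 / c\<^sup>2 * (q * q)"
      proof -
        have q: "q = 1 / p" using pq by (simp add: field_simps)
        show ?thesis unfolding q using pq c by (simp add: power2_eq_square)
      qed
      ultimately show ?case using rate[OF elim(2) 1, folded p_def q_def, OF 2, unfolded 3] by simp
    qed
  qed
  \<comment> \<open>Countably many radii suffice for convergence; the entry \<open>2^33 / D\<close>
    keeps them within the admissible range.\<close>
  hence "AE \<omega> in M. \<forall>m. \<forall>\<^sub>F n in sequentially. E n \<omega> \<and> h n \<omega> \<le> min (2 ^ 33 / D) (1 / real (Suc m))"
    unfolding AE_all_countable using D by (simp add: field_simps min_def)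
  hence cons: "AE \<omega> in M. h_lim \<omega> \<and> (\<forall>\<^sub>F n in sequentially. E n \<omega>)" if "h_lim = (\<lambda>\<omega>. (\<lambda>n. h n \<omega>) \<longlonglongrightarrow> 0)" for h_lim
  proof eventually_elim
    case (elim \<omega>)
    have "(\<lambda>n. h n \<omega>) \<longlonglongrightarrow> 0"
    proof (rule order_tendstoI)
      fix a :: real assume "a < 0"
      hence "a < h n \<omega>" for n using h0[of n \<omega>] by linarith
      thus "\<forall>\<^sub>F n in sequentially. a < h n \<omega>" by simp
    next
      fix a :: real assume "0 < a"
      then obtain m where m: "1 / real (Suc m) < a" using reals_Archimedean[of a] by (auto simp: inverse_eq_divide)
      show "\<forall>\<^sub>F n in sequentially. h n \<omega> < a"
        using elim[rule_format, of m] by eventually_elim (use m in auto)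
    qed
    moreover have "\<forall>\<^sub>F n in sequentially. E n \<omega>" using elim[rule_format, of 0] by eventually_elim simp
    ultimately show ?case using that by simp
  qed
  have "AE \<omega> in M. (\<lambda>n. hellinger (fhat n \<omega>) f0) \<longlonglongrightarrow> 0"
    using cons[OF refl]
  proof eventually_elim
    case (elim \<omega>)
    hence "(\<lambda>n. sqrt (h n \<omega>)) \<longlonglongrightarrow> sqrt 0" by (intro tendsto_real_sqrt) auto
    thus ?case by (simp add: fh)
  qed
  moreover have "AE \<omega> in M. (\<lambda>n. hellinger (ghat n \<omega>) g0) \<longlonglongrightarrow> 0"
    using cons[OF refl]
  proof eventually_elim
    case (elim \<omega>)
    have "\<forall>\<^sub>F n in sequentially. h n \<omega> < \<eta>" using elim \<eta> by (auto intro: order_tendstoD(2))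
    hence "\<forall>\<^sub>F n in sequentially. norm (k n \<omega>) \<le> K * h n \<omega>"
      using elim[THEN conjunct2] by eventually_elim (use close k0 in auto)
    moreover have "(\<lambda>n. K * h n \<omega>) \<longlonglongrightarrow> K * 0" using elim by (intro tendsto_mult_left) auto
    ultimately have "(\<lambda>n. k n \<omega>) \<longlonglongrightarrow> 0" by (auto intro: Lim_null_comparison)
    hence "(\<lambda>n. sqrt (k n \<omega>)) \<longlonglongrightarrow> sqrt 0" by (rule tendsto_real_sqrt)
    thus ?case by (simp add: gh)
  qed
  moreover have "bounded_in_prob M (\<lambda>n \<omega>. (hellinger (fhat n \<omega>) f0)\<^sup>2) (\<lambda>n. real n powr (- 4 / 5))"
  proof (rule rates)
    fix L :: real
    show "\<exists>C. \<forall>n \<omega>. E n \<omega> \<longrightarrow> h n \<omega> \<le> \<eta> \<longrightarrow> h n \<omega> \<le> L * real n powr (- (4/5)) \<longrightarrow> \<bar>(hellinger (fhat n \<omega>) f0)\<^sup>2\<bar> \<le> C * real n powr (- 4 / 5)"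
      by (rule exI[of _ L]) (simp add: fh h0)
  qed
  moreover have "bounded_in_prob M (\<lambda>n \<omega>. \<bar>\<theta>hat n \<omega> - \<theta>0\<bar>) (\<lambda>n. real n powr (- 2 / 5))"
  proof (rule rates)
    fix L :: real assume L: "0 \<le> L"
    have "\<bar>\<theta>hat n \<omega> - \<theta>0\<bar> \<le> sqrt (K * L) * real n powr (- 2 / 5)"
      if "E n \<omega>" "h n \<omega> \<le> \<eta>" "h n \<omega> \<le> L * real n powr (- (4/5))" for n \<omega>
    proof -
      have "(\<theta>hat n \<omega> - \<theta>0)\<^sup>2 \<le> K * (L * real n powr (- (4/5)))"
        using close(1)[OF that(1,2)] mult_left_mono[OF that(3) K] by linarith
      also have "\<dots> = K * L * (real n powr (- 2 / 5))\<^sup>2"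
        by (simp add: power2_eq_square powr_add[symmetric])
      finally have "sqrt ((\<theta>hat n \<omega> - \<theta>0)\<^sup>2) \<le> sqrt (K * L * (real n powr (- 2 / 5))\<^sup>2)" by (rule real_sqrt_le_mono)
      thus ?thesis by (simp add: real_sqrt_mult)
    qed
    thus "\<exists>C. \<forall>n \<omega>. E n \<omega> \<longrightarrow> h n \<omega> \<le> \<eta> \<longrightarrow> h n \<omega> \<le> L * real n powr (- (4/5)) \<longrightarrow> \<bar>\<bar>\<theta>hat n \<omega> - \<theta>0\<bar>\<bar> \<le> C * real n powr (- 2 / 5)"
      by (intro exI[of _ "sqrt (K * L)"]) simp
  qed
  moreover have "bounded_in_prob M (\<lambda>n \<omega>. (hellinger (ghat n \<omega>) g0)\<^sup>2) (\<lambda>n. real n powr (- 4 / 5))"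
  proof (rule rates)
    fix L :: real
    have "k n \<omega> \<le> K * L * real n powr (- (4 / 5))"
      if "E n \<omega>" "h n \<omega> \<le> \<eta>" "h n \<omega> \<le> L * real n powr (- (4/5))" for n \<omega>
      using close(2)[OF that(1,2)] mult_left_mono[OF that(3) K] by (simp add: mult.assoc)
    thus "\<exists>C. \<forall>n \<omega>. E n \<omega> \<longrightarrow> h n \<omega> \<le> \<eta> \<longrightarrow> h n \<omega> \<le> L * real n powr (- (4/5)) \<longrightarrow> \<bar>(hellinger (ghat n \<omega>) g0)\<^sup>2\<bar> \<le> C * real n powr (- 4 / 5)"
      by (intro exI[of _ "K * L"]) (simp add: gh k0)
  qed
  ultimately show ?thesis by blast
qed

end
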